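(* Let $\mathcal C$ be a closed symmetric monoidal category and $\mathcal M$ a left $\mathcal C$-actegory satisfying the standing assumptions in the context. (1) The assignment $Aff_{\mathcal C}\ni Spec(a)\mapsto\{\text{fpqc }\mathcal M\text{-covers for }Spec(a)\}$ is a basis for a Grothendieck topology on $Aff_{\mathcal C}$. (2) The assignment $Aff_{\mathcal C}\ni Spec(a)\mapsto\{\text{spectral }\mathcal M\text{-covers for }Spec(a)\}$ is a basis for a Grothendieck topology on $Aff_{\mathcal C}$.
   Context: $(\mathcal C,\otimes,1)$ is a closed symmetric monoidal category which is complete and cocomplete. A left $\mathcal C$-actegory $(\mathcal M,\boxtimes,\lambda,l)$ is a category $\mathcal M$ with a bifunctor $\boxtimes:\mathcal C\times\mathcal M\to\mathcal M$ and natural isomorphisms $\lambda_{a,b,m}:a\boxtimes(b\boxtimes m)\to(a\otimes b)\boxtimes m$ and $l_m:1\boxtimes m\to m$ satisfying the usual pentagon and unit coherence axioms. $\mathcal M$ is a fixed left $\mathcal C$-actegory whose underlying category is complete and cocomplete and such that all functors $a\boxtimes -$ ($a\in\mathcal C$) and $-\boxtimes m$ ($m\in\mathcal M$) preserve colimits. $Comm(\mathcal C)$ is the category of commutative monoid objects in $\mathcal C$. For $a=(a,\mu_a,\iota_a)\in Comm(\mathcal C)$, $\mathbf{Mod}_{\mathcal M}(a)$ is the category of pairs $(m,\rho)$ with $m\in\mathcal M$, $\rho:a\boxtimes m\to m$ satisfying $\rho\circ(\mu_a\boxtimes 1_m)\circ\lambda_{a,a,m}=\rho\circ(1_a\boxtimes\rho)$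 and $\rho\circ(\iota_a\boxtimes 1_m)=l_m$; morphisms are morphisms in $\mathcal M$ commuting with the actions. For $\alpha:a\to b$ in $Comm(\mathcal C)$, $\alpha_*:\mathbf{Mod}_{\mathcal M}(b)\to\mathbf{Mod}_{\mathcal M}(a)$, $(n,\tau)\mapsto(n,\tau\circ(\alpha\boxtimes1_n))$, is restriction of scalars and $\alpha^*=b\boxtimes_a-$ denotes its left adjoint (extension of scalars). $Aff_{\mathcal C}:=Comm(\mathcal C)^{op}$; the object corresponding to $a$ is $Spec(a)$ and the morphism corresponding to $\alpha:a\to b$ is $\alpha^{op}:Spec(b)\to Spec(a)$. A morphism $\alpha:a\to b$ is $\mathcal M$-flat if $\alpha^*$ preserves finite limits. It is of finite type if for every filtered diagram $\mathbb D:\mathcal I\to a/Comm(\mathcal C)$ the canonical map $\mathrm{colim}_{i}\,a/Comm(\mathcal C)(b,\mathbb D(i))\to a/Comm(\mathcal C)(b,\mathrm{colim}_i\,\mathbb D(i))$ is an isomorphism, where $a/Comm(\mathcal C)$ is the coslice category. A family $\{\alpha_i^{op}:Spec(a_i)\to Spec(a)\}_{i\in I}$ is an fpqc $\mathcal M$-cover for $Spec(a)$ if each $\alpha_i$ is $\mathcal M$-flat and there is a finite subset $J\subseteq I$ such that the family $\{\alpha_j^*:\mathbf{Mod}_{\mathcal M}(a)\to\mathbf{Mod}_{\mathcal M}(a_j)\}_{j\in J}$ is conservative (a morphism $\phi$ is an isomorphism iff all $\alpha_j^*(\phi)$, $j\in J$, are). A morphism $\alpha^{op}$ is a spectral immersion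 relative to $\mathcal M$ if $\alpha$ is $\mathcal M$-flat and is an epimorphism of finite type in $Comm(\mathcal C)$. A spectral $\mathcal M$-cover is an fpqc $\mathcal M$-cover all of whose members are spectral immersions relative to $\mathcal M$. *)

theory Defs
  imports Main "HOL-Library.Equipollence"
begin

section \<open>Categories, functors, limits\<close>

text \<open>Composition is written in the usual order: \<open>g \<cdot>\<^bsub>C\<^esub> f\<close> is \<open>g\<close> after \<open>f\<close>.\<close>

record ('o, 'a) cat =
  Obj :: "'o set"
  Arr :: "'a set"
  Dom :: "'a \<Rightarrow> 'o"
  Cod :: "'a \<Rightarrow> 'o"
  Ide :: "'o \<Rightarrow> 'a"
  Cmp :: "'a \<Rightarrow> 'a \<Rightarrow> 'a"  (infixr \<open>\<cdot>\<index>\<close> 70)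

definition Hom :: "('o, 'a, 'z) cat_scheme \<Rightarrow> 'o \<Rightarrow> 'o \<Rightarrow> 'a set" where
  "Hom C a b = {f \<in> Arr C. Dom C f = a \<and> Cod C f = b}"

locale category =
  fixes C :: "('o, 'a, 'z) cat_scheme" (structure)
  assumes Dom_Obj: "f \<in> Arr C \<Longrightarrow> Dom C f \<in> Obj C"
    and Cod_Obj: "f \<in> Arr C \<Longrightarrow> Cod C f \<in> Obj C"
    and Ide_Hom: "a \<in> Obj C \<Longrightarrow> Ide C a \<in> Hom C a a"
    and Cmp_Hom: "f \<in> Hom C a b \<Longrightarrow> g \<in> Hom C b c \<Longrightarrow> g \<cdot> f \<in> Hom C a c"
    and Cmp_Ide_right: "f \<in> Hom C a b \<Longrightarrow> f \<cdot> Ide C a = f"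
    and Cmp_Ide_left: "f \<in> Hom C a b \<Longrightarrow> Ide C b \<cdot> f = f"
    and Cmp_assoc: "f \<in> Hom C a b \<Longrightarrow> g \<in> Hom C b c \<Longrightarrow> h \<in> Hom C c d \<Longrightarrow>
                      (h \<cdot> g) \<cdot> f = h \<cdot> (g \<cdot> f)"

definition is_iso :: "('o, 'a, 'z) cat_scheme \<Rightarrow> 'a \<Rightarrow> bool" where
  "is_iso C f \<longleftrightarrow> f \<in> Arr C \<and>
     (\<exists>g \<in> Hom C (Cod C f) (Dom C f).
        g \<cdot>\<^bsub>C\<^esub> f = Ide C (Dom C f) \<and> f \<cdot>\<^bsub>C\<^esub> g = Ide C (Cod C f))"

definition is_epi :: "('o, 'a, 'z) cat_scheme \<Rightarrow> 'a \<Rightarrow> bool" where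
  "is_epi C f \<longleftrightarrow> f \<in> Arr C \<and>
     (\<forall>x. \<forall>g \<in> Hom C (Cod C f) x. \<forall>h \<in> Hom C (Cod C f) x. g \<cdot>\<^bsub>C\<^esub> f = h \<cdot>\<^bsub>C\<^esub> f \<longrightarrow> g = h)"

definition op_cat :: "('o, 'a, 'z) cat_scheme \<Rightarrow> ('o, 'a) cat" where
  "op_cat C = \<lparr>Obj = Obj C, Arr = Arr C, Dom = Cod C, Cod = Dom C,
               Ide = Ide C, Cmp = (\<lambda>g f. f \<cdot>\<^bsub>C\<^esub> g)\<rparr>"

record ('o, 'a, 'p, 'b) functr =
  fob :: "'o \<Rightarrow> 'p"
  far :: "'a \<Rightarrow> 'b"

locale cat_functor = A: category A + B: category B
  for A :: "('o, 'a, 'y) cat_scheme" and B :: "('p, 'b, 'z) cat_scheme" +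
  fixes F :: "('o, 'a, 'p, 'b) functr"
  assumes fob_Obj: "a \<in> Obj A \<Longrightarrow> fob F a \<in> Obj B"
    and far_Hom: "f \<in> Hom A a a' \<Longrightarrow> far F f \<in> Hom B (fob F a) (fob F a')"
    and far_Ide: "a \<in> Obj A \<Longrightarrow> far F (Ide A a) = Ide B (fob F a)"
    and far_Cmp: "f \<in> Hom A a a' \<Longrightarrow> g \<in> Hom A a' a'' \<Longrightarrow>
                    far F (g \<cdot>\<^bsub>A\<^esub> f) = far F g \<cdot>\<^bsub>B\<^esub> far F f"

definition functr_comp ::
  "('p, 'b, 'q, 'c) functr \<Rightarrow> ('o, 'a, 'p, 'b) functr \<Rightarrow> ('o, 'a, 'q, 'c) functr" where
  "functr_comp G F = \<lparr>fob = fob G \<circ> fob F, far = far G \<circ> far F\<rparr>"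

text \<open>\<open>L\<close> is left adjoint to \<open>R\<close>: there is a bijection \<open>B(L a, b) \<cong> A(a, R b)\<close>,
  natural in \<open>a\<close> and \<open>b\<close>.\<close>

definition left_adjoint ::
  "('o, 'a, 'y) cat_scheme \<Rightarrow> ('p, 'b, 'z) cat_scheme \<Rightarrow>
   ('o, 'a, 'p, 'b) functr \<Rightarrow> ('p, 'b, 'o, 'a) functr \<Rightarrow> bool" where
  "left_adjoint A B L R \<longleftrightarrow> cat_functor A B L \<and> cat_functor B A R \<and>
     (\<exists>\<Phi> :: 'o \<Rightarrow> 'p \<Rightarrow> 'b \<Rightarrow> 'a.
        (\<forall>a \<in> Obj A. \<forall>b \<in> Obj B.
           bij_betw (\<Phi> a b) (Hom B (fob L a) b) (Hom A a (fob R b))) \<and>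
        (\<forall>a \<in> Obj A. \<forall>a' \<in> Obj A. \<forall>b \<in> Obj B. \<forall>b' \<in> Obj B.
           \<forall>h \<in> Hom A a' a. \<forall>g \<in> Hom B (fob L a) b. \<forall>k \<in> Hom B b b'.
             \<Phi> a' b' (k \<cdot>\<^bsub>B\<^esub> (g \<cdot>\<^bsub>B\<^esub> far L h)) = far R k \<cdot>\<^bsub>A\<^esub> (\<Phi> a b g \<cdot>\<^bsub>A\<^esub> h)))"

definition is_cone where
  "is_cone J A D l \<pi> \<longleftrightarrow> l \<in> Obj A \<and> (\<forall>j \<in> Obj J. \<pi> j \<in> Hom A l (fob D j)) \<and>
     (\<forall>u \<in> Arr J. far D u \<cdot>\<^bsub>A\<^esub> \<pi> (Dom J u) = \<pi> (Cod J u))"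

definition is_limit ::
  "('j, 'k, 'y) cat_scheme \<Rightarrow> ('o, 'a, 'z) cat_scheme \<Rightarrow> ('j, 'k, 'o, 'a) functr \<Rightarrow>
   'o \<Rightarrow> ('j \<Rightarrow> 'a) \<Rightarrow> bool" where
  "is_limit J A D l \<pi> \<longleftrightarrow> is_cone J A D l \<pi> \<and>
     (\<forall>x \<xi>. is_cone J A D x \<xi> \<longrightarrow> (\<exists>!h. h \<in> Hom A x l \<and> (\<forall>j \<in> Obj J. \<pi> j \<cdot>\<^bsub>A\<^esub> h = \<xi> j)))"

definition is_cocone where
  "is_cocone J A D c \<iota> \<longleftrightarrow> c \<in> Obj A \<and> (\<forall>j \<in> Obj J. \<iota> j \<in> Hom A (fob D j) c) \<and>
     (\<forall>u \<in> Arr J. \<iota> (Cod J u) \<cdot>\<^bsub>A\<^esub> far D u = \<iota> (Dom J u))"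

definition is_colimit ::
  "('j, 'k, 'y) cat_scheme \<Rightarrow> ('o, 'a, 'z) cat_scheme \<Rightarrow> ('j, 'k, 'o, 'a) functr \<Rightarrow>
   'o \<Rightarrow> ('j \<Rightarrow> 'a) \<Rightarrow> bool" where
  "is_colimit J A D c \<iota> \<longleftrightarrow> is_cocone J A D c \<iota> \<and>
     (\<forall>x \<xi>. is_cocone J A D x \<xi> \<longrightarrow> (\<exists>!h. h \<in> Hom A c x \<and> (\<forall>j \<in> Obj J. h \<cdot>\<^bsub>A\<^esub> \<iota> j = \<xi> j)))"

text \<open>Sizes: an (infinite) type \<open>'u\<close> plays the role of the universe, and a set is small if
  its cardinality is strictly below that of \<open>'u\<close>. Up to isomorphism, every category with a
  small set of arrows has objects and arrows in \<open>'u\<close>. For \<open>'u\<close> of inaccessible cardinality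
  this is smallness with respect to the corresponding Grothendieck universe.\<close>

definition small_cat :: "('u, 'u) cat \<Rightarrow> bool" where
  "small_cat J \<longleftrightarrow> category J \<and> lesspoll (Arr J) (UNIV :: 'u set)"

definition complete_cat :: "'u itself \<Rightarrow> ('o, 'a, 'z) cat_scheme \<Rightarrow> bool" where
  "complete_cat _ A \<longleftrightarrow> (\<forall>(J :: ('u, 'u) cat) D. small_cat J \<and> cat_functor J A D \<longrightarrow>
     (\<exists>l \<pi>. is_limit J A D l \<pi>))"

definition cocomplete_cat :: "'u itself \<Rightarrow> ('o, 'a, 'z) cat_scheme \<Rightarrow> bool" where
  "cocomplete_cat _ A \<longleftrightarrow> (\<forall>(J :: ('u, 'u) cat) D. small_cat J \<and> cat_functor J A D \<longrightarrow>
     (\<exists>c \<iota>. is_colimit J A D c \<iota>))"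

definition preserves_colimits ::
  "'u itself \<Rightarrow> ('o, 'a, 'y) cat_scheme \<Rightarrow> ('p, 'b, 'z) cat_scheme \<Rightarrow>
   ('o, 'a, 'p, 'b) functr \<Rightarrow> bool" where
  "preserves_colimits _ A B F \<longleftrightarrow>
     (\<forall>(J :: ('u, 'u) cat) D c \<iota>. small_cat J \<and> cat_functor J A D \<and> is_colimit J A D c \<iota> \<longrightarrow>
        is_colimit J B (functr_comp F D) (fob F c) (far F \<circ> \<iota>))"

text \<open>Every finite category is isomorphic to one whose objects and arrows are natural numbers.\<close>

definition preserves_finite_limits ::
  "('o, 'a, 'y) cat_scheme \<Rightarrow> ('p, 'b, 'z) cat_scheme \<Rightarrow> ('o, 'a, 'p, 'b) functr \<Rightarrow> bool" where
  "preserves_finite_limits A B F \<longleftrightarrow>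
     (\<forall>(J :: (nat, nat) cat) D l \<pi>.
        category J \<and> finite (Arr J) \<and> cat_functor J A D \<and> is_limit J A D l \<pi> \<longrightarrow>
        is_limit J B (functr_comp F D) (fob F l) (far F \<circ> \<pi>))"

definition filtered_cat :: "('j, 'k, 'z) cat_scheme \<Rightarrow> bool" where
  "filtered_cat J \<longleftrightarrow> category J \<and> Obj J \<noteq> {} \<and>
     (\<forall>i \<in> Obj J. \<forall>j \<in> Obj J. \<exists>k u v. u \<in> Hom J i k \<and> v \<in> Hom J j k) \<and>
     (\<forall>i j. \<forall>u \<in> Hom J i j. \<forall>v \<in> Hom J i j. \<exists>k. \<exists>w \<in> Hom J j k. w \<cdot>\<^bsub>J\<^esub> u = w \<cdot>\<^bsub>J\<^esub> v)"

text \<open>The colimit, in the category of sets, of the diagram \<open>j \<mapsto> A(b, D j)\<close>: the quotient of the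
  disjoint union by the equivalence relation generated by \<open>(i, x) \<sim> (j, D u \<cdot> x)\<close> for
  \<open>u : i \<rightarrow> j\<close>.\<close>

definition colim_Hom ::
  "('j, 'k, 'y) cat_scheme \<Rightarrow> ('o, 'a, 'z) cat_scheme \<Rightarrow> ('j, 'k, 'o, 'a) functr \<Rightarrow> 'o \<Rightarrow>
   ('j \<times> 'a) set set" where
  "colim_Hom J A D b =
     (let r = {((i, x), (j, far D u \<cdot>\<^bsub>A\<^esub> x)) | i j u x. u \<in> Hom J i j \<and> x \<in> Hom A b (fob D i)}
      in (SIGMA i : Obj J. Hom A b (fob D i)) // (r \<union> r\<inverse>)\<^sup>*)"

text \<open>The map \<open>[(i, x)] \<mapsto> \<iota> i \<cdot> x\<close> out of \<open>colim_Hom\<close> induced by a cocone \<open>\<iota>\<close>.\<close>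

definition canonical_map ::
  "('o, 'a, 'z) cat_scheme \<Rightarrow> ('j \<Rightarrow> 'a) \<Rightarrow> ('j \<times> 'a) set \<Rightarrow> 'a" where
  "canonical_map A \<iota> X = the_elem ((\<lambda>(i, x). \<iota> i \<cdot>\<^bsub>A\<^esub> x) ` X)"

definition Hom_commutes_with_filtered_colimits ::
  "'u itself \<Rightarrow> ('o, 'a, 'z) cat_scheme \<Rightarrow> 'o \<Rightarrow> bool" where
  "Hom_commutes_with_filtered_colimits _ A b \<longleftrightarrow>
     (\<forall>(J :: ('u, 'u) cat) D c \<iota>.
        small_cat J \<and> filtered_cat J \<and> cat_functor J A D \<and> is_colimit J A D c \<iota> \<longrightarrow>
        bij_betw (canonical_map A \<iota>) (colim_Hom J A D b) (Hom A b c))"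

text \<open>Categories of structured objects: the objects are the elements of \<open>X\<close>, with underlying
  object \<open>U\<close>; the arrows \<open>x \<rightarrow> y\<close> are the arrows \<open>f : U x \<rightarrow> U y\<close> of \<open>A\<close> satisfying \<open>P x y f\<close>,
  tagged with \<open>x\<close> and \<open>y\<close> so that they determine their domain and codomain.\<close>

datatype ('x, 'a) sarr = SArr (src: 'x) (und: 'a) (tgt: 'x)

definition structured_cat ::
  "('o, 'a, 'z) cat_scheme \<Rightarrow> 'x set \<Rightarrow> ('x \<Rightarrow> 'o) \<Rightarrow> ('x \<Rightarrow> 'x \<Rightarrow> 'a \<Rightarrow> bool) \<Rightarrow>
   ('x, ('x, 'a) sarr) cat" where
  "structured_cat A X U P =
     \<lparr>Obj = X,
      Arr = {SArr x f y | x f y. x \<in> X \<and> y \<in> X \<and> f \<in> Hom A (U x) (U y) \<and> P x y f},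
      Dom = src, Cod = tgt,
      Ide = (\<lambda>x. SArr x (Ide A (U x)) x),
      Cmp = (\<lambda>g f. SArr (src f) (und g \<cdot>\<^bsub>A\<^esub> und f) (tgt g))\<rparr>"

text \<open>The coslice category \<open>a/A\<close>; an object \<open>a \<rightarrow> b\<close> is represented by this arrow itself.\<close>

definition coslice :: "('o, 'a, 'z) cat_scheme \<Rightarrow> 'o \<Rightarrow> ('a, ('a, 'a) sarr) cat" where
  "coslice A a =
     structured_cat A {h \<in> Arr A. Dom A h = a} (Cod A) (\<lambda>h k f. f \<cdot>\<^bsub>A\<^esub> h = k)"


section \<open>Bases for Grothendieck topologies\<close>

definition is_pullback ::
  "('o, 'a, 'z) cat_scheme \<Rightarrow> 'a \<Rightarrow> 'a \<Rightarrow> 'a \<Rightarrow> 'a \<Rightarrow> bool" where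
  "is_pullback C f g p q \<longleftrightarrow>
     f \<in> Arr C \<and> g \<in> Arr C \<and> Cod C f = Cod C g \<and>
     p \<in> Arr C \<and> q \<in> Arr C \<and> Dom C p = Dom C q \<and> Cod C p = Dom C f \<and> Cod C q = Dom C g \<and>
     f \<cdot>\<^bsub>C\<^esub> p = g \<cdot>\<^bsub>C\<^esub> q \<and>
     (\<forall>x. \<forall>s \<in> Hom C x (Dom C f). \<forall>t \<in> Hom C x (Dom C g). f \<cdot>\<^bsub>C\<^esub> s = g \<cdot>\<^bsub>C\<^esub> t \<longrightarrow>
        (\<exists>!h. h \<in> Hom C x (Dom C p) \<and> p \<cdot>\<^bsub>C\<^esub> h = s \<and> q \<cdot>\<^bsub>C\<^esub> h = t))"

text \<open>\<open>K c I f\<close> says that the family \<open>(f i)\<^sub>i\<close>, \<open>i \<in> I\<close>, belongs to the collection of covering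
  families assigned to \<open>c\<close>. Index sets are subsets of a type \<open>'i\<close>; in the transitivity axiom the
  composite family, naturally indexed by the disjoint union of the \<open>I' i\<close>, is reindexed along
  a bijection from an arbitrary subset \<open>L\<close> of \<open>'i\<close>.\<close>

locale grothendieck_basis = category C
  for C :: "('o, 'a, 'z) cat_scheme" (structure) +
  fixes K :: "'o \<Rightarrow> 'i set \<Rightarrow> ('i \<Rightarrow> 'a) \<Rightarrow> bool"
  assumes members: "c \<in> Obj C \<Longrightarrow> K c I f \<Longrightarrow> i \<in> I \<Longrightarrow> f i \<in> Arr C \<and> Cod C (f i) = c"
    and iso: "c \<in> Obj C \<Longrightarrow> is_iso C (f i) \<Longrightarrow> Cod C (f i) = c \<Longrightarrow> K c {i} f"
    and pullbacks_exist: "c \<in> Obj C \<Longrightarrow> K c I f \<Longrightarrow> g \<in> Hom C d c \<Longrightarrow> i \<in> I \<Longrightarrow>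
          \<exists>p q. is_pullback C (f i) g p q"
    and pullback_stable: "c \<in> Obj C \<Longrightarrow> K c I f \<Longrightarrow> g \<in> Hom C d c \<Longrightarrow>
          (\<And>i. i \<in> I \<Longrightarrow> is_pullback C (f i) g (p i) (q i)) \<Longrightarrow> K d I q"
    and transitive: "c \<in> Obj C \<Longrightarrow> K c I f \<Longrightarrow>
          (\<And>i. i \<in> I \<Longrightarrow> K (Dom C (f i)) (I' i) (f' i)) \<Longrightarrow>
          bij_betw e L (SIGMA i : I. I' i) \<Longrightarrow>
          K c L (\<lambda>l. case e l of (i, j) \<Rightarrow> f i \<cdot> f' i j)"


section \<open>Symmetric monoidal categories and actegories\<close>

locale bifunctor = A: category A + B: category B + X: category X
  for A :: "('o, 'a, 'x) cat_scheme" and B :: "('p, 'b, 'y) cat_scheme"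
    and X :: "('q, 'c, 'z) cat_scheme" +
  fixes T\<^sub>o :: "'o \<Rightarrow> 'p \<Rightarrow> 'q" and T\<^sub>a :: "'a \<Rightarrow> 'b \<Rightarrow> 'c"
  assumes bi_Obj: "a \<in> Obj A \<Longrightarrow> b \<in> Obj B \<Longrightarrow> T\<^sub>o a b \<in> Obj X"
    and bi_Hom: "f \<in> Hom A a a' \<Longrightarrow> g \<in> Hom B b b' \<Longrightarrow> T\<^sub>a f g \<in> Hom X (T\<^sub>o a b) (T\<^sub>o a' b')"
    and bi_Ide: "a \<in> Obj A \<Longrightarrow> b \<in> Obj B \<Longrightarrow> T\<^sub>a (Ide A a) (Ide B b) = Ide X (T\<^sub>o a b)"
    and bi_Cmp: "f \<in> Hom A a a' \<Longrightarrow> f' \<in> Hom A a' a'' \<Longrightarrow>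
                 g \<in> Hom B b b' \<Longrightarrow> g' \<in> Hom B b' b'' \<Longrightarrow>
                 T\<^sub>a (f' \<cdot>\<^bsub>A\<^esub> f) (g' \<cdot>\<^bsub>B\<^esub> g) = T\<^sub>a f' g' \<cdot>\<^bsub>X\<^esub> T\<^sub>a f g"

record ('o, 'a) smcat = "('o, 'a) cat" +
  ten :: "'o \<Rightarrow> 'o \<Rightarrow> 'o"      (infixr \<open>\<otimes>\<index>\<close> 75)
  tenA :: "'a \<Rightarrow> 'a \<Rightarrow> 'a"     (infixr \<open>\<otimes>\<^sub>a\<index>\<close> 75)
  tunit :: "'o"               (\<open>\<one>\<index>\<close>)
  assoc :: "'o \<Rightarrow> 'o \<Rightarrow> 'o \<Rightarrow> 'a"
  lunit :: "'o \<Rightarrow> 'a"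
  runit :: "'o \<Rightarrow> 'a"
  braid :: "'o \<Rightarrow> 'o \<Rightarrow> 'a"

text \<open>As for the actegory constraint \<open>\<lambda>\<close>, the associator goes \<open>a \<otimes> (b \<otimes> c) \<rightarrow> (a \<otimes> b) \<otimes> c\<close>.\<close>

locale symmetric_monoidal = bifunctor C C C "ten C" "tenA C"
  for C :: "('o, 'a, 'z) smcat_scheme" (structure) +
  assumes tunit_Obj: "\<one> \<in> Obj C"
    and assoc_Hom: "a \<in> Obj C \<Longrightarrow> b \<in> Obj C \<Longrightarrow> c \<in> Obj C \<Longrightarrow>
          assoc C a b c \<in> Hom C (a \<otimes> (b \<otimes> c)) ((a \<otimes> b) \<otimes> c)"
    and assoc_iso: "a \<in> Obj C \<Longrightarrow> b \<in> Obj C \<Longrightarrow> c \<in> Obj C \<Longrightarrow> is_iso C (assoc C a b c)"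
    and assoc_nat: "f \<in> Hom C a a' \<Longrightarrow> g \<in> Hom C b b' \<Longrightarrow> h \<in> Hom C c c' \<Longrightarrow>
          assoc C a' b' c' \<cdot> (f \<otimes>\<^sub>a (g \<otimes>\<^sub>a h)) = ((f \<otimes>\<^sub>a g) \<otimes>\<^sub>a h) \<cdot> assoc C a b c"
    and lunit_Hom: "a \<in> Obj C \<Longrightarrow> lunit C a \<in> Hom C (\<one> \<otimes> a) a"
    and lunit_iso: "a \<in> Obj C \<Longrightarrow> is_iso C (lunit C a)"
    and lunit_nat: "f \<in> Hom C a a' \<Longrightarrow> lunit C a' \<cdot> (Ide C \<one> \<otimes>\<^sub>a f) = f \<cdot> lunit C a"
    and runit_Hom: "a \<in> Obj C \<Longrightarrow> runit C a \<in> Hom C (a \<otimes> \<one>) a"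
    and runit_iso: "a \<in> Obj C \<Longrightarrow> is_iso C (runit C a)"
    and runit_nat: "f \<in> Hom C a a' \<Longrightarrow> runit C a' \<cdot> (f \<otimes>\<^sub>a Ide C \<one>) = f \<cdot> runit C a"
    and braid_Hom: "a \<in> Obj C \<Longrightarrow> b \<in> Obj C \<Longrightarrow> braid C a b \<in> Hom C (a \<otimes> b) (b \<otimes> a)"
    and braid_nat: "f \<in> Hom C a a' \<Longrightarrow> g \<in> Hom C b b' \<Longrightarrow>
          braid C a' b' \<cdot> (f \<otimes>\<^sub>a g) = (g \<otimes>\<^sub>a f) \<cdot> braid C a b"
    and pentagon: "a \<in> Obj C \<Longrightarrow> b \<in> Obj C \<Longrightarrow> c \<in> Obj C \<Longrightarrow> d \<in> Obj C \<Longrightarrow>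
          assoc C (a \<otimes> b) c d \<cdot> assoc C a b (c \<otimes> d) =
          (assoc C a b c \<otimes>\<^sub>a Ide C d) \<cdot> (assoc C a (b \<otimes> c) d \<cdot> (Ide C a \<otimes>\<^sub>a assoc C b c d))"
    and triangle: "a \<in> Obj C \<Longrightarrow> b \<in> Obj C \<Longrightarrow>
          (runit C a \<otimes>\<^sub>a Ide C b) \<cdot> assoc C a \<one> b = Ide C a \<otimes>\<^sub>a lunit C b"
    and hexagon: "a \<in> Obj C \<Longrightarrow> b \<in> Obj C \<Longrightarrow> c \<in> Obj C \<Longrightarrow>
          assoc C c a b \<cdot> (braid C (a \<otimes> b) c \<cdot> assoc C a b c) =
          (braid C a c \<otimes>\<^sub>a Ide C b) \<cdot> (assoc C a c b \<cdot> (Ide C a \<otimes>\<^sub>a braid C b c))"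
    and symmetry: "a \<in> Obj C \<Longrightarrow> b \<in> Obj C \<Longrightarrow> braid C b a \<cdot> braid C a b = Ide C (a \<otimes> b)"

text \<open>Closedness: every functor \<open>- \<otimes> a\<close> has a right adjoint (the internal hom \<open>[a, -]\<close>).\<close>

locale closed_symmetric_monoidal = symmetric_monoidal C
  for C :: "('o, 'a, 'z) smcat_scheme" (structure) +
  assumes closed: "a \<in> Obj C \<Longrightarrow>
    \<exists>R. left_adjoint C C \<lparr>fob = (\<lambda>b. b \<otimes> a), far = (\<lambda>f. f \<otimes>\<^sub>a Ide C a)\<rparr> R"

text \<open>In the record below the last two fields are the constraints \<open>\<lambda>\<close> and \<open>l\<close>.\<close>

record ('o, 'a, 'm, 'n) actegory = "('m, 'n) cat" +
  act :: "'o \<Rightarrow> 'm \<Rightarrow> 'm"      (infixr \<open>\<odot>\<index>\<close> 75)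
  actA :: "'a \<Rightarrow> 'n \<Rightarrow> 'n"     (infixr \<open>\<odot>\<^sub>a\<index>\<close> 75)
  act_assoc :: "'o \<Rightarrow> 'o \<Rightarrow> 'm \<Rightarrow> 'n"
  act_unit :: "'m \<Rightarrow> 'n"

locale left_actegory = symmetric_monoidal C + bifunctor C M M "act M" "actA M"
  for C :: "('o, 'a, 'y) smcat_scheme" (structure)
    and M :: "('o, 'a, 'm, 'n, 'z) actegory_scheme" (structure) +
  assumes act_assoc_Hom: "a \<in> Obj C \<Longrightarrow> b \<in> Obj C \<Longrightarrow> m \<in> Obj M \<Longrightarrow>
          act_assoc M a b m \<in> Hom M (a \<odot>\<^bsub>M\<^esub> (b \<odot>\<^bsub>M\<^esub> m)) ((a \<otimes> b) \<odot>\<^bsub>M\<^esub> m)"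
    and act_assoc_iso: "a \<in> Obj C \<Longrightarrow> b \<in> Obj C \<Longrightarrow> m \<in> Obj M \<Longrightarrow> is_iso M (act_assoc M a b m)"
    and act_assoc_nat: "f \<in> Hom C a a' \<Longrightarrow> g \<in> Hom C b b' \<Longrightarrow> h \<in> Hom M m m' \<Longrightarrow>
          act_assoc M a' b' m' \<cdot>\<^bsub>M\<^esub> (f \<odot>\<^sub>a\<^bsub>M\<^esub> (g \<odot>\<^sub>a\<^bsub>M\<^esub> h)) =
          ((f \<otimes>\<^sub>a g) \<odot>\<^sub>a\<^bsub>M\<^esub> h) \<cdot>\<^bsub>M\<^esub> act_assoc M a b m"
    and act_unit_Hom: "m \<in> Obj M \<Longrightarrow> act_unit M m \<in> Hom M (\<one> \<odot>\<^bsub>M\<^esub> m) m"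
    and act_unit_iso: "m \<in> Obj M \<Longrightarrow> is_iso M (act_unit M m)"
    and act_unit_nat: "h \<in> Hom M m m' \<Longrightarrow>
          act_unit M m' \<cdot>\<^bsub>M\<^esub> (Ide C \<one> \<odot>\<^sub>a\<^bsub>M\<^esub> h) = h \<cdot>\<^bsub>M\<^esub> act_unit M m"
    and act_pentagon: "a \<in> Obj C \<Longrightarrow> b \<in> Obj C \<Longrightarrow> c \<in> Obj C \<Longrightarrow> m \<in> Obj M \<Longrightarrow>
          act_assoc M (a \<otimes> b) c m \<cdot>\<^bsub>M\<^esub> act_assoc M a b (c \<odot>\<^bsub>M\<^esub> m) =
          (assoc C a b c \<odot>\<^sub>a\<^bsub>M\<^esub> Ide M m) \<cdot>\<^bsub>M\<^esub>
            (act_assoc M a (b \<otimes> c) m \<cdot>\<^bsub>M\<^esub> (Ide C a \<odot>\<^sub>a\<^bsub>M\<^esub> act_assoc M b c m))"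
    and act_triangle_right: "a \<in> Obj C \<Longrightarrow> m \<in> Obj M \<Longrightarrow>
          (runit C a \<odot>\<^sub>a\<^bsub>M\<^esub> Ide M m) \<cdot>\<^bsub>M\<^esub> act_assoc M a \<one> m = Ide C a \<odot>\<^sub>a\<^bsub>M\<^esub> act_unit M m"
    and act_triangle_left: "a \<in> Obj C \<Longrightarrow> m \<in> Obj M \<Longrightarrow>
          (lunit C a \<odot>\<^sub>a\<^bsub>M\<^esub> Ide M m) \<cdot>\<^bsub>M\<^esub> act_assoc M \<one> a m = act_unit M (a \<odot>\<^bsub>M\<^esub> m)"

definition act_by ::
  "('o, 'a, 'y) smcat_scheme \<Rightarrow> ('o, 'a, 'm, 'n, 'z) actegory_scheme \<Rightarrow> 'o \<Rightarrow>
   ('m, 'n, 'm, 'n) functr" where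
  "act_by C M a = \<lparr>fob = (\<lambda>m. a \<odot>\<^bsub>M\<^esub> m), far = (\<lambda>h. Ide C a \<odot>\<^sub>a\<^bsub>M\<^esub> h)\<rparr>"

definition act_on ::
  "('o, 'a, 'm, 'n, 'z) actegory_scheme \<Rightarrow> 'm \<Rightarrow> ('o, 'a, 'm, 'n) functr" where
  "act_on M m = \<lparr>fob = (\<lambda>a. a \<odot>\<^bsub>M\<^esub> m), far = (\<lambda>f. f \<odot>\<^sub>a\<^bsub>M\<^esub> Ide M m)\<rparr>"


section \<open>Commutative monoids, modules, change of scalars\<close>

record ('o, 'a) monoid_obj =
  carr :: 'o
  mult :: 'a
  unit :: 'a

definition comm_monoid_obj :: "('o, 'a, 'z) smcat_scheme \<Rightarrow> ('o, 'a) monoid_obj \<Rightarrow> bool" where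
  "comm_monoid_obj C A \<longleftrightarrow> (let a = carr A; \<mu> = mult A; \<iota> = unit A in
     a \<in> Obj C \<and> \<mu> \<in> Hom C (a \<otimes>\<^bsub>C\<^esub> a) a \<and> \<iota> \<in> Hom C \<one>\<^bsub>C\<^esub> a \<and>
     \<mu> \<cdot>\<^bsub>C\<^esub> ((\<mu> \<otimes>\<^sub>a\<^bsub>C\<^esub> Ide C a) \<cdot>\<^bsub>C\<^esub> assoc C a a a) = \<mu> \<cdot>\<^bsub>C\<^esub> (Ide C a \<otimes>\<^sub>a\<^bsub>C\<^esub> \<mu>) \<and>
     \<mu> \<cdot>\<^bsub>C\<^esub> (\<iota> \<otimes>\<^sub>a\<^bsub>C\<^esub> Ide C a) = lunit C a \<and>
     \<mu> \<cdot>\<^bsub>C\<^esub> (Ide C a \<otimes>\<^sub>a\<^bsub>C\<^esub> \<iota>) = runit C a \<and>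
     \<mu> \<cdot>\<^bsub>C\<^esub> braid C a a = \<mu>)"

type_synonym ('o, 'a) monoid_arr = "(('o, 'a) monoid_obj, 'a) sarr"

definition Comm ::
  "('o, 'a, 'z) smcat_scheme \<Rightarrow> (('o, 'a) monoid_obj, ('o, 'a) monoid_arr) cat" where
  "Comm C = structured_cat C {A. comm_monoid_obj C A} carr
     (\<lambda>A B f. f \<cdot>\<^bsub>C\<^esub> mult A = mult B \<cdot>\<^bsub>C\<^esub> (f \<otimes>\<^sub>a\<^bsub>C\<^esub> f) \<and> f \<cdot>\<^bsub>C\<^esub> unit A = unit B)"

record ('m, 'n) module_obj =
  mcarr :: 'm
  mact :: 'n

definition module_over ::
  "('o, 'a, 'y) smcat_scheme \<Rightarrow> ('o, 'a, 'm, 'n, 'z) actegory_scheme \<Rightarrow>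
   ('o, 'a) monoid_obj \<Rightarrow> ('m, 'n) module_obj \<Rightarrow> bool" where
  "module_over C M A X \<longleftrightarrow> (let a = carr A; m = mcarr X; \<rho> = mact X in
     m \<in> Obj M \<and> \<rho> \<in> Hom M (a \<odot>\<^bsub>M\<^esub> m) m \<and>
     \<rho> \<cdot>\<^bsub>M\<^esub> ((mult A \<odot>\<^sub>a\<^bsub>M\<^esub> Ide M m) \<cdot>\<^bsub>M\<^esub> act_assoc M a a m) = \<rho> \<cdot>\<^bsub>M\<^esub> (Ide C a \<odot>\<^sub>a\<^bsub>M\<^esub> \<rho>) \<and>
     \<rho> \<cdot>\<^bsub>M\<^esub> (unit A \<odot>\<^sub>a\<^bsub>M\<^esub> Ide M m) = act_unit M m)"

type_synonym ('m, 'n) module_arr = "(('m, 'n) module_obj, 'n) sarr"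

definition Mod ::
  "('o, 'a, 'y) smcat_scheme \<Rightarrow> ('o, 'a, 'm, 'n, 'z) actegory_scheme \<Rightarrow>
   ('o, 'a) monoid_obj \<Rightarrow> (('m, 'n) module_obj, ('m, 'n) module_arr) cat" where
  "Mod C M A = structured_cat M {X. module_over C M A X} mcarr
     (\<lambda>X Y f. f \<cdot>\<^bsub>M\<^esub> mact X = mact Y \<cdot>\<^bsub>M\<^esub> (Ide C (carr A) \<odot>\<^sub>a\<^bsub>M\<^esub> f))"

definition restrict_module ::
  "('o, 'a, 'm, 'n, 'z) actegory_scheme \<Rightarrow> ('o, 'a) monoid_arr \<Rightarrow>
   ('m, 'n) module_obj \<Rightarrow> ('m, 'n) module_obj" where
  "restrict_module M \<alpha> Y =
     \<lparr>mcarr = mcarr Y, mact = mact Y \<cdot>\<^bsub>M\<^esub> (und \<alpha> \<odot>\<^sub>a\<^bsub>M\<^esub> Ide M (mcarr Y))\<rparr>"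

text \<open>For \<open>\<alpha> : a \<rightarrow> b\<close>, restriction of scalars \<open>\<alpha>\<^sub>*\<close> from \<open>b\<close>-modules to \<open>a\<close>-modules.\<close>

definition restr ::
  "('o, 'a, 'm, 'n, 'z) actegory_scheme \<Rightarrow> ('o, 'a) monoid_arr \<Rightarrow>
   (('m, 'n) module_obj, ('m, 'n) module_arr, ('m, 'n) module_obj, ('m, 'n) module_arr) functr"
  where
  "restr M \<alpha> =
     \<lparr>fob = restrict_module M \<alpha>,
      far = (\<lambda>f. SArr (restrict_module M \<alpha> (src f)) (und f) (restrict_module M \<alpha> (tgt f)))\<rparr>"

text \<open>Extension of scalars \<open>\<alpha>\<^sup>*\<close>: a chosen left adjoint of \<open>\<alpha>\<^sub>*\<close>. It is unique up to isomorphism,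
  so that the properties considered below do not depend on the choice.\<close>

definition ext ::
  "('o, 'a, 'y) smcat_scheme \<Rightarrow> ('o, 'a, 'm, 'n, 'z) actegory_scheme \<Rightarrow> ('o, 'a) monoid_arr \<Rightarrow>
   (('m, 'n) module_obj, ('m, 'n) module_arr, ('m, 'n) module_obj, ('m, 'n) module_arr) functr"
  where
  "ext C M \<alpha> = (SOME L. left_adjoint (Mod C M (src \<alpha>)) (Mod C M (tgt \<alpha>)) L (restr M \<alpha>))"


section \<open>Covers\<close>

text \<open>The object \<open>Spec a\<close> of \<open>Aff C\<close> is represented by \<open>a\<close>, and the arrow
  \<open>\<alpha>\<^sup>o\<^sup>p : Spec b \<rightarrow> Spec a\<close> by \<open>\<alpha> : a \<rightarrow> b\<close>.\<close>

definition Aff ::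
  "('o, 'a, 'z) smcat_scheme \<Rightarrow> (('o, 'a) monoid_obj, ('o, 'a) monoid_arr) cat" where
  "Aff C = op_cat (Comm C)"

definition flat ::
  "('o, 'a, 'y) smcat_scheme \<Rightarrow> ('o, 'a, 'm, 'n, 'z) actegory_scheme \<Rightarrow>
   ('o, 'a) monoid_arr \<Rightarrow> bool" where
  "flat C M \<alpha> \<longleftrightarrow>
     preserves_finite_limits (Mod C M (src \<alpha>)) (Mod C M (tgt \<alpha>)) (ext C M \<alpha>)"

definition finite_type ::
  "'u itself \<Rightarrow> ('o, 'a, 'z) smcat_scheme \<Rightarrow> ('o, 'a) monoid_arr \<Rightarrow> bool" where
  "finite_type U C \<alpha> \<longleftrightarrow>
     Hom_commutes_with_filtered_colimits U (coslice (Comm C) (src \<alpha>)) \<alpha>"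

definition conservative_family ::
  "('o, 'a, 'y) smcat_scheme \<Rightarrow> ('o, 'a, 'm, 'n, 'z) actegory_scheme \<Rightarrow>
   ('o, 'a) monoid_obj \<Rightarrow> 'i set \<Rightarrow> ('i \<Rightarrow> ('o, 'a) monoid_arr) \<Rightarrow> bool" where
  "conservative_family C M a J \<alpha> \<longleftrightarrow>
     (\<forall>\<phi> \<in> Arr (Mod C M a).
        is_iso (Mod C M a) \<phi> \<longleftrightarrow>
        (\<forall>j \<in> J. is_iso (Mod C M (tgt (\<alpha> j))) (far (ext C M (\<alpha> j)) \<phi>)))"

definition fpqc_cover ::
  "('o, 'a, 'y) smcat_scheme \<Rightarrow> ('o, 'a, 'm, 'n, 'z) actegory_scheme \<Rightarrow>
   ('o, 'a) monoid_obj \<Rightarrow> 'i set \<Rightarrow> ('i \<Rightarrow> ('o, 'a) monoid_arr) \<Rightarrow> bool" where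
  "fpqc_cover C M a I \<alpha> \<longleftrightarrow>
     (\<forall>i \<in> I. \<alpha> i \<in> Arr (Aff C) \<and> Cod (Aff C) (\<alpha> i) = a \<and> flat C M (\<alpha> i)) \<and>
     (\<exists>J \<subseteq> I. finite J \<and> conservative_family C M a J \<alpha>)"

definition spectral_immersion ::
  "'u itself \<Rightarrow> ('o, 'a, 'y) smcat_scheme \<Rightarrow> ('o, 'a, 'm, 'n, 'z) actegory_scheme \<Rightarrow>
   ('o, 'a) monoid_arr \<Rightarrow> bool" where
  "spectral_immersion U C M \<alpha> \<longleftrightarrow> flat C M \<alpha> \<and> is_epi (Comm C) \<alpha> \<and> finite_type U C \<alpha>"

definition spectral_cover ::
  "'u itself \<Rightarrow> ('o, 'a, 'y) smcat_scheme \<Rightarrow> ('o, 'a, 'm, 'n, 'z) actegory_scheme \<Rightarrow>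
   ('o, 'a) monoid_obj \<Rightarrow> 'i set \<Rightarrow> ('i \<Rightarrow> ('o, 'a) monoid_arr) \<Rightarrow> bool" where
  "spectral_cover U C M a I \<alpha> \<longleftrightarrow>
     fpqc_cover C M a I \<alpha> \<and> (\<forall>i \<in> I. spectral_immersion U C M (\<alpha> i))"

end

theory Submission
  imports Defs
begin

text \<open>For \<open>\<alpha> : a \<rightarrow> b\<close> the extension of scalars of an \<open>a\<close>-module \<open>n\<close> is the coequalizer of
  \<open>b \<odot> (a \<odot> n) \<rightrightarrows> b \<odot> n\<close>. The pushout \<open>e\<close> of \<open>\<alpha>\<close> and \<open>\<gamma> : a \<rightarrow> d\<close> in \<open>Comm C\<close>, with \<open>\<gamma>' : b \<rightarrow> e\<close> and
  \<open>\<beta> : d \<rightarrow> e\<close>, is carried by the coequalizer of \<open>b \<otimes> (a \<otimes> d) \<rightrightarrows> b \<otimes> d\<close> in \<open>C\<close>, which \<open>- \<odot> m\<close> preserves;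
  this yields the base change isomorphism \<open>\<alpha>\<^sup>* \<gamma>\<^sub>* \<cong> \<gamma>'\<^sub>* \<beta>\<^sup>*\<close>. As restriction of scalars preserves and
  reflects limits and isomorphisms, flatness and conservativity are stable under base change, and
  \<open>(\<beta> \<alpha>)\<^sup>* \<cong> \<beta>\<^sup>* \<alpha>\<^sup>*\<close> makes them stable under composition. For an epimorphism, being of finite type only
  means that it factors some member of a filtered diagram as soon as it factors the colimit, and
  this is stable under pushout and composition.\<close>

section \<open>Categories and universal arrows\<close>

text \<open>One obstacle is that \<open>ext\<close> is an arbitrary left adjoint and that
  \<open>pullback_stable\<close> speaks of arbitrary pullbacks, so no preferred model of an
  extension of scalars or of a pushout can be relied on. Every fact about \<open>ext\<close> is
  therefore phrased up to \<open>nat_iso\<close>, and such isomorphisms always come from exhibiting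
  two functors as left adjoint, with explicit units, to one and the same restriction functor.
  Restriction is strictly functorial, which keeps coherence data out of these comparisons. The other
  obstacle is bracketing. An equation between arrows of \<open>C\<close> is mostly proved after
  letting both sides act on an object \<open>x\<close>, where a tensor product becomes an iterated
  action; taking the unit object for \<open>x\<close> loses nothing, because tensoring with it is
  faithful. Since \<open>C\<close> acts on itself, one calculus serves for monoids in
  \<open>C\<close> and for modules in \<open>M\<close>. Structure on a quotient is obtained by
  descent: actions and multiplications are induced because whiskering preserves coequalizers, and
  their axioms are checked after precomposing with epimorphisms.\<close>

lemma in_Hom: "f \<in> Hom C a b \<longleftrightarrow> f \<in> Arr C \<and> Dom C f = a \<and> Cod C f = b"
  by (auto simp: Hom_def)

context category
begin

lemma Dom_Cod_Obj [simp]: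
  "f \<in> Arr C \<Longrightarrow> Dom C f \<in> Obj C" "f \<in> Arr C \<Longrightarrow> Cod C f \<in> Obj C"
  by (simp_all add: Dom_Obj Cod_Obj)

lemma Ide_simps [simp]:
  assumes "a \<in> Obj C"
  shows "Ide C a \<in> Arr C" "Dom C (Ide C a) = a" "Cod C (Ide C a) = a"
  using Ide_Hom[OF assms] by (auto simp: in_Hom)

lemma Cmp_simps [simp]:
  assumes "f \<in> Arr C" "g \<in> Arr C" "Cod C f = Dom C g"
  shows "g \<cdot> f \<in> Arr C" "Dom C (g \<cdot> f) = Dom C f" "Cod C (g \<cdot> f) = Cod C g"
  using Cmp_Hom[of f "Dom C f" "Cod C f" g "Cod C g"] assms by (auto simp: in_Hom)

lemma Cmp_Ide [simp]:
  "f \<in> Arr C \<Longrightarrow> Dom C f = a \<Longrightarrow> f \<cdot> Ide C a = f"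
  "f \<in> Arr C \<Longrightarrow> Cod C f = a \<Longrightarrow> Ide C a \<cdot> f = f"
  using Cmp_Ide_right Cmp_Ide_left by (auto simp: in_Hom)

lemma Cmp_assoc' [simp]:
  assumes "f \<in> Arr C" "g \<in> Arr C" "h \<in> Arr C" "Cod C f = Dom C g" "Cod C g = Dom C h"
  shows "(h \<cdot> g) \<cdot> f = h \<cdot> (g \<cdot> f)"
  using Cmp_assoc[of f "Dom C f" "Cod C f" g "Cod C g" h "Cod C h"] assms by (auto simp: in_Hom)

lemma is_isoI:
  assumes "f \<in> Hom C a b" "g \<in> Hom C b a" "g \<cdot> f = Ide C a" "f \<cdot> g = Ide C b"
  shows "is_iso C f"
  using assms by (auto simp: is_iso_def in_Hom)

lemma is_isoE:
  assumes "is_iso C f"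
  obtains g where "f \<in> Arr C" "g \<in> Arr C" "Dom C g = Cod C f" "Cod C g = Dom C f"
    "g \<cdot> f = Ide C (Dom C f)" "f \<cdot> g = Ide C (Cod C f)"
  using assms by (auto simp: is_iso_def in_Hom)

lemma is_iso_Ide [simp]: "a \<in> Obj C \<Longrightarrow> is_iso C (Ide C a)"
  by (rule is_isoI[of _ a a "Ide C a"]) (auto simp: in_Hom)

lemma is_iso_Cmp:
  assumes "is_iso C f" "is_iso C g" "Cod C f = Dom C g"
  shows "is_iso C (g \<cdot> f)"
proof -
  obtain f' where f: "f \<in> Arr C" "f' \<in> Arr C" "Dom C f' = Cod C f" "Cod C f' = Dom C f"
    "f' \<cdot> f = Ide C (Dom C f)" "f \<cdot> f' = Ide C (Cod C f)"
    by (rule is_isoE[OF assms(1)]) metis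
  obtain g' where g: "g \<in> Arr C" "g' \<in> Arr C" "Dom C g' = Cod C g" "Cod C g' = Dom C g"
    "g' \<cdot> g = Ide C (Dom C g)" "g \<cdot> g' = Ide C (Cod C g)"
    by (rule is_isoE[OF assms(2)]) metis
  have "(f' \<cdot> g') \<cdot> (g \<cdot> f) = f' \<cdot> ((g' \<cdot> g) \<cdot> f)"
    using f(1-4) g(1-4) assms(3) by simp
  moreover have "(g \<cdot> f) \<cdot> (f' \<cdot> g') = g \<cdot> ((f \<cdot> f') \<cdot> g')"
    using f(1-4) g(1-4) assms(3) by simp
  ultimately show ?thesis
    using f g assms(3) by (intro is_isoI[of _ "Dom C f" "Cod C g" "f' \<cdot> g'"]) (auto simp: in_Hom)
qed

lemma is_iso_Arr: "is_iso C f \<Longrightarrow> f \<in> Arr C"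
  by (simp add: is_iso_def)

text \<open>Junk unless \<open>f\<close> is an isomorphism.\<close>

definition inv_arr :: "'a \<Rightarrow> 'a" where
  "inv_arr f = (SOME g. g \<in> Hom C (Cod C f) (Dom C f) \<and>
     g \<cdot> f = Ide C (Dom C f) \<and> f \<cdot> g = Ide C (Cod C f))"

lemma inv_arr [simp]:
  assumes "is_iso C f"
  shows "inv_arr f \<in> Arr C" "Dom C (inv_arr f) = Cod C f" "Cod C (inv_arr f) = Dom C f"
    "inv_arr f \<cdot> f = Ide C (Dom C f)" "f \<cdot> inv_arr f = Ide C (Cod C f)"
proof -
  have "\<exists>g. g \<in> Hom C (Cod C f) (Dom C f) \<and> g \<cdot> f = Ide C (Dom C f) \<and> f \<cdot> g = Ide C (Cod C f)"
    using assms by (auto simp: is_iso_def)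
  from someI_ex[OF this, folded inv_arr_def]
  show "inv_arr f \<in> Arr C" "Dom C (inv_arr f) = Cod C f" "Cod C (inv_arr f) = Dom C f"
    "inv_arr f \<cdot> f = Ide C (Dom C f)" "f \<cdot> inv_arr f = Ide C (Cod C f)"
    by (auto simp: in_Hom)
qed

lemma inv_arr_cancel [simp]:
  assumes f: "is_iso C f" and t: "t \<in> Arr C"
  shows "Cod C t = Dom C f \<Longrightarrow> inv_arr f \<cdot> (f \<cdot> t) = t"
    and "Cod C t = Cod C f \<Longrightarrow> f \<cdot> (inv_arr f \<cdot> t) = t"
proof -
  assume c: "Cod C t = Dom C f"
  have "inv_arr f \<cdot> (f \<cdot> t) = (inv_arr f \<cdot> f) \<cdot> t"
    by (rule Cmp_assoc'[symmetric]) (use is_iso_Arr[OF f] f t c in simp_all)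
  then show "inv_arr f \<cdot> (f \<cdot> t) = t" using f t c by simp
next
  assume c: "Cod C t = Cod C f"
  have "f \<cdot> (inv_arr f \<cdot> t) = (f \<cdot> inv_arr f) \<cdot> t"
    by (rule Cmp_assoc'[symmetric]) (use is_iso_Arr[OF f] f t c in simp_all)
  then show "f \<cdot> (inv_arr f \<cdot> t) = t" using f t c by simp
qed

lemma is_iso_inv_arr [simp]: "is_iso C f \<Longrightarrow> is_iso C (inv_arr f)"
  by (rule is_isoI[of _ "Cod C f" "Dom C f" f]) (auto simp: in_Hom is_iso_Arr)

lemma iso_cancel_right:
  assumes "is_iso C f" "g \<in> Arr C" "h \<in> Arr C" "Dom C g = Cod C f" "Dom C h = Cod C f"
    and eq: "g \<cdot> f = h \<cdot> f"
  shows "g = h"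
proof -
  have "(g \<cdot> f) \<cdot> inv_arr f = (h \<cdot> f) \<cdot> inv_arr f" by (simp add: eq)
  then show ?thesis using assms(1-5) is_iso_Arr[OF assms(1)] by simp
qed

lemma iso_cancel_left:
  assumes "is_iso C f" "g \<in> Arr C" "h \<in> Arr C" "Cod C g = Dom C f" "Cod C h = Dom C f"
    and eq: "f \<cdot> g = f \<cdot> h"
  shows "g = h"
proof -
  have "inv_arr f \<cdot> (f \<cdot> g) = inv_arr f \<cdot> (f \<cdot> h)" by (simp add: eq)
  then show ?thesis using assms(1-5) is_iso_Arr[OF assms(1)] by simp
qed

lemma epiD:
  assumes "is_epi C f" "g \<in> Arr C" "h \<in> Arr C" "Dom C g = Cod C f" "Dom C h = Cod C f"
    "Cod C g = Cod C h" "g \<cdot> f = h \<cdot> f"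
  shows "g = h"
proof -
  have "\<forall>g \<in> Hom C (Cod C f) (Cod C h). \<forall>h \<in> Hom C (Cod C f) (Cod C h). g \<cdot> f = h \<cdot> f \<longrightarrow> g = h"
    using assms(1) unfolding is_epi_def by blast
  then show ?thesis using assms by (simp add: in_Hom)
qed

lemma iso_is_epi: "is_iso C f \<Longrightarrow> is_epi C f"
  unfolding is_epi_def by (auto simp: in_Hom is_iso_Arr intro: iso_cancel_right)

lemma epi_Cmp:
  assumes "is_epi C f" "is_epi C g" "Cod C f = Dom C g"
  shows "is_epi C (g \<cdot> f)"
  unfolding is_epi_def
proof (intro conjI ballI allI impI)
  have fg: "f \<in> Arr C" "g \<in> Arr C" using assms by (auto simp: is_epi_def)
  then show "g \<cdot> f \<in> Arr C" using assms(3) by simp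
  fix x u v
  assume u: "u \<in> Hom C (Cod C (g \<cdot> f)) x" and v: "v \<in> Hom C (Cod C (g \<cdot> f)) x"
    and eq: "u \<cdot> (g \<cdot> f) = v \<cdot> (g \<cdot> f)"
  have uv: "u \<in> Arr C" "Dom C u = Cod C g" "v \<in> Arr C" "Dom C v = Cod C g" "Cod C u = x" "Cod C v = x"
    using u v fg assms(3) by (auto simp: in_Hom)
  have "(u \<cdot> g) \<cdot> f = (v \<cdot> g) \<cdot> f" using eq fg assms(3) uv by simp
  then have "u \<cdot> g = v \<cdot> g" by (rule epiD[OF assms(1), rotated -1]) (use fg assms(3) uv in simp_all)
  then show "u = v" by (rule epiD[OF assms(2), rotated -1]) (use fg assms(3) uv in simp_all)
qed

lemma is_epi_split:
  assumes "f \<cdot> s = Ide C b" "f \<in> Arr C" "s \<in> Arr C" "Cod C s = Dom C f" "Cod C f = b"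
  shows "is_epi C f"
  unfolding is_epi_def
proof (intro conjI ballI allI impI)
  fix x g h assume gh: "g \<in> Hom C (Cod C f) x" "h \<in> Hom C (Cod C f) x" and eq: "g \<cdot> f = h \<cdot> f"
  have "(g \<cdot> f) \<cdot> s = (h \<cdot> f) \<cdot> s" by (simp only: eq)
  then show "g = h" using gh assms by (simp add: in_Hom)
qed (use assms in auto)

lemma is_epi_right_factor:
  assumes "is_epi C (g \<cdot> f)" and [simp]: "f \<in> Arr C" "g \<in> Arr C" "Cod C f = Dom C g"
  shows "is_epi C g"
  unfolding is_epi_def
proof (intro conjI ballI allI impI)
  fix x u v assume "u \<in> Hom C (Cod C g) x" "v \<in> Hom C (Cod C g) x" and eq: "u \<cdot> g = v \<cdot> g"
  then have [simp]: "u \<in> Arr C" "v \<in> Arr C" "Dom C u = Cod C g" "Dom C v = Cod C g" "Cod C u = Cod C v"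
    by (auto simp: in_Hom)
  have "(u \<cdot> g) \<cdot> f = (v \<cdot> g) \<cdot> f" by (simp only: eq)
  then show "u = v" by (intro epiD[OF assms(1), of u v]) simp_all
qed simp

end

lemma category_op_cat: "category C \<Longrightarrow> category (op_cat C)"
proof -
  assume "category C"
  then interpret category C .
  show ?thesis
    by unfold_locales (auto simp: op_cat_def in_Hom)
qed

lemma is_iso_op_cat: "is_iso (op_cat C) f \<longleftrightarrow> is_iso C f"
  by (auto simp: is_iso_def op_cat_def in_Hom)

context cat_functor
begin

lemma fob_in [simp]: "a \<in> Obj A \<Longrightarrow> fob F a \<in> Obj B"
  by (rule fob_Obj)

lemma far_simps [simp]:
  assumes "f \<in> Arr A"
  shows "far F f \<in> Arr B" "Dom B (far F f) = fob F (Dom A f)" "Cod B (far F f) = fob F (Cod A f)"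
  using far_Hom[of f "Dom A f" "Cod A f"] assms by (auto simp: in_Hom)

lemma far_Cmp_simp [simp]:
  assumes "f \<in> Arr A" "g \<in> Arr A" "Cod A f = Dom A g"
  shows "far F (g \<cdot>\<^bsub>A\<^esub> f) = far F g \<cdot>\<^bsub>B\<^esub> far F f"
  using far_Cmp[of f "Dom A f" "Cod A f" g "Cod A g"] assms by (auto simp: in_Hom)

lemma far_Ide_simp [simp]: "a \<in> Obj A \<Longrightarrow> far F (Ide A a) = Ide B (fob F a)"
  by (rule far_Ide)

end

definition id_functr :: "('o, 'a, 'o, 'a) functr" where
  "id_functr = \<lparr>fob = (\<lambda>x. x), far = (\<lambda>f. f)\<rparr>"

lemma id_functr_simps [simp]: "fob id_functr x = x" "far id_functr f = f"
  by (simp_all add: id_functr_def)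

lemma functr_comp_simps [simp]:
  "fob (functr_comp G F) x = fob G (fob F x)" "far (functr_comp G F) f = far G (far F f)"
  by (simp_all add: functr_comp_def)

lemma cat_functorI:
  assumes "category A" "category B"
    and "\<And>a. a \<in> Obj A \<Longrightarrow> fob F a \<in> Obj B"
    and "\<And>f. f \<in> Arr A \<Longrightarrow> far F f \<in> Hom B (fob F (Dom A f)) (fob F (Cod A f))"
    and "\<And>a. a \<in> Obj A \<Longrightarrow> far F (Ide A a) = Ide B (fob F a)"
    and "\<And>f g. f \<in> Arr A \<Longrightarrow> g \<in> Arr A \<Longrightarrow> Cod A f = Dom A g \<Longrightarrow>
      far F (g \<cdot>\<^bsub>A\<^esub> f) = far F g \<cdot>\<^bsub>B\<^esub> far F f"
  shows "cat_functor A B F"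
  using assms by (auto simp: cat_functor_def cat_functor_axioms_def in_Hom)

lemma cat_functor_id: "category A \<Longrightarrow> cat_functor A A id_functr"
  by (rule cat_functorI) (auto simp: in_Hom)

lemma cat_functor_comp:
  assumes "cat_functor A B F" "cat_functor B C G"
  shows "cat_functor A C (functr_comp G F)"
proof -
  interpret F: cat_functor A B F by fact
  interpret G: cat_functor B C G by fact
  show ?thesis
    by (rule cat_functorI) (auto simp: in_Hom F.A.category_axioms G.B.category_axioms)
qed

text \<open>An initial object of the comma category of \<open>a\<close> over \<open>R\<close>. Left
  adjoints are handled one object at a time through such arrows, since a universal arrow can be
  recognised without building a functor beforehand.\<close>

definition universal_arrow ::
  "('o, 'a, 'y) cat_scheme \<Rightarrow> ('p, 'b, 'z) cat_scheme \<Rightarrow> ('p, 'b, 'o, 'a) functr \<Rightarrow>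
   'o \<Rightarrow> 'p \<Rightarrow> 'a \<Rightarrow> bool" where
  "universal_arrow A B R a b \<eta> \<longleftrightarrow> b \<in> Obj B \<and> \<eta> \<in> Hom A a (fob R b) \<and>
     (\<forall>b' \<in> Obj B. \<forall>f \<in> Hom A a (fob R b'). \<exists>!h. h \<in> Hom B b b' \<and> far R h \<cdot>\<^bsub>A\<^esub> \<eta> = f)"

text \<open>\<open>F\<close> is left adjoint to \<open>R\<close> relative to \<open>H\<close>, i.e. \<open>B(F x, b) \<cong> A(H x, R b)\<close>,
  with unit \<open>\<theta>\<close>.\<close>

definition adj_unit ::
  "('q, 'c, 'x) cat_scheme \<Rightarrow> ('o, 'a, 'y) cat_scheme \<Rightarrow> ('p, 'b, 'z) cat_scheme \<Rightarrow>
   ('q, 'c, 'o, 'a) functr \<Rightarrow> ('q, 'c, 'p, 'b) functr \<Rightarrow> ('p, 'b, 'o, 'a) functr \<Rightarrow>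
   ('q \<Rightarrow> 'a) \<Rightarrow> bool" where
  "adj_unit X A B H F R \<theta> \<longleftrightarrow>
     cat_functor X A H \<and> cat_functor X B F \<and> cat_functor B A R \<and>
     (\<forall>x \<in> Obj X. universal_arrow A B R (fob H x) (fob F x) (\<theta> x)) \<and>
     (\<forall>f \<in> Arr X. far R (far F f) \<cdot>\<^bsub>A\<^esub> \<theta> (Dom X f) = \<theta> (Cod X f) \<cdot>\<^bsub>A\<^esub> far H f)"

lemma adj_unit_nat:
  assumes "adj_unit X A B H F R \<theta>" "f \<in> Arr X"
  shows "far R (far F f) \<cdot>\<^bsub>A\<^esub> \<theta> (Dom X f) = \<theta> (Cod X f) \<cdot>\<^bsub>A\<^esub> far H f"
  using assms by (simp add: adj_unit_def)

lemma universal_arrow_ex: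
  assumes "universal_arrow A B R a b \<eta>" "b' \<in> Obj B" "f \<in> Arr A" "Dom A f = a" "Cod A f = fob R b'"
  obtains h where "h \<in> Arr B" "Dom B h = b" "Cod B h = b'" "far R h \<cdot>\<^bsub>A\<^esub> \<eta> = f"
proof -
  have "\<exists>!h. h \<in> Hom B b b' \<and> far R h \<cdot>\<^bsub>A\<^esub> \<eta> = f"
    using assms unfolding universal_arrow_def by (simp add: in_Hom[of f])
  then show ?thesis using that by (auto simp: in_Hom)
qed

lemma universal_arrow_uniq:
  assumes "universal_arrow A B R a b \<eta>" "cat_functor B A R"
    and "h \<in> Arr B" "Dom B h = b" "k \<in> Arr B" "Dom B k = b" "Cod B h = Cod B k"
    and "far R h \<cdot>\<^bsub>A\<^esub> \<eta> = far R k \<cdot>\<^bsub>A\<^esub> \<eta>"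
  shows "h = k"
proof -
  interpret R: cat_functor B A R by fact
  have "far R k \<cdot>\<^bsub>A\<^esub> \<eta> \<in> Hom A a (fob R (Cod B k))"
    using assms(1,5,6) by (auto simp: universal_arrow_def in_Hom)
  moreover have "Cod B k \<in> Obj B" using assms(5) by simp
  ultimately have "\<exists>!h. h \<in> Hom B b (Cod B k) \<and> far R h \<cdot>\<^bsub>A\<^esub> \<eta> = far R k \<cdot>\<^bsub>A\<^esub> \<eta>"
    using assms(1) unfolding universal_arrow_def by blast
  then show ?thesis using assms by (auto simp: in_Hom)
qed

lemma universal_arrow_Dom:
  assumes "universal_arrow A B R a b \<eta>"
  shows "\<eta> \<in> Arr A" "Dom A \<eta> = a" "Cod A \<eta> = fob R b" "b \<in> Obj B"
  using assms by (auto simp: universal_arrow_def in_Hom)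

text \<open>A choice of universal arrows extends to a functor because \<open>ar f\<close> is forced
  by universality at the domain of \<open>f\<close>; identities and composites are then preserved by
  uniqueness. The adjunction bijection is precomposition with the unit.\<close>

lemma left_adjoint_ex:
  assumes R: "cat_functor B A R"
    and ex: "\<And>a. a \<in> Obj A \<Longrightarrow> \<exists>b \<eta>. universal_arrow A B R a b \<eta>"
  shows "\<exists>L. left_adjoint A B L R"
proof -
  interpret R: cat_functor B A R by fact
  obtain ob un where u: "\<And>a. a \<in> Obj A \<Longrightarrow> universal_arrow A B R a (ob a) (un a)"
    using ex by metis
  note u' [simp] = universal_arrow_Dom[OF u]
  define ar where "ar f = (SOME h. h \<in> Arr B \<and> Dom B h = ob (Dom A f) \<and> Cod B h = ob (Cod A f) \<and>
     far R h \<cdot>\<^bsub>A\<^esub> un (Dom A f) = un (Cod A f) \<cdot>\<^bsub>A\<^esub> f)" for f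
  have ar: "ar f \<in> Arr B \<and> Dom B (ar f) = ob (Dom A f) \<and> Cod B (ar f) = ob (Cod A f) \<and>
     far R (ar f) \<cdot>\<^bsub>A\<^esub> un (Dom A f) = un (Cod A f) \<cdot>\<^bsub>A\<^esub> f" if f: "f \<in> Arr A" for f
    unfolding ar_def
  proof (rule someI_ex)
    show "\<exists>h. h \<in> Arr B \<and> Dom B h = ob (Dom A f) \<and> Cod B h = ob (Cod A f) \<and>
     far R h \<cdot>\<^bsub>A\<^esub> un (Dom A f) = un (Cod A f) \<cdot>\<^bsub>A\<^esub> f"
      by (rule universal_arrow_ex[OF u, of "Dom A f" "ob (Cod A f)" "un (Cod A f) \<cdot>\<^bsub>A\<^esub> f"])
        (use f in auto)
  qed
  note [simp] = ar[THEN conjunct1] ar[THEN conjunct2, THEN conjunct1]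
    ar[THEN conjunct2, THEN conjunct2, THEN conjunct1]
    ar[THEN conjunct2, THEN conjunct2, THEN conjunct2]
  let ?L = "\<lparr>fob = ob, far = ar\<rparr>"
  have L: "cat_functor A B ?L"
  proof (rule cat_functorI)
    fix a assume a: "a \<in> Obj A"
    have "ar (Ide A a) = Ide B (ob a)"
      by (rule universal_arrow_uniq[OF u[OF a] R]) (use a ar[of "Ide A a"] in auto)
    then show "far ?L (Ide A a) = Ide B (fob ?L a)" by simp
  next
    fix f g assume fg: "f \<in> Arr A" "g \<in> Arr A" "Cod A f = Dom A g"
    have "far R (ar g) \<cdot>\<^bsub>A\<^esub> (far R (ar f) \<cdot>\<^bsub>A\<^esub> un (Dom A f)) =
      (far R (ar g) \<cdot>\<^bsub>A\<^esub> un (Dom A g)) \<cdot>\<^bsub>A\<^esub> f"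
      using fg by (simp del: ar[THEN conjunct2, THEN conjunct2, THEN conjunct2] add: ar[of f])
    then have "far R (ar g) \<cdot>\<^bsub>A\<^esub> (far R (ar f) \<cdot>\<^bsub>A\<^esub> un (Dom A f)) = un (Cod A g) \<cdot>\<^bsub>A\<^esub> (g \<cdot>\<^bsub>A\<^esub> f)"
      using fg by simp
    then have "ar (g \<cdot>\<^bsub>A\<^esub> f) = ar g \<cdot>\<^bsub>B\<^esub> ar f"
      by (intro universal_arrow_uniq[OF u[of "Dom A f"] R])
        (use fg ar[of "g \<cdot>\<^bsub>A\<^esub> f"] in simp_all)
    then show "far ?L (g \<cdot>\<^bsub>A\<^esub> f) = far ?L g \<cdot>\<^bsub>B\<^esub> far ?L f" by simp
  qed (auto simp: in_Hom R.A.category_axioms R.B.category_axioms)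
  have "left_adjoint A B ?L R"
    unfolding left_adjoint_def
  proof (intro conjI exI[of _ "\<lambda>a b g. far R g \<cdot>\<^bsub>A\<^esub> un a"] ballI)
    fix a b assume ab: "a \<in> Obj A" "b \<in> Obj B"
    show "bij_betw (\<lambda>g. far R g \<cdot>\<^bsub>A\<^esub> un a) (Hom B (fob ?L a) b) (Hom A a (fob R b))"
    proof (rule bij_betwI')
      fix g h assume "g \<in> Hom B (fob ?L a) b" "h \<in> Hom B (fob ?L a) b"
      then show "(far R g \<cdot>\<^bsub>A\<^esub> un a = far R h \<cdot>\<^bsub>A\<^esub> un a) = (g = h)"
        using universal_arrow_uniq[OF u[OF ab(1)] R, of g h] by (auto simp: in_Hom)
    next
      fix g assume "g \<in> Hom B (fob ?L a) b"
      then show "far R g \<cdot>\<^bsub>A\<^esub> un a \<in> Hom A a (fob R b)" using ab by (auto simp: in_Hom)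
    next
      fix f assume "f \<in> Hom A a (fob R b)"
      then have "f \<in> Arr A" "Dom A f = a" "Cod A f = fob R b" by (auto simp: in_Hom)
      from universal_arrow_ex[OF u[OF ab(1)] ab(2) this]
      show "\<exists>g\<in>Hom B (fob ?L a) b. f = far R g \<cdot>\<^bsub>A\<^esub> un a"
        by (metis in_Hom functr.select_convs(1))
    qed
  next
    fix a a' b b' h g k
    assume "a \<in> Obj A" "a' \<in> Obj A" "b \<in> Obj B" "b' \<in> Obj B"
      "h \<in> Hom A a' a" "g \<in> Hom B (fob ?L a) b" "k \<in> Hom B b b'"
    then show "far R (k \<cdot>\<^bsub>B\<^esub> g \<cdot>\<^bsub>B\<^esub> far ?L h) \<cdot>\<^bsub>A\<^esub> un a' = far R k \<cdot>\<^bsub>A\<^esub> (far R g \<cdot>\<^bsub>A\<^esub> un a) \<cdot>\<^bsub>A\<^esub> h"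
      using ar[of h] by (auto simp: in_Hom)
  qed (use L R in auto)
  then show ?thesis by blast
qed

text \<open>The unit is the transpose of the identity of \<open>fob L a\<close>. Naturality in the
  second variable writes every transpose \<open>\<Phi> a b g\<close> as \<open>far R g\<close> after
  \<theta>, so bijectivity of \<Phi> is exactly universality of \<theta>.\<close>

lemma adj_unit_ex:
  assumes "left_adjoint A B L R"
  obtains \<theta> where "adj_unit A A B id_functr L R \<theta>"
proof -
  obtain \<Phi> where L: "cat_functor A B L" and R: "cat_functor B A R" and
    bij: "\<And>a b. a \<in> Obj A \<Longrightarrow> b \<in> Obj B \<Longrightarrow> bij_betw (\<Phi> a b) (Hom B (fob L a) b) (Hom A a (fob R b))" and
    nat: "\<And>a a' b b' h g k. \<lbrakk>a \<in> Obj A; a' \<in> Obj A; b \<in> Obj B; b' \<in> Obj B; h \<in> Hom A a' a;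
      g \<in> Hom B (fob L a) b; k \<in> Hom B b b'\<rbrakk> \<Longrightarrow>
      \<Phi> a' b' (k \<cdot>\<^bsub>B\<^esub> (g \<cdot>\<^bsub>B\<^esub> far L h)) = far R k \<cdot>\<^bsub>A\<^esub> (\<Phi> a b g \<cdot>\<^bsub>A\<^esub> h)"
    using assms unfolding left_adjoint_def by blast
  interpret L: cat_functor A B L by fact
  interpret R: cat_functor B A R by fact
  define \<theta> where "\<theta> a = \<Phi> a (fob L a) (Ide B (fob L a))" for a
  have \<theta>: "\<theta> a \<in> Hom A a (fob R (fob L a))" if "a \<in> Obj A" for a
    unfolding \<theta>_def by (rule bij_betw_apply[OF bij]) (use that in \<open>auto simp: in_Hom\<close>)
  have \<Phi>: "\<Phi> a b g = far R g \<cdot>\<^bsub>A\<^esub> \<theta> a" if "a \<in> Obj A" "b \<in> Obj B" "g \<in> Hom B (fob L a) b" for a b g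
    using nat[of a a "fob L a" b "Ide A a" "Ide B (fob L a)" g] that \<theta>[of a]
    by (auto simp: in_Hom \<theta>_def)
  have "universal_arrow A B R a (fob L a) (\<theta> a)" if a: "a \<in> Obj A" for a
    unfolding universal_arrow_def
  proof (intro conjI ballI)
    fix b f assume b: "b \<in> Obj B" and f: "f \<in> Hom A a (fob R b)"
    obtain h where h: "h \<in> Hom B (fob L a) b" "\<Phi> a b h = f"
      using f bij_betw_imp_surj_on[OF bij[OF a b]] by (metis imageE)
    show "\<exists>!h. h \<in> Hom B (fob L a) b \<and> far R h \<cdot>\<^bsub>A\<^esub> \<theta> a = f"
      using h inj_onD[OF bij_betw_imp_inj_on[OF bij[OF a b]]]
      by (intro ex1I[of _ h]) (auto simp: \<Phi>[OF a b])
  qed (use a \<theta> in auto)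
  moreover have "far R (far L f) \<cdot>\<^bsub>A\<^esub> \<theta> (Dom A f) = \<theta> (Cod A f) \<cdot>\<^bsub>A\<^esub> f" if f: "f \<in> Arr A" for f
    using nat[of "Cod A f" "Dom A f" "fob L (Cod A f)" "fob L (Cod A f)" f
        "Ide B (fob L (Cod A f))" "Ide B (fob L (Cod A f))"] f
      \<Phi>[of "Dom A f" "fob L (Cod A f)" "far L f"] \<theta>[of "Cod A f"]
    by (auto simp: in_Hom simp flip: \<theta>_def)
  ultimately have "adj_unit A A B id_functr L R \<theta>"
    unfolding adj_unit_def using L R cat_functor_id[OF L.A.category_axioms] by auto
  then show ?thesis using that by blast
qed

section \<open>Limits, natural isomorphisms and right adjoints\<close>

lemma is_limit_ex:
  assumes "is_limit J A D l \<pi>" "is_cone J A D x \<xi>"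
  obtains h where "h \<in> Arr A" "Dom A h = x" "Cod A h = l" "\<And>j. j \<in> Obj J \<Longrightarrow> \<pi> j \<cdot>\<^bsub>A\<^esub> h = \<xi> j"
proof -
  have "\<exists>!h. h \<in> Hom A x l \<and> (\<forall>j \<in> Obj J. \<pi> j \<cdot>\<^bsub>A\<^esub> h = \<xi> j)"
    using assms unfolding is_limit_def by simp
  then show ?thesis using that by (auto simp: in_Hom)
qed

lemma is_limit_uniq:
  assumes "is_limit J A D l \<pi>" "is_cone J A D x \<xi>"
    and "h \<in> Arr A" "Dom A h = x" "Cod A h = l" "\<And>j. j \<in> Obj J \<Longrightarrow> \<pi> j \<cdot>\<^bsub>A\<^esub> h = \<xi> j"
    and "k \<in> Arr A" "Dom A k = x" "Cod A k = l" "\<And>j. j \<in> Obj J \<Longrightarrow> \<pi> j \<cdot>\<^bsub>A\<^esub> k = \<xi> j"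
  shows "h = k"
proof -
  have "\<exists>!h. h \<in> Hom A x l \<and> (\<forall>j \<in> Obj J. \<pi> j \<cdot>\<^bsub>A\<^esub> h = \<xi> j)"
    using assms(1,2) unfolding is_limit_def by simp
  then show ?thesis using assms(3-) unfolding in_Hom by metis
qed

text \<open>The components stay existentially bound: only properties that do not depend on the
  chosen isomorphism, such as preservation of limits, are transported along it.\<close>

definition nat_iso ::
  "('q, 'c, 'x) cat_scheme \<Rightarrow> ('p, 'b, 'z) cat_scheme \<Rightarrow>
   ('q, 'c, 'p, 'b) functr \<Rightarrow> ('q, 'c, 'p, 'b) functr \<Rightarrow> bool" where
  "nat_iso X B F G \<longleftrightarrow> cat_functor X B F \<and> cat_functor X B G \<and>
     (\<exists>\<tau>. (\<forall>x \<in> Obj X. is_iso B (\<tau> x) \<and> Dom B (\<tau> x) = fob F x \<and> Cod B (\<tau> x) = fob G x) \<and>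
          (\<forall>f \<in> Arr X. \<tau> (Cod X f) \<cdot>\<^bsub>B\<^esub> far F f = far G f \<cdot>\<^bsub>B\<^esub> \<tau> (Dom X f)))"

lemma universal_arrows_iso:
  assumes u: "universal_arrow A B R a b \<eta>" and v: "universal_arrow A B R a c \<zeta>"
    and R: "cat_functor B A R"
  obtains h where "is_iso B h" "Dom B h = b" "Cod B h = c" "far R h \<cdot>\<^bsub>A\<^esub> \<eta> = \<zeta>"
proof -
  interpret R: cat_functor B A R by fact
  note [simp] = universal_arrow_Dom[OF u] universal_arrow_Dom[OF v]
  obtain h where h: "h \<in> Arr B" "Dom B h = b" "Cod B h = c" "far R h \<cdot>\<^bsub>A\<^esub> \<eta> = \<zeta>"
    by (rule universal_arrow_ex[OF u, of c \<zeta>]) auto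
  obtain k where k: "k \<in> Arr B" "Dom B k = c" "Cod B k = b" "far R k \<cdot>\<^bsub>A\<^esub> \<zeta> = \<eta>"
    by (rule universal_arrow_ex[OF v, of b \<eta>]) auto
  have "k \<cdot>\<^bsub>B\<^esub> h = Ide B b"
    by (rule universal_arrow_uniq[OF u R]) (use h k in simp_all)
  moreover have "h \<cdot>\<^bsub>B\<^esub> k = Ide B c"
    by (rule universal_arrow_uniq[OF v R]) (use h k in simp_all)
  ultimately have "is_iso B h"
    by (intro R.A.is_isoI[of _ b c k]) (use h k in \<open>auto simp: in_Hom\<close>)
  then show ?thesis using that h by blast
qed

text \<open>At each object both functors carry a universal arrow from \<open>fob H x\<close> to
  \<open>R\<close>, so they differ by an isomorphism compatible with the units. Tested against the
  unit of \<open>F\<close>, naturality of the comparison becomes naturality of \<theta> and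
  \<theta>'.\<close>

lemma adj_unit_nat_iso:
  assumes F: "adj_unit X A B H F R \<theta>" and G: "adj_unit X A B H G R \<theta>'"
  shows "nat_iso X B F G"
proof -
  interpret F: cat_functor X B F using F by (simp add: adj_unit_def)
  interpret G: cat_functor X B G using G by (simp add: adj_unit_def)
  interpret H: cat_functor X A H using G by (simp add: adj_unit_def)
  have R: "cat_functor B A R" using F by (simp add: adj_unit_def)
  interpret R: cat_functor B A R by fact
  have uF: "universal_arrow A B R (fob H x) (fob F x) (\<theta> x)"
    and uG: "universal_arrow A B R (fob H x) (fob G x) (\<theta>' x)" if "x \<in> Obj X" for x
    using F G that by (auto simp: adj_unit_def)
  note [simp] = universal_arrow_Dom[OF uF] universal_arrow_Dom[OF uG]
  have "\<exists>h. is_iso B h \<and> Dom B h = fob F x \<and> Cod B h = fob G x \<and> far R h \<cdot>\<^bsub>A\<^esub> \<theta> x = \<theta>' x"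
    if "x \<in> Obj X" for x
    using universal_arrows_iso[OF uF[OF that] uG[OF that] R] by metis
  then obtain \<tau> where \<tau>: "\<And>x. x \<in> Obj X \<Longrightarrow> is_iso B (\<tau> x) \<and> Dom B (\<tau> x) = fob F x \<and>
      Cod B (\<tau> x) = fob G x \<and> far R (\<tau> x) \<cdot>\<^bsub>A\<^esub> \<theta> x = \<theta>' x"
    by metis
  have [simp]: "\<tau> x \<in> Arr B" "Dom B (\<tau> x) = fob F x" "Cod B (\<tau> x) = fob G x"
    "far R (\<tau> x) \<cdot>\<^bsub>A\<^esub> \<theta> x = \<theta>' x" if "x \<in> Obj X" for x
    using \<tau>[OF that] by (auto simp: is_iso_def)
  have "\<tau> (Cod X f) \<cdot>\<^bsub>B\<^esub> far F f = far G f \<cdot>\<^bsub>B\<^esub> \<tau> (Dom X f)" if f: "f \<in> Arr X" for f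
  proof (rule universal_arrow_uniq[OF uF[of "Dom X f"] R])
    have "far R (\<tau> (Cod X f) \<cdot>\<^bsub>B\<^esub> far F f) \<cdot>\<^bsub>A\<^esub> \<theta> (Dom X f) =
        far R (\<tau> (Cod X f)) \<cdot>\<^bsub>A\<^esub> (\<theta> (Cod X f) \<cdot>\<^bsub>A\<^esub> far H f)"
      using F f by (simp add: adj_unit_def)
    also have "\<dots> = (far R (\<tau> (Cod X f)) \<cdot>\<^bsub>A\<^esub> \<theta> (Cod X f)) \<cdot>\<^bsub>A\<^esub> far H f"
      by (rule H.B.Cmp_assoc'[symmetric]) (use f in simp_all)
    also have "\<dots> = far R (far G f) \<cdot>\<^bsub>A\<^esub> \<theta>' (Dom X f)"
      using G f by (simp add: adj_unit_def)
    finally show "far R (\<tau> (Cod X f) \<cdot>\<^bsub>B\<^esub> far F f) \<cdot>\<^bsub>A\<^esub> \<theta> (Dom X f) =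
      far R (far G f \<cdot>\<^bsub>B\<^esub> \<tau> (Dom X f)) \<cdot>\<^bsub>A\<^esub> \<theta> (Dom X f)"
      using f by simp
  qed (use f in simp_all)
  then show ?thesis
    unfolding nat_iso_def using \<tau> F.cat_functor_axioms G.cat_functor_axioms by blast
qed

lemma nat_iso_sym:
  assumes "nat_iso X B F G"
  shows "nat_iso X B G F"
proof -
  obtain \<tau> where F: "cat_functor X B F" and G: "cat_functor X B G" and
    \<tau>: "\<And>x. x \<in> Obj X \<Longrightarrow> is_iso B (\<tau> x) \<and> Dom B (\<tau> x) = fob F x \<and> Cod B (\<tau> x) = fob G x"
    and n: "\<And>f. f \<in> Arr X \<Longrightarrow> \<tau> (Cod X f) \<cdot>\<^bsub>B\<^esub> far F f = far G f \<cdot>\<^bsub>B\<^esub> \<tau> (Dom X f)"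
    using assms unfolding nat_iso_def by blast
  interpret F: cat_functor X B F by fact
  interpret G: cat_functor X B G by fact
  note [simp] = \<tau>[THEN conjunct1] \<tau>[THEN conjunct2, THEN conjunct1] \<tau>[THEN conjunct2, THEN conjunct2]
    \<tau>[THEN conjunct1, THEN F.B.is_iso_Arr]
  have "F.B.inv_arr (\<tau> (Cod X f)) \<cdot>\<^bsub>B\<^esub> far G f = far F f \<cdot>\<^bsub>B\<^esub> F.B.inv_arr (\<tau> (Dom X f))"
    if f: "f \<in> Arr X" for f
    by (rule F.B.iso_cancel_right[of "\<tau> (Dom X f)"]) (use f in \<open>simp_all flip: n\<close>)
  then show ?thesis
    unfolding nat_iso_def using F G
    by (intro conjI exI[of _ "\<lambda>x. F.B.inv_arr (\<tau> x)"]) auto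
qed

lemma nat_iso_is_iso:
  assumes "nat_iso X B F G" "f \<in> Arr X"
  shows "is_iso B (far F f) \<longleftrightarrow> is_iso B (far G f)"
proof -
  have "is_iso B (far G f)" if FG: "nat_iso X B F G" "is_iso B (far F f)" for F G
  proof -
    obtain \<tau> where F: "cat_functor X B F" and G: "cat_functor X B G" and
      \<tau>: "\<And>x. x \<in> Obj X \<Longrightarrow> is_iso B (\<tau> x) \<and> Dom B (\<tau> x) = fob F x \<and> Cod B (\<tau> x) = fob G x"
      and n: "\<And>f. f \<in> Arr X \<Longrightarrow> \<tau> (Cod X f) \<cdot>\<^bsub>B\<^esub> far F f = far G f \<cdot>\<^bsub>B\<^esub> \<tau> (Dom X f)"
      using FG(1) unfolding nat_iso_def by blast
    interpret F: cat_functor X B F by fact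
    interpret G: cat_functor X B G by fact
    note [simp] = \<tau>[THEN conjunct1] \<tau>[THEN conjunct2, THEN conjunct1] \<tau>[THEN conjunct2, THEN conjunct2]
      \<tau>[THEN conjunct1, THEN F.B.is_iso_Arr]
    have "far G f = (\<tau> (Cod X f) \<cdot>\<^bsub>B\<^esub> far F f) \<cdot>\<^bsub>B\<^esub> F.B.inv_arr (\<tau> (Dom X f))"
      using assms(2) by (simp add: n)
    also have "is_iso B \<dots>"
      using assms(2) FG(2) by (intro F.B.is_iso_Cmp) auto
    finally show ?thesis .
  qed
  then show ?thesis using assms nat_iso_sym by blast
qed

text \<open>A cone over the \<open>G\<close>-image of the diagram becomes one over the
  \<open>F\<close>-image after composing with inverse components; the mediating arrow is brought
  back by the component at \<open>l\<close>. That \<pi> is a cone before any functor is applied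
  makes its image under \<open>G\<close> a cone too.\<close>

lemma is_limit_nat_iso:
  assumes "nat_iso X B F G" and D: "cat_functor J X D" and c: "is_cone J X D l \<pi>"
    and lim: "is_limit J B (functr_comp F D) (fob F l) (far F \<circ> \<pi>)"
  shows "is_limit J B (functr_comp G D) (fob G l) (far G \<circ> \<pi>)"
proof -
  obtain \<tau> where F: "cat_functor X B F" and G: "cat_functor X B G" and
    \<tau>: "\<And>x. x \<in> Obj X \<Longrightarrow> is_iso B (\<tau> x) \<and> Dom B (\<tau> x) = fob F x \<and> Cod B (\<tau> x) = fob G x"
    and n: "\<And>f. f \<in> Arr X \<Longrightarrow> \<tau> (Cod X f) \<cdot>\<^bsub>B\<^esub> far F f = far G f \<cdot>\<^bsub>B\<^esub> \<tau> (Dom X f)"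
    using assms(1) unfolding nat_iso_def by blast
  interpret F: cat_functor X B F by fact
  interpret G: cat_functor X B G by fact
  interpret D: cat_functor J X D by fact
  let ?i = F.B.inv_arr
  note [simp] = \<tau>[THEN conjunct1] \<tau>[THEN conjunct2, THEN conjunct1] \<tau>[THEN conjunct2, THEN conjunct2]
    \<tau>[THEN conjunct1, THEN F.B.is_iso_Arr]
  have [simp]: "l \<in> Obj X" "\<And>j. j \<in> Obj J \<Longrightarrow> \<pi> j \<in> Arr X" "\<And>j. j \<in> Obj J \<Longrightarrow> Dom X (\<pi> j) = l"
    "\<And>j. j \<in> Obj J \<Longrightarrow> Cod X (\<pi> j) = fob D j"
    and co: "\<And>u. u \<in> Arr J \<Longrightarrow> far D u \<cdot>\<^bsub>X\<^esub> \<pi> (Dom J u) = \<pi> (Cod J u)"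
    using c by (auto simp: is_cone_def in_Hom)
  have n': "?i (\<tau> (Cod X f)) \<cdot>\<^bsub>B\<^esub> far G f = far F f \<cdot>\<^bsub>B\<^esub> ?i (\<tau> (Dom X f))" if f: "f \<in> Arr X" for f
    by (rule F.B.iso_cancel_right[of "\<tau> (Dom X f)"]) (use f in \<open>simp_all flip: n\<close>)
  show ?thesis
    unfolding is_limit_def
  proof (intro conjI allI impI)
    show "is_cone J B (functr_comp G D) (fob G l) (far G \<circ> \<pi>)"
      unfolding is_cone_def
      by (auto simp: in_Hom co simp flip: G.far_Cmp_simp)
    fix x \<xi> assume x: "is_cone J B (functr_comp G D) x \<xi>"
    have [simp]: "x \<in> Obj B" "\<And>j. j \<in> Obj J \<Longrightarrow> \<xi> j \<in> Arr B" "\<And>j. j \<in> Obj J \<Longrightarrow> Dom B (\<xi> j) = x"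
      "\<And>j. j \<in> Obj J \<Longrightarrow> Cod B (\<xi> j) = fob G (fob D j)"
      and x': "\<And>u. u \<in> Arr J \<Longrightarrow> far G (far D u) \<cdot>\<^bsub>B\<^esub> \<xi> (Dom J u) = \<xi> (Cod J u)"
      using x by (auto simp: is_cone_def in_Hom)
    have "is_cone J B (functr_comp F D) x (\<lambda>j. ?i (\<tau> (fob D j)) \<cdot>\<^bsub>B\<^esub> \<xi> j)"
      unfolding is_cone_def
    proof (intro conjI ballI)
      fix u assume u: "u \<in> Arr J"
      have "far F (far D u) \<cdot>\<^bsub>B\<^esub> ?i (\<tau> (fob D (Dom J u))) \<cdot>\<^bsub>B\<^esub> \<xi> (Dom J u) =
         (far F (far D u) \<cdot>\<^bsub>B\<^esub> ?i (\<tau> (fob D (Dom J u)))) \<cdot>\<^bsub>B\<^esub> \<xi> (Dom J u)"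
        using u by simp
      also have "\<dots> = (?i (\<tau> (fob D (Cod J u))) \<cdot>\<^bsub>B\<^esub> far G (far D u)) \<cdot>\<^bsub>B\<^esub> \<xi> (Dom J u)"
        using n'[of "far D u"] u by simp
      also have "\<dots> = ?i (\<tau> (fob D (Cod J u))) \<cdot>\<^bsub>B\<^esub> \<xi> (Cod J u)"
        using u by (simp add: x')
      finally show "far (functr_comp F D) u \<cdot>\<^bsub>B\<^esub> ?i (\<tau> (fob D (Dom J u))) \<cdot>\<^bsub>B\<^esub> \<xi> (Dom J u) =
         ?i (\<tau> (fob D (Cod J u))) \<cdot>\<^bsub>B\<^esub> \<xi> (Cod J u)" by simp
    qed (auto simp: in_Hom)
    note cone = this
    obtain h where h: "h \<in> Arr B" "Dom B h = x" "Cod B h = fob F l"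
      "\<And>j. j \<in> Obj J \<Longrightarrow> far F (\<pi> j) \<cdot>\<^bsub>B\<^esub> h = ?i (\<tau> (fob D j)) \<cdot>\<^bsub>B\<^esub> \<xi> j"
      by (rule is_limit_ex[OF lim cone]) auto
    show "\<exists>!h. h \<in> Hom B x (fob G l) \<and> (\<forall>j\<in>Obj J. (far G \<circ> \<pi>) j \<cdot>\<^bsub>B\<^esub> h = \<xi> j)"
    proof (intro ex1I[of _ "\<tau> l \<cdot>\<^bsub>B\<^esub> h"] conjI ballI)
      fix j assume j: "j \<in> Obj J"
      have "far G (\<pi> j) \<cdot>\<^bsub>B\<^esub> \<tau> l \<cdot>\<^bsub>B\<^esub> h = (far G (\<pi> j) \<cdot>\<^bsub>B\<^esub> \<tau> l) \<cdot>\<^bsub>B\<^esub> h" using j h by simp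
      also have "\<dots> = (\<tau> (fob D j) \<cdot>\<^bsub>B\<^esub> far F (\<pi> j)) \<cdot>\<^bsub>B\<^esub> h" using n[of "\<pi> j"] j by simp
      also have "\<dots> = \<tau> (fob D j) \<cdot>\<^bsub>B\<^esub> (far F (\<pi> j) \<cdot>\<^bsub>B\<^esub> h)"
        by (rule F.B.Cmp_assoc') (use j h in simp_all)
      also have "\<dots> = \<xi> j" using j by (simp add: h)
      finally show "(far G \<circ> \<pi>) j \<cdot>\<^bsub>B\<^esub> \<tau> l \<cdot>\<^bsub>B\<^esub> h = \<xi> j" by simp
    next
      fix k assume k: "k \<in> Hom B x (fob G l) \<and> (\<forall>j\<in>Obj J. (far G \<circ> \<pi>) j \<cdot>\<^bsub>B\<^esub> k = \<xi> j)"
      have k': "k \<in> Arr B" "Dom B k = x" "Cod B k = fob G l"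
        "\<And>j. j \<in> Obj J \<Longrightarrow> far G (\<pi> j) \<cdot>\<^bsub>B\<^esub> k = \<xi> j" using k by (auto simp: in_Hom)
      have "?i (\<tau> l) \<cdot>\<^bsub>B\<^esub> k = h"
      proof (rule is_limit_uniq[OF lim cone])
        fix j assume j: "j \<in> Obj J"
        have "far F (\<pi> j) \<cdot>\<^bsub>B\<^esub> ?i (\<tau> l) \<cdot>\<^bsub>B\<^esub> k = (far F (\<pi> j) \<cdot>\<^bsub>B\<^esub> ?i (\<tau> l)) \<cdot>\<^bsub>B\<^esub> k" using j k' by simp
        also have "\<dots> = (?i (\<tau> (fob D j)) \<cdot>\<^bsub>B\<^esub> far G (\<pi> j)) \<cdot>\<^bsub>B\<^esub> k" using n'[of "\<pi> j"] j by simp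
        also have "\<dots> = ?i (\<tau> (fob D j)) \<cdot>\<^bsub>B\<^esub> (far G (\<pi> j) \<cdot>\<^bsub>B\<^esub> k)"
          by (rule F.B.Cmp_assoc') (use j k' in simp_all)
        finally show "(far F \<circ> \<pi>) j \<cdot>\<^bsub>B\<^esub> ?i (\<tau> l) \<cdot>\<^bsub>B\<^esub> k = ?i (\<tau> (fob D j)) \<cdot>\<^bsub>B\<^esub> \<xi> j"
          using j by (simp add: k')
      qed (use h k' in simp_all)
      then show "k = \<tau> l \<cdot>\<^bsub>B\<^esub> h" using k' by (auto simp flip: F.B.Cmp_assoc')
    qed (use h in \<open>auto simp: in_Hom\<close>)
  qed
qed

lemma preserves_finite_limits_nat_iso:
  assumes "nat_iso X B F G" and F: "preserves_finite_limits X B F"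
  shows "preserves_finite_limits X B G"
  unfolding preserves_finite_limits_def
proof (intro allI impI, elim conjE)
  fix J :: "(nat, nat) cat" and D l \<pi>
  assume *: "category J" "finite (Arr J)" "cat_functor J X D" "is_limit J X D l \<pi>"
  show "is_limit J B (functr_comp G D) (fob G l) (far G \<circ> \<pi>)"
    by (rule is_limit_nat_iso[OF assms(1)])
      (use * F in \<open>auto simp: preserves_finite_limits_def is_limit_def\<close>)
qed

lemma preserves_finite_limits_comp:
  assumes F: "preserves_finite_limits A B F" and G: "preserves_finite_limits B C G"
    and "cat_functor A B F"
  shows "preserves_finite_limits A C (functr_comp G F)"
  unfolding preserves_finite_limits_def
proof (intro allI impI, elim conjE)
  fix J :: "(nat, nat) cat" and D l \<pi>
  assume *: "category J" "finite (Arr J)" "cat_functor J A D" "is_limit J A D l \<pi>"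
  have "is_limit J C (functr_comp G (functr_comp F D)) (fob G (fob F l)) (far G \<circ> (far F \<circ> \<pi>))"
    using * F G cat_functor_comp[OF *(3) assms(3)] unfolding preserves_finite_limits_def by simp
  then show "is_limit J C (functr_comp (functr_comp G F) D) (fob (functr_comp G F) l)
      (far (functr_comp G F) \<circ> \<pi>)"
    by (simp add: functr_comp_def comp_assoc)
qed

text \<open>A cone with vertex \<open>x\<close> transposes, leg by leg, to a cone over
  \<open>D\<close> with vertex \<open>fob L x\<close>. The transposed legs are compatible because
  arrows out of \<open>fob L x\<close> agree once their composites with the unit do.\<close>

lemma right_adjoint_is_limit:
  assumes adj: "adj_unit A A B id_functr L R \<theta>" and D: "cat_functor J B D"
    and lim: "is_limit J B D l \<pi>"
  shows "is_limit J A (functr_comp R D) (fob R l) (far R \<circ> \<pi>)"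
proof -
  have R: "cat_functor B A R" using adj by (simp add: adj_unit_def)
  interpret R: cat_functor B A R by fact
  interpret D: cat_functor J B D by fact
  have u: "universal_arrow A B R x (fob L x) (\<theta> x)" if "x \<in> Obj A" for x
    using adj that by (auto simp: adj_unit_def)
  have [simp]: "l \<in> Obj B" "\<And>j. j \<in> Obj J \<Longrightarrow> \<pi> j \<in> Arr B" "\<And>j. j \<in> Obj J \<Longrightarrow> Dom B (\<pi> j) = l"
    "\<And>j. j \<in> Obj J \<Longrightarrow> Cod B (\<pi> j) = fob D j"
    and co: "\<And>u. u \<in> Arr J \<Longrightarrow> far D u \<cdot>\<^bsub>B\<^esub> \<pi> (Dom J u) = \<pi> (Cod J u)"
    using lim by (auto simp: is_limit_def is_cone_def in_Hom)
  show ?thesis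
    unfolding is_limit_def
  proof (intro conjI allI impI)
    show "is_cone J A (functr_comp R D) (fob R l) (far R \<circ> \<pi>)"
      unfolding is_cone_def by (auto simp: in_Hom co simp flip: R.far_Cmp_simp)
    fix x \<xi> assume x: "is_cone J A (functr_comp R D) x \<xi>"
    have X [simp]: "x \<in> Obj A" "\<And>j. j \<in> Obj J \<Longrightarrow> \<xi> j \<in> Arr A" "\<And>j. j \<in> Obj J \<Longrightarrow> Dom A (\<xi> j) = x"
      "\<And>j. j \<in> Obj J \<Longrightarrow> Cod A (\<xi> j) = fob R (fob D j)"
      and x': "\<And>u. u \<in> Arr J \<Longrightarrow> far R (far D u) \<cdot>\<^bsub>A\<^esub> \<xi> (Dom J u) = \<xi> (Cod J u)"
      using x by (auto simp: is_cone_def in_Hom)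
    note [simp] = universal_arrow_Dom[OF u[OF X(1)]]
    have "\<exists>h. h \<in> Arr B \<and> Dom B h = fob L x \<and> Cod B h = fob D j \<and> far R h \<cdot>\<^bsub>A\<^esub> \<theta> x = \<xi> j"
      if "j \<in> Obj J" for j
      by (rule universal_arrow_ex[OF u[OF X(1)], of "fob D j" "\<xi> j"]) (use that in auto)
    then obtain \<zeta> where z [simp]: "\<And>j. j \<in> Obj J \<Longrightarrow> \<zeta> j \<in> Arr B"
      "\<And>j. j \<in> Obj J \<Longrightarrow> Dom B (\<zeta> j) = fob L x" "\<And>j. j \<in> Obj J \<Longrightarrow> Cod B (\<zeta> j) = fob D j"
      "\<And>j. j \<in> Obj J \<Longrightarrow> far R (\<zeta> j) \<cdot>\<^bsub>A\<^esub> \<theta> x = \<xi> j" by metis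
    have "is_cone J B D (fob L x) \<zeta>"
      unfolding is_cone_def
    proof (intro conjI ballI)
      fix v assume v: "v \<in> Arr J"
      show "far D v \<cdot>\<^bsub>B\<^esub> \<zeta> (Dom J v) = \<zeta> (Cod J v)"
        by (rule universal_arrow_uniq[OF u[OF X(1)] R]) (use v in \<open>simp_all add: x'\<close>)
    qed (auto simp: in_Hom)
    note cone = this
    obtain h where h: "h \<in> Arr B" "Dom B h = fob L x" "Cod B h = l"
      "\<And>j. j \<in> Obj J \<Longrightarrow> \<pi> j \<cdot>\<^bsub>B\<^esub> h = \<zeta> j"
      by (rule is_limit_ex[OF lim cone]) auto
    show "\<exists>!h. h \<in> Hom A x (fob R l) \<and> (\<forall>j\<in>Obj J. (far R \<circ> \<pi>) j \<cdot>\<^bsub>A\<^esub> h = \<xi> j)"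
    proof (intro ex1I[of _ "far R h \<cdot>\<^bsub>A\<^esub> \<theta> x"] conjI ballI)
      fix j assume j: "j \<in> Obj J"
      have "far R (\<pi> j) \<cdot>\<^bsub>A\<^esub> far R h \<cdot>\<^bsub>A\<^esub> \<theta> x = far R (\<pi> j \<cdot>\<^bsub>B\<^esub> h) \<cdot>\<^bsub>A\<^esub> \<theta> x"
        using j h(1-3) by simp
      then show "(far R \<circ> \<pi>) j \<cdot>\<^bsub>A\<^esub> far R h \<cdot>\<^bsub>A\<^esub> \<theta> x = \<xi> j" using j by (simp add: h(4))
    next
      fix k assume k: "k \<in> Hom A x (fob R l) \<and> (\<forall>j\<in>Obj J. (far R \<circ> \<pi>) j \<cdot>\<^bsub>A\<^esub> k = \<xi> j)"
      then have k': "k \<in> Arr A" "Dom A k = x" "Cod A k = fob R l"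
        "\<And>j. j \<in> Obj J \<Longrightarrow> far R (\<pi> j) \<cdot>\<^bsub>A\<^esub> k = \<xi> j" by (auto simp: in_Hom)
      obtain h' where h': "h' \<in> Arr B" "Dom B h' = fob L x" "Cod B h' = l" "far R h' \<cdot>\<^bsub>A\<^esub> \<theta> x = k"
        by (rule universal_arrow_ex[OF u[OF X(1)], of l k]) (use k' in auto)
      have "h' = h"
      proof (rule is_limit_uniq[OF lim cone])
        fix j assume j: "j \<in> Obj J"
        show "\<pi> j \<cdot>\<^bsub>B\<^esub> h' = \<zeta> j"
          by (rule universal_arrow_uniq[OF u[OF X(1)] R]) (use j h' k' in simp_all)
      qed (use h h' in auto)
      then show "k = far R h \<cdot>\<^bsub>A\<^esub> \<theta> x" using h' by simp
    qed (use h in \<open>auto simp: in_Hom\<close>)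
  qed
qed

section \<open>Coequalizers\<close>

definition is_coeq :: "('o, 'a, 'z) cat_scheme \<Rightarrow> 'a \<Rightarrow> 'a \<Rightarrow> 'a \<Rightarrow> bool" where
  "is_coeq A f g q \<longleftrightarrow> f \<in> Arr A \<and> g \<in> Arr A \<and> q \<in> Arr A \<and> Dom A f = Dom A g \<and>
     Cod A f = Dom A q \<and> Cod A g = Dom A q \<and> q \<cdot>\<^bsub>A\<^esub> f = q \<cdot>\<^bsub>A\<^esub> g \<and>
     (\<forall>t. t \<in> Arr A \<and> Dom A t = Dom A q \<and> t \<cdot>\<^bsub>A\<^esub> f = t \<cdot>\<^bsub>A\<^esub> g \<longrightarrow>
        (\<exists>!h. h \<in> Hom A (Cod A q) (Cod A t) \<and> h \<cdot>\<^bsub>A\<^esub> q = t))"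

lemma is_coeqD:
  assumes "is_coeq A f g q"
  shows "f \<in> Arr A" "g \<in> Arr A" "q \<in> Arr A" "Dom A f = Dom A g" "Cod A f = Dom A q"
    "Cod A g = Dom A q" "q \<cdot>\<^bsub>A\<^esub> f = q \<cdot>\<^bsub>A\<^esub> g"
  using assms by (auto simp: is_coeq_def)

lemma is_coeq_ex:
  assumes "is_coeq A f g q" "t \<in> Arr A" "Dom A t = Dom A q" "t \<cdot>\<^bsub>A\<^esub> f = t \<cdot>\<^bsub>A\<^esub> g"
  obtains h where "h \<in> Arr A" "Dom A h = Cod A q" "Cod A h = Cod A t" "h \<cdot>\<^bsub>A\<^esub> q = t"
proof -
  have "\<exists>!h. h \<in> Hom A (Cod A q) (Cod A t) \<and> h \<cdot>\<^bsub>A\<^esub> q = t"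
    using assms by (simp add: is_coeq_def)
  then show ?thesis using that by (auto simp: in_Hom)
qed

lemma (in category) is_coeq_epi:
  assumes "is_coeq C f g q"
  shows "is_epi C q"
  unfolding is_epi_def
proof (intro conjI allI ballI impI)
  note [simp] = is_coeqD[OF assms]
  show "q \<in> Arr C" by simp
  fix x u v assume u: "u \<in> Hom C (Cod C q) x" and v: "v \<in> Hom C (Cod C q) x" and eq: "u \<cdot> q = v \<cdot> q"
  have "\<exists>!h. h \<in> Hom C (Cod C q) (Cod C (u \<cdot> q)) \<and> h \<cdot> q = u \<cdot> q"
  proof -
    have "\<forall>t. t \<in> Arr C \<and> Dom C t = Dom C q \<and> t \<cdot> f = t \<cdot> g \<longrightarrow>
        (\<exists>!h. h \<in> Hom C (Cod C q) (Cod C t) \<and> h \<cdot> q = t)"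
      using assms unfolding is_coeq_def by blast
    moreover have "u \<cdot> q \<in> Arr C \<and> Dom C (u \<cdot> q) = Dom C q \<and> (u \<cdot> q) \<cdot> f = (u \<cdot> q) \<cdot> g"
      using u by (simp add: in_Hom)
    ultimately show ?thesis by blast
  qed
  then show "u = v" using u v eq by (auto simp: in_Hom)
qed

text \<open>Uniqueness of the factorization is traded for \<open>q\<close> being an epimorphism,
  which usually comes from composites or right factors of known epimorphisms.\<close>

lemma (in category) is_coeqI:
  assumes "f \<in> Arr C" "g \<in> Arr C" "is_epi C q" "Dom C f = Dom C g" "Cod C f = Dom C q"
    "Cod C g = Dom C q" "q \<cdot> f = q \<cdot> g"
    and "\<And>t. t \<in> Arr C \<Longrightarrow> Dom C t = Dom C q \<Longrightarrow> t \<cdot> f = t \<cdot> g \<Longrightarrow>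
      \<exists>h \<in> Hom C (Cod C q) (Cod C t). h \<cdot> q = t"
  shows "is_coeq C f g q"
  unfolding is_coeq_def
proof (intro conjI allI impI)
  show "q \<in> Arr C" using assms(3) by (simp add: is_epi_def)
  fix t assume t: "t \<in> Arr C \<and> Dom C t = Dom C q \<and> t \<cdot> f = t \<cdot> g"
  then obtain h where h: "h \<in> Hom C (Cod C q) (Cod C t)" "h \<cdot> q = t" using assms(8) by blast
  have "k = h" if "k \<in> Hom C (Cod C q) (Cod C t)" "k \<cdot> q = t" for k
    by (rule epiD[OF assms(3)]) (use h that in \<open>auto simp: in_Hom\<close>)
  then show "\<exists>!h. h \<in> Hom C (Cod C q) (Cod C t) \<and> h \<cdot> q = t" using h by blast
qed (use assms in auto)

text \<open>Simplification keeps composites nested to the right, and there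
  \<open>p \<cdot> q\<close> is not a subterm of \<open>p \<cdot> (q \<cdot> s)\<close>. Feeding an
  equation through this rule gives the version that rewrites within a longer composite.\<close>

lemma (in category) comp_chain:
  assumes "p \<cdot> q = r" "p \<in> Arr C" "q \<in> Arr C" "s \<in> Arr C" "Cod C q = Dom C p" "Cod C s = Dom C q"
  shows "p \<cdot> (q \<cdot> s) = r \<cdot> s"
  using assms by (simp flip: assms(1))

text \<open>Replacing a parallel pair by an isomorphic one changes its coequalizer only by
  precomposition with \<open>j\<close>. This serves to swap tensor factors and to pass from tensor
  products to iterated actions.\<close>

lemma (in category) is_coeq_iso:
  assumes q: "is_coeq C f g q" and i: "is_iso C i" "Cod C i = Dom C f" and j: "is_iso C j" "Cod C j = Dom C q"
    and f: "f' \<in> Arr C" "Dom C f' = Dom C i" "Cod C f' = Dom C j" "f \<cdot> i = j \<cdot> f'"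
    and g: "g' \<in> Arr C" "Dom C g' = Dom C i" "Cod C g' = Dom C j" "g \<cdot> i = j \<cdot> g'"
  shows "is_coeq C f' g' (q \<cdot> j)"
proof (rule is_coeqI)
  note [simp] = is_coeqD[OF q] i(2) j(2) f(1-3) g(1-3) is_iso_Arr[OF i(1)] is_iso_Arr[OF j(1)] i(1) j(1)
  show "is_epi C (q \<cdot> j)"
    by (rule epi_Cmp[OF iso_is_epi[OF j(1)] is_coeq_epi[OF q]]) simp
  have "(q \<cdot> f) \<cdot> i = (q \<cdot> g) \<cdot> i" by (simp only: is_coeqD(7)[OF q])
  then have "q \<cdot> (f \<cdot> i) = q \<cdot> (g \<cdot> i)" by (simp del: is_coeqD(7)[OF q])
  then show "(q \<cdot> j) \<cdot> f' = (q \<cdot> j) \<cdot> g'" unfolding f(4) g(4) by simp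
  fix t assume t [simp]: "t \<in> Arr C" "Dom C t = Dom C (q \<cdot> j)" and eq: "t \<cdot> f' = t \<cdot> g'"
  have "(t \<cdot> inv_arr j) \<cdot> f = (t \<cdot> inv_arr j) \<cdot> g"
  proof (rule iso_cancel_right[OF i(1)])
    have "((t \<cdot> inv_arr j) \<cdot> f) \<cdot> i = t \<cdot> (inv_arr j \<cdot> (f \<cdot> i))" by simp
    also have "\<dots> = t \<cdot> f'" by (simp add: f(4))
    also have "\<dots> = t \<cdot> (inv_arr j \<cdot> (g \<cdot> i))" by (simp add: g(4) eq)
    also have "\<dots> = ((t \<cdot> inv_arr j) \<cdot> g) \<cdot> i" by simp
    finally show "((t \<cdot> inv_arr j) \<cdot> f) \<cdot> i = ((t \<cdot> inv_arr j) \<cdot> g) \<cdot> i" .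
  qed simp_all
  note eq' = this
  obtain h where h: "h \<in> Arr C" "Dom C h = Cod C q" "Cod C h = Cod C t" "h \<cdot> q = t \<cdot> inv_arr j"
    by (rule is_coeq_ex[OF q _ _ eq']) auto
  have "h \<cdot> (q \<cdot> j) = t \<cdot> inv_arr j \<cdot> j" using h by (simp add: comp_chain[OF h(4)])
  then show "\<exists>h\<in>Hom C (Cod C (q \<cdot> j)) (Cod C t). h \<cdot> q \<cdot> j = t"
    using h by (intro bexI[of _ h]) (auto simp: in_Hom)
qed (use assms in \<open>auto simp: is_coeq_def is_iso_def\<close>)

lemma (in category) is_coeq_post_iso:
  assumes q: "is_coeq C f g q" and i: "is_iso C i" "Dom C i = Cod C q"
  shows "is_coeq C f g (i \<cdot> q)"
proof (rule is_coeqI)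
  note [simp] = is_coeqD[OF q] i is_iso_Arr[OF i(1)]
  show "is_epi C (i \<cdot> q)"
    by (rule epi_Cmp[OF is_coeq_epi[OF q] iso_is_epi[OF i(1)]]) simp
  show "(i \<cdot> q) \<cdot> f = (i \<cdot> q) \<cdot> g" by simp
  fix t assume t [simp]: "t \<in> Arr C" "Dom C t = Dom C (i \<cdot> q)" and eq: "t \<cdot> f = t \<cdot> g"
  obtain h where h: "h \<in> Arr C" "Dom C h = Cod C q" "Cod C h = Cod C t" "h \<cdot> q = t"
    by (rule is_coeq_ex[OF q t(1) _ eq]) auto
  show "\<exists>h\<in>Hom C (Cod C (i \<cdot> q)) (Cod C t). h \<cdot> i \<cdot> q = t"
    by (rule bexI[of _ "h \<cdot> inv_arr i"]) (use h in \<open>auto simp: in_Hom\<close>)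
qed (use assms in \<open>auto simp: is_coeq_def is_iso_def\<close>)

text \<open>The walking parallel pair \<open>c, d : a \<rightarrow> b\<close>; the identities of \<open>a\<close> and \<open>b\<close> are \<open>a\<close> and \<open>b\<close>.\<close>

definition pair_cat :: "'u \<Rightarrow> 'u \<Rightarrow> 'u \<Rightarrow> 'u \<Rightarrow> ('u, 'u) cat" where
  "pair_cat a b c d = \<lparr>Obj = {a, b}, Arr = {a, b, c, d},
     Dom = (\<lambda>x. if x = b then b else a), Cod = (\<lambda>x. if x = a then a else b),
     Ide = (\<lambda>x. x), Cmp = (\<lambda>g f. if g = a \<or> g = b then f else g)\<rparr>"

definition pair_functr ::
  "('o, 'a, 'z) cat_scheme \<Rightarrow> 'a \<Rightarrow> 'a \<Rightarrow> 'u \<Rightarrow> 'u \<Rightarrow> 'u \<Rightarrow> 'u \<Rightarrow> ('u, 'u, 'o, 'a) functr" where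
  "pair_functr A f g a b c d = \<lparr>fob = (\<lambda>x. if x = a then Dom A f else Cod A f),
     far = (\<lambda>x. if x = a then Ide A (Dom A f) else if x = b then Ide A (Cod A f)
                else if x = c then f else g)\<rparr>"

lemma small_pair_cat:
  assumes "infinite (UNIV :: 'u set)" "distinct [a, b, c, d :: 'u]"
  shows "small_cat (pair_cat a b c d)"
proof -
  have "category (pair_cat a b c d)"
    using assms(2) by unfold_locales (auto simp: pair_cat_def in_Hom split: if_splits)
  then show ?thesis
    using assms(1) by (auto simp: small_cat_def pair_cat_def intro: finite_lesspoll_infinite)
qed

lemma cat_functor_pair:
  assumes "infinite (UNIV :: 'u set)" "distinct [a, b, c, d :: 'u]"
    and "category A" "f \<in> Arr A" "g \<in> Arr A" "Dom A f = Dom A g" "Cod A f = Cod A g"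
  shows "cat_functor (pair_cat a b c d) A (pair_functr A f g a b c d)"
proof -
  interpret category A by fact
  show ?thesis
    using small_pair_cat[OF assms(1,2)] assms(2-)
    by (intro cat_functorI) (auto simp: small_cat_def pair_cat_def pair_functr_def in_Hom)
qed

text \<open>A cocone on the walking pair is determined by its leg at \<open>b\<close>, since the leg
  at \<open>a\<close> is that one composed with either arrow. The two universal properties match
  once the leg at \<open>a\<close> is discarded.\<close>

lemma is_colimit_pair_coeq:
  assumes d: "distinct [a, b, c, d]" and "cat_functor (pair_cat a b c d) A D"
    and lim: "is_colimit (pair_cat a b c d) A D e \<iota>"
  shows "is_coeq A (far D c) (far D d) (\<iota> b)"
proof -
  interpret D: cat_functor "pair_cat a b c d" A D by fact
  have [simp]: "far D c \<in> Arr A" "Dom A (far D c) = fob D a" "Cod A (far D c) = fob D b"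
      "far D d \<in> Arr A" "Dom A (far D d) = fob D a" "Cod A (far D d) = fob D b"
      "fob D a \<in> Obj A" "fob D b \<in> Obj A" "far D a = Ide A (fob D a)" "far D b = Ide A (fob D b)"
    using D.far_simps[of c] D.far_simps[of d] D.fob_in[of a] D.fob_in[of b]
      D.far_Ide_simp[of a] D.far_Ide_simp[of b] d by (auto simp: pair_cat_def)
  have i [simp]: "\<iota> a \<in> Arr A" "\<iota> b \<in> Arr A" "Dom A (\<iota> a) = fob D a" "Dom A (\<iota> b) = fob D b"
    "Cod A (\<iota> a) = e" "Cod A (\<iota> b) = e" "\<iota> b \<cdot>\<^bsub>A\<^esub> far D c = \<iota> a" "\<iota> b \<cdot>\<^bsub>A\<^esub> far D d = \<iota> a"
    using lim d by (auto simp: is_colimit_def is_cocone_def pair_cat_def in_Hom)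
  show ?thesis
    unfolding is_coeq_def
  proof (intro conjI allI impI)
    fix t assume t: "t \<in> Arr A \<and> Dom A t = Dom A (\<iota> b) \<and> t \<cdot>\<^bsub>A\<^esub> far D c = t \<cdot>\<^bsub>A\<^esub> far D d"
    then have [simp]: "t \<in> Arr A" "Dom A t = fob D b" and eq: "t \<cdot>\<^bsub>A\<^esub> far D d = t \<cdot>\<^bsub>A\<^esub> far D c" by auto
    have "is_cocone (pair_cat a b c d) A D (Cod A t) (\<lambda>x. if x = a then t \<cdot>\<^bsub>A\<^esub> far D c else t)"
      using d by (auto simp: is_cocone_def pair_cat_def in_Hom eq)
    then have "\<exists>!h. h \<in> Hom A e (Cod A t) \<and>
       (\<forall>j\<in>Obj (pair_cat a b c d). h \<cdot>\<^bsub>A\<^esub> \<iota> j = (if j = a then t \<cdot>\<^bsub>A\<^esub> far D c else t))"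
      using lim unfolding is_colimit_def by blast
    moreover have "h \<cdot>\<^bsub>A\<^esub> \<iota> a = t \<cdot>\<^bsub>A\<^esub> far D c" if "h \<in> Hom A e (Cod A t)" "h \<cdot>\<^bsub>A\<^esub> \<iota> b = t" for h
    proof -
      have "h \<cdot>\<^bsub>A\<^esub> \<iota> a = (h \<cdot>\<^bsub>A\<^esub> \<iota> b) \<cdot>\<^bsub>A\<^esub> far D c"
        using that(1) by (simp add: in_Hom)
      then show ?thesis using that(2) by simp
    qed
    ultimately have "\<exists>!h. h \<in> Hom A e (Cod A t) \<and> h \<cdot>\<^bsub>A\<^esub> \<iota> b = t"
      using d by (simp add: pair_cat_def) metis
    then show "\<exists>!h. h \<in> Hom A (Cod A (\<iota> b)) (Cod A t) \<and> h \<cdot>\<^bsub>A\<^esub> \<iota> b = t"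
      by simp
  qed simp_all
qed

lemma is_coeq_colimit_pair:
  assumes d: "distinct [a, b, c, d]" and "category A" and q: "is_coeq A f g q"
  shows "is_colimit (pair_cat a b c d) A (pair_functr A f g a b c d) (Cod A q)
    (\<lambda>x. if x = a then q \<cdot>\<^bsub>A\<^esub> f else q)"
proof -
  interpret category A by fact
  note [simp] = is_coeqD(1-3)[OF q] is_coeqD(7)[OF q]
  have [simp]: "Dom A f = Dom A g" "Cod A f = Dom A q" "Cod A g = Dom A q" using is_coeqD[OF q] by auto
  show ?thesis
    unfolding is_colimit_def
  proof (intro conjI allI impI)
    show "is_cocone (pair_cat a b c d) A (pair_functr A f g a b c d) (Cod A q)
      (\<lambda>x. if x = a then q \<cdot>\<^bsub>A\<^esub> f else q)"
      using d by (auto simp: is_cocone_def pair_cat_def pair_functr_def in_Hom)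
    fix x \<xi> assume "is_cocone (pair_cat a b c d) A (pair_functr A f g a b c d) x \<xi>"
    then have [simp]: "\<xi> a \<in> Arr A" "\<xi> b \<in> Arr A" "Dom A (\<xi> a) = Dom A g" "Dom A (\<xi> b) = Dom A q"
      "Cod A (\<xi> a) = x" "Cod A (\<xi> b) = x" "\<xi> b \<cdot>\<^bsub>A\<^esub> f = \<xi> a" "\<xi> b \<cdot>\<^bsub>A\<^esub> g = \<xi> a"
      using d by (auto simp: is_cocone_def pair_cat_def pair_functr_def in_Hom)
    obtain h where h: "h \<in> Arr A" "Dom A h = Cod A q" "Cod A h = x" "h \<cdot>\<^bsub>A\<^esub> q = \<xi> b"
      by (rule is_coeq_ex[OF q, of "\<xi> b"]) auto
    show "\<exists>!h. h \<in> Hom A (Cod A q) x \<and>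
      (\<forall>j\<in>Obj (pair_cat a b c d). h \<cdot>\<^bsub>A\<^esub> (if j = a then q \<cdot>\<^bsub>A\<^esub> f else q) = \<xi> j)"
    proof (rule ex1I[of _ h])
      have "h \<cdot>\<^bsub>A\<^esub> q \<cdot>\<^bsub>A\<^esub> f = \<xi> a"
        by (subst comp_chain[OF h(4)]) (use h(1-3) in simp_all)
      then show "h \<in> Hom A (Cod A q) x \<and>
        (\<forall>j\<in>Obj (pair_cat a b c d). h \<cdot>\<^bsub>A\<^esub> (if j = a then q \<cdot>\<^bsub>A\<^esub> f else q) = \<xi> j)"
        using h by (simp add: pair_cat_def in_Hom)
      fix k assume k: "k \<in> Hom A (Cod A q) x \<and>
        (\<forall>j\<in>Obj (pair_cat a b c d). k \<cdot>\<^bsub>A\<^esub> (if j = a then q \<cdot>\<^bsub>A\<^esub> f else q) = \<xi> j)"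
      have k: "k \<cdot>\<^bsub>A\<^esub> q = \<xi> b" "k \<in> Arr A" "Dom A k = Cod A q" "Cod A k = x"
        using k d by (auto simp: pair_cat_def in_Hom)
      show "k = h"
        by (rule epiD[OF is_coeq_epi[OF q]]) (use h k in simp_all)
    qed
  qed
qed

text \<open>Diagrams in \<open>cocomplete_cat\<close> and \<open>preserves_colimits\<close> are
  indexed by categories over the universe \<open>'u\<close>, so the four arrows of the walking pair
  have to be found there.\<close>

lemma infinite_distinct4:
  assumes "infinite (UNIV :: 'u set)"
  obtains a b c d :: 'u where "distinct [a, b, c, d]"
proof -
  obtain A :: "'u set" where "finite A" "card A = 4"
    using infinite_arbitrarily_large[OF assms] by blast
  then obtain xs where "set xs = A" "distinct xs" by (meson finite_distinct_list)
  then have "distinct xs" "length xs = 4" using \<open>card A = 4\<close> distinct_card[of xs] by auto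
  then show ?thesis using that[of "xs ! 0" "xs ! 1" "xs ! 2" "xs ! 3"]
    by (simp add: nth_eq_iff_index_eq)
qed

lemma cocomplete_coeq:
  assumes "infinite (UNIV :: 'u set)" "cocomplete_cat TYPE('u) A" "category A"
    and "f \<in> Arr A" "g \<in> Arr A" "Dom A f = Dom A g" "Cod A f = Cod A g"
  obtains q where "is_coeq A f g q"
proof -
  obtain a b c d :: 'u where d: "distinct [a, b, c, d]" by (rule infinite_distinct4[OF assms(1)])
  let ?D = "pair_functr A f g a b c d"
  have D: "cat_functor (pair_cat a b c d) A ?D"
    using cat_functor_pair[OF assms(1) d assms(3-)] .
  obtain e \<iota> where "is_colimit (pair_cat a b c d) A ?D e \<iota>"
    using assms(2) D small_pair_cat[OF assms(1) d] unfolding cocomplete_cat_def by blast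
  from is_colimit_pair_coeq[OF d D this] show ?thesis
    using that d by (auto simp: pair_functr_def)
qed

lemma preserves_colimits_coeq:
  assumes inf: "infinite (UNIV :: 'u set)" and F: "preserves_colimits TYPE('u) A B F" "cat_functor A B F"
    and q: "is_coeq A f g q"
  shows "is_coeq B (far F f) (far F g) (far F q)"
proof -
  interpret F: cat_functor A B F by fact
  obtain a b c d :: 'u where d: "distinct [a, b, c, d]" by (rule infinite_distinct4[OF inf])
  let ?D = "pair_functr A f g a b c d"
  have D: "cat_functor (pair_cat a b c d) A ?D"
    by (rule cat_functor_pair[OF inf d F.A.category_axioms]) (use is_coeqD[OF q] in auto)
  have "is_colimit (pair_cat a b c d) B (functr_comp F ?D) (fob F (Cod A q))
     (far F \<circ> (\<lambda>x. if x = a then q \<cdot>\<^bsub>A\<^esub> f else q))"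
    using F(1) D small_pair_cat[OF inf d] is_coeq_colimit_pair[OF d F.A.category_axioms q]
    unfolding preserves_colimits_def by blast
  from is_colimit_pair_coeq[OF d cat_functor_comp[OF D F(2)] this] show ?thesis
    using d by (auto simp: pair_functr_def)
qed

text \<open>Arrows out of \<open>fob L x\<close> are transposed to arrows out of \<open>x\<close>,
  where the property of \<open>q\<close> applies. The purpose is preservation of coequalizers by
  \<open>- \<otimes> X\<close>, a left adjoint by closedness.\<close>

lemma left_adjoint_coeq:
  assumes adj: "adj_unit A A B id_functr L R \<theta>" and q: "is_coeq A f g q"
  shows "is_coeq B (far L f) (far L g) (far L q)"
proof -
  have R: "cat_functor B A R" using adj by (simp add: adj_unit_def)
  interpret R: cat_functor B A R by fact
  interpret L: cat_functor A B L using adj by (simp add: adj_unit_def)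
  have u: "universal_arrow A B R x (fob L x) (\<theta> x)" if "x \<in> Obj A" for x
    using adj that by (auto simp: adj_unit_def)
  have n: "far R (far L f) \<cdot>\<^bsub>A\<^esub> \<theta> x = \<theta> y \<cdot>\<^bsub>A\<^esub> f"
    if "f \<in> Arr A" "Dom A f = x" "Cod A f = y" for f x y
    using adj that by (auto simp: adj_unit_def)
  note [simp] = is_coeqD(1-3)[OF q] universal_arrow_Dom[OF u]
  have [simp]: "Dom A f = Dom A g" "Cod A f = Dom A q" "Cod A g = Dom A q" using is_coeqD[OF q] by auto
  have eq: "far L q \<cdot>\<^bsub>B\<^esub> far L f = far L q \<cdot>\<^bsub>B\<^esub> far L g"
    using is_coeqD(7)[OF q] by (simp flip: L.far_Cmp_simp)
  have epi: "is_epi B (far L q)"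
    unfolding is_epi_def
  proof (intro conjI allI ballI impI)
    fix x s t assume st: "s \<in> Hom B (Cod B (far L q)) x" "t \<in> Hom B (Cod B (far L q)) x"
      and eq: "s \<cdot>\<^bsub>B\<^esub> far L q = t \<cdot>\<^bsub>B\<^esub> far L q"
    have [simp]: "s \<in> Arr B" "t \<in> Arr B" "Dom B s = fob L (Cod A q)" "Dom B t = fob L (Cod A q)"
      "Cod B s = x" "Cod B t = x" using st by (auto simp: in_Hom)
    show "s = t"
    proof (rule universal_arrow_uniq[OF u R])
      show "far R s \<cdot>\<^bsub>A\<^esub> \<theta> (Cod A q) = far R t \<cdot>\<^bsub>A\<^esub> \<theta> (Cod A q)"
      proof (rule R.B.epiD[OF R.B.is_coeq_epi[OF q]])
        have "far R s \<cdot>\<^bsub>A\<^esub> (\<theta> (Cod A q) \<cdot>\<^bsub>A\<^esub> q) = far R (s \<cdot>\<^bsub>B\<^esub> far L q) \<cdot>\<^bsub>A\<^esub> \<theta> (Dom A q)"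
          by (simp add: n)
        also have "\<dots> = far R t \<cdot>\<^bsub>A\<^esub> (\<theta> (Cod A q) \<cdot>\<^bsub>A\<^esub> q)"
          unfolding eq by (simp add: n)
        finally show "(far R s \<cdot>\<^bsub>A\<^esub> \<theta> (Cod A q)) \<cdot>\<^bsub>A\<^esub> q = (far R t \<cdot>\<^bsub>A\<^esub> \<theta> (Cod A q)) \<cdot>\<^bsub>A\<^esub> q"
          by simp
      qed simp_all
    qed simp_all
  qed simp
  show ?thesis
  proof (rule R.A.is_coeqI[OF _ _ epi])
    fix t assume t: "t \<in> Arr B" "Dom B t = Dom B (far L q)"
      and teq: "t \<cdot>\<^bsub>B\<^esub> far L f = t \<cdot>\<^bsub>B\<^esub> far L g"
    then have [simp]: "t \<in> Arr B" "Dom B t = fob L (Dom A q)" by auto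
    have "(far R t \<cdot>\<^bsub>A\<^esub> \<theta> (Dom A q)) \<cdot>\<^bsub>A\<^esub> f = far R (t \<cdot>\<^bsub>B\<^esub> far L f) \<cdot>\<^bsub>A\<^esub> \<theta> (Dom A f)"
      by (simp add: n)
    also have "\<dots> = (far R t \<cdot>\<^bsub>A\<^esub> \<theta> (Dom A q)) \<cdot>\<^bsub>A\<^esub> g"
      unfolding teq by (simp add: n)
    finally have eq': "(far R t \<cdot>\<^bsub>A\<^esub> \<theta> (Dom A q)) \<cdot>\<^bsub>A\<^esub> f = (far R t \<cdot>\<^bsub>A\<^esub> \<theta> (Dom A q)) \<cdot>\<^bsub>A\<^esub> g" .
    obtain h where h: "h \<in> Arr A" "Dom A h = Cod A q" "Cod A h = fob R (Cod B t)"
      "h \<cdot>\<^bsub>A\<^esub> q = far R t \<cdot>\<^bsub>A\<^esub> \<theta> (Dom A q)"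
      by (rule is_coeq_ex[OF q _ _ eq']) auto
    obtain k where k: "k \<in> Arr B" "Dom B k = fob L (Cod A q)" "Cod B k = Cod B t"
      "far R k \<cdot>\<^bsub>A\<^esub> \<theta> (Cod A q) = h"
      by (rule universal_arrow_ex[OF u, of "Cod A q" "Cod B t" h]) (use h in auto)
    have "k \<cdot>\<^bsub>B\<^esub> far L q = t"
    proof (rule universal_arrow_uniq[OF u R])
      have "far R (k \<cdot>\<^bsub>B\<^esub> far L q) \<cdot>\<^bsub>A\<^esub> \<theta> (Dom A q) = (far R k \<cdot>\<^bsub>A\<^esub> \<theta> (Cod A q)) \<cdot>\<^bsub>A\<^esub> q"
        using k(1-3) by (simp add: n)
      then show "far R (k \<cdot>\<^bsub>B\<^esub> far L q) \<cdot>\<^bsub>A\<^esub> \<theta> (Dom A q) = far R t \<cdot>\<^bsub>A\<^esub> \<theta> (Dom A q)"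
        using k h by simp
    qed (use k in simp_all)
    then show "\<exists>h\<in>Hom B (Cod B (far L q)) (Cod B t). h \<cdot>\<^bsub>B\<^esub> far L q = t"
      using k by (intro bexI[of _ k]) (auto simp: in_Hom)
  qed (use eq in simp_all)
qed

section \<open>Epimorphisms of finite type\<close>

lemma filtered_catD:
  assumes "filtered_cat J"
  shows "category J" "Obj J \<noteq> {}"
    "\<And>i j. i \<in> Obj J \<Longrightarrow> j \<in> Obj J \<Longrightarrow> \<exists>k u v. u \<in> Hom J i k \<and> v \<in> Hom J j k"
    "\<And>i j u v. u \<in> Hom J i j \<Longrightarrow> v \<in> Hom J i j \<Longrightarrow> \<exists>k. \<exists>w \<in> Hom J j k. w \<cdot>\<^bsub>J\<^esub> u = w \<cdot>\<^bsub>J\<^esub> v"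
  using assms unfolding filtered_cat_def by blast+

text \<open>If all sets \<open>A(b, x)\<close> have at most one element, then the canonical map is injective for
  trivial reasons, and bijectivity only asserts that its domain is inhabited when its codomain is.\<close>

lemma canonical_map_bij_iff:
  assumes sub: "\<And>x f g. f \<in> Hom A b x \<Longrightarrow> g \<in> Hom A b x \<Longrightarrow> f = g"
    and J: "filtered_cat J" and D: "cat_functor J A D" and c: "is_cocone J A D c \<iota>"
  shows "bij_betw (canonical_map A \<iota>) (colim_Hom J A D b) (Hom A b c) \<longleftrightarrow>
    (Hom A b c \<noteq> {} \<longrightarrow> (\<exists>i \<in> Obj J. Hom A b (fob D i) \<noteq> {}))"
proof -
  interpret D: cat_functor J A D by fact
  define S where "S = (SIGMA i : Obj J. Hom A b (fob D i))"
  define r where "r = {((i, x), (j, far D u \<cdot>\<^bsub>A\<^esub> x)) | i j u x. u \<in> Hom J i j \<and> x \<in> Hom A b (fob D i)}"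
  define R where "R = (r \<union> r\<inverse>)\<^sup>*"
  have H: "colim_Hom J A D b = S // R"
    by (simp add: colim_Hom_def Let_def S_def r_def R_def)
  have rS: "r \<subseteq> S \<times> S"
    by (auto simp: r_def S_def in_Hom)
  have RS: "q \<in> S" if "(p, q) \<in> R" "p \<in> S" for p q
    using that unfolding R_def by (induction rule: rtrancl_induct) (use rS in auto)
  have sym: "sym R" and trans: "trans R"
    unfolding R_def by (auto intro: sym_rtrancl sym_Un_converse trans_rtrancl)
  \<comment> \<open>Both elements are moved to a common upper bound \<open>k\<close>, where their
    images coincide because \<open>Hom A b (fob D k)\<close> has at most one element. Hence there is
    at most one equivalence class.\<close>
  have related: "(p, q) \<in> R" if "p \<in> S" "q \<in> S" for p q
  proof -
    obtain i x j y where pq: "p = (i, x)" "q = (j, y)" by (cases p, cases q)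
    have ij: "i \<in> Obj J" "j \<in> Obj J" "x \<in> Hom A b (fob D i)" "y \<in> Hom A b (fob D j)"
      using that by (auto simp: S_def pq)
    obtain k u v where uv: "u \<in> Hom J i k" "v \<in> Hom J j k" using filtered_catD(3)[OF J ij(1,2)] by blast
    have "far D u \<cdot>\<^bsub>A\<^esub> x \<in> Hom A b (fob D k)" "far D v \<cdot>\<^bsub>A\<^esub> y \<in> Hom A b (fob D k)"
      using uv ij by (auto simp: in_Hom)
    then have "far D u \<cdot>\<^bsub>A\<^esub> x = far D v \<cdot>\<^bsub>A\<^esub> y" by (rule sub)
    then have "(p, (k, far D u \<cdot>\<^bsub>A\<^esub> x)) \<in> r" "(q, (k, far D u \<cdot>\<^bsub>A\<^esub> x)) \<in> r"
      using uv ij unfolding r_def pq by blast+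
    then have "(p, (k, far D u \<cdot>\<^bsub>A\<^esub> x)) \<in> R" "((k, far D u \<cdot>\<^bsub>A\<^esub> x), q) \<in> R"
      unfolding R_def by (auto intro: r_into_rtrancl)
    then show ?thesis using trans by (blast dest: transD)
  qed
  have cls: "R `` {p} = S" if "p \<in> S" for p
    using that related RS by blast
  have Q: "S // R = (if S = {} then {} else {S})"
  proof (cases "S = {}")
    case False
    then obtain p where "p \<in> S" by blast
    then show ?thesis unfolding quotient_def using cls by (simp add: False)
  qed (simp add: quotient_def)
  \<comment> \<open>\<open>the_elem\<close> is meaningful here since the image of the single class
    lies in \<open>Hom A b c\<close>, again a set with at most one element.\<close>
  have img: "canonical_map A \<iota> S \<in> Hom A b c" if S: "S \<noteq> {}"
  proof -
    have sH: "(\<lambda>(i, x). \<iota> i \<cdot>\<^bsub>A\<^esub> x) ` S \<subseteq> Hom A b c"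
      using c by (auto simp: S_def is_cocone_def in_Hom)
    obtain p where p: "p \<in> S" using S by blast
    let ?f = "\<lambda>(i, x). \<iota> i \<cdot>\<^bsub>A\<^esub> x"
    have "?f ` S = {?f p}" using sH p sub by blast
    then show ?thesis unfolding canonical_map_def using sH p by auto
  qed
  have ne: "S \<noteq> {} \<longleftrightarrow> (\<exists>i \<in> Obj J. Hom A b (fob D i) \<noteq> {})"
    by (auto simp: S_def)
  show ?thesis
  proof (cases "S = {}")
    case True
    then show ?thesis using ne by (auto simp: H Q bij_betw_def)
  next
    case False
    then have "Hom A b c = {canonical_map A \<iota> S}" using img sub by blast
    then show ?thesis using False ne by (auto simp: H Q bij_betw_def)
  qed
qed

context category
begin

lemma coslice_simps [simp]:
  "Obj (coslice C a) = {h \<in> Arr C. Dom C h = a}" "Dom (coslice C a) = src" "Cod (coslice C a) = tgt"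
  "Ide (coslice C a) h = SArr h (Ide C (Cod C h)) h"
  "g \<cdot>\<^bsub>coslice C a\<^esub> f = SArr (src f) (und g \<cdot> und f) (tgt g)"
  by (simp_all add: coslice_def structured_cat_def)

lemma coslice_Arr:
  "f \<in> Arr (coslice C a) \<longleftrightarrow> src f \<in> Arr C \<and> Dom C (src f) = a \<and> tgt f \<in> Arr C \<and> Dom C (tgt f) = a \<and>
     und f \<in> Arr C \<and> Dom C (und f) = Cod C (src f) \<and> Cod C (und f) = Cod C (tgt f) \<and> und f \<cdot> src f = tgt f"
  by (cases f) (auto simp: coslice_def structured_cat_def in_Hom)

lemma coslice_Hom_ne:
  assumes "h \<in> Arr C" "k \<in> Arr C" "Dom C h = a" "Dom C k = a"
  shows "Hom (coslice C a) h k \<noteq> {} \<longleftrightarrow> (\<exists>f. f \<in> Arr C \<and> Dom C f = Cod C h \<and> Cod C f = Cod C k \<and> f \<cdot> h = k)"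
proof
  assume "Hom (coslice C a) h k \<noteq> {}"
  then obtain f where "f \<in> Hom (coslice C a) h k" by blast
  then show "\<exists>f. f \<in> Arr C \<and> Dom C f = Cod C h \<and> Cod C f = Cod C k \<and> f \<cdot> h = k"
    by (intro exI[of _ "und f"]) (auto simp: in_Hom coslice_Arr)
next
  assume "\<exists>f. f \<in> Arr C \<and> Dom C f = Cod C h \<and> Cod C f = Cod C k \<and> f \<cdot> h = k"
  then obtain f where "f \<in> Arr C" "Dom C f = Cod C h" "Cod C f = Cod C k" "f \<cdot> h = k" by blast
  then have "SArr h f k \<in> Hom (coslice C a) h k"
    using assms by (simp add: in_Hom coslice_Arr)
  then show "Hom (coslice C a) h k \<noteq> {}" by blast
qed

lemma category_coslice: "category (coslice C a)"
proof (unfold_locales, goal_cases)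
  case (4 f a b g c)
  then show ?case by (auto simp: in_Hom coslice_Arr comp_chain)
qed (auto simp: in_Hom coslice_Arr intro: sarr.expand)

text \<open>This is the hypothesis under which finite type collapses to the existence of a
  factorization: the underlying arrows agree after precomposition with the epimorphism
  \<alpha>.\<close>

lemma coslice_Hom_epi:
  assumes "is_epi C \<alpha>" "Dom C \<alpha> = a" "f \<in> Hom (coslice C a) \<alpha> k" "g \<in> Hom (coslice C a) \<alpha> k"
  shows "f = g"
proof (rule sarr.expand)
  have "und f = und g"
    by (rule epiD[OF assms(1)]) (use assms(3,4) in \<open>auto simp: in_Hom coslice_Arr\<close>)
  then show "src f = src g \<and> und f = und g \<and> tgt f = tgt g" using assms(3,4) by (auto simp: in_Hom)
qed

text \<open>For an epimorphism, this amounts to being of finite type by the preceding observation.\<close>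

definition finite_epi :: "'u itself \<Rightarrow> 'a \<Rightarrow> bool" where
  "finite_epi _ \<alpha> \<longleftrightarrow> is_epi C \<alpha> \<and> (\<forall>(J :: ('u, 'u) cat) D c \<iota> f.
     small_cat J \<and> filtered_cat J \<and> cat_functor J (coslice C (Dom C \<alpha>)) D \<and>
     is_colimit J (coslice C (Dom C \<alpha>)) D c \<iota> \<and>
     f \<in> Arr C \<and> Dom C f = Cod C \<alpha> \<and> Cod C f = Cod C c \<and> f \<cdot> \<alpha> = c \<longrightarrow>
     (\<exists>i \<in> Obj J. \<exists>g. g \<in> Arr C \<and> Dom C g = Cod C \<alpha> \<and> Cod C g = Cod C (fob D i) \<and> g \<cdot> \<alpha> = fob D i))"

lemma finite_epi_iff:
  "finite_epi TYPE('u) \<alpha> \<longleftrightarrow> is_epi C \<alpha> \<and>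
     Hom_commutes_with_filtered_colimits TYPE('u) (coslice C (Dom C \<alpha>)) \<alpha>"
proof (cases "is_epi C \<alpha>")
  case True
  then have \<alpha>: "\<alpha> \<in> Arr C" by (simp add: is_epi_def)
  let ?K = "coslice C (Dom C \<alpha>)"
  have "bij_betw (canonical_map ?K \<iota>) (colim_Hom J ?K D \<alpha>) (Hom ?K \<alpha> c) \<longleftrightarrow>
     (\<forall>f. f \<in> Arr C \<and> Dom C f = Cod C \<alpha> \<and> Cod C f = Cod C c \<and> f \<cdot> \<alpha> = c \<longrightarrow>
     (\<exists>i \<in> Obj J. \<exists>g. g \<in> Arr C \<and> Dom C g = Cod C \<alpha> \<and> Cod C g = Cod C (fob D i) \<and> g \<cdot> \<alpha> = fob D i))"
    if "filtered_cat J" "cat_functor J ?K D" "is_colimit J ?K D c \<iota>" for J :: "('u, 'u) cat" and D c \<iota>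
  proof -
    have co: "is_cocone J ?K D c \<iota>" using that(3) by (simp add: is_colimit_def)
    have c: "c \<in> Arr C" "Dom C c = Dom C \<alpha>" using co by (auto simp: is_cocone_def)
    have d: "fob D i \<in> Arr C" "Dom C (fob D i) = Dom C \<alpha>" if "i \<in> Obj J" for i
      using cat_functor.fob_Obj[OF \<open>cat_functor J ?K D\<close> that] by auto
    have 1: "bij_betw (canonical_map ?K \<iota>) (colim_Hom J ?K D \<alpha>) (Hom ?K \<alpha> c) \<longleftrightarrow>
      (Hom ?K \<alpha> c \<noteq> {} \<longrightarrow> (\<exists>i \<in> Obj J. Hom ?K \<alpha> (fob D i) \<noteq> {}))"
      by (rule canonical_map_bij_iff[OF _ that(1,2) co]) (rule coslice_Hom_epi[OF True refl])
    have 2: "(\<exists>i \<in> Obj J. Hom ?K \<alpha> (fob D i) \<noteq> {}) \<longleftrightarrow>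
      (\<exists>i \<in> Obj J. \<exists>g. g \<in> Arr C \<and> Dom C g = Cod C \<alpha> \<and> Cod C g = Cod C (fob D i) \<and> g \<cdot> \<alpha> = fob D i)"
      by (rule bex_cong[OF refl]) (rule coslice_Hom_ne[OF \<alpha> d(1) refl d(2)])
    show ?thesis
      unfolding 1 2 unfolding coslice_Hom_ne[OF \<alpha> c(1) refl c(2)] by blast
  qed
  then show ?thesis
    using True unfolding finite_epi_def Hom_commutes_with_filtered_colimits_def by simp blast
qed (simp add: finite_epi_def)

lemma finite_epiE:
  fixes J :: "('u, 'u) cat"
  assumes "finite_epi TYPE('u) \<alpha>" "small_cat J" "filtered_cat J" "cat_functor J (coslice C (Dom C \<alpha>)) D"
    "is_colimit J (coslice C (Dom C \<alpha>)) D c \<iota>"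
    "f \<in> Arr C" "Dom C f = Cod C \<alpha>" "Cod C f = Cod C c" "f \<cdot> \<alpha> = c"
  obtains i g where "i \<in> Obj J" "g \<in> Arr C" "Dom C g = Cod C \<alpha>" "Cod C g = Cod C (fob D i)" "g \<cdot> \<alpha> = fob D i"
  using assms unfolding finite_epi_def by blast

text \<open>Every object of the coslice factors through an isomorphism, so any index will do; one
  exists because filtered categories are inhabited.\<close>

lemma iso_finite_epi:
  assumes "is_iso C \<alpha>"
  shows "finite_epi TYPE('u) \<alpha>"
  unfolding finite_epi_def
proof (intro conjI allI impI; (elim conjE)?)
  show "is_epi C \<alpha>" using assms by (rule iso_is_epi)
  fix J :: "('u, 'u) cat" and D c \<iota> f
  assume J: "filtered_cat J" and D: "cat_functor J (coslice C (Dom C \<alpha>)) D"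
  obtain i where i: "i \<in> Obj J" using filtered_catD(2)[OF J] by blast
  have [simp]: "fob D i \<in> Arr C" "Dom C (fob D i) = Dom C \<alpha>"
    using cat_functor.fob_Obj[OF D i] by auto
  note [simp] = assms is_iso_Arr[OF assms]
  show "\<exists>i \<in> Obj J. \<exists>g. g \<in> Arr C \<and> Dom C g = Cod C \<alpha> \<and> Cod C g = Cod C (fob D i) \<and> g \<cdot> \<alpha> = fob D i"
    by (intro bexI[OF _ i] exI[of _ "fob D i \<cdot> inv_arr \<alpha>"]) simp
qed

definition coslice_restr :: "'a \<Rightarrow> ('a, ('a, 'a) sarr, 'a, ('a, 'a) sarr) functr" where
  "coslice_restr g = \<lparr>fob = (\<lambda>h. h \<cdot> g), far = (\<lambda>f. SArr (src f \<cdot> g) (und f) (tgt f \<cdot> g))\<rparr>"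

lemma cat_functor_coslice_restr:
  assumes [simp]: "g \<in> Arr C" "Dom C g = a" "Cod C g = d"
  shows "cat_functor (coslice C d) (coslice C a) (coslice_restr g)"
  by (rule cat_functorI) (auto simp: category_coslice coslice_restr_def in_Hom coslice_Arr
      simp flip: Cmp_assoc')

text \<open>Connected colimits in a coslice are computed in the category itself.\<close>

lemma coslice_restr_colimit:
  assumes g [simp]: "g \<in> Arr C" "Dom C g = a" "Cod C g = d" and J: "filtered_cat J"
    and D: "cat_functor J (coslice C d) D" and lim: "is_colimit J (coslice C d) D c \<iota>"
  shows "is_colimit J (coslice C a) (functr_comp (coslice_restr g) D) (c \<cdot> g) (far (coslice_restr g) \<circ> \<iota>)"
proof -
  interpret J: category J using filtered_catD(1)[OF J] .
  interpret D: cat_functor J "coslice C d" D by fact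
  let ?R = "coslice_restr g"
  have Dj [simp]: "fob D j \<in> Arr C" "Dom C (fob D j) = d" if "j \<in> Obj J" for j
    using D.fob_Obj[OF that] by auto
  have Du [simp]: "src (far D u) = fob D (Dom J u)" "tgt (far D u) = fob D (Cod J u)" "und (far D u) \<in> Arr C"
    "Dom C (und (far D u)) = Cod C (fob D (Dom J u))" "Cod C (und (far D u)) = Cod C (fob D (Cod J u))"
    "und (far D u) \<cdot> fob D (Dom J u) = fob D (Cod J u)" if "u \<in> Arr J" for u
    using D.far_simps[OF that] by (auto simp: coslice_Arr)
  have co: "is_cocone J (coslice C d) D c \<iota>" using lim by (simp add: is_colimit_def)
  have c [simp]: "c \<in> Arr C" "Dom C c = d" using co by (auto simp: is_cocone_def)
  have i [simp]: "src (\<iota> j) = fob D j" "tgt (\<iota> j) = c" "und (\<iota> j) \<in> Arr C" "Dom C (und (\<iota> j)) = Cod C (fob D j)"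
    "Cod C (und (\<iota> j)) = Cod C c" "und (\<iota> j) \<cdot> fob D j = c" if "j \<in> Obj J" for j
    using co that by (auto simp: is_cocone_def in_Hom coslice_Arr)
  have iu: "und (\<iota> (Cod J u)) \<cdot> und (far D u) = und (\<iota> (Dom J u))" if "u \<in> Arr J" for u
  proof -
    have "\<iota> (Cod J u) \<cdot>\<^bsub>coslice C d\<^esub> far D u = \<iota> (Dom J u)" using co that by (simp add: is_cocone_def)
    then show ?thesis by (metis coslice_simps(5) sarr.sel(2))
  qed
  have chain: "h \<cdot> (k \<cdot> g) = l \<cdot> g" if "h \<cdot> k = l" "h \<in> Arr C" "k \<in> Arr C" "Cod C k = Dom C h" "Dom C k = d" for h k l
    using that by (intro comp_chain) simp_all
  show ?thesis
    unfolding is_colimit_def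
  proof (intro conjI allI impI)
    show "is_cocone J (coslice C a) (functr_comp ?R D) (c \<cdot> g) (far ?R \<circ> \<iota>)"
      by (auto simp: is_cocone_def coslice_restr_def in_Hom coslice_Arr iu chain)
    fix x \<xi> assume x0: "is_cocone J (coslice C a) (functr_comp ?R D) x \<xi>"
    then have x [simp]: "x \<in> Arr C" "Dom C x = a" by (auto simp: is_cocone_def)
    have xi [simp]: "src (\<xi> j) = fob D j \<cdot> g" "tgt (\<xi> j) = x" "und (\<xi> j) \<in> Arr C"
      "Dom C (und (\<xi> j)) = Cod C (fob D j)" "Cod C (und (\<xi> j)) = Cod C x" "und (\<xi> j) \<cdot> (fob D j \<cdot> g) = x"
      if "j \<in> Obj J" for j
      using x0 that by (auto simp: is_cocone_def in_Hom coslice_Arr coslice_restr_def)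
    have xu: "und (\<xi> (Cod J u)) \<cdot> und (far D u) = und (\<xi> (Dom J u))" if u: "u \<in> Arr J" for u
    proof -
      have "\<xi> (Cod J u) \<cdot>\<^bsub>coslice C a\<^esub> far ?R (far D u) = \<xi> (Dom J u)" using x0 u by (simp add: is_cocone_def)
      then show ?thesis by (auto simp: coslice_restr_def dest: arg_cong[of _ _ und])
    qed
    \<comment> \<open>The vertex \<open>x\<close> lives in the coslice under \<open>a\<close> and
      has to be lifted to the coslice under \<open>d\<close>. Any leg of the cocone provides a lift,
      and an upper bound of two indices shows that it does not depend on the leg.\<close>
    obtain i0 where i0: "i0 \<in> Obj J" using filtered_catD(2)[OF J] by blast
    define z where "z = und (\<xi> i0) \<cdot> fob D i0"
    have [simp]: "z \<in> Arr C" "Dom C z = d" "Cod C z = Cod C x" using i0 by (simp_all add: z_def)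
    have zx: "z \<cdot> g = x" using i0 by (simp add: z_def)
    have z: "und (\<xi> j) \<cdot> fob D j = z" if j: "j \<in> Obj J" for j
    proof -
      obtain k u v where u: "u \<in> Hom J i0 k" and v: "v \<in> Hom J j k" using filtered_catD(3)[OF J i0 j] by blast
      have e: "und (\<xi> l) \<cdot> fob D l = und (\<xi> k) \<cdot> fob D k" if "w \<in> Hom J l k" for l w
      proof -
        have w: "w \<in> Arr J" "Dom J w = l" "Cod J w = k" using that by (auto simp: in_Hom)
        have "k \<in> Obj J" "l \<in> Obj J" using w J.Dom_Cod_Obj[of w] by auto
        then have "und (\<xi> k) \<cdot> (und (far D w) \<cdot> fob D l) = und (\<xi> l) \<cdot> fob D l"
          using xu[OF w(1)] w Du[OF w(1)] by (intro comp_chain) simp_all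
        then show ?thesis using Du(6)[OF w(1)] w by simp
      qed
      show ?thesis unfolding z_def e[OF u] e[OF v] ..
    qed
    have "is_cocone J (coslice C d) D z (\<lambda>j. SArr (fob D j) (und (\<xi> j)) z)"
      by (auto simp: is_cocone_def in_Hom coslice_Arr z xu)
    then have ex1: "\<exists>!h. h \<in> Hom (coslice C d) c z \<and>
      (\<forall>j\<in>Obj J. h \<cdot>\<^bsub>coslice C d\<^esub> \<iota> j = SArr (fob D j) (und (\<xi> j)) z)"
      using lim unfolding is_colimit_def by blast
    then obtain h where h: "h \<in> Hom (coslice C d) c z"
      "\<And>j. j \<in> Obj J \<Longrightarrow> h \<cdot>\<^bsub>coslice C d\<^esub> \<iota> j = SArr (fob D j) (und (\<xi> j)) z" by blast
    have h' [simp]: "und h \<in> Arr C" "Dom C (und h) = Cod C c" "Cod C (und h) = Cod C x" "und h \<cdot> c = z"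
      "\<And>j. j \<in> Obj J \<Longrightarrow> und h \<cdot> und (\<iota> j) = und (\<xi> j)"
      using h by (auto simp: in_Hom coslice_Arr)
    show "\<exists>!h. h \<in> Hom (coslice C a) (c \<cdot> g) x \<and> (\<forall>j\<in>Obj J. h \<cdot>\<^bsub>coslice C a\<^esub> (far ?R \<circ> \<iota>) j = \<xi> j)"
    proof (intro ex1I[of _ "SArr (c \<cdot> g) (und h) x"] conjI ballI)
      show "SArr (c \<cdot> g) (und h) x \<in> Hom (coslice C a) (c \<cdot> g) x"
        by (simp add: in_Hom coslice_Arr chain zx)
      fix j assume "j \<in> Obj J"
      then show "SArr (c \<cdot> g) (und h) x \<cdot>\<^bsub>coslice C a\<^esub> (far ?R \<circ> \<iota>) j = \<xi> j"
        by (auto simp: coslice_restr_def intro!: sarr.expand)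
    next
      fix k assume k: "k \<in> Hom (coslice C a) (c \<cdot> g) x \<and> (\<forall>j\<in>Obj J. k \<cdot>\<^bsub>coslice C a\<^esub> (far ?R \<circ> \<iota>) j = \<xi> j)"
      have k' [simp]: "und k \<in> Arr C" "Dom C (und k) = Cod C c" "Cod C (und k) = Cod C x" "src k = c \<cdot> g" "tgt k = x"
        using k by (auto simp: in_Hom coslice_Arr)
      have ki: "und k \<cdot> und (\<iota> j) = und (\<xi> j)" if "j \<in> Obj J" for j
      proof -
        have "und (k \<cdot>\<^bsub>coslice C a\<^esub> (far ?R \<circ> \<iota>) j) = und (\<xi> j)" using k that by simp
        then show ?thesis by (simp add: coslice_restr_def)
      qed
      have "und k \<cdot> (und (\<iota> i0) \<cdot> fob D i0) = und (\<xi> i0) \<cdot> fob D i0"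
        using i0 ki[OF i0] by (intro comp_chain) simp_all
      then have "und k \<cdot> c = z" using i0 by (simp add: z_def)
      then have "SArr c (und k) z \<in> Hom (coslice C d) c z"
        "\<And>j. j \<in> Obj J \<Longrightarrow> SArr c (und k) z \<cdot>\<^bsub>coslice C d\<^esub> \<iota> j = SArr (fob D j) (und (\<xi> j)) z"
        by (simp_all add: in_Hom coslice_Arr ki)
      then have "SArr c (und k) z = h" using ex1 h by blast
      then have "und k = und h" by (metis sarr.sel(2))
      then show "k = SArr (c \<cdot> g) (und h) x" by (intro sarr.expand) simp
    qed
  qed
qed

text \<open>A pullback in the opposite category is a pushout, and by its universal property a member
  \<open>fob D i\<close> factors through \<open>q\<close> as soon as
  \<open>fob D i \<cdot> g\<close> factors through \<alpha>. So finiteness of \<alpha> is applied to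
  the diagram restricted along \<open>g\<close>, which has the restricted colimit.\<close>

lemma finite_epi_pushout:
  assumes \<alpha>: "finite_epi TYPE('u) \<alpha>" and pb: "is_pullback (op_cat C) \<alpha> g p q"
  shows "finite_epi TYPE('u) q"
proof -
  have epi: "is_epi C \<alpha>" using \<alpha> by (simp add: finite_epi_def)
  have [simp]: "\<alpha> \<in> Arr C" "g \<in> Arr C" "p \<in> Arr C" "q \<in> Arr C" "Dom C g = Dom C \<alpha>" "Cod C p = Cod C q"
    "Dom C p = Cod C \<alpha>" "Dom C q = Cod C g" and sq: "p \<cdot> \<alpha> = q \<cdot> g"
    using pb by (auto simp: is_pullback_def op_cat_def)
  have ex1: "\<exists>!h. h \<in> Arr C \<and> Dom C h = Cod C q \<and> Cod C h = Cod C t \<and> h \<cdot> p = s \<and> h \<cdot> q = t"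
    if "s \<in> Arr C" "t \<in> Arr C" "Dom C s = Cod C \<alpha>" "Dom C t = Cod C g" "Cod C s = Cod C t" "s \<cdot> \<alpha> = t \<cdot> g" for s t
  proof -
    have "\<forall>x. \<forall>s\<in>Hom (op_cat C) x (Dom (op_cat C) \<alpha>). \<forall>t\<in>Hom (op_cat C) x (Dom (op_cat C) g).
       \<alpha> \<cdot>\<^bsub>op_cat C\<^esub> s = g \<cdot>\<^bsub>op_cat C\<^esub> t \<longrightarrow>
       (\<exists>!h. h \<in> Hom (op_cat C) x (Dom (op_cat C) p) \<and> p \<cdot>\<^bsub>op_cat C\<^esub> h = s \<and> q \<cdot>\<^bsub>op_cat C\<^esub> h = t)"
      using pb unfolding is_pullback_def by blast
    from this[rule_format, of s "Cod C t" t] that show ?thesis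
      by (simp add: op_cat_def in_Hom conj_ac)
  qed
  \<comment> \<open>Arrows that agree after \<open>q\<close> agree after
    \<open>p \<cdot> \<alpha>\<close>, hence after \<open>p\<close>; the pushout property then
    identifies them.\<close>
  have epi_q: "is_epi C q"
    unfolding is_epi_def
  proof (intro conjI allI ballI impI)
    fix x u v assume "u \<in> Hom C (Cod C q) x" "v \<in> Hom C (Cod C q) x" and eq: "u \<cdot> q = v \<cdot> q"
    then have [simp]: "u \<in> Arr C" "v \<in> Arr C" "Dom C u = Cod C q" "Dom C v = Cod C q" "Cod C u = x" "Cod C v = x"
      by (auto simp: in_Hom)
    have "(u \<cdot> q) \<cdot> g = (v \<cdot> q) \<cdot> g" by (simp only: eq)
    then have "(u \<cdot> p) \<cdot> \<alpha> = (v \<cdot> p) \<cdot> \<alpha>" by (simp add: sq)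
    then have "u \<cdot> p = v \<cdot> p" by (rule epiD[OF epi, rotated -1]) simp_all
    moreover have "\<exists>!h. h \<in> Arr C \<and> Dom C h = Cod C q \<and> Cod C h = Cod C (v \<cdot> q) \<and> h \<cdot> p = v \<cdot> p \<and> h \<cdot> q = v \<cdot> q"
      by (rule ex1) (simp_all add: sq)
    moreover have "Cod C (v \<cdot> q) = x" by simp
    ultimately show "u = v"
      using eq \<open>u \<in> Arr C\<close> \<open>v \<in> Arr C\<close> \<open>Dom C u = Cod C q\<close> \<open>Dom C v = Cod C q\<close> \<open>Cod C u = x\<close> \<open>Cod C v = x\<close>
      by metis
  qed simp
  show ?thesis
    unfolding finite_epi_def
  proof (intro conjI allI impI; (elim conjE)?)
    fix J :: "('u, 'u) cat" and D c \<iota> f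
    assume J: "small_cat J" "filtered_cat J" and D: "cat_functor J (coslice C (Dom C q)) D"
      and lim: "is_colimit J (coslice C (Dom C q)) D c \<iota>"
      and f [simp]: "f \<in> Arr C" "Dom C f = Cod C q" "Cod C f = Cod C c" and fc: "f \<cdot> q = c"
    have D': "cat_functor J (coslice C (Cod C g)) D" and lim': "is_colimit J (coslice C (Cod C g)) D c \<iota>"
      using D lim by simp_all
    let ?D = "functr_comp (coslice_restr g) D"
    have DD: "cat_functor J (coslice C (Dom C \<alpha>)) ?D"
      by (rule cat_functor_comp[OF D' cat_functor_coslice_restr]) simp_all
    have ll: "is_colimit J (coslice C (Dom C \<alpha>)) ?D (c \<cdot> g) (far (coslice_restr g) \<circ> \<iota>)"
      by (rule coslice_restr_colimit[OF _ _ _ J(2) D' lim']) simp_all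
    have [simp]: "c \<in> Arr C" "Dom C c = Cod C g" using lim' by (auto simp: is_colimit_def is_cocone_def)
    have "(f \<cdot> p) \<cdot> \<alpha> = c \<cdot> g" using fc by (simp add: sq flip: fc)
    note fpc = this
    have fp: "f \<cdot> p \<in> Arr C" "Dom C (f \<cdot> p) = Cod C \<alpha>" "Cod C (f \<cdot> p) = Cod C (c \<cdot> g)" by simp_all
    obtain i x where i: "i \<in> Obj J" and x: "x \<in> Arr C" "Dom C x = Cod C \<alpha>" "Cod C x = Cod C (fob ?D i)"
      "x \<cdot> \<alpha> = fob ?D i"
      using finite_epiE[OF \<alpha> J DD ll fp fpc] by blast
    have d [simp]: "fob D i \<in> Arr C" "Dom C (fob D i) = Cod C g"
      using cat_functor.fob_Obj[OF D' i] by auto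
    have "\<exists>!h. h \<in> Arr C \<and> Dom C h = Cod C q \<and> Cod C h = Cod C (fob D i) \<and> h \<cdot> p = x \<and> h \<cdot> q = fob D i"
      by (rule ex1) (use x in \<open>simp_all add: coslice_restr_def\<close>)
    then show "\<exists>i \<in> Obj J. \<exists>g. g \<in> Arr C \<and> Dom C g = Cod C q \<and> Cod C g = Cod C (fob D i) \<and> g \<cdot> q = fob D i"
      using i by blast
  qed (rule epi_q)
qed

text \<open>Since \<open>\<alpha>\<close> is epi, the members of the diagram that factor through \<open>\<alpha>\<close> form a full
  subdiagram which lifts to the coslice under \<open>Cod \<alpha>\<close>; being closed under successors, it is
  cofinal as soon as it is inhabited.\<close>

lemma finite_epi_Cmp:
  assumes \<alpha>: "finite_epi TYPE('u) \<alpha>" and \<beta>: "finite_epi TYPE('u) \<beta>" and \<alpha>\<beta>: "Cod C \<alpha> = Dom C \<beta>"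
  shows "finite_epi TYPE('u) (\<beta> \<cdot> \<alpha>)"
  unfolding finite_epi_def
proof (intro conjI allI impI; (elim conjE)?)
  have epi: "is_epi C \<alpha>" "is_epi C \<beta>" using \<alpha> \<beta> by (simp_all add: finite_epi_def)
  then have [simp]: "\<alpha> \<in> Arr C" "\<beta> \<in> Arr C" by (simp_all add: is_epi_def)
  note [simp] = \<alpha>\<beta>
  show "is_epi C (\<beta> \<cdot> \<alpha>)" using epi \<alpha>\<beta> by (intro epi_Cmp)
  fix J :: "('u, 'u) cat" and D c \<iota> y
  let ?a = "Dom C \<alpha>" and ?b = "Dom C \<beta>"
  assume J: "small_cat J" "filtered_cat J" and D0: "cat_functor J (coslice C (Dom C (\<beta> \<cdot> \<alpha>))) D"
    and lim0: "is_colimit J (coslice C (Dom C (\<beta> \<cdot> \<alpha>))) D c \<iota>"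
    and y: "y \<in> Arr C" "Dom C y = Cod C (\<beta> \<cdot> \<alpha>)" "Cod C y = Cod C c" and yc: "y \<cdot> (\<beta> \<cdot> \<alpha>) = c"
  have D: "cat_functor J (coslice C ?a) D" and lim: "is_colimit J (coslice C ?a) D c \<iota>" using D0 lim0 by simp_all
  note [simp] = y(1,3)
  have [simp]: "Dom C y = Cod C \<beta>" using y by simp
  interpret J: category J using filtered_catD(1)[OF J(2)] .
  interpret D: cat_functor J "coslice C ?a" D by fact
  have Dj [simp]: "fob D j \<in> Arr C" "Dom C (fob D j) = ?a" if "j \<in> Obj J" for j
    using D.fob_Obj[OF that] by auto
  have Du [simp]: "src (far D u) = fob D (Dom J u)" "tgt (far D u) = fob D (Cod J u)" "und (far D u) \<in> Arr C"
    "Dom C (und (far D u)) = Cod C (fob D (Dom J u))" "Cod C (und (far D u)) = Cod C (fob D (Cod J u))"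
    "und (far D u) \<cdot> fob D (Dom J u) = fob D (Cod J u)" if "u \<in> Arr J" for u
    using D.far_simps[OF that] by (auto simp: coslice_Arr)
  have DC [simp]: "und (far D (v \<cdot>\<^bsub>J\<^esub> u)) = und (far D v) \<cdot> und (far D u)"
    if "u \<in> Arr J" "v \<in> Arr J" "Cod J u = Dom J v" for u v
    using that by (simp add: D.far_Cmp_simp)
  have DI [simp]: "und (far D (Ide J j)) = Ide C (Cod C (fob D j))" if "j \<in> Obj J" for j
    using that by (simp add: D.far_Ide_simp)
  have co: "is_cocone J (coslice C ?a) D c \<iota>" using lim by (simp add: is_colimit_def)
  have c [simp]: "c \<in> Arr C" "Dom C c = ?a" using co by (auto simp: is_cocone_def)
  have i [simp]: "src (\<iota> j) = fob D j" "tgt (\<iota> j) = c" "und (\<iota> j) \<in> Arr C" "Dom C (und (\<iota> j)) = Cod C (fob D j)"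
    "Cod C (und (\<iota> j)) = Cod C c" "und (\<iota> j) \<cdot> fob D j = c" if "j \<in> Obj J" for j
    using co that by (auto simp: is_cocone_def in_Hom coslice_Arr)
  have iu: "und (\<iota> (Cod J u)) \<cdot> und (far D u) = und (\<iota> (Dom J u))" if "u \<in> Arr J" for u
  proof -
    have "\<iota> (Cod J u) \<cdot>\<^bsub>coslice C ?a\<^esub> far D u = \<iota> (Dom J u)" using co that by (simp add: is_cocone_def)
    then show ?thesis by (metis coslice_simps(5) sarr.sel(2))
  qed
  define O' where "O' = {j \<in> Obj J. \<exists>x. x \<in> Arr C \<and> Dom C x = ?b \<and> Cod C x = Cod C (fob D j) \<and> x \<cdot> \<alpha> = fob D j}"
  have "\<forall>j \<in> O'. \<exists>x. x \<in> Arr C \<and> Dom C x = ?b \<and> Cod C x = Cod C (fob D j) \<and> x \<cdot> \<alpha> = fob D j"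
    by (simp add: O'_def)
  \<comment> \<open>The choice is harmless: \<alpha> is an epimorphism, so the factor
    \<open>X j\<close> is unique. For the same reason \<open>X\<close> is compatible with the
    transition arrows, as \<open>DX\<close> records.\<close>
  from bchoice[OF this] obtain X where
    X: "\<And>j. j \<in> O' \<Longrightarrow> X j \<in> Arr C \<and> Dom C (X j) = ?b \<and> Cod C (X j) = Cod C (fob D j) \<and> X j \<cdot> \<alpha> = fob D j"
    by blast
  have X' [simp]: "X j \<in> Arr C" "Dom C (X j) = ?b" "Cod C (X j) = Cod C (fob D j)" "X j \<cdot> \<alpha> = fob D j" "j \<in> Obj J"
    if "j \<in> O'" for j
    using X[OF that] that by (auto simp: O'_def)
  have up: "Cod J u \<in> O'" if "u \<in> Arr J" "Dom J u \<in> O'" for u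
    unfolding O'_def using that
    by (auto intro!: exI[of _ "und (far D u) \<cdot> X (Dom J u)"])
  \<comment> \<open>Since \<open>c\<close> factors through the composite it factors through
    \<alpha>, and finiteness of \<alpha> supplies an index \<open>j0\<close> that makes the
    subdiagram inhabited.\<close>
  have "(y \<cdot> \<beta>) \<cdot> \<alpha> = c" using yc by simp
  note ybc = this
  have yb: "y \<cdot> \<beta> \<in> Arr C" "Dom C (y \<cdot> \<beta>) = Cod C \<alpha>" "Cod C (y \<cdot> \<beta>) = Cod C c" by simp_all
  obtain j0 x0 where "j0 \<in> Obj J" "x0 \<in> Arr C" "Dom C x0 = Cod C \<alpha>" "Cod C x0 = Cod C (fob D j0)" "x0 \<cdot> \<alpha> = fob D j0"
    using finite_epiE[OF \<alpha> J D lim yb ybc] by blast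
  then have j0: "j0 \<in> O'" unfolding O'_def by (simp only: mem_Collect_eq) (metis \<alpha>\<beta>)
  have succ: "\<exists>k u. k \<in> O' \<and> u \<in> Arr J \<and> Dom J u = j \<and> Cod J u = k" if j: "j \<in> Obj J" for j
  proof -
    obtain k u v where "u \<in> Hom J j0 k" "v \<in> Hom J j k"
      using filtered_catD(3)[OF J(2) _ j, of j0] X'(5)[OF j0] by blast
    then show ?thesis using up[of u] j0 by (auto simp: in_Hom)
  qed
  define J' where "J' = J\<lparr>Obj := O', Arr := {u \<in> Arr J. Dom J u \<in> O' \<and> Cod J u \<in> O'}\<rparr>"
  have J's [simp]: "Obj J' = O'" "Arr J' = {u \<in> Arr J. Dom J u \<in> O' \<and> Cod J u \<in> O'}" "Dom J' = Dom J"
    "Cod J' = Cod J" "Ide J' = Ide J" "Cmp J' = Cmp J" by (simp_all add: J'_def)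
  have catJ': "category J'"
    by unfold_locales (auto simp: in_Hom)
  have smallJ': "small_cat J'"
  proof -
    have "lesspoll (Arr J) (UNIV :: 'u set)" using J(1) by (simp add: small_cat_def)
    then have "lesspoll (Arr J') (UNIV :: 'u set)"
      by (rule lesspoll_trans1[rotated]) (auto intro: subset_imp_lepoll)
    then show ?thesis using catJ' by (simp add: small_cat_def)
  qed
  have filtJ': "filtered_cat J'"
    unfolding filtered_cat_def
  proof (intro conjI ballI allI)
    show "category J'" by (rule catJ')
    show "Obj J' \<noteq> {}" using j0 by auto
    fix i j assume ij: "i \<in> Obj J'" "j \<in> Obj J'"
    then obtain k u v where "u \<in> Hom J i k" "v \<in> Hom J j k"
      using filtered_catD(3)[OF J(2), of i j] by auto
    then have "u \<in> Hom J' i k" "v \<in> Hom J' j k"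
      using ij up[of u] by (auto simp: in_Hom)
    then show "\<exists>k u v. u \<in> Hom J' i k \<and> v \<in> Hom J' j k" by blast
  next
    fix i j u v assume uv: "u \<in> Hom J' i j" "v \<in> Hom J' i j"
    then obtain k w where "w \<in> Hom J j k" "w \<cdot>\<^bsub>J\<^esub> u = w \<cdot>\<^bsub>J\<^esub> v"
      using filtered_catD(4)[OF J(2), of u i j v] by (auto simp: in_Hom)
    then show "\<exists>k. \<exists>w\<in>Hom J' j k. w \<cdot>\<^bsub>J'\<^esub> u = w \<cdot>\<^bsub>J'\<^esub> v"
      using uv up[of w] by (intro exI[of _ k] bexI[of _ w]) (auto simp: in_Hom)
  qed
  have DX: "und (far D u) \<cdot> X (Dom J u) = X (Cod J u)" if "u \<in> Arr J" "Dom J u \<in> O'" "Cod J u \<in> O'" for u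
    by (rule epiD[OF epi(1)]) (use that in simp_all)
  let ?D = "\<lparr>fob = X, far = (\<lambda>u. SArr (X (Dom J u)) (und (far D u)) (X (Cod J u)))\<rparr>"
  have D': "cat_functor J' (coslice C ?b) ?D"
    by (rule cat_functorI) (auto simp: catJ' category_coslice in_Hom coslice_Arr DX)
  have iX: "und (\<iota> j) \<cdot> X j = y \<cdot> \<beta>" if "j \<in> O'" for j
    by (rule epiD[OF epi(1)]) (use that yc in simp_all)
  \<comment> \<open>The colimit of the lifted diagram is the lift \<open>y \<cdot> \<beta>\<close>
    of \<open>c\<close>. To see this, a cocone on the subdiagram is extended to all of
    \<open>J\<close>, where the colimit property of \<open>c\<close> is available.\<close>
  have lim': "is_colimit J' (coslice C ?b) ?D (y \<cdot> \<beta>) (\<lambda>j. SArr (X j) (und (\<iota> j)) (y \<cdot> \<beta>))"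
    unfolding is_colimit_def
  proof (intro conjI allI impI)
    show "is_cocone J' (coslice C ?b) ?D (y \<cdot> \<beta>) (\<lambda>j. SArr (X j) (und (\<iota> j)) (y \<cdot> \<beta>))"
      by (auto simp: is_cocone_def in_Hom coslice_Arr iX iu)
    fix z \<xi> assume z0: "is_cocone J' (coslice C ?b) ?D z \<xi>"
    then have z [simp]: "z \<in> Arr C" "Dom C z = ?b" by (auto simp: is_cocone_def)
    have xi [simp]: "src (\<xi> j) = X j" "tgt (\<xi> j) = z" "und (\<xi> j) \<in> Arr C" "Dom C (und (\<xi> j)) = Cod C (fob D j)"
      "Cod C (und (\<xi> j)) = Cod C z" "und (\<xi> j) \<cdot> X j = z" if "j \<in> O'" for j
      using z0 that by (auto simp: is_cocone_def in_Hom coslice_Arr)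
    have xu: "und (\<xi> (Cod J u)) \<cdot> und (far D u) = und (\<xi> (Dom J u))"
      if u: "u \<in> Arr J" "Dom J u \<in> O'" "Cod J u \<in> O'" for u
    proof -
      have "\<xi> (Cod J u) \<cdot>\<^bsub>coslice C ?b\<^esub> far ?D u = \<xi> (Dom J u)" using z0 u by (simp add: is_cocone_def)
      then have "und (\<xi> (Cod J u) \<cdot>\<^bsub>coslice C ?b\<^esub> far ?D u) = und (\<xi> (Dom J u))" by simp
      then show ?thesis by simp
    qed
    obtain U where U: "\<And>j. j \<in> Obj J \<Longrightarrow> U j \<in> Arr J \<and> Dom J (U j) = j \<and> Cod J (U j) \<in> O'"
      using succ by metis
    have U' [simp]: "U j \<in> Arr J" "Dom J (U j) = j" "Cod J (U j) \<in> O'" if "j \<in> Obj J" for j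
      using U[OF that] by auto
    \<comment> \<open>Leg at an index outside \<open>O'\<close>: move along some arrow
      \<open>U j\<close> into \<open>O'\<close> and use the leg there.\<close>
    define \<zeta> where "\<zeta> j = und (\<xi> (Cod J (U j))) \<cdot> und (far D (U j))" for j
    have [simp]: "\<zeta> j \<in> Arr C" "Dom C (\<zeta> j) = Cod C (fob D j)" "Cod C (\<zeta> j) = Cod C z" if "j \<in> Obj J" for j
      using that by (simp_all add: \<zeta>_def)
    \<comment> \<open>The leg does not depend on the arrow into \<open>O'\<close>. The arrow
      \<open>u\<close> and the chosen one are continued to a common index \<open>l\<close>, and
      \<open>w\<close> equalizes the two resulting parallel arrows; both filteredness conditions
      enter.\<close>
    have \<zeta>: "und (\<xi> (Cod J u)) \<cdot> und (far D u) = \<zeta> (Dom J u)" if u: "u \<in> Arr J" "Cod J u \<in> O'" for u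
    proof -
      let ?v = "U (Dom J u)"
      have v: "?v \<in> Arr J" "Dom J ?v = Dom J u" "Cod J ?v \<in> O'" using u by simp_all
      obtain l s t where s: "s \<in> Hom J (Cod J u) l" and t: "t \<in> Hom J (Cod J ?v) l"
        using filtered_catD(3)[OF J(2), of "Cod J u" "Cod J ?v"] u v by auto
      have st: "s \<in> Arr J" "Dom J s = Cod J u" "Cod J s = l" "t \<in> Arr J" "Dom J t = Cod J ?v" "Cod J t = l"
        using s t by (auto simp: in_Hom)
      have "s \<cdot>\<^bsub>J\<^esub> u \<in> Hom J (Dom J u) l" "t \<cdot>\<^bsub>J\<^esub> ?v \<in> Hom J (Dom J u) l"
        using st u v by (simp_all add: in_Hom)
      from filtered_catD(4)[OF J(2) this] obtain m w where w: "w \<in> Arr J" "Dom J w = l" "Cod J w = m"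
        and weq: "w \<cdot>\<^bsub>J\<^esub> (s \<cdot>\<^bsub>J\<^esub> u) = w \<cdot>\<^bsub>J\<^esub> (t \<cdot>\<^bsub>J\<^esub> ?v)"
        by (auto simp: in_Hom)
      have lm: "l \<in> O'" "m \<in> O'" using up[of s] st u up[of w] w by auto
      have e: "und (\<xi> (Cod J r)) \<cdot> und (far D r) = und (\<xi> m) \<cdot> und (far D (w \<cdot>\<^bsub>J\<^esub> (p \<cdot>\<^bsub>J\<^esub> r)))"
        if "r \<in> Arr J" "Cod J r \<in> O'" "p \<in> Arr J" "Dom J p = Cod J r" "Cod J p = l" for r p
      proof -
        have "und (\<xi> m) \<cdot> (und (far D w) \<cdot> (und (far D p) \<cdot> und (far D r))) =
          ((und (\<xi> m) \<cdot> und (far D w)) \<cdot> und (far D p)) \<cdot> und (far D r)"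
          using that w lm by simp
        also have "\<dots> = und (\<xi> (Cod J r)) \<cdot> und (far D r)"
          using xu[of w] xu[of p] that w lm by simp
        finally show ?thesis using that w by simp
      qed
      show ?thesis
        unfolding \<zeta>_def e[OF u st(1-3)] e[OF v(1,3) st(4-6)] weq ..
    qed
    have \<zeta>O: "\<zeta> j = und (\<xi> j)" if "j \<in> O'" for j
      using \<zeta>[of "Ide J j"] that by simp
    have \<zeta>u: "\<zeta> (Cod J u) \<cdot> und (far D u) = \<zeta> (Dom J u)" if "u \<in> Arr J" for u
      using \<zeta>[of "U (Cod J u) \<cdot>\<^bsub>J\<^esub> u"] that by (simp add: \<zeta>_def)
    have \<zeta>a: "\<zeta> j \<cdot> fob D j = z \<cdot> \<alpha>" if "j \<in> Obj J" for j
    proof -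
      have "\<zeta> j \<cdot> fob D j = und (\<xi> (Cod J (U j))) \<cdot> (und (far D (U j)) \<cdot> fob D j)"
        using that by (simp add: \<zeta>_def)
      also have "\<dots> = und (\<xi> (Cod J (U j))) \<cdot> (X (Cod J (U j)) \<cdot> \<alpha>)"
        using Du(6)[of "U j"] that by simp
      also have "\<dots> = (und (\<xi> (Cod J (U j))) \<cdot> X (Cod J (U j))) \<cdot> \<alpha>"
        by (rule Cmp_assoc'[symmetric]) (use that in simp_all)
      finally show ?thesis using that by simp
    qed
    have "is_cocone J (coslice C ?a) D (z \<cdot> \<alpha>) (\<lambda>j. SArr (fob D j) (\<zeta> j) (z \<cdot> \<alpha>))"
      by (auto simp: is_cocone_def in_Hom coslice_Arr \<zeta>u \<zeta>a)
    then have ex1: "\<exists>!h. h \<in> Hom (coslice C ?a) c (z \<cdot> \<alpha>) \<and>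
      (\<forall>j\<in>Obj J. h \<cdot>\<^bsub>coslice C ?a\<^esub> \<iota> j = SArr (fob D j) (\<zeta> j) (z \<cdot> \<alpha>))"
      using lim unfolding is_colimit_def by blast
    then obtain h where h: "h \<in> Hom (coslice C ?a) c (z \<cdot> \<alpha>)"
      "\<And>j. j \<in> Obj J \<Longrightarrow> h \<cdot>\<^bsub>coslice C ?a\<^esub> \<iota> j = SArr (fob D j) (\<zeta> j) (z \<cdot> \<alpha>)" by blast
    have h' [simp]: "und h \<in> Arr C" "Dom C (und h) = Cod C c" "Cod C (und h) = Cod C z"
      and hc: "und h \<cdot> c = z \<cdot> \<alpha>" and hi: "\<And>j. j \<in> Obj J \<Longrightarrow> und h \<cdot> und (\<iota> j) = \<zeta> j"
      using h by (auto simp: in_Hom coslice_Arr)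
    have hy: "und h \<cdot> (y \<cdot> \<beta>) = z"
      by (rule epiD[OF epi(1)]) (simp_all add: yc hc)
    show "\<exists>!h. h \<in> Hom (coslice C ?b) (y \<cdot> \<beta>) z \<and>
      (\<forall>j\<in>Obj J'. h \<cdot>\<^bsub>coslice C ?b\<^esub> SArr (X j) (und (\<iota> j)) (y \<cdot> \<beta>) = \<xi> j)"
    proof (intro ex1I[of _ "SArr (y \<cdot> \<beta>) (und h) z"] conjI ballI)
      show "SArr (y \<cdot> \<beta>) (und h) z \<in> Hom (coslice C ?b) (y \<cdot> \<beta>) z"
        using hy by (simp add: in_Hom coslice_Arr)
      fix j assume "j \<in> Obj J'"
      then show "SArr (y \<cdot> \<beta>) (und h) z \<cdot>\<^bsub>coslice C ?b\<^esub> SArr (X j) (und (\<iota> j)) (y \<cdot> \<beta>) = \<xi> j"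
        by (auto simp: hi \<zeta>O intro!: sarr.expand)
    next
      fix k assume k: "k \<in> Hom (coslice C ?b) (y \<cdot> \<beta>) z \<and>
        (\<forall>j\<in>Obj J'. k \<cdot>\<^bsub>coslice C ?b\<^esub> SArr (X j) (und (\<iota> j)) (y \<cdot> \<beta>) = \<xi> j)"
      have k' [simp]: "und k \<in> Arr C" "Dom C (und k) = Cod C c" "Cod C (und k) = Cod C z" "src k = y \<cdot> \<beta>" "tgt k = z"
        and ky: "und k \<cdot> (y \<cdot> \<beta>) = z"
        using k by (auto simp: in_Hom coslice_Arr)
      have ki: "und k \<cdot> und (\<iota> j) = und (\<xi> j)" if "j \<in> O'" for j
      proof -
        have "und (k \<cdot>\<^bsub>coslice C ?b\<^esub> SArr (X j) (und (\<iota> j)) (y \<cdot> \<beta>)) = und (\<xi> j)" using k that by simp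
        then show ?thesis by simp
      qed
      have k\<zeta>: "und k \<cdot> und (\<iota> j) = \<zeta> j" if "j \<in> Obj J" for j
      proof -
        have "und k \<cdot> (und (\<iota> (Cod J (U j))) \<cdot> und (far D (U j))) = \<zeta> j"
          unfolding \<zeta>_def by (rule comp_chain[OF ki]) (use that in simp_all)
        then show ?thesis using iu[of "U j"] that by simp
      qed
      have "und k \<cdot> c = z \<cdot> \<alpha>"
        using comp_chain[OF ky, of \<alpha>] yc by simp
      then have "SArr c (und k) (z \<cdot> \<alpha>) \<in> Hom (coslice C ?a) c (z \<cdot> \<alpha>)"
        "\<And>j. j \<in> Obj J \<Longrightarrow> SArr c (und k) (z \<cdot> \<alpha>) \<cdot>\<^bsub>coslice C ?a\<^esub> \<iota> j = SArr (fob D j) (\<zeta> j) (z \<cdot> \<alpha>)"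
        by (simp_all add: in_Hom coslice_Arr k\<zeta>)
      then have "SArr c (und k) (z \<cdot> \<alpha>) = h" using ex1 h by blast
      then have "und k = und h" by (metis sarr.sel(2))
      then show "k = SArr (y \<cdot> \<beta>) (und h) z" by (intro sarr.expand) simp
    qed
  qed
  \<comment> \<open>Finiteness of \<beta> is applied to the lifted diagram; \<open>y\<close> is the
    factorization of its colimit \<open>y \<cdot> \<beta>\<close> through \<beta>.\<close>
  have yb': "Dom C y = Cod C \<beta>" "Cod C y = Cod C (y \<cdot> \<beta>)" "y \<cdot> \<beta> = y \<cdot> \<beta>" by simp_all
  obtain j s where j: "j \<in> O'" and s: "s \<in> Arr C" "Dom C s = Cod C \<beta>" "Cod C s = Cod C (fob D j)" "s \<cdot> \<beta> = X j"
    using finite_epiE[OF \<beta> smallJ' filtJ' D' lim' y(1) yb'] by auto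
  have "s \<cdot> (\<beta> \<cdot> \<alpha>) = X j \<cdot> \<alpha>" by (rule comp_chain[OF s(4)]) (use s in simp_all)
  then show "\<exists>i \<in> Obj J. \<exists>g. g \<in> Arr C \<and> Dom C g = Cod C (\<beta> \<cdot> \<alpha>) \<and> Cod C g = Cod C (fob D i) \<and> g \<cdot> (\<beta> \<cdot> \<alpha>) = fob D i"
    using j s by (intro bexI[of _ j] exI[of _ s]) simp_all
qed

end

section \<open>Calculus in an actegory\<close>

context bifunctor
begin

lemma bi_simps [simp]:
  assumes "f \<in> Arr A" "g \<in> Arr B"
  shows "T\<^sub>a f g \<in> Arr X" "Dom X (T\<^sub>a f g) = T\<^sub>o (Dom A f) (Dom B g)"
    "Cod X (T\<^sub>a f g) = T\<^sub>o (Cod A f) (Cod B g)"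
  using bi_Hom[of f "Dom A f" "Cod A f" g "Dom B g" "Cod B g"] assms by (auto simp: in_Hom)

lemma bi_Obj_simp [simp]: "a \<in> Obj A \<Longrightarrow> b \<in> Obj B \<Longrightarrow> T\<^sub>o a b \<in> Obj X"
  by (rule bi_Obj)

lemma bi_Ide_simp [simp]: "a \<in> Obj A \<Longrightarrow> b \<in> Obj B \<Longrightarrow> T\<^sub>a (Ide A a) (Ide B b) = Ide X (T\<^sub>o a b)"
  by (rule bi_Ide)

lemma bi_merge:
  assumes "f \<in> Arr A" "f' \<in> Arr A" "Cod A f = Dom A f'" "g \<in> Arr B" "g' \<in> Arr B" "Cod B g = Dom B g'"
  shows "T\<^sub>a f' g' \<cdot>\<^bsub>X\<^esub> T\<^sub>a f g = T\<^sub>a (f' \<cdot>\<^bsub>A\<^esub> f) (g' \<cdot>\<^bsub>B\<^esub> g)"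
  using bi_Cmp[of f "Dom A f" "Cod A f" f' "Cod A f'" g "Dom B g" "Cod B g" g' "Cod B g'"] assms
  by (auto simp: in_Hom)

lemma bi_is_iso:
  assumes "is_iso A f" "is_iso B g"
  shows "is_iso X (T\<^sub>a f g)"
proof -
  obtain f' where f: "f \<in> Arr A" "f' \<in> Arr A" "Dom A f' = Cod A f" "Cod A f' = Dom A f"
    "f' \<cdot>\<^bsub>A\<^esub> f = Ide A (Dom A f)" "f \<cdot>\<^bsub>A\<^esub> f' = Ide A (Cod A f)"
    by (rule A.is_isoE[OF assms(1)]) metis
  obtain g' where g: "g \<in> Arr B" "g' \<in> Arr B" "Dom B g' = Cod B g" "Cod B g' = Dom B g"
    "g' \<cdot>\<^bsub>B\<^esub> g = Ide B (Dom B g)" "g \<cdot>\<^bsub>B\<^esub> g' = Ide B (Cod B g)"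
    by (rule B.is_isoE[OF assms(2)]) metis
  show ?thesis
    by (rule X.is_isoI[of _ "T\<^sub>o (Dom A f) (Dom B g)" "T\<^sub>o (Cod A f) (Cod B g)" "T\<^sub>a f' g'"])
      (use f g in \<open>simp_all add: in_Hom bi_merge\<close>)
qed

end

context symmetric_monoidal
begin

lemma tensor_bifunctor: "bifunctor C C C (ten C) (tenA C)"
  by (rule bifunctor_axioms)

lemma tensor_category: "category C"
  by (rule A.category_axioms)

lemmas ten_merge = bifunctor.bi_merge[OF tensor_bifunctor]
lemmas ten_chain = category.comp_chain[OF tensor_category]

lemma tunit_Obj_simp [simp]: "\<one> \<in> Obj C"
  by (rule tunit_Obj)

lemma assoc_simps [simp]:
  assumes "a \<in> Obj C" "b \<in> Obj C" "c \<in> Obj C"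
  shows "assoc C a b c \<in> Arr C" "Dom C (assoc C a b c) = a \<otimes> (b \<otimes> c)"
    "Cod C (assoc C a b c) = (a \<otimes> b) \<otimes> c" "is_iso C (assoc C a b c)"
  using assoc_Hom[OF assms] assoc_iso[OF assms] by (auto simp: in_Hom)

lemma unitor_simps [simp]:
  assumes "a \<in> Obj C"
  shows "lunit C a \<in> Arr C" "Dom C (lunit C a) = \<one> \<otimes> a" "Cod C (lunit C a) = a" "is_iso C (lunit C a)"
    "runit C a \<in> Arr C" "Dom C (runit C a) = a \<otimes> \<one>" "Cod C (runit C a) = a" "is_iso C (runit C a)"
  using lunit_Hom[OF assms] lunit_iso[OF assms] runit_Hom[OF assms] runit_iso[OF assms]
  by (auto simp: in_Hom)

lemma braid_simps [simp]:
  assumes "a \<in> Obj C" "b \<in> Obj C"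
  shows "braid C a b \<in> Arr C" "Dom C (braid C a b) = a \<otimes> b" "Cod C (braid C a b) = b \<otimes> a"
  using braid_Hom[OF assms] by (auto simp: in_Hom)

lemma assoc_nat':
  assumes "f \<in> Arr C" "g \<in> Arr C" "h \<in> Arr C"
  shows "assoc C (Cod C f) (Cod C g) (Cod C h) \<cdot> (f \<otimes>\<^sub>a (g \<otimes>\<^sub>a h)) =
    ((f \<otimes>\<^sub>a g) \<otimes>\<^sub>a h) \<cdot> assoc C (Dom C f) (Dom C g) (Dom C h)"
  using assoc_nat[of f "Dom C f" "Cod C f" g "Dom C g" "Cod C g" h "Dom C h" "Cod C h"] assms
  by (auto simp: in_Hom)

lemma lunit_nat':
  "f \<in> Arr C \<Longrightarrow> lunit C (Cod C f) \<cdot> (Ide C \<one> \<otimes>\<^sub>a f) = f \<cdot> lunit C (Dom C f)"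
  using lunit_nat[of f "Dom C f" "Cod C f"] by (auto simp: in_Hom)

lemma runit_nat':
  "f \<in> Arr C \<Longrightarrow> runit C (Cod C f) \<cdot> (f \<otimes>\<^sub>a Ide C \<one>) = f \<cdot> runit C (Dom C f)"
  using runit_nat[of f "Dom C f" "Cod C f"] by (auto simp: in_Hom)

lemma braid_nat':
  assumes "f \<in> Arr C" "g \<in> Arr C"
  shows "braid C (Cod C f) (Cod C g) \<cdot> (f \<otimes>\<^sub>a g) = (g \<otimes>\<^sub>a f) \<cdot> braid C (Dom C f) (Dom C g)"
  using braid_nat[of f "Dom C f" "Cod C f" g "Dom C g" "Cod C g"] assms by (auto simp: in_Hom)

lemma braid_is_iso [simp]: "a \<in> Obj C \<Longrightarrow> b \<in> Obj C \<Longrightarrow> is_iso C (braid C a b)"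
  by (rule A.is_isoI[of _ "a \<otimes> b" "b \<otimes> a" "braid C b a"]) (auto simp: in_Hom symmetry)

text \<open>By naturality of the left unitor, \<open>f\<close> is recovered from
  \<open>Ide C \<one> \<otimes>\<^sub>a f\<close> by composing with isomorphisms.\<close>

lemma unit_tensor_faithful:
  assumes "f \<in> Arr C" "g \<in> Arr C" "Dom C f = Dom C g" "Cod C f = Cod C g"
    and eq: "Ide C \<one> \<otimes>\<^sub>a f = Ide C \<one> \<otimes>\<^sub>a g"
  shows "f = g"
proof (rule A.iso_cancel_right)
  show "f \<cdot> lunit C (Dom C f) = g \<cdot> lunit C (Dom C f)"
    using lunit_nat'[of f] lunit_nat'[of g] assms by simp
qed (use assms in simp_all)

lemma tensor_unit_faithful:
  assumes "f \<in> Arr C" "g \<in> Arr C" "Dom C f = Dom C g" "Cod C f = Cod C g"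
    and eq: "f \<otimes>\<^sub>a Ide C \<one> = g \<otimes>\<^sub>a Ide C \<one>"
  shows "f = g"
proof (rule A.iso_cancel_right)
  show "f \<cdot> runit C (Dom C f) = g \<cdot> runit C (Dom C f)"
    using runit_nat'[of f] runit_nat'[of g] assms by simp
qed (use assms in simp_all)

text \<open>Kelly's argument that this triangle follows from the pentagon and the middle triangle.
  Both sides are tensored with the unit object on the left, which is faithful; there the pentagon at
  \<open>\<one>\<close>, \<open>\<one>\<close>, \<open>a\<close>, \<open>b\<close> and two middle
  triangles connect them. It supplies \<open>act_triangle_left\<close> for the action of
  \<open>C\<close> on itself.\<close>

lemma kelly_lunit:
  assumes a: "a \<in> Obj C" and b: "b \<in> Obj C"
  shows "(lunit C a \<otimes>\<^sub>a Ide C b) \<cdot> assoc C \<one> a b = lunit C (a \<otimes> b)"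
proof -
  note [simp] = a b ten_merge
  let ?I = "Ide C \<one>" and ?b = "Ide C b"
  have "assoc C \<one> a b \<cdot> (?I \<otimes>\<^sub>a ((lunit C a \<otimes>\<^sub>a ?b) \<cdot> assoc C \<one> a b)) =
     assoc C \<one> a b \<cdot> ((?I \<otimes>\<^sub>a (lunit C a \<otimes>\<^sub>a ?b)) \<cdot> (?I \<otimes>\<^sub>a assoc C \<one> a b))"
    by simp
  also have "\<dots> = (assoc C \<one> a b \<cdot> (?I \<otimes>\<^sub>a (lunit C a \<otimes>\<^sub>a ?b))) \<cdot> (?I \<otimes>\<^sub>a assoc C \<one> a b)"
    by (simp del: ten_merge)
  also have "\<dots> = ((?I \<otimes>\<^sub>a lunit C a) \<otimes>\<^sub>a ?b) \<cdot> (assoc C \<one> (\<one> \<otimes> a) b \<cdot> (?I \<otimes>\<^sub>a assoc C \<one> a b))"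
    using assoc_nat'[of ?I "lunit C a" ?b] by (simp del: ten_merge)
  also have "(?I \<otimes>\<^sub>a lunit C a) \<otimes>\<^sub>a ?b = ((runit C \<one> \<otimes>\<^sub>a Ide C a) \<otimes>\<^sub>a ?b) \<cdot> (assoc C \<one> \<one> a \<otimes>\<^sub>a ?b)"
    using triangle[of \<one> a] by simp
  also have "(((runit C \<one> \<otimes>\<^sub>a Ide C a) \<otimes>\<^sub>a ?b) \<cdot> (assoc C \<one> \<one> a \<otimes>\<^sub>a ?b)) \<cdot>
       (assoc C \<one> (\<one> \<otimes> a) b \<cdot> (?I \<otimes>\<^sub>a assoc C \<one> a b)) =
     ((runit C \<one> \<otimes>\<^sub>a Ide C a) \<otimes>\<^sub>a ?b) \<cdot> ((assoc C \<one> \<one> a \<otimes>\<^sub>a ?b) \<cdot>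
       (assoc C \<one> (\<one> \<otimes> a) b \<cdot> (?I \<otimes>\<^sub>a assoc C \<one> a b)))"
    by (rule A.Cmp_assoc') simp_all
  also have "\<dots> = ((runit C \<one> \<otimes>\<^sub>a Ide C a) \<otimes>\<^sub>a ?b) \<cdot> (assoc C (\<one> \<otimes> \<one>) a b \<cdot> assoc C \<one> \<one> (a \<otimes> b))"
    using pentagon[of \<one> \<one> a b] by simp
  also have "\<dots> = (((runit C \<one> \<otimes>\<^sub>a Ide C a) \<otimes>\<^sub>a ?b) \<cdot> assoc C (\<one> \<otimes> \<one>) a b) \<cdot> assoc C \<one> \<one> (a \<otimes> b)"
    by simp
  also have "((runit C \<one> \<otimes>\<^sub>a Ide C a) \<otimes>\<^sub>a ?b) \<cdot> assoc C (\<one> \<otimes> \<one>) a b =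
      assoc C \<one> a b \<cdot> (runit C \<one> \<otimes>\<^sub>a Ide C (a \<otimes> b))"
    using assoc_nat'[of "runit C \<one>" "Ide C a" ?b] by simp
  also have "\<dots> \<cdot> assoc C \<one> \<one> (a \<otimes> b) = assoc C \<one> a b \<cdot> ((runit C \<one> \<otimes>\<^sub>a Ide C (a \<otimes> b)) \<cdot> assoc C \<one> \<one> (a \<otimes> b))"
    by simp
  also have "\<dots> = assoc C \<one> a b \<cdot> (?I \<otimes>\<^sub>a lunit C (a \<otimes> b))"
    using triangle[of \<one> "a \<otimes> b"] by simp
  finally have "?I \<otimes>\<^sub>a ((lunit C a \<otimes>\<^sub>a ?b) \<cdot> assoc C \<one> a b) = ?I \<otimes>\<^sub>a lunit C (a \<otimes> b)"
    by (rule A.iso_cancel_left[rotated -1]) simp_all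
  then show ?thesis
    by (rule unit_tensor_faithful[rotated -1]) simp_all
qed

end

section \<open>Whiskering, and the action of the monoidal category on itself\<close>

definition self_act :: "('o, 'a, 'z) smcat_scheme \<Rightarrow> ('o, 'a, 'o, 'a) actegory" where
  "self_act C = \<lparr>Obj = Obj C, Arr = Arr C, Dom = Dom C, Cod = Cod C, Ide = Ide C, Cmp = Cmp C,
     act = ten C, actA = tenA C, act_assoc = assoc C, act_unit = lunit C\<rparr>"

lemma self_act_simps [simp]:
  "Obj (self_act C) = Obj C" "Arr (self_act C) = Arr C" "Dom (self_act C) = Dom C"
  "Cod (self_act C) = Cod C" "Ide (self_act C) = Ide C" "Cmp (self_act C) = Cmp C"
  "act (self_act C) = ten C" "actA (self_act C) = tenA C" "act_assoc (self_act C) = assoc C"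
  "act_unit (self_act C) = lunit C" "Hom (self_act C) = Hom C" "is_iso (self_act C) = is_iso C"
  "is_epi (self_act C) = is_epi C"
  by (auto simp: self_act_def Hom_def is_iso_def is_epi_def fun_eq_iff)

context left_actegory
begin

lemma act_bifunctor: "bifunctor C M M (act M) (actA M)"
  by (rule bifunctor_axioms)

lemma act_category: "category M"
  using act_bifunctor by (simp add: bifunctor_def)

lemmas act_merge = bifunctor.bi_merge[OF act_bifunctor]
lemmas act_chain = category.comp_chain[OF act_category]
lemmas act_cancel_left = category.iso_cancel_left[OF act_category]
lemmas act_cancel_right = category.iso_cancel_right[OF act_category]

lemma act_assoc_simps [simp]:
  assumes "a \<in> Obj C" "b \<in> Obj C" "m \<in> Obj M"
  shows "act_assoc M a b m \<in> Arr M" "Dom M (act_assoc M a b m) = a \<odot>\<^bsub>M\<^esub> (b \<odot>\<^bsub>M\<^esub> m)"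
    "Cod M (act_assoc M a b m) = (a \<otimes> b) \<odot>\<^bsub>M\<^esub> m" "is_iso M (act_assoc M a b m)"
  using act_assoc_Hom[OF assms] act_assoc_iso[OF assms] by (auto simp: in_Hom)

lemma act_unit_simps [simp]:
  assumes "m \<in> Obj M"
  shows "act_unit M m \<in> Arr M" "Dom M (act_unit M m) = \<one> \<odot>\<^bsub>M\<^esub> m" "Cod M (act_unit M m) = m"
    "is_iso M (act_unit M m)"
  using act_unit_Hom[OF assms] act_unit_iso[OF assms] by (auto simp: in_Hom)

text \<open>Whiskering; together with the natural transformations \<open>mul\<close>, \<open>un\<close> and \<open>sw\<close> below it
  replaces the associativity constraint in all calculations, which thereby take place in the
  strict monoidal category of endofunctors of \<open>M\<close>.\<close>

definition lact (infixr "\<rhd>" 75) where "A \<rhd> h = Ide C A \<odot>\<^sub>a\<^bsub>M\<^esub> h"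

definition ract (infixr "\<lhd>" 75) where "f \<lhd> m = f \<odot>\<^sub>a\<^bsub>M\<^esub> Ide M m"

text \<open>\<open>mul\<close> and \<open>un\<close> are the multiplication and unit of the monad
  \<open>carr A \<odot> -\<close> on \<open>M\<close>, whose algebras are the modules over
  \<open>A\<close>; \<open>sw\<close> is the braiding seen as a transformation between the two
  composites of \<open>A \<odot> -\<close> and \<open>B \<odot> -\<close>.\<close>

definition mul where "mul A m = (mult A \<lhd> m) \<cdot>\<^bsub>M\<^esub> act_assoc M (carr A) (carr A) m"

definition un where "un A m = (unit A \<lhd> m) \<cdot>\<^bsub>M\<^esub> category.inv_arr M (act_unit M m)"

definition sw where
  "sw A B m = category.inv_arr M (act_assoc M B A m) \<cdot>\<^bsub>M\<^esub> ((braid C A B \<lhd> m) \<cdot>\<^bsub>M\<^esub> act_assoc M A B m)"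

lemma lact_simps [simp]:
  assumes "A \<in> Obj C" "h \<in> Arr M"
  shows "A \<rhd> h \<in> Arr M" "Dom M (A \<rhd> h) = A \<odot>\<^bsub>M\<^esub> Dom M h" "Cod M (A \<rhd> h) = A \<odot>\<^bsub>M\<^esub> Cod M h"
  using assms by (simp_all add: lact_def)

lemma ract_simps [simp]:
  assumes "f \<in> Arr C" "m \<in> Obj M"
  shows "f \<lhd> m \<in> Arr M" "Dom M (f \<lhd> m) = Dom C f \<odot>\<^bsub>M\<^esub> m" "Cod M (f \<lhd> m) = Cod C f \<odot>\<^bsub>M\<^esub> m"
  using assms by (simp_all add: ract_def)

lemma lact_Cmp [simp]:
  "A \<in> Obj C \<Longrightarrow> g \<in> Arr M \<Longrightarrow> h \<in> Arr M \<Longrightarrow> Cod M h = Dom M g \<Longrightarrow>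
    A \<rhd> (g \<cdot>\<^bsub>M\<^esub> h) = (A \<rhd> g) \<cdot>\<^bsub>M\<^esub> (A \<rhd> h)"
  by (simp add: lact_def act_merge)

lemma lact_Ide [simp]: "A \<in> Obj C \<Longrightarrow> m \<in> Obj M \<Longrightarrow> A \<rhd> Ide M m = Ide M (A \<odot>\<^bsub>M\<^esub> m)"
  by (simp add: lact_def)

lemma ract_Cmp [simp]:
  "m \<in> Obj M \<Longrightarrow> f \<in> Arr C \<Longrightarrow> g \<in> Arr C \<Longrightarrow> Cod C f = Dom C g \<Longrightarrow>
    (g \<cdot> f) \<lhd> m = (g \<lhd> m) \<cdot>\<^bsub>M\<^esub> (f \<lhd> m)"
  by (simp add: ract_def act_merge)

lemma ract_Ide [simp]: "A \<in> Obj C \<Longrightarrow> m \<in> Obj M \<Longrightarrow> Ide C A \<lhd> m = Ide M (A \<odot>\<^bsub>M\<^esub> m)"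
  by (simp add: ract_def)

lemma lact_is_iso [simp]: "A \<in> Obj C \<Longrightarrow> is_iso M h \<Longrightarrow> is_iso M (A \<rhd> h)"
  unfolding lact_def by (rule bifunctor.bi_is_iso[OF act_bifunctor]) auto

lemma ract_is_iso [simp]: "is_iso C f \<Longrightarrow> m \<in> Obj M \<Longrightarrow> is_iso M (f \<lhd> m)"
  unfolding ract_def
  by (rule bifunctor.bi_is_iso[OF act_bifunctor]) (auto simp: category.is_iso_Ide[OF act_category])

text \<open>The interchange law of the bifunctor. As a rewrite rule it moves the arrow that acts
  from outside to the right of those inside.\<close>

lemma ract_lact:
  assumes "f \<in> Arr C" "h \<in> Arr M" "m = Cod M h" "A = Dom C f"
  shows "(f \<lhd> m) \<cdot>\<^bsub>M\<^esub> (A \<rhd> h) = (Cod C f \<rhd> h) \<cdot>\<^bsub>M\<^esub> (f \<lhd> Dom M h)"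
  using assms by (simp add: lact_def ract_def act_merge)

lemma act_assoc_nat':
  assumes "f \<in> Arr C" "g \<in> Arr C" "h \<in> Arr M"
  shows "act_assoc M (Cod C f) (Cod C g) (Cod M h) \<cdot>\<^bsub>M\<^esub> (f \<odot>\<^sub>a\<^bsub>M\<^esub> (g \<odot>\<^sub>a\<^bsub>M\<^esub> h)) =
    ((f \<otimes>\<^sub>a g) \<odot>\<^sub>a\<^bsub>M\<^esub> h) \<cdot>\<^bsub>M\<^esub> act_assoc M (Dom C f) (Dom C g) (Dom M h)"
  using act_assoc_nat[of f "Dom C f" "Cod C f" g "Dom C g" "Cod C g" h "Dom M h" "Cod M h"] assms
  by (auto simp: in_Hom)

lemma act_assoc_nat_lact:
  assumes "A \<in> Obj C" "B \<in> Obj C" "h \<in> Arr M" "m = Cod M h"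
  shows "act_assoc M A B m \<cdot>\<^bsub>M\<^esub> (A \<rhd> (B \<rhd> h)) = ((A \<otimes> B) \<rhd> h) \<cdot>\<^bsub>M\<^esub> act_assoc M A B (Dom M h)"
  using act_assoc_nat'[of "Ide C A" "Ide C B" h] assms by (simp add: lact_def)

lemma act_assoc_nat_ract:
  assumes "f \<in> Arr C" "B \<in> Obj C" "m \<in> Obj M" "A = Cod C f"
  shows "act_assoc M A B m \<cdot>\<^bsub>M\<^esub> (f \<lhd> (B \<odot>\<^bsub>M\<^esub> m)) = ((f \<otimes>\<^sub>a Ide C B) \<lhd> m) \<cdot>\<^bsub>M\<^esub> act_assoc M (Dom C f) B m"
  using act_assoc_nat'[of f "Ide C B" "Ide M m"] assms by (simp add: ract_def)

lemma act_assoc_nat_mid: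
  assumes "f \<in> Arr C" "A \<in> Obj C" "m \<in> Obj M" "B = Cod C f"
  shows "act_assoc M A B m \<cdot>\<^bsub>M\<^esub> (A \<rhd> (f \<lhd> m)) = ((Ide C A \<otimes>\<^sub>a f) \<lhd> m) \<cdot>\<^bsub>M\<^esub> act_assoc M A (Dom C f) m"
  using act_assoc_nat'[of "Ide C A" f "Ide M m"] assms by (simp add: ract_def lact_def)

lemma act_unit_nat':
  "h \<in> Arr M \<Longrightarrow> m = Cod M h \<Longrightarrow> act_unit M m \<cdot>\<^bsub>M\<^esub> (\<one> \<rhd> h) = h \<cdot>\<^bsub>M\<^esub> act_unit M (Dom M h)"
  using act_unit_nat[of h "Dom M h" "Cod M h"] by (auto simp: in_Hom lact_def)

lemma act_pentagon':
  assumes "a \<in> Obj C" "b \<in> Obj C" "c \<in> Obj C" "m \<in> Obj M"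
  shows "(assoc C a b c \<lhd> m) \<cdot>\<^bsub>M\<^esub> (act_assoc M a (b \<otimes> c) m \<cdot>\<^bsub>M\<^esub> (a \<rhd> act_assoc M b c m)) =
    act_assoc M (a \<otimes> b) c m \<cdot>\<^bsub>M\<^esub> act_assoc M a b (c \<odot>\<^bsub>M\<^esub> m)"
  using act_pentagon[OF assms] by (simp add: lact_def ract_def)

text \<open>The left side of the pentagon has three factors, so \<open>act_chain\<close> alone would
  leave a left side that is not in normal form; this is the normalised version for use in a longer
  composite.\<close>

lemma act_pentagon_chain:
  assumes "a \<in> Obj C" "b \<in> Obj C" "c \<in> Obj C" "m \<in> Obj M" "t \<in> Arr M"
    "Cod M t = a \<odot>\<^bsub>M\<^esub> (b \<odot>\<^bsub>M\<^esub> (c \<odot>\<^bsub>M\<^esub> m))"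
  shows "(assoc C a b c \<lhd> m) \<cdot>\<^bsub>M\<^esub> (act_assoc M a (b \<otimes> c) m \<cdot>\<^bsub>M\<^esub> ((a \<rhd> act_assoc M b c m) \<cdot>\<^bsub>M\<^esub> t)) =
    act_assoc M (a \<otimes> b) c m \<cdot>\<^bsub>M\<^esub> (act_assoc M a b (c \<odot>\<^bsub>M\<^esub> m) \<cdot>\<^bsub>M\<^esub> t)"
  using act_chain[OF act_pentagon'[OF assms(1-4)], of t] assms by simp

lemma act_triangle_right':
  "a \<in> Obj C \<Longrightarrow> m \<in> Obj M \<Longrightarrow> (runit C a \<lhd> m) \<cdot>\<^bsub>M\<^esub> act_assoc M a \<one> m = a \<rhd> act_unit M m"
  using act_triangle_right by (simp add: lact_def ract_def)

lemma act_triangle_left':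
  "a \<in> Obj C \<Longrightarrow> m \<in> Obj M \<Longrightarrow> (lunit C a \<lhd> m) \<cdot>\<^bsub>M\<^esub> act_assoc M \<one> a m = act_unit M (a \<odot>\<^bsub>M\<^esub> m)"
  using act_triangle_left by (simp add: lact_def ract_def)

end

context symmetric_monoidal
begin

text \<open>The rewrites erase every trace of \<open>self_act\<close>. The whole calculus thus
  becomes available for \<open>C\<close> under the prefix \<open>self\<close>, and equations about
  monoids are proved by the same rules as those about modules.\<close>

sublocale self: left_actegory C "self_act C"
  rewrites "Obj (self_act C) = Obj C" and "Arr (self_act C) = Arr C" and "Dom (self_act C) = Dom C"
  and "Cod (self_act C) = Cod C" and "Ide (self_act C) = Ide C" and "Cmp (self_act C) = Cmp C"
  and "act (self_act C) = ten C" and "actA (self_act C) = tenA C" and "act_assoc (self_act C) = assoc C"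
  and "act_unit (self_act C) = lunit C" and "Hom (self_act C) = Hom C" and "is_iso (self_act C) = is_iso C"
  and "is_epi (self_act C) = is_epi C" and "category.inv_arr (self_act C) = category.inv_arr C"
proof -
  have cat: "category (self_act C)"
    using tensor_category by (simp add: category_def)
  then show "category.inv_arr (self_act C) = category.inv_arr C"
    by (simp add: fun_eq_iff category.inv_arr_def tensor_category)
  have "bifunctor C (self_act C) (self_act C) (ten C) (tenA C)"
    using tensor_bifunctor cat by (simp add: bifunctor_def bifunctor_axioms_def)
  then show "left_actegory C (self_act C)"
    using symmetric_monoidal_axioms
    by (simp add: left_actegory_def left_actegory_axioms_def assoc_Hom assoc_iso assoc_nat lunit_Hom
      lunit_nat pentagon triangle kelly_lunit)
qed simp_all

end

context symmetric_monoidal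
begin

lemma comm_monoid_simps [simp]:
  assumes "comm_monoid_obj C a"
  shows "carr a \<in> Obj C" "mult a \<in> Arr C" "Dom C (mult a) = carr a \<otimes> carr a" "Cod C (mult a) = carr a"
    "unit a \<in> Arr C" "Dom C (unit a) = \<one>" "Cod C (unit a) = carr a"
  using assms by (auto simp: comm_monoid_obj_def Let_def in_Hom)

lemma comm_monoid_laws:
  assumes "comm_monoid_obj C a"
  shows "mult a \<cdot> ((mult a \<otimes>\<^sub>a Ide C (carr a)) \<cdot> assoc C (carr a) (carr a) (carr a)) =
      mult a \<cdot> (Ide C (carr a) \<otimes>\<^sub>a mult a)"
    "mult a \<cdot> (unit a \<otimes>\<^sub>a Ide C (carr a)) = lunit C (carr a)"
    "mult a \<cdot> (Ide C (carr a) \<otimes>\<^sub>a unit a) = runit C (carr a)"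
    "mult a \<cdot> braid C (carr a) (carr a) = mult a"
  using assms by (simp_all add: comm_monoid_obj_def Let_def)

text \<open>The condition on arrows of \<open>Comm C\<close>, stated for the untagged underlying
  arrow so that it can be used inside calculations in \<open>C\<close>.\<close>

definition monoid_map where
  "monoid_map a b f \<longleftrightarrow> f \<in> Arr C \<and> Dom C f = carr a \<and> Cod C f = carr b \<and>
     f \<cdot> mult a = mult b \<cdot> (f \<otimes>\<^sub>a f) \<and> f \<cdot> unit a = unit b"

lemma monoid_mapD:
  assumes "monoid_map a b f"
  shows "f \<in> Arr C" "Dom C f = carr a" "Cod C f = carr b"
    "f \<cdot> mult a = mult b \<cdot> (f \<otimes>\<^sub>a f)" "f \<cdot> unit a = unit b"
  using assms by (auto simp: monoid_map_def)

end

section \<open>The monad of an acting monoid, and the exchange of two acting objects\<close>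

context left_actegory
begin

lemma lact_inv [simp]:
  assumes "A \<in> Obj C" "is_iso M h"
  shows "(A \<rhd> h) \<cdot>\<^bsub>M\<^esub> (A \<rhd> category.inv_arr M h) = Ide M (A \<odot>\<^bsub>M\<^esub> Cod M h)"
    "(A \<rhd> category.inv_arr M h) \<cdot>\<^bsub>M\<^esub> (A \<rhd> h) = Ide M (A \<odot>\<^bsub>M\<^esub> Dom M h)"
    "t \<in> Arr M \<Longrightarrow> Cod M t = A \<odot>\<^bsub>M\<^esub> Cod M h \<Longrightarrow> (A \<rhd> h) \<cdot>\<^bsub>M\<^esub> ((A \<rhd> category.inv_arr M h) \<cdot>\<^bsub>M\<^esub> t) = t"
    "t \<in> Arr M \<Longrightarrow> Cod M t = A \<odot>\<^bsub>M\<^esub> Dom M h \<Longrightarrow> (A \<rhd> category.inv_arr M h) \<cdot>\<^bsub>M\<^esub> ((A \<rhd> h) \<cdot>\<^bsub>M\<^esub> t) = t"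
proof -
  have h [simp]: "h \<in> Arr M" using assms(2) by (simp add: is_iso_def)
  note [simp] = assms
  show 1: "(A \<rhd> h) \<cdot>\<^bsub>M\<^esub> (A \<rhd> category.inv_arr M h) = Ide M (A \<odot>\<^bsub>M\<^esub> Cod M h)"
    and 2: "(A \<rhd> category.inv_arr M h) \<cdot>\<^bsub>M\<^esub> (A \<rhd> h) = Ide M (A \<odot>\<^bsub>M\<^esub> Dom M h)"
    by (simp_all flip: lact_Cmp)
  show "t \<in> Arr M \<Longrightarrow> Cod M t = A \<odot>\<^bsub>M\<^esub> Cod M h \<Longrightarrow> (A \<rhd> h) \<cdot>\<^bsub>M\<^esub> ((A \<rhd> category.inv_arr M h) \<cdot>\<^bsub>M\<^esub> t) = t"
    by (subst act_chain[OF 1]) simp_all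
  show "t \<in> Arr M \<Longrightarrow> Cod M t = A \<odot>\<^bsub>M\<^esub> Dom M h \<Longrightarrow> (A \<rhd> category.inv_arr M h) \<cdot>\<^bsub>M\<^esub> ((A \<rhd> h) \<cdot>\<^bsub>M\<^esub> t) = t"
    by (subst act_chain[OF 2]) simp_all
qed

text \<open>Inverts the two parallel isomorphisms of a commuting square; in this way naturality of a
  constraint passes to its inverse.\<close>

lemma act_inv_swap:
  assumes "i \<cdot>\<^bsub>M\<^esub> f = g \<cdot>\<^bsub>M\<^esub> j" "is_iso M i" "is_iso M j"
    and "f \<in> Arr M" "g \<in> Arr M" "Cod M f = Dom M i" "Dom M f = Dom M j" "Dom M g = Cod M j" "Cod M g = Cod M i"
  shows "category.inv_arr M i \<cdot>\<^bsub>M\<^esub> g = f \<cdot>\<^bsub>M\<^esub> category.inv_arr M j"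
proof -
  have [simp]: "i \<in> Arr M" "j \<in> Arr M" using assms(2,3) by (simp_all add: is_iso_def)
  have "(i \<cdot>\<^bsub>M\<^esub> f) \<cdot>\<^bsub>M\<^esub> category.inv_arr M j = g"
    using assms by simp
  then have "category.inv_arr M i \<cdot>\<^bsub>M\<^esub> g = category.inv_arr M i \<cdot>\<^bsub>M\<^esub> ((i \<cdot>\<^bsub>M\<^esub> f) \<cdot>\<^bsub>M\<^esub> category.inv_arr M j)"
    by simp
  also have "\<dots> = f \<cdot>\<^bsub>M\<^esub> category.inv_arr M j"
    using assms(2-) by simp
  finally show ?thesis .
qed

lemma mul_simps [simp]:
  assumes "comm_monoid_obj C a" "m \<in> Obj M"
  shows "mul a m \<in> Arr M" "Dom M (mul a m) = carr a \<odot>\<^bsub>M\<^esub> (carr a \<odot>\<^bsub>M\<^esub> m)" "Cod M (mul a m) = carr a \<odot>\<^bsub>M\<^esub> m"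
  using assms by (simp_all add: mul_def)

lemma un_simps [simp]:
  assumes "comm_monoid_obj C a" "m \<in> Obj M"
  shows "un a m \<in> Arr M" "Dom M (un a m) = m" "Cod M (un a m) = carr a \<odot>\<^bsub>M\<^esub> m"
  using assms by (simp_all add: un_def)

lemma sw_simps [simp]:
  assumes "A \<in> Obj C" "B \<in> Obj C" "m \<in> Obj M"
  shows "sw A B m \<in> Arr M" "Dom M (sw A B m) = A \<odot>\<^bsub>M\<^esub> (B \<odot>\<^bsub>M\<^esub> m)" "Cod M (sw A B m) = B \<odot>\<^bsub>M\<^esub> (A \<odot>\<^bsub>M\<^esub> m)"
  using assms by (simp_all add: sw_def)

lemma mul_nat:
  assumes "comm_monoid_obj C a" "h \<in> Arr M" "m = Cod M h"
  shows "mul a m \<cdot>\<^bsub>M\<^esub> (carr a \<rhd> (carr a \<rhd> h)) = (carr a \<rhd> h) \<cdot>\<^bsub>M\<^esub> mul a (Dom M h)"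
  using assms by (simp add: mul_def act_assoc_nat_lact ract_lact ract_lact[THEN act_chain])

text \<open>Associativity of the monad: the associativity law of the monoid is made to act on
  \<open>m\<close>, and the pentagon of the action removes the associator of \<open>C\<close>
  contained in it.\<close>

lemma mul_assoc:
  assumes a: "comm_monoid_obj C a" and m: "m \<in> Obj M"
  shows "mul a m \<cdot>\<^bsub>M\<^esub> (carr a \<rhd> mul a m) = mul a m \<cdot>\<^bsub>M\<^esub> mul a (carr a \<odot>\<^bsub>M\<^esub> m)"
proof -
  note [simp] = a m
  let ?a = "carr a" and ?l = "act_assoc M"
  have "(mult a \<cdot> (Ide C ?a \<otimes>\<^sub>a mult a)) \<lhd> m = (mult a \<cdot> ((mult a \<otimes>\<^sub>a Ide C ?a) \<cdot> assoc C ?a ?a ?a)) \<lhd> m"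
    by (simp only: comm_monoid_laws[OF a])
  then have eq: "(mult a \<lhd> m) \<cdot>\<^bsub>M\<^esub> ((Ide C ?a \<otimes>\<^sub>a mult a) \<lhd> m) =
      (mult a \<lhd> m) \<cdot>\<^bsub>M\<^esub> (((mult a \<otimes>\<^sub>a Ide C ?a) \<lhd> m) \<cdot>\<^bsub>M\<^esub> (assoc C ?a ?a ?a \<lhd> m))"
    by simp
  have "mul a m \<cdot>\<^bsub>M\<^esub> (?a \<rhd> mul a m) =
    (mult a \<lhd> m) \<cdot>\<^bsub>M\<^esub> (((Ide C ?a \<otimes>\<^sub>a mult a) \<lhd> m) \<cdot>\<^bsub>M\<^esub> (?l ?a (?a \<otimes> ?a) m \<cdot>\<^bsub>M\<^esub> (?a \<rhd> ?l ?a ?a m)))"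
    by (simp add: mul_def act_assoc_nat_mid[THEN act_chain])
  also have "\<dots> = (mult a \<lhd> m) \<cdot>\<^bsub>M\<^esub> (((mult a \<otimes>\<^sub>a Ide C ?a) \<lhd> m) \<cdot>\<^bsub>M\<^esub>
      (?l (?a \<otimes> ?a) ?a m \<cdot>\<^bsub>M\<^esub> ?l ?a ?a (?a \<odot>\<^bsub>M\<^esub> m)))"
    by (simp add: eq[THEN act_chain] act_pentagon')
  also have "\<dots> = mul a m \<cdot>\<^bsub>M\<^esub> mul a (?a \<odot>\<^bsub>M\<^esub> m)"
    by (simp add: mul_def act_assoc_nat_ract[THEN act_chain])
  finally show ?thesis .
qed

lemma mul_un_left:
  assumes a: "comm_monoid_obj C a" and m: "m \<in> Obj M"
  shows "mul a m \<cdot>\<^bsub>M\<^esub> un a (carr a \<odot>\<^bsub>M\<^esub> m) = Ide M (carr a \<odot>\<^bsub>M\<^esub> m)"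
proof -
  note [simp] = a m
  let ?a = "carr a" and ?l = "act_assoc M"
  have "(mult a \<cdot> (unit a \<otimes>\<^sub>a Ide C ?a)) \<lhd> m = lunit C ?a \<lhd> m"
    by (simp only: comm_monoid_laws[OF a])
  then have eq: "(mult a \<lhd> m) \<cdot>\<^bsub>M\<^esub> ((unit a \<otimes>\<^sub>a Ide C ?a) \<lhd> m) = lunit C ?a \<lhd> m"
    by simp
  show ?thesis
    by (simp add: mul_def un_def act_assoc_nat_ract[THEN act_chain] eq[THEN act_chain]
      act_triangle_left'[THEN act_chain])
qed

lemma mul_un_right:
  assumes a: "comm_monoid_obj C a" and m: "m \<in> Obj M"
  shows "mul a m \<cdot>\<^bsub>M\<^esub> (carr a \<rhd> un a m) = Ide M (carr a \<odot>\<^bsub>M\<^esub> m)"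
proof -
  note [simp] = a m
  let ?a = "carr a" and ?l = "act_assoc M"
  have "(mult a \<cdot> (Ide C ?a \<otimes>\<^sub>a unit a)) \<lhd> m = runit C ?a \<lhd> m"
    by (simp only: comm_monoid_laws[OF a])
  then have eq: "(mult a \<lhd> m) \<cdot>\<^bsub>M\<^esub> ((Ide C ?a \<otimes>\<^sub>a unit a) \<lhd> m) = runit C ?a \<lhd> m"
    by simp
  show ?thesis
    by (simp add: mul_def un_def act_assoc_nat_mid[THEN act_chain] eq[THEN act_chain]
      act_triangle_right'[THEN act_chain])
qed

lemma un_nat:
  assumes "comm_monoid_obj C a" "h \<in> Arr M" "m = Cod M h"
  shows "un a m \<cdot>\<^bsub>M\<^esub> h = (carr a \<rhd> h) \<cdot>\<^bsub>M\<^esub> un a (Dom M h)"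
proof -
  note [simp] = assms
  have "category.inv_arr M (act_unit M m) \<cdot>\<^bsub>M\<^esub> h = (\<one> \<rhd> h) \<cdot>\<^bsub>M\<^esub> category.inv_arr M (act_unit M (Dom M h))"
    by (rule act_inv_swap) (simp_all add: act_unit_nat')
  then show ?thesis
    by (simp add: un_def ract_lact[THEN act_chain])
qed

lemma inv_assoc_nat_lact:
  assumes "A \<in> Obj C" "B \<in> Obj C" "h \<in> Arr M" "m = Cod M h"
  shows "category.inv_arr M (act_assoc M A B m) \<cdot>\<^bsub>M\<^esub> ((A \<otimes> B) \<rhd> h) =
    (A \<rhd> (B \<rhd> h)) \<cdot>\<^bsub>M\<^esub> category.inv_arr M (act_assoc M A B (Dom M h))"
  by (rule act_inv_swap) (use assms in \<open>simp_all add: act_assoc_nat_lact\<close>)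

lemma inv_assoc_nat_mid:
  assumes "f \<in> Arr C" "A \<in> Obj C" "m \<in> Obj M" "B = Cod C f"
  shows "category.inv_arr M (act_assoc M A B m) \<cdot>\<^bsub>M\<^esub> ((Ide C A \<otimes>\<^sub>a f) \<lhd> m) =
    (A \<rhd> (f \<lhd> m)) \<cdot>\<^bsub>M\<^esub> category.inv_arr M (act_assoc M A (Dom C f) m)"
  by (rule act_inv_swap) (use assms in \<open>simp_all add: act_assoc_nat_mid\<close>)

lemma sw_nat:
  assumes "A \<in> Obj C" "B \<in> Obj C" "h \<in> Arr M" "m = Cod M h"
  shows "sw A B m \<cdot>\<^bsub>M\<^esub> (A \<rhd> (B \<rhd> h)) = (B \<rhd> (A \<rhd> h)) \<cdot>\<^bsub>M\<^esub> sw A B (Dom M h)"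
  using assms by (simp add: sw_def act_assoc_nat_lact ract_lact[THEN act_chain]
      inv_assoc_nat_lact[THEN act_chain])

lemma sw_nat_ract:
  assumes f: "f \<in> Arr C" and "B \<in> Obj C" "m \<in> Obj M" "A = Cod C f"
  shows "sw A B m \<cdot>\<^bsub>M\<^esub> (f \<lhd> (B \<odot>\<^bsub>M\<^esub> m)) = (B \<rhd> (f \<lhd> m)) \<cdot>\<^bsub>M\<^esub> sw (Dom C f) B m"
proof -
  note [simp] = assms
  have "(braid C A B \<cdot> (f \<otimes>\<^sub>a Ide C B)) \<lhd> m = ((Ide C B \<otimes>\<^sub>a f) \<cdot> braid C (Dom C f) B) \<lhd> m"
    using braid_nat'[of f "Ide C B"] by simp
  then have "(braid C A B \<lhd> m) \<cdot>\<^bsub>M\<^esub> ((f \<otimes>\<^sub>a Ide C B) \<lhd> m) = ((Ide C B \<otimes>\<^sub>a f) \<lhd> m) \<cdot>\<^bsub>M\<^esub> (braid C (Dom C f) B \<lhd> m)"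
    by simp
  note eq = this[THEN act_chain]
  show ?thesis
    using eq by (simp add: sw_def act_assoc_nat_ract inv_assoc_nat_mid[THEN act_chain])
qed

lemma sw_sw:
  assumes "A \<in> Obj C" "B \<in> Obj C" "m \<in> Obj M"
  shows "sw B A m \<cdot>\<^bsub>M\<^esub> sw A B m = Ide M (A \<odot>\<^bsub>M\<^esub> (B \<odot>\<^bsub>M\<^esub> m))"
proof -
  note [simp] = assms
  have "(braid C B A \<cdot> braid C A B) \<lhd> m = Ide C (A \<otimes> B) \<lhd> m"
    by (simp only: symmetry[OF assms(1,2)])
  then have "(braid C B A \<lhd> m) \<cdot>\<^bsub>M\<^esub> (braid C A B \<lhd> m) = Ide M ((A \<otimes> B) \<odot>\<^bsub>M\<^esub> m)"
    by simp
  note eq = this[THEN act_chain]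
  show ?thesis
    by (simp add: sw_def eq)
qed

lemma sw_is_iso [simp]:
  assumes "A \<in> Obj C" "B \<in> Obj C" "m \<in> Obj M"
  shows "is_iso M (sw A B m)"
  by (rule category.is_isoI[OF act_category, of _ "A \<odot>\<^bsub>M\<^esub> (B \<odot>\<^bsub>M\<^esub> m)" "B \<odot>\<^bsub>M\<^esub> (A \<odot>\<^bsub>M\<^esub> m)" "sw B A m"])
    (use assms in \<open>simp_all add: in_Hom sw_sw\<close>)

text \<open>Composing both sides with the inverse exchange \<open>sw B A m\<close> reduces the claim
  to \<open>sw_nat_ract\<close>.\<close>

lemma sw_nat_mid:
  assumes f: "f \<in> Arr C" and "A \<in> Obj C" "m \<in> Obj M" "B = Cod C f"
  shows "sw A B m \<cdot>\<^bsub>M\<^esub> (A \<rhd> (f \<lhd> m)) = (f \<lhd> (A \<odot>\<^bsub>M\<^esub> m)) \<cdot>\<^bsub>M\<^esub> sw A (Dom C f) m"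
proof (rule act_cancel_left)
  show "sw B A m \<cdot>\<^bsub>M\<^esub> (sw A B m \<cdot>\<^bsub>M\<^esub> (A \<rhd> (f \<lhd> m))) = sw B A m \<cdot>\<^bsub>M\<^esub> ((f \<lhd> (A \<odot>\<^bsub>M\<^esub> m)) \<cdot>\<^bsub>M\<^esub> sw A (Dom C f) m)"
    using assms by (simp add: sw_sw[THEN act_chain] sw_nat_ract[THEN act_chain] sw_sw)
qed (use assms in simp_all)

text \<open>The hexagon of the braiding in the language of actions. Both sides are compared after
  the isomorphisms \<open>act_assoc M X (A \<otimes> B) m\<close> and the whiskered associator;
  there the pentagon of the action, and on the left also the hexagon of \<open>C\<close>, turn each
  into the same composite \<open>?w\<close>.\<close>

lemma sw_hexagon:
  assumes "A \<in> Obj C" "B \<in> Obj C" "X \<in> Obj C" "m \<in> Obj M"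
  shows "sw (A \<otimes> B) X m \<cdot>\<^bsub>M\<^esub> act_assoc M A B (X \<odot>\<^bsub>M\<^esub> m) =
    (X \<rhd> act_assoc M A B m) \<cdot>\<^bsub>M\<^esub> (sw A X (B \<odot>\<^bsub>M\<^esub> m) \<cdot>\<^bsub>M\<^esub> (A \<rhd> sw B X m))"
    (is "?lhs = ?rhs")
proof -
  note [simp] = assms
  let ?l = "act_assoc M" and ?\<alpha> = "assoc C" and ?\<beta> = "braid C"
  let ?w = "((?\<beta> A X \<otimes>\<^sub>a Ide C B) \<lhd> m) \<cdot>\<^bsub>M\<^esub> ((?\<alpha> A X B \<lhd> m) \<cdot>\<^bsub>M\<^esub> (((Ide C A \<otimes>\<^sub>a ?\<beta> B X) \<lhd> m) \<cdot>\<^bsub>M\<^esub>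
      (?l A (B \<otimes> X) m \<cdot>\<^bsub>M\<^esub> (A \<rhd> ?l B X m))))"
  have "(?\<alpha> X A B \<cdot> (?\<beta> (A \<otimes> B) X \<cdot> ?\<alpha> A B X)) \<lhd> m =
      ((?\<beta> A X \<otimes>\<^sub>a Ide C B) \<cdot> (?\<alpha> A X B \<cdot> (Ide C A \<otimes>\<^sub>a ?\<beta> B X))) \<lhd> m"
    by (simp only: hexagon[OF assms(1-3)])
  then have hex: "((?\<alpha> X A B \<lhd> m) \<cdot>\<^bsub>M\<^esub> ((?\<beta> (A \<otimes> B) X \<lhd> m) \<cdot>\<^bsub>M\<^esub> (?\<alpha> A B X \<lhd> m))) =
      ((?\<beta> A X \<otimes>\<^sub>a Ide C B) \<lhd> m) \<cdot>\<^bsub>M\<^esub> ((?\<alpha> A X B \<lhd> m) \<cdot>\<^bsub>M\<^esub> ((Ide C A \<otimes>\<^sub>a ?\<beta> B X) \<lhd> m))"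
    by simp
  have "(?\<alpha> X A B \<lhd> m) \<cdot>\<^bsub>M\<^esub> (?l X (A \<otimes> B) m \<cdot>\<^bsub>M\<^esub> ?lhs) =
    ((?\<alpha> X A B \<lhd> m) \<cdot>\<^bsub>M\<^esub> ((?\<beta> (A \<otimes> B) X \<lhd> m) \<cdot>\<^bsub>M\<^esub> (?\<alpha> A B X \<lhd> m))) \<cdot>\<^bsub>M\<^esub> (?l A (B \<otimes> X) m \<cdot>\<^bsub>M\<^esub> (A \<rhd> ?l B X m))"
    by (simp add: sw_def act_pentagon')
  also have "\<dots> = ?w"
    by (simp add: hex)
  finally have l: "(?\<alpha> X A B \<lhd> m) \<cdot>\<^bsub>M\<^esub> (?l X (A \<otimes> B) m \<cdot>\<^bsub>M\<^esub> ?lhs) = ?w" .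
  have "(?\<alpha> X A B \<lhd> m) \<cdot>\<^bsub>M\<^esub> (?l X (A \<otimes> B) m \<cdot>\<^bsub>M\<^esub> ?rhs) =
    ((?\<alpha> X A B \<lhd> m) \<cdot>\<^bsub>M\<^esub> (?l X (A \<otimes> B) m \<cdot>\<^bsub>M\<^esub> (X \<rhd> ?l A B m))) \<cdot>\<^bsub>M\<^esub> (sw A X (B \<odot>\<^bsub>M\<^esub> m) \<cdot>\<^bsub>M\<^esub> (A \<rhd> sw B X m))"
    by simp
  also have "\<dots> = ?l (X \<otimes> A) B m \<cdot>\<^bsub>M\<^esub> (?l X A (B \<odot>\<^bsub>M\<^esub> m) \<cdot>\<^bsub>M\<^esub> (sw A X (B \<odot>\<^bsub>M\<^esub> m) \<cdot>\<^bsub>M\<^esub> (A \<rhd> sw B X m)))"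
    by (simp add: act_pentagon')
  also have "\<dots> = ((?\<beta> A X \<otimes>\<^sub>a Ide C B) \<lhd> m) \<cdot>\<^bsub>M\<^esub> ((?l (A \<otimes> X) B m \<cdot>\<^bsub>M\<^esub> ?l A X (B \<odot>\<^bsub>M\<^esub> m)) \<cdot>\<^bsub>M\<^esub> (A \<rhd> sw B X m))"
    by (simp add: sw_def[of A X] act_assoc_nat_ract[THEN act_chain])
  also have "\<dots> = ?w"
    by (simp add: sw_def[of B X] act_assoc_nat_mid[THEN act_chain] flip: act_pentagon')
  finally have r: "(?\<alpha> X A B \<lhd> m) \<cdot>\<^bsub>M\<^esub> (?l X (A \<otimes> B) m \<cdot>\<^bsub>M\<^esub> ?rhs) = ?w" .
  have "?l X (A \<otimes> B) m \<cdot>\<^bsub>M\<^esub> ?lhs = ?l X (A \<otimes> B) m \<cdot>\<^bsub>M\<^esub> ?rhs"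
    by (rule act_cancel_left[of "?\<alpha> X A B \<lhd> m"]) (use l r in simp_all)
  then show ?thesis
    by (rule act_cancel_left[rotated -1]) simp_all
qed

text \<open>The mirror image of \<open>sw_hexagon\<close>, obtained by cancelling exchanges against
  their inverses, which is where symmetry of the braiding enters.\<close>

lemma sw_hexagon':
  assumes "A \<in> Obj C" "B \<in> Obj C" "X \<in> Obj C" "m \<in> Obj M"
  shows "sw X (A \<otimes> B) m \<cdot>\<^bsub>M\<^esub> (X \<rhd> act_assoc M A B m) =
    act_assoc M A B (X \<odot>\<^bsub>M\<^esub> m) \<cdot>\<^bsub>M\<^esub> ((A \<rhd> sw X B m) \<cdot>\<^bsub>M\<^esub> sw X A (B \<odot>\<^bsub>M\<^esub> m))"
proof (rule act_cancel_left)
  note [simp] = assms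
  have "(A \<rhd> sw B X m) \<cdot>\<^bsub>M\<^esub> (A \<rhd> sw X B m) = Ide M (A \<odot>\<^bsub>M\<^esub> (X \<odot>\<^bsub>M\<^esub> (B \<odot>\<^bsub>M\<^esub> m)))"
    by (simp add: sw_sw flip: lact_Cmp)
  note eq = this[THEN act_chain]
  show "sw (A \<otimes> B) X m \<cdot>\<^bsub>M\<^esub> (sw X (A \<otimes> B) m \<cdot>\<^bsub>M\<^esub> (X \<rhd> act_assoc M A B m)) =
    sw (A \<otimes> B) X m \<cdot>\<^bsub>M\<^esub> (act_assoc M A B (X \<odot>\<^bsub>M\<^esub> m) \<cdot>\<^bsub>M\<^esub> ((A \<rhd> sw X B m) \<cdot>\<^bsub>M\<^esub> sw X A (B \<odot>\<^bsub>M\<^esub> m)))"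
    by (simp add: sw_hexagon[THEN act_chain] sw_sw[THEN act_chain] sw_sw eq)
qed (use assms in simp_all)

text \<open>One of the axioms of a distributive law between monads: the hexagon carries the exchange
  past a multiplication.\<close>

lemma sw_mul:
  assumes "comm_monoid_obj C a" "B \<in> Obj C" "m \<in> Obj M"
  shows "sw (carr a) B m \<cdot>\<^bsub>M\<^esub> mul a (B \<odot>\<^bsub>M\<^esub> m) =
    (B \<rhd> mul a m) \<cdot>\<^bsub>M\<^esub> (sw (carr a) B (carr a \<odot>\<^bsub>M\<^esub> m) \<cdot>\<^bsub>M\<^esub> (carr a \<rhd> sw (carr a) B m))"
  using assms by (simp add: mul_def sw_nat_ract[THEN act_chain] sw_hexagon)

lemma sw_mul':
  assumes "comm_monoid_obj C a" "B \<in> Obj C" "m \<in> Obj M"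
  shows "sw B (carr a) m \<cdot>\<^bsub>M\<^esub> (B \<rhd> mul a m) =
    mul a (B \<odot>\<^bsub>M\<^esub> m) \<cdot>\<^bsub>M\<^esub> ((carr a \<rhd> sw B (carr a) m) \<cdot>\<^bsub>M\<^esub> sw B (carr a) (carr a \<odot>\<^bsub>M\<^esub> m))"
  using assms by (simp add: mul_def sw_nat_mid[THEN act_chain] sw_hexagon')

text \<open>Compatibility of the braiding with the unit object is not among the axioms. It comes
  from the hexagon with \<open>A\<close> and \<open>B\<close> the unit: with the left triangle this
  gives the claim at \<open>\<one> \<odot> m\<close> after cancelling an exchange, and the
  isomorphism \<open>act_unit M m\<close> transports it to \<open>m\<close>.\<close>

lemma sw_unit:
  assumes X: "X \<in> Obj C" and m: "m \<in> Obj M"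
  shows "(X \<rhd> act_unit M m) \<cdot>\<^bsub>M\<^esub> sw \<one> X m = act_unit M (X \<odot>\<^bsub>M\<^esub> m)"
proof -
  note [simp] = X m
  let ?m = "\<one> \<odot>\<^bsub>M\<^esub> m" and ?u = "act_unit M"
  have "?u (X \<odot>\<^bsub>M\<^esub> ?m) \<cdot>\<^bsub>M\<^esub> (\<one> \<rhd> sw \<one> X m) = sw \<one> X m \<cdot>\<^bsub>M\<^esub> ?u (\<one> \<odot>\<^bsub>M\<^esub> (X \<odot>\<^bsub>M\<^esub> m))"
    by (simp add: act_unit_nat')
  also have "\<dots> = sw \<one> X m \<cdot>\<^bsub>M\<^esub> ((lunit C \<one> \<lhd> (X \<odot>\<^bsub>M\<^esub> m)) \<cdot>\<^bsub>M\<^esub> act_assoc M \<one> \<one> (X \<odot>\<^bsub>M\<^esub> m))"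
    by (simp add: act_triangle_left')
  also have "\<dots> = (X \<rhd> (lunit C \<one> \<lhd> m)) \<cdot>\<^bsub>M\<^esub> ((X \<rhd> act_assoc M \<one> \<one> m) \<cdot>\<^bsub>M\<^esub>
      (sw \<one> X ?m \<cdot>\<^bsub>M\<^esub> (\<one> \<rhd> sw \<one> X m)))"
    by (simp add: sw_nat_ract[THEN act_chain] sw_hexagon)
  also have "\<dots> = ((X \<rhd> ((lunit C \<one> \<lhd> m) \<cdot>\<^bsub>M\<^esub> act_assoc M \<one> \<one> m)) \<cdot>\<^bsub>M\<^esub> sw \<one> X ?m) \<cdot>\<^bsub>M\<^esub> (\<one> \<rhd> sw \<one> X m)"
    by simp
  also have "\<dots> = ((X \<rhd> ?u ?m) \<cdot>\<^bsub>M\<^esub> sw \<one> X ?m) \<cdot>\<^bsub>M\<^esub> (\<one> \<rhd> sw \<one> X m)"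
    by (simp only: act_triangle_left'[OF tunit_Obj m])
  finally have 1: "?u (X \<odot>\<^bsub>M\<^esub> ?m) = (X \<rhd> ?u ?m) \<cdot>\<^bsub>M\<^esub> sw \<one> X ?m"
    by (rule act_cancel_right[rotated -1]) simp_all
  have "(X \<rhd> ?u m) \<cdot>\<^bsub>M\<^esub> (X \<rhd> (\<one> \<rhd> ?u m)) = (X \<rhd> ?u m) \<cdot>\<^bsub>M\<^esub> (X \<rhd> ?u ?m)"
    using act_unit_nat'[of "?u m" m] by (simp flip: lact_Cmp)
  note 2 = this[THEN act_chain]
  show ?thesis
  proof (rule act_cancel_right)
    show "((X \<rhd> ?u m) \<cdot>\<^bsub>M\<^esub> sw \<one> X m) \<cdot>\<^bsub>M\<^esub> (\<one> \<rhd> (X \<rhd> ?u m)) = ?u (X \<odot>\<^bsub>M\<^esub> m) \<cdot>\<^bsub>M\<^esub> (\<one> \<rhd> (X \<rhd> ?u m))"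
      by (simp add: sw_nat 2 act_unit_nat' flip: 1)
  qed simp_all
qed

lemma sw_un:
  assumes a: "comm_monoid_obj C a" and B: "B \<in> Obj C" and m: "m \<in> Obj M"
  shows "sw (carr a) B m \<cdot>\<^bsub>M\<^esub> un a (B \<odot>\<^bsub>M\<^esub> m) = B \<rhd> un a m"
proof -
  note [simp] = assms
  have "sw \<one> B m \<cdot>\<^bsub>M\<^esub> category.inv_arr M (act_unit M (B \<odot>\<^bsub>M\<^esub> m)) = B \<rhd> category.inv_arr M (act_unit M m)"
  proof (rule act_cancel_left)
    show "(B \<rhd> act_unit M m) \<cdot>\<^bsub>M\<^esub> (sw \<one> B m \<cdot>\<^bsub>M\<^esub> category.inv_arr M (act_unit M (B \<odot>\<^bsub>M\<^esub> m))) =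
      (B \<rhd> act_unit M m) \<cdot>\<^bsub>M\<^esub> (B \<rhd> category.inv_arr M (act_unit M m))"
      by (simp add: sw_unit[THEN act_chain])
  qed simp_all
  then show ?thesis
    by (simp add: un_def sw_nat_ract[THEN act_chain])
qed

lemma sw_un':
  assumes "comm_monoid_obj C a" "B \<in> Obj C" "m \<in> Obj M"
  shows "sw B (carr a) m \<cdot>\<^bsub>M\<^esub> (B \<rhd> un a m) = un a (B \<odot>\<^bsub>M\<^esub> m)"
  using assms by (simp add: sw_sw[THEN act_chain] flip: sw_un)

lemma mul_sw:
  assumes a: "comm_monoid_obj C a" and m: "m \<in> Obj M"
  shows "mul a m \<cdot>\<^bsub>M\<^esub> sw (carr a) (carr a) m = mul a m"
proof -
  note [simp] = assms
  have "(mult a \<cdot> braid C (carr a) (carr a)) \<lhd> m = mult a \<lhd> m"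
    by (simp only: comm_monoid_laws[OF a])
  then have "(mult a \<lhd> m) \<cdot>\<^bsub>M\<^esub> (braid C (carr a) (carr a) \<lhd> m) = mult a \<lhd> m"
    by simp
  note eq = this[THEN act_chain]
  show ?thesis
    by (simp add: mul_def sw_def eq)
qed

text \<open>Together with \<open>ract_un\<close> this says that a homomorphism of monoids induces a
  morphism of the associated monads.\<close>

lemma ract_mul:
  assumes a: "comm_monoid_obj C a" and b: "comm_monoid_obj C b" and f: "monoid_map a b f" and m: "m \<in> Obj M"
  shows "(f \<lhd> m) \<cdot>\<^bsub>M\<^esub> mul a m = mul b m \<cdot>\<^bsub>M\<^esub> ((carr b \<rhd> (f \<lhd> m)) \<cdot>\<^bsub>M\<^esub> (f \<lhd> (carr a \<odot>\<^bsub>M\<^esub> m)))"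
proof -
  note [simp] = a b m monoid_mapD(1-3)[OF f]
  have "f \<otimes>\<^sub>a f = (Ide C (carr b) \<otimes>\<^sub>a f) \<cdot> (f \<otimes>\<^sub>a Ide C (carr a))"
    by (simp add: ten_merge)
  then have "(f \<cdot> mult a) \<lhd> m = (mult b \<cdot> ((Ide C (carr b) \<otimes>\<^sub>a f) \<cdot> (f \<otimes>\<^sub>a Ide C (carr a)))) \<lhd> m"
    by (simp only: monoid_mapD(4)[OF f])
  then have "(f \<lhd> m) \<cdot>\<^bsub>M\<^esub> (mult a \<lhd> m) = (mult b \<lhd> m) \<cdot>\<^bsub>M\<^esub> (((Ide C (carr b) \<otimes>\<^sub>a f) \<lhd> m) \<cdot>\<^bsub>M\<^esub> ((f \<otimes>\<^sub>a Ide C (carr a)) \<lhd> m))"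
    by simp
  note eq = this[THEN act_chain]
  show ?thesis
    by (simp add: mul_def eq act_assoc_nat_mid[THEN act_chain] act_assoc_nat_ract)
qed

lemma ract_un:
  assumes a: "comm_monoid_obj C a" and b: "comm_monoid_obj C b" and f: "monoid_map a b f" and m: "m \<in> Obj M"
  shows "(f \<lhd> m) \<cdot>\<^bsub>M\<^esub> un a m = un b m"
proof -
  note [simp] = a b m monoid_mapD(1-3)[OF f]
  have "(f \<cdot> unit a) \<lhd> m = unit b \<lhd> m"
    by (simp only: monoid_mapD(5)[OF f])
  then have "(f \<lhd> m) \<cdot>\<^bsub>M\<^esub> (unit a \<lhd> m) = unit b \<lhd> m" by simp
  note eq = this[THEN act_chain]
  show ?thesis by (simp add: un_def eq)
qed

end

context left_actegory
begin

text \<open>Here and in the next two lemmas the calculus of \<open>C\<close> on itself is compared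
  with the one on \<open>M\<close>: an arrow between words in \<open>C\<close>, acting on
  \<open>m\<close>, becomes one between iterated actions. This lets coequalizers formed in
  \<open>C\<close> be read off in \<open>M\<close>.\<close>

lemma mul_ract:
  assumes a: "comm_monoid_obj C a" and y: "y \<in> Obj C" and m: "m \<in> Obj M"
  shows "(self.mul a y \<lhd> m) \<cdot>\<^bsub>M\<^esub> (act_assoc M (carr a) (carr a \<otimes> y) m \<cdot>\<^bsub>M\<^esub> (carr a \<rhd> act_assoc M (carr a) y m)) =
    act_assoc M (carr a) y m \<cdot>\<^bsub>M\<^esub> mul a (y \<odot>\<^bsub>M\<^esub> m)"
  using assms
  by (simp add: self.mul_def self.ract_def mul_def act_pentagon' act_assoc_nat_ract[THEN act_chain])

lemma un_ract:
  assumes a: "comm_monoid_obj C a" and y: "y \<in> Obj C" and m: "m \<in> Obj M"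
  shows "self.un a y \<lhd> m = act_assoc M (carr a) y m \<cdot>\<^bsub>M\<^esub> un a (y \<odot>\<^bsub>M\<^esub> m)"
proof -
  note [simp] = assms
  have "(lunit C y \<lhd> m) \<cdot>\<^bsub>M\<^esub> (category.inv_arr C (lunit C y) \<lhd> m) = Ide M (y \<odot>\<^bsub>M\<^esub> m)"
    by (simp flip: ract_Cmp)
  note eq = this
  have "act_assoc M \<one> y m \<cdot>\<^bsub>M\<^esub> category.inv_arr M (act_unit M (y \<odot>\<^bsub>M\<^esub> m)) = category.inv_arr C (lunit C y) \<lhd> m"
    by (rule act_cancel_left[of "lunit C y \<lhd> m"])
      (simp_all add: act_triangle_left'[THEN act_chain] eq)
  then show ?thesis
    by (simp add: self.un_def self.ract_def un_def act_assoc_nat_ract[THEN act_chain])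
qed

lemma sw_ract:
  assumes A: "A \<in> Obj C" and B: "B \<in> Obj C" and y: "y \<in> Obj C" and m: "m \<in> Obj M"
  shows "(self.sw A B y \<lhd> m) \<cdot>\<^bsub>M\<^esub> (act_assoc M A (B \<otimes> y) m \<cdot>\<^bsub>M\<^esub> (A \<rhd> act_assoc M B y m)) =
    act_assoc M B (A \<otimes> y) m \<cdot>\<^bsub>M\<^esub> ((B \<rhd> act_assoc M A y m) \<cdot>\<^bsub>M\<^esub> sw A B (y \<odot>\<^bsub>M\<^esub> m))"
proof (rule act_cancel_left)
  note [simp] = assms
  have "(assoc C B A y \<lhd> m) \<cdot>\<^bsub>M\<^esub> (category.inv_arr C (assoc C B A y) \<lhd> m) = Ide M (((B \<otimes> A) \<otimes> y) \<odot>\<^bsub>M\<^esub> m)"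
    by (simp flip: ract_Cmp)
  note eq = this[THEN act_chain]
  show "(assoc C B A y \<lhd> m) \<cdot>\<^bsub>M\<^esub> ((self.sw A B y \<lhd> m) \<cdot>\<^bsub>M\<^esub>
      (act_assoc M A (B \<otimes> y) m \<cdot>\<^bsub>M\<^esub> (A \<rhd> act_assoc M B y m))) =
    (assoc C B A y \<lhd> m) \<cdot>\<^bsub>M\<^esub> (act_assoc M B (A \<otimes> y) m \<cdot>\<^bsub>M\<^esub> ((B \<rhd> act_assoc M A y m) \<cdot>\<^bsub>M\<^esub> sw A B (y \<odot>\<^bsub>M\<^esub> m)))"
    by (simp add: self.sw_def self.ract_def sw_def eq act_pentagon' act_pentagon_chain
      act_assoc_nat_ract[THEN act_chain])
qed (use assms in simp_all)

end

section \<open>Modules and change of scalars\<close>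

lemma structured_cat_simps [simp]:
  "Obj (structured_cat A X U P) = X" "Dom (structured_cat A X U P) = src"
  "Cod (structured_cat A X U P) = tgt" "Ide (structured_cat A X U P) x = SArr x (Ide A (U x)) x"
  "g \<cdot>\<^bsub>structured_cat A X U P\<^esub> f = SArr (src f) (und g \<cdot>\<^bsub>A\<^esub> und f) (tgt g)"
  by (simp_all add: structured_cat_def)

lemma structured_cat_Arr:
  "f \<in> Arr (structured_cat A X U P) \<longleftrightarrow> src f \<in> X \<and> tgt f \<in> X \<and> und f \<in> Arr A \<and>
     Dom A (und f) = U (src f) \<and> Cod A (und f) = U (tgt f) \<and> P (src f) (tgt f) (und f)"
  by (cases f) (auto simp: structured_cat_def in_Hom)

lemma category_structured_cat:
  assumes "category A" and "\<And>x. x \<in> X \<Longrightarrow> U x \<in> Obj A"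
    and "\<And>x. x \<in> X \<Longrightarrow> P x x (Ide A (U x))"
    and "\<And>x y z f g. x \<in> X \<Longrightarrow> y \<in> X \<Longrightarrow> z \<in> X \<Longrightarrow> f \<in> Arr A \<Longrightarrow> g \<in> Arr A \<Longrightarrow>
      Dom A f = U x \<Longrightarrow> Cod A f = U y \<Longrightarrow> Dom A g = U y \<Longrightarrow> Cod A g = U z \<Longrightarrow>
      P x y f \<Longrightarrow> P y z g \<Longrightarrow> P x z (g \<cdot>\<^bsub>A\<^esub> f)"
  shows "category (structured_cat A X U P)"
proof -
  interpret category A by fact
  show ?thesis
    by unfold_locales (auto simp: in_Hom structured_cat_Arr assms(2-3) intro: assms(4) sarr.expand)
qed

section \<open>The category of commutative monoids\<close>

context symmetric_monoidal
begin

lemma monoid_map_Ide: "comm_monoid_obj C a \<Longrightarrow> monoid_map a a (Ide C (carr a))"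
  by (simp add: monoid_map_def)

lemma monoid_map_Cmp:
  assumes f: "monoid_map a b f" and g: "monoid_map b c g"
    and [simp]: "comm_monoid_obj C a" "comm_monoid_obj C b" "comm_monoid_obj C c"
  shows "monoid_map a c (g \<cdot> f)"
proof -
  note [simp] = monoid_mapD(1-3)[OF f] monoid_mapD(1-3)[OF g]
  have "g \<cdot> (f \<cdot> mult a) = (g \<cdot> mult b) \<cdot> (f \<otimes>\<^sub>a f)"
    by (simp add: monoid_mapD(4)[OF f])
  then have "g \<cdot> (f \<cdot> mult a) = mult c \<cdot> ((g \<cdot> f) \<otimes>\<^sub>a (g \<cdot> f))"
    by (simp add: monoid_mapD(4)[OF g] ten_merge)
  then show ?thesis
    using monoid_mapD(5)[OF f] monoid_mapD(5)[OF g] by (simp add: monoid_map_def)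
qed

lemma Comm_simps [simp]:
  "Obj (Comm C) = {a. comm_monoid_obj C a}" "Dom (Comm C) = src" "Cod (Comm C) = tgt"
  "Ide (Comm C) a = SArr a (Ide C (carr a)) a" "g \<cdot>\<^bsub>Comm C\<^esub> f = SArr (src f) (und g \<cdot> und f) (tgt g)"
  by (simp_all add: Comm_def)

lemma Comm_Arr:
  "f \<in> Arr (Comm C) \<longleftrightarrow> comm_monoid_obj C (src f) \<and> comm_monoid_obj C (tgt f) \<and>
     monoid_map (src f) (tgt f) (und f)"
  by (auto simp: Comm_def structured_cat_Arr monoid_map_def)

lemma category_Comm: "category (Comm C)"
  unfolding Comm_def
  by (rule category_structured_cat[OF tensor_category])
    (use monoid_map_Ide monoid_map_Cmp in \<open>auto simp: monoid_map_def\<close>)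

end

section \<open>Module categories and restriction of scalars\<close>

context left_actegory
begin

text \<open>Modules as algebras over the monad \<open>carr a \<odot> -\<close>. The unit axiom can
  be restated with \<open>un\<close> because \<open>act_unit\<close> is invertible.\<close>

lemma module_over_iff:
  assumes "comm_monoid_obj C a"
  shows "module_over C M a X \<longleftrightarrow> mcarr X \<in> Obj M \<and> mact X \<in> Arr M \<and>
    Dom M (mact X) = carr a \<odot>\<^bsub>M\<^esub> mcarr X \<and> Cod M (mact X) = mcarr X \<and>
    mact X \<cdot>\<^bsub>M\<^esub> mul a (mcarr X) = mact X \<cdot>\<^bsub>M\<^esub> (carr a \<rhd> mact X) \<and>
    mact X \<cdot>\<^bsub>M\<^esub> un a (mcarr X) = Ide M (mcarr X)" (is "_ = ?rhs")
proof -
  have "mact X \<cdot>\<^bsub>M\<^esub> (unit a \<lhd> mcarr X) = act_unit M (mcarr X) \<longleftrightarrow> mact X \<cdot>\<^bsub>M\<^esub> un a (mcarr X) = Ide M (mcarr X)"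
    if [simp]: "mcarr X \<in> Obj M" "mact X \<in> Arr M" "Dom M (mact X) = carr a \<odot>\<^bsub>M\<^esub> mcarr X"
  proof -
    note [simp] = assms
    let ?i = "category.inv_arr M (act_unit M (mcarr X))"
    have "mact X \<cdot>\<^bsub>M\<^esub> un a (mcarr X) = (mact X \<cdot>\<^bsub>M\<^esub> (unit a \<lhd> mcarr X)) \<cdot>\<^bsub>M\<^esub> ?i"
      by (simp add: un_def)
    moreover have "mact X \<cdot>\<^bsub>M\<^esub> (unit a \<lhd> mcarr X) = (mact X \<cdot>\<^bsub>M\<^esub> un a (mcarr X)) \<cdot>\<^bsub>M\<^esub> act_unit M (mcarr X)"
      by (simp add: un_def)
    ultimately show ?thesis by (metis (no_types) category.inv_arr(5)[OF act_category]
      category.Cmp_Ide(2)[OF act_category] act_unit_simps that(1))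
  qed
  then show ?thesis
    unfolding module_over_def Let_def
    by (auto simp: in_Hom mul_def lact_def simp flip: ract_def)
qed

lemma moduleD:
  assumes "module_over C M a X" "comm_monoid_obj C a"
  shows "mcarr X \<in> Obj M" "mact X \<in> Arr M"
    "Dom M (mact X) = carr a \<odot>\<^bsub>M\<^esub> mcarr X" "Cod M (mact X) = mcarr X"
    "mact X \<cdot>\<^bsub>M\<^esub> mul a (mcarr X) = mact X \<cdot>\<^bsub>M\<^esub> (carr a \<rhd> mact X)"
    "mact X \<cdot>\<^bsub>M\<^esub> un a (mcarr X) = Ide M (mcarr X)"
  using assms by (auto simp: module_over_iff)

lemma Mod_simps [simp]:
  "Obj (Mod C M a) = {X. module_over C M a X}" "Dom (Mod C M a) = src" "Cod (Mod C M a) = tgt"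
  "Ide (Mod C M a) X = SArr X (Ide M (mcarr X)) X"
  "g \<cdot>\<^bsub>Mod C M a\<^esub> f = SArr (src f) (und g \<cdot>\<^bsub>M\<^esub> und f) (tgt g)"
  by (simp_all add: Mod_def)

lemma Mod_Arr:
  "f \<in> Arr (Mod C M a) \<longleftrightarrow> module_over C M a (src f) \<and> module_over C M a (tgt f) \<and> und f \<in> Arr M \<and>
     Dom M (und f) = mcarr (src f) \<and> Cod M (und f) = mcarr (tgt f) \<and>
     und f \<cdot>\<^bsub>M\<^esub> mact (src f) = mact (tgt f) \<cdot>\<^bsub>M\<^esub> (carr a \<rhd> und f)"
  by (auto simp: Mod_def structured_cat_Arr lact_def)

lemma category_Mod:
  assumes a [simp]: "comm_monoid_obj C a"
  shows "category (Mod C M a)"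
  unfolding Mod_def
proof (rule category_structured_cat[OF act_category], goal_cases)
  case (3 x y z f g)
  then have xyz: "module_over C M a x" "module_over C M a y" "module_over C M a z" by auto
  note [simp] = moduleD(1-4)[OF xyz(1) a] moduleD(1-4)[OF xyz(2) a] moduleD(1-4)[OF xyz(3) a] 3(4-9)
  have f: "f \<cdot>\<^bsub>M\<^esub> mact x = mact y \<cdot>\<^bsub>M\<^esub> (carr a \<rhd> f)" and g: "g \<cdot>\<^bsub>M\<^esub> mact y = mact z \<cdot>\<^bsub>M\<^esub> (carr a \<rhd> g)"
    using 3(10,11) by (simp_all add: lact_def)
  have "(g \<cdot>\<^bsub>M\<^esub> f) \<cdot>\<^bsub>M\<^esub> mact x = mact z \<cdot>\<^bsub>M\<^esub> (carr a \<rhd> (g \<cdot>\<^bsub>M\<^esub> f))"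
    by (simp add: f g[THEN act_chain])
  then show ?case unfolding lact_def .
qed (auto simp: moduleD lact_def simp flip: lact_def)

text \<open>The inverse of a linear isomorphism is linear, by inverting the square that expresses
  linearity. Isomorphisms of modules over different monoids can thus be compared in
  \<open>M\<close>.\<close>

lemma Mod_is_iso:
  assumes a [simp]: "comm_monoid_obj C a" and f: "f \<in> Arr (Mod C M a)"
  shows "is_iso (Mod C M a) f \<longleftrightarrow> is_iso M (und f)"
proof
  assume "is_iso (Mod C M a) f"
  then obtain g where "g \<in> Hom (Mod C M a) (tgt f) (src f)"
    "und g \<cdot>\<^bsub>M\<^esub> und f = Ide M (mcarr (src f))" "und f \<cdot>\<^bsub>M\<^esub> und g = Ide M (mcarr (tgt f))"
    by (auto simp: is_iso_def)
  then show "is_iso M (und f)"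
    using f by (intro category.is_isoI[OF act_category, of _ "mcarr (src f)" "mcarr (tgt f)" "und g"])
      (auto simp: in_Hom Mod_Arr)
next
  assume i: "is_iso M (und f)"
  let ?x = "src f" and ?y = "tgt f" and ?i = "category.inv_arr M (und f)"
  have xy: "module_over C M a ?x" "module_over C M a ?y" and [simp]: "und f \<in> Arr M"
    "Dom M (und f) = mcarr ?x" "Cod M (und f) = mcarr ?y" and
    l: "und f \<cdot>\<^bsub>M\<^esub> mact ?x = mact ?y \<cdot>\<^bsub>M\<^esub> (carr a \<rhd> und f)"
    using f by (auto simp: Mod_Arr)
  note [simp] = moduleD(1-4)[OF xy(1) a] moduleD(1-4)[OF xy(2) a] i
  have "category.inv_arr M (carr a \<rhd> und f) = carr a \<rhd> ?i"
    by (rule act_cancel_left[of "carr a \<rhd> und f"]) simp_all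
  then have "?i \<cdot>\<^bsub>M\<^esub> mact ?y = mact ?x \<cdot>\<^bsub>M\<^esub> (carr a \<rhd> ?i)"
    using act_inv_swap[OF l] by simp
  then have "SArr ?y ?i ?x \<in> Arr (Mod C M a)"
    using xy by (simp add: Mod_Arr)
  then show "is_iso (Mod C M a) f"
    by (intro category.is_isoI[OF category_Mod[OF a], of _ ?x ?y "SArr ?y ?i ?x"])
      (use f in \<open>auto simp: in_Hom\<close>)
qed

lemma restrict_module_simps [simp]:
  "mcarr (restrict_module M \<alpha> Y) = mcarr Y"
  "mact (restrict_module M \<alpha> Y) = mact Y \<cdot>\<^bsub>M\<^esub> (und \<alpha> \<lhd> mcarr Y)"
  by (simp_all add: restrict_module_def ract_def)

lemma restr_simps [simp]:
  "fob (restr M \<alpha>) Y = restrict_module M \<alpha> Y"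
  "far (restr M \<alpha>) f = SArr (restrict_module M \<alpha> (src f)) (und f) (restrict_module M \<alpha> (tgt f))"
  by (simp_all add: restr_def)

lemma Comm_ArrD:
  assumes "\<alpha> \<in> Arr (Comm C)"
  shows "comm_monoid_obj C (src \<alpha>)" "comm_monoid_obj C (tgt \<alpha>)" "monoid_map (src \<alpha>) (tgt \<alpha>) (und \<alpha>)"
    "und \<alpha> \<in> Arr C" "Dom C (und \<alpha>) = carr (src \<alpha>)" "Cod C (und \<alpha>) = carr (tgt \<alpha>)"
  using assms by (auto simp: Comm_Arr dest: monoid_mapD)

lemma module_restrict:
  assumes \<alpha>: "\<alpha> \<in> Arr (Comm C)" and Y: "module_over C M (tgt \<alpha>) Y"
  shows "module_over C M (src \<alpha>) (restrict_module M \<alpha> Y)"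
proof -
  note [simp] = Comm_ArrD[OF \<alpha>] moduleD[OF Y Comm_ArrD(2)[OF \<alpha>]]
  let ?y = "mcarr Y" and ?r = "mact Y"
  have "?r \<cdot>\<^bsub>M\<^esub> ((und \<alpha> \<lhd> ?y) \<cdot>\<^bsub>M\<^esub> mul (src \<alpha>) ?y) =
    (?r \<cdot>\<^bsub>M\<^esub> mul (tgt \<alpha>) ?y) \<cdot>\<^bsub>M\<^esub> ((carr (tgt \<alpha>) \<rhd> (und \<alpha> \<lhd> ?y)) \<cdot>\<^bsub>M\<^esub> (und \<alpha> \<lhd> (carr (src \<alpha>) \<odot>\<^bsub>M\<^esub> ?y)))"
    by (simp add: ract_mul[of "src \<alpha>" "tgt \<alpha>"] del: moduleD(5)[OF Y Comm_ArrD(2)[OF \<alpha>]])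
  also have "\<dots> = ?r \<cdot>\<^bsub>M\<^esub> ((und \<alpha> \<lhd> ?y) \<cdot>\<^bsub>M\<^esub> (carr (src \<alpha>) \<rhd> (?r \<cdot>\<^bsub>M\<^esub> (und \<alpha> \<lhd> ?y))))"
    by (simp add: ract_lact ract_lact[THEN act_chain])
  finally show ?thesis
    by (simp add: module_over_iff ract_un[of "src \<alpha>" "tgt \<alpha>"])
qed

lemma cat_functor_restr:
  assumes \<alpha>: "\<alpha> \<in> Arr (Comm C)"
  shows "cat_functor (Mod C M (tgt \<alpha>)) (Mod C M (src \<alpha>)) (restr M \<alpha>)"
proof (rule cat_functorI)
  note [simp] = Comm_ArrD[OF \<alpha>]
  fix f assume f: "f \<in> Arr (Mod C M (tgt \<alpha>))"
  then have xy: "module_over C M (tgt \<alpha>) (src f)" "module_over C M (tgt \<alpha>) (tgt f)" and [simp]: "und f \<in> Arr M"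
    "Dom M (und f) = mcarr (src f)" "Cod M (und f) = mcarr (tgt f)" and
    l: "und f \<cdot>\<^bsub>M\<^esub> mact (src f) = mact (tgt f) \<cdot>\<^bsub>M\<^esub> (carr (tgt \<alpha>) \<rhd> und f)"
    by (auto simp: Mod_Arr)
  note [simp] = moduleD(1-4)[OF xy(1) Comm_ArrD(2)[OF \<alpha>]] moduleD(1-4)[OF xy(2) Comm_ArrD(2)[OF \<alpha>]]
  have "und f \<cdot>\<^bsub>M\<^esub> (mact (src f) \<cdot>\<^bsub>M\<^esub> (und \<alpha> \<lhd> mcarr (src f))) =
    mact (tgt f) \<cdot>\<^bsub>M\<^esub> ((und \<alpha> \<lhd> mcarr (tgt f)) \<cdot>\<^bsub>M\<^esub> (carr (src \<alpha>) \<rhd> und f))"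
    by (simp add: l[THEN act_chain] ract_lact)
  then show "far (restr M \<alpha>) f \<in> Hom (Mod C M (src \<alpha>)) (fob (restr M \<alpha>) (Dom (Mod C M (tgt \<alpha>)) f))
       (fob (restr M \<alpha>) (Cod (Mod C M (tgt \<alpha>)) f))"
    using xy by (simp add: in_Hom Mod_Arr module_restrict[OF \<alpha>])
qed (use \<alpha> in \<open>auto simp: category_Mod Comm_ArrD module_restrict\<close>)

text \<open>An equality of modules and not merely an isomorphism: restrictions can be replaced
  literally, so that left adjoints are identified later without coherence data.\<close>

lemma restrict_module_Cmp:
  assumes \<alpha>: "\<alpha> \<in> Arr (Comm C)" and \<beta>: "\<beta> \<in> Arr (Comm C)" and "tgt \<alpha> = src \<beta>"
    and Y: "module_over C M (tgt \<beta>) Y"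
  shows "restrict_module M \<alpha> (restrict_module M \<beta> Y) = restrict_module M (SArr (src \<alpha>) (und \<beta> \<cdot> und \<alpha>) (tgt \<beta>)) Y"
proof -
  note [simp] = Comm_ArrD[OF \<alpha>] Comm_ArrD[OF \<beta>] moduleD[OF Y Comm_ArrD(2)[OF \<beta>]]
  show ?thesis
    by (rule module_obj.equality) (simp_all add: assms(3))
qed

text \<open>\<open>t\<close> is the transpose of \<open>u\<close>, its candidate extension to the
  free module. The conclusions say that it descends to the extension of scalars, that it is linear
  over \<open>tgt \<alpha>\<close> for the free action, and that it restricts to \<open>u\<close>
  along the unit.\<close>

lemma linear_coequalizes:
  assumes \<alpha>: "\<alpha> \<in> Arr (Comm C)" and X: "module_over C M (src \<alpha>) X" and Y: "module_over C M (tgt \<alpha>) Y"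
    and u [simp]: "u \<in> Arr M" "Dom M u = mcarr X" "Cod M u = mcarr Y"
    and lin: "u \<cdot>\<^bsub>M\<^esub> mact X = mact Y \<cdot>\<^bsub>M\<^esub> ((und \<alpha> \<lhd> mcarr Y) \<cdot>\<^bsub>M\<^esub> (carr (src \<alpha>) \<rhd> u))"
  defines "t \<equiv> mact Y \<cdot>\<^bsub>M\<^esub> (carr (tgt \<alpha>) \<rhd> u)"
  shows "t \<cdot>\<^bsub>M\<^esub> (carr (tgt \<alpha>) \<rhd> mact X) =
    t \<cdot>\<^bsub>M\<^esub> (mul (tgt \<alpha>) (mcarr X) \<cdot>\<^bsub>M\<^esub> (carr (tgt \<alpha>) \<rhd> (und \<alpha> \<lhd> mcarr X)))"
    and "t \<cdot>\<^bsub>M\<^esub> mul (tgt \<alpha>) (mcarr X) = mact Y \<cdot>\<^bsub>M\<^esub> (carr (tgt \<alpha>) \<rhd> t)"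
    and "t \<cdot>\<^bsub>M\<^esub> un (tgt \<alpha>) (mcarr X) = u"
proof -
  let ?a = "src \<alpha>" and ?b = "tgt \<alpha>" and ?f = "und \<alpha>" and ?n = "mcarr X" and ?w = "mcarr Y"
  note [simp] = Comm_ArrD[OF \<alpha>] moduleD(1-4)[OF X Comm_ArrD(1)[OF \<alpha>]] moduleD(1-4)[OF Y Comm_ArrD(2)[OF \<alpha>]]
  note Y' = moduleD(5-6)[OF Y Comm_ArrD(2)[OF \<alpha>]]
  have [simp]: "t \<in> Arr M" "Dom M t = carr ?b \<odot>\<^bsub>M\<^esub> ?n" "Cod M t = ?w" by (simp_all add: t_def)
  have m: "(carr ?b \<rhd> u) \<cdot>\<^bsub>M\<^esub> mul ?b ?n = mul ?b ?w \<cdot>\<^bsub>M\<^esub> (carr ?b \<rhd> (carr ?b \<rhd> u))"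
    by (simp add: mul_nat)
  have n: "(carr ?b \<rhd> u) \<cdot>\<^bsub>M\<^esub> un ?b ?n = un ?b ?w \<cdot>\<^bsub>M\<^esub> u"
    by (simp add: un_nat)
  show 1: "t \<cdot>\<^bsub>M\<^esub> mul ?b ?n = mact Y \<cdot>\<^bsub>M\<^esub> (carr ?b \<rhd> t)"
    by (simp add: t_def m Y'[THEN act_chain])
  have "t \<cdot>\<^bsub>M\<^esub> (carr ?b \<rhd> mact X) = mact Y \<cdot>\<^bsub>M\<^esub> (carr ?b \<rhd> (u \<cdot>\<^bsub>M\<^esub> mact X))"
    by (simp add: t_def)
  also have "\<dots> = mact Y \<cdot>\<^bsub>M\<^esub> (carr ?b \<rhd> (t \<cdot>\<^bsub>M\<^esub> (?f \<lhd> ?n)))"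
    unfolding lin t_def by (simp only: ract_lact u(1-3) Comm_ArrD[OF \<alpha>]) (simp add: ract_lact)
  also have "\<dots> = (t \<cdot>\<^bsub>M\<^esub> mul ?b ?n) \<cdot>\<^bsub>M\<^esub> (carr ?b \<rhd> (?f \<lhd> ?n))"
    unfolding 1 by simp
  finally show "t \<cdot>\<^bsub>M\<^esub> (carr ?b \<rhd> mact X) = t \<cdot>\<^bsub>M\<^esub> (mul ?b ?n \<cdot>\<^bsub>M\<^esub> (carr ?b \<rhd> (?f \<lhd> ?n)))"
    by simp
  show "t \<cdot>\<^bsub>M\<^esub> un ?b ?n = u"
    by (simp add: t_def n Y'[THEN act_chain])
qed

end

text \<open>The form in which cocompleteness and preservation of colimits enter the theory of
  modules: extensions of scalars are constructed as coequalizers, and both whiskerings carry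
  coequalizers to coequalizers.\<close>

locale coeq_actegory = left_actegory C M
  for C :: "('o, 'a, 'y) smcat_scheme" (structure)
    and M :: "('o, 'a, 'm, 'n, 'z) actegory_scheme" (structure) +
  assumes coeq_ex: "f \<in> Arr M \<Longrightarrow> g \<in> Arr M \<Longrightarrow> Dom M f = Dom M g \<Longrightarrow> Cod M f = Cod M g \<Longrightarrow> \<exists>q. is_coeq M f g q"
    and lact_coeq: "A \<in> Obj C \<Longrightarrow> is_coeq M f g q \<Longrightarrow> is_coeq M (A \<rhd> f) (A \<rhd> g) (A \<rhd> q)"
    and ract_coeq: "m \<in> Obj M \<Longrightarrow> is_coeq C s t r \<Longrightarrow> is_coeq M (s \<lhd> m) (t \<lhd> m) (r \<lhd> m)"
begin

lemmas act_coeq_epi = category.is_coeq_epi[OF act_category]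
lemmas act_epiD = category.epiD[OF act_category]

text \<open>For \<open>\<alpha> : a \<rightarrow> b\<close> and an \<open>a\<close>-module \<open>X\<close> on \<open>n\<close>, the coequalizer \<open>q : b \<odot> n \<rightarrow> b \<odot>\<^sub>a n\<close> that presents
  the extension of scalars.\<close>

definition ext_pair where
  "ext_pair \<alpha> X q \<longleftrightarrow> is_coeq M (carr (tgt \<alpha>) \<rhd> mact X)
     (mul (tgt \<alpha>) (mcarr X) \<cdot>\<^bsub>M\<^esub> (carr (tgt \<alpha>) \<rhd> (und \<alpha> \<lhd> mcarr X))) q"

text \<open>A recognition criterion that applies to the extension constructed below and equally to a
  module that arises otherwise, as in base change. The transpose of a given \<open>g\<close> factors
  through the coequalizer \<open>p\<close>, and linearity of the factor \<open>h\<close> is tested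
  after the epimorphism \<open>carr ?b \<rhd> p\<close>.\<close>

lemma universal_arrow_ext:
  assumes \<alpha>: "\<alpha> \<in> Arr (Comm C)" and X: "module_over C M (src \<alpha>) X" and Z: "module_over C M (tgt \<alpha>) Z"
    and e: "e \<in> Arr M" "Dom M e = mcarr X" "Cod M e = mcarr Z"
    and lin: "e \<cdot>\<^bsub>M\<^esub> mact X = mact Z \<cdot>\<^bsub>M\<^esub> ((und \<alpha> \<lhd> mcarr Z) \<cdot>\<^bsub>M\<^esub> (carr (src \<alpha>) \<rhd> e))"
    and q: "ext_pair \<alpha> X (mact Z \<cdot>\<^bsub>M\<^esub> (carr (tgt \<alpha>) \<rhd> e))"
  shows "universal_arrow (Mod C M (src \<alpha>)) (Mod C M (tgt \<alpha>)) (restr M \<alpha>) X Z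
    (SArr X e (restrict_module M \<alpha> Z))"
  unfolding universal_arrow_def
proof (intro conjI ballI)
  let ?a = "src \<alpha>" and ?b = "tgt \<alpha>" and ?f = "und \<alpha>" and ?n = "mcarr X" and ?z = "mcarr Z"
  define p where "p = mact Z \<cdot>\<^bsub>M\<^esub> (carr ?b \<rhd> e)"
  note C [simp] = Comm_ArrD[OF \<alpha>]
  note [simp] = moduleD(1-4)[OF X C(1)] moduleD(1-4)[OF Z C(2)] e
  note q = q[unfolded ext_pair_def, folded p_def]
  have [simp]: "p \<in> Arr M" "Dom M p = carr ?b \<odot>\<^bsub>M\<^esub> ?n" "Cod M p = ?z" by (simp_all add: p_def)
  note pl = linear_coequalizes[OF \<alpha> X Z e lin, folded p_def]
  show "Z \<in> Obj (Mod C M ?b)" using Z by simp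
  show "SArr X e (restrict_module M \<alpha> Z) \<in> Hom (Mod C M ?a) X (fob (restr M \<alpha>) Z)"
    using X Z \<alpha> lin by (simp add: in_Hom Mod_Arr module_restrict)
  fix Y g assume Y0: "Y \<in> Obj (Mod C M ?b)" and g: "g \<in> Hom (Mod C M ?a) X (fob (restr M \<alpha>) Y)"
  then have Y: "module_over C M ?b Y" by simp
  note [simp] = moduleD(1-4)[OF Y C(2)]
  define u where "u = und g"
  have g': "g = SArr X u (restrict_module M \<alpha> Y)" and u [simp]: "u \<in> Arr M" "Dom M u = ?n" "Cod M u = mcarr Y"
    and ul: "u \<cdot>\<^bsub>M\<^esub> mact X = mact Y \<cdot>\<^bsub>M\<^esub> ((?f \<lhd> mcarr Y) \<cdot>\<^bsub>M\<^esub> (carr ?a \<rhd> u))"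
    using g by (auto simp: in_Hom Mod_Arr u_def intro: sarr.expand)
  define t where "t = mact Y \<cdot>\<^bsub>M\<^esub> (carr ?b \<rhd> u)"
  have [simp]: "t \<in> Arr M" "Dom M t = carr ?b \<odot>\<^bsub>M\<^esub> ?n" "Cod M t = mcarr Y" by (simp_all add: t_def)
  note tl = linear_coequalizes[OF \<alpha> X Y u ul, folded t_def]
  obtain h where h [simp]: "h \<in> Arr M" "Dom M h = ?z" "Cod M h = mcarr Y" and hp: "h \<cdot>\<^bsub>M\<^esub> p = t"
    by (rule is_coeq_ex[OF q _ _ tl(1)]) auto
  have "h \<cdot>\<^bsub>M\<^esub> mact Z = mact Y \<cdot>\<^bsub>M\<^esub> (carr ?b \<rhd> h)"
  proof (rule act_epiD[OF act_coeq_epi[OF lact_coeq[OF _ q]]])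
    have "(h \<cdot>\<^bsub>M\<^esub> mact Z) \<cdot>\<^bsub>M\<^esub> (carr ?b \<rhd> p) = h \<cdot>\<^bsub>M\<^esub> (mact Z \<cdot>\<^bsub>M\<^esub> (carr ?b \<rhd> p))" by simp
    also have "\<dots> = (h \<cdot>\<^bsub>M\<^esub> p) \<cdot>\<^bsub>M\<^esub> mul ?b ?n" by (simp flip: pl(2))
    also have "\<dots> = mact Y \<cdot>\<^bsub>M\<^esub> (carr ?b \<rhd> (h \<cdot>\<^bsub>M\<^esub> p))" unfolding hp by (rule tl(2))
    finally show "(h \<cdot>\<^bsub>M\<^esub> mact Z) \<cdot>\<^bsub>M\<^esub> (carr ?b \<rhd> p) = (mact Y \<cdot>\<^bsub>M\<^esub> (carr ?b \<rhd> h)) \<cdot>\<^bsub>M\<^esub> (carr ?b \<rhd> p)"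
      by simp
  qed simp_all
  then have hl: "SArr Z h Y \<in> Hom (Mod C M ?b) Z Y" using Z Y by (simp add: in_Hom Mod_Arr)
  have "(h \<cdot>\<^bsub>M\<^esub> p) \<cdot>\<^bsub>M\<^esub> un ?b ?n = h \<cdot>\<^bsub>M\<^esub> e" using pl(3) by simp
  then have he: "h \<cdot>\<^bsub>M\<^esub> e = u" unfolding hp tl(3) ..
  show "\<exists>!h. h \<in> Hom (Mod C M ?b) Z Y \<and>
     far (restr M \<alpha>) h \<cdot>\<^bsub>Mod C M ?a\<^esub> SArr X e (restrict_module M \<alpha> Z) = g"
  proof (intro ex1I[of _ "SArr Z h Y"] conjI)
    fix k assume k: "k \<in> Hom (Mod C M ?b) Z Y \<and>
     far (restr M \<alpha>) k \<cdot>\<^bsub>Mod C M ?a\<^esub> SArr X e (restrict_module M \<alpha> Z) = g"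
    then have [simp]: "und k \<in> Arr M" "Dom M (und k) = ?z" "Cod M (und k) = mcarr Y" and
      k': "src k = Z" "tgt k = Y" "und k \<cdot>\<^bsub>M\<^esub> mact Z = mact Y \<cdot>\<^bsub>M\<^esub> (carr ?b \<rhd> und k)" "und k \<cdot>\<^bsub>M\<^esub> e = u"
      by (auto simp: in_Hom Mod_Arr g')
    have "und k \<cdot>\<^bsub>M\<^esub> p = mact Y \<cdot>\<^bsub>M\<^esub> (carr ?b \<rhd> (und k \<cdot>\<^bsub>M\<^esub> e))"
      by (simp add: p_def k'(3)[THEN act_chain])
    then have "und k \<cdot>\<^bsub>M\<^esub> p = h \<cdot>\<^bsub>M\<^esub> p" unfolding k'(4) hp t_def .
    then have "und k = h" by (rule act_epiD[OF act_coeq_epi[OF q], rotated -1]) simp_all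
    then show "k = SArr Z h Y" using k' by (intro sarr.expand) simp
  qed (use hl he in \<open>auto simp: g'\<close>)
qed

text \<open>The action \<tau> on the quotient exists because \<open>?B \<rhd> q\<close> is still a
  coequalizer, and its axioms are checked after precomposing with whiskered copies of
  \<open>q\<close>. The unit is \<open>q\<close> after \<open>un\<close>, and its transpose is
  \<open>q\<close> again.\<close>

lemma ext_ex:
  assumes \<alpha>: "\<alpha> \<in> Arr (Comm C)" and X: "module_over C M (src \<alpha>) X"
  obtains Z e where "module_over C M (tgt \<alpha>) Z" "e \<in> Arr M" "Dom M e = mcarr X" "Cod M e = mcarr Z"
    "e \<cdot>\<^bsub>M\<^esub> mact X = mact Z \<cdot>\<^bsub>M\<^esub> ((und \<alpha> \<lhd> mcarr Z) \<cdot>\<^bsub>M\<^esub> (carr (src \<alpha>) \<rhd> e))"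
    "ext_pair \<alpha> X (mact Z \<cdot>\<^bsub>M\<^esub> (carr (tgt \<alpha>) \<rhd> e))"
proof -
  let ?a = "src \<alpha>" and ?b = "tgt \<alpha>" and ?f = "und \<alpha>" and ?n = "mcarr X"
  let ?A = "carr ?a" and ?B = "carr ?b"
  note C [simp] = Comm_ArrD[OF \<alpha>]
  note [simp] = moduleD(1-4)[OF X C(1)]
  obtain q where q: "ext_pair \<alpha> X q"
    using coeq_ex[of "?B \<rhd> mact X" "mul ?b ?n \<cdot>\<^bsub>M\<^esub> (?B \<rhd> (?f \<lhd> ?n))"] unfolding ext_pair_def by auto
  note q' = q[unfolded ext_pair_def]
  have [simp]: "q \<in> Arr M" "Dom M q = ?B \<odot>\<^bsub>M\<^esub> ?n" using is_coeqD[OF q'] by simp_all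
  define z where "z = Cod M q"
  have [simp]: "z \<in> Obj M" "Cod M q = z" by (simp_all add: z_def)
  note q1 = is_coeqD(7)[OF q']
  note q2 = lact_coeq[OF _ q', of ?B] note q3 = lact_coeq[OF _ q2, of ?B]
  have "(q \<cdot>\<^bsub>M\<^esub> mul ?b ?n) \<cdot>\<^bsub>M\<^esub> (?B \<rhd> (?B \<rhd> mact X)) = (q \<cdot>\<^bsub>M\<^esub> (?B \<rhd> mact X)) \<cdot>\<^bsub>M\<^esub> mul ?b (?A \<odot>\<^bsub>M\<^esub> ?n)"
    by (simp add: mul_nat)
  also have "\<dots> = q \<cdot>\<^bsub>M\<^esub> (mul ?b ?n \<cdot>\<^bsub>M\<^esub> ((?B \<rhd> (?f \<lhd> ?n)) \<cdot>\<^bsub>M\<^esub> mul ?b (?A \<odot>\<^bsub>M\<^esub> ?n)))"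
    unfolding q1 by simp
  also have "\<dots> = (q \<cdot>\<^bsub>M\<^esub> mul ?b ?n) \<cdot>\<^bsub>M\<^esub> (?B \<rhd> (mul ?b ?n \<cdot>\<^bsub>M\<^esub> (?B \<rhd> (?f \<lhd> ?n))))"
    by (simp add: mul_assoc[THEN act_chain] mul_nat)
  finally have eq: "(q \<cdot>\<^bsub>M\<^esub> mul ?b ?n) \<cdot>\<^bsub>M\<^esub> (?B \<rhd> (?B \<rhd> mact X)) = (q \<cdot>\<^bsub>M\<^esub> mul ?b ?n) \<cdot>\<^bsub>M\<^esub> (?B \<rhd> (mul ?b ?n \<cdot>\<^bsub>M\<^esub> (?B \<rhd> (?f \<lhd> ?n))))" .
  obtain \<tau> where [simp]: "\<tau> \<in> Arr M" "Dom M \<tau> = ?B \<odot>\<^bsub>M\<^esub> z" "Cod M \<tau> = z" and \<tau>: "\<tau> \<cdot>\<^bsub>M\<^esub> (?B \<rhd> q) = q \<cdot>\<^bsub>M\<^esub> mul ?b ?n"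
    by (rule is_coeq_ex[OF q2 _ _ eq]) auto
  let ?Z = "\<lparr>mcarr = z, mact = \<tau>\<rparr>" and ?e = "q \<cdot>\<^bsub>M\<^esub> un ?b ?n"
  have "\<tau> \<cdot>\<^bsub>M\<^esub> mul ?b z = \<tau> \<cdot>\<^bsub>M\<^esub> (?B \<rhd> \<tau>)"
  proof (rule act_epiD[OF act_coeq_epi[OF q3]])
    have "(\<tau> \<cdot>\<^bsub>M\<^esub> (?B \<rhd> \<tau>)) \<cdot>\<^bsub>M\<^esub> (?B \<rhd> (?B \<rhd> q)) = \<tau> \<cdot>\<^bsub>M\<^esub> (?B \<rhd> (\<tau> \<cdot>\<^bsub>M\<^esub> (?B \<rhd> q)))" by simp
    also have "\<dots> = (\<tau> \<cdot>\<^bsub>M\<^esub> mul ?b z) \<cdot>\<^bsub>M\<^esub> (?B \<rhd> (?B \<rhd> q))"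
      unfolding \<tau> by (simp add: mul_nat mul_assoc \<tau>[THEN act_chain])
    finally show "(\<tau> \<cdot>\<^bsub>M\<^esub> mul ?b z) \<cdot>\<^bsub>M\<^esub> (?B \<rhd> (?B \<rhd> q)) = (\<tau> \<cdot>\<^bsub>M\<^esub> (?B \<rhd> \<tau>)) \<cdot>\<^bsub>M\<^esub> (?B \<rhd> (?B \<rhd> q))" ..
  qed simp_all
  moreover have "\<tau> \<cdot>\<^bsub>M\<^esub> un ?b z = Ide M z"
    by (rule act_epiD[OF act_coeq_epi[OF q']]) (simp_all add: un_nat \<tau>[THEN act_chain] mul_un_left)
  ultimately have Z: "module_over C M ?b ?Z"
    by (simp add: module_over_iff)
  have p: "\<tau> \<cdot>\<^bsub>M\<^esub> (?B \<rhd> ?e) = q"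
    by (simp add: \<tau>[THEN act_chain] mul_un_right)
  have "?e \<cdot>\<^bsub>M\<^esub> mact X = (q \<cdot>\<^bsub>M\<^esub> (?B \<rhd> mact X)) \<cdot>\<^bsub>M\<^esub> un ?b (?A \<odot>\<^bsub>M\<^esub> ?n)"
    by (simp add: un_nat)
  also have "\<dots> = q \<cdot>\<^bsub>M\<^esub> (mul ?b ?n \<cdot>\<^bsub>M\<^esub> (un ?b (?B \<odot>\<^bsub>M\<^esub> ?n) \<cdot>\<^bsub>M\<^esub> (?f \<lhd> ?n)))"
    unfolding q1 by (simp add: un_nat)
  also have "\<dots> = q \<cdot>\<^bsub>M\<^esub> (?f \<lhd> ?n)"
    by (simp add: mul_un_left[THEN act_chain])
  also have "\<dots> = (\<tau> \<cdot>\<^bsub>M\<^esub> (?B \<rhd> ?e)) \<cdot>\<^bsub>M\<^esub> (?f \<lhd> ?n)" unfolding p ..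
  also have "\<dots> = \<tau> \<cdot>\<^bsub>M\<^esub> ((?f \<lhd> z) \<cdot>\<^bsub>M\<^esub> (?A \<rhd> ?e))"
    by (simp add: ract_lact ract_lact[THEN act_chain])
  finally show ?thesis
    using that[OF Z, of ?e] p q by simp
qed

text \<open>Justifies the choice made in \<open>ext\<close>; afterwards only its universal property
  is used.\<close>

lemma left_adjoint_ext:
  assumes \<alpha>: "\<alpha> \<in> Arr (Comm C)"
  shows "left_adjoint (Mod C M (src \<alpha>)) (Mod C M (tgt \<alpha>)) (ext C M \<alpha>) (restr M \<alpha>)"
  unfolding ext_def
proof (rule someI_ex, rule left_adjoint_ex[OF cat_functor_restr[OF \<alpha>]])
  fix X assume "X \<in> Obj (Mod C M (src \<alpha>))"
  then have X: "module_over C M (src \<alpha>) X" by simp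
  show "\<exists>Z \<eta>. universal_arrow (Mod C M (src \<alpha>)) (Mod C M (tgt \<alpha>)) (restr M \<alpha>) X Z \<eta>"
    by (rule ext_ex[OF \<alpha> X]) (use universal_arrow_ext[OF \<alpha> X] in blast)
qed

lemma ext_unit:
  assumes "\<alpha> \<in> Arr (Comm C)"
  obtains \<theta> where
    "adj_unit (Mod C M (src \<alpha>)) (Mod C M (src \<alpha>)) (Mod C M (tgt \<alpha>)) id_functr (ext C M \<alpha>) (restr M \<alpha>) \<theta>"
  using adj_unit_ex[OF left_adjoint_ext[OF assms]] .

text \<open>Universal arrows are unique up to isomorphism, so the presentation by a coequalizer
  holds for every one of them, in particular for the unit of the chosen \<open>ext\<close>.\<close>

lemma universal_arrow_ext_pair:
  assumes \<alpha>: "\<alpha> \<in> Arr (Comm C)" and u: "universal_arrow (Mod C M (src \<alpha>)) (Mod C M (tgt \<alpha>)) (restr M \<alpha>) X Z \<eta>"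
    and X: "module_over C M (src \<alpha>) X"
  shows "ext_pair \<alpha> X (mact Z \<cdot>\<^bsub>M\<^esub> (carr (tgt \<alpha>) \<rhd> und \<eta>))"
proof -
  obtain Z0 e0 where Z0: "module_over C M (tgt \<alpha>) Z0" "e0 \<in> Arr M" "Dom M e0 = mcarr X" "Cod M e0 = mcarr Z0"
    "e0 \<cdot>\<^bsub>M\<^esub> mact X = mact Z0 \<cdot>\<^bsub>M\<^esub> ((und \<alpha> \<lhd> mcarr Z0) \<cdot>\<^bsub>M\<^esub> (carr (src \<alpha>) \<rhd> e0))"
    and q: "ext_pair \<alpha> X (mact Z0 \<cdot>\<^bsub>M\<^esub> (carr (tgt \<alpha>) \<rhd> e0))"
    by (rule ext_ex[OF \<alpha> X])
  note C [simp] = Comm_ArrD[OF \<alpha>]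
  note [simp] = moduleD(1-4)[OF X C(1)] moduleD(1-4)[OF Z0(1) C(2)] Z0(2-4)
  obtain i where i: "is_iso (Mod C M (tgt \<alpha>)) i" "src i = Z0" "tgt i = Z"
    "far (restr M \<alpha>) i \<cdot>\<^bsub>Mod C M (src \<alpha>)\<^esub> SArr X e0 (restrict_module M \<alpha> Z0) = \<eta>"
    by (rule universal_arrows_iso[OF universal_arrow_ext[OF \<alpha> X Z0 q] u cat_functor_restr[OF \<alpha>]]) auto
  have iA: "i \<in> Arr (Mod C M (tgt \<alpha>))" using i(1) by (simp add: is_iso_def)
  then have [simp]: "und i \<in> Arr M" "Dom M (und i) = mcarr Z0" "Cod M (und i) = mcarr Z"
    and il: "und i \<cdot>\<^bsub>M\<^esub> mact Z0 = mact Z \<cdot>\<^bsub>M\<^esub> (carr (tgt \<alpha>) \<rhd> und i)" and Z: "module_over C M (tgt \<alpha>) Z"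
    using i(2,3) by (auto simp: Mod_Arr)
  note [simp] = moduleD(1-4)[OF Z C(2)]
  have e: "und \<eta> = und i \<cdot>\<^bsub>M\<^esub> e0" using i(4) by auto
  have "is_iso M (und i)" using i(1) Mod_is_iso[OF C(2) iA] by simp
  then have "ext_pair \<alpha> X (und i \<cdot>\<^bsub>M\<^esub> (mact Z0 \<cdot>\<^bsub>M\<^esub> (carr (tgt \<alpha>) \<rhd> e0)))"
    using q unfolding ext_pair_def by (rule_tac category.is_coeq_post_iso[OF act_category]) simp_all
  then show ?thesis by (simp add: e il[THEN act_chain])
qed

end

section \<open>Base change\<close>

context coeq_actegory
begin

text \<open>The arrow \<open>b \<odot> (d \<odot> m) \<rightarrow> e \<odot> m\<close> induced by \<open>\<gamma>' : b \<rightarrow> e\<close> and \<open>\<beta> : d \<rightarrow> e\<close>.\<close>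

definition cospan_act where
  "cospan_act \<gamma>' \<beta> m = mul (tgt \<beta>) m \<cdot>\<^bsub>M\<^esub>
     ((und \<gamma>' \<lhd> (carr (tgt \<beta>) \<odot>\<^bsub>M\<^esub> m)) \<cdot>\<^bsub>M\<^esub> (carr (src \<gamma>') \<rhd> (und \<beta> \<lhd> m)))"

text \<open>The square \<open>\<gamma>' \<alpha> = \<beta> \<gamma>\<close> exhibits \<open>e \<odot> m\<close> as the extension of scalars of \<open>d \<odot> m\<close> along \<open>\<alpha>\<close>.\<close>

definition base_change_square where
  "base_change_square \<alpha> \<gamma> \<gamma>' \<beta> \<longleftrightarrow>
     \<alpha> \<in> Arr (Comm C) \<and> \<gamma> \<in> Arr (Comm C) \<and> \<gamma>' \<in> Arr (Comm C) \<and> \<beta> \<in> Arr (Comm C) \<and>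
     src \<gamma> = src \<alpha> \<and> src \<gamma>' = tgt \<alpha> \<and> src \<beta> = tgt \<gamma> \<and> tgt \<gamma>' = tgt \<beta> \<and>
     und \<gamma>' \<cdot> und \<alpha> = und \<beta> \<cdot> und \<gamma> \<and>
     (\<forall>m \<in> Obj M. ext_pair \<alpha> \<lparr>mcarr = carr (tgt \<gamma>) \<odot>\<^bsub>M\<^esub> m,
         mact = mul (tgt \<gamma>) m \<cdot>\<^bsub>M\<^esub> (und \<gamma> \<lhd> (carr (tgt \<gamma>) \<odot>\<^bsub>M\<^esub> m))\<rparr> (cospan_act \<gamma>' \<beta> m))"

text \<open>No action of \<open>d\<close> on \<open>b \<odot>\<^sub>a n\<close> has to be constructed: \<open>e \<odot>\<^sub>d n\<close> itself, restricted to \<open>b\<close>, turns out to be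
  the coequalizer presenting \<open>b \<odot>\<^sub>a n\<close>.\<close>

lemma base_change_ext_pair:
  assumes sq: "base_change_square \<alpha> \<gamma> \<gamma>' \<beta>"
    and X: "module_over C M (tgt \<gamma>) X" and Z: "module_over C M (tgt \<beta>) Z"
    and e: "e \<in> Arr M" "Dom M e = mcarr X" "Cod M e = mcarr Z"
    and lin: "e \<cdot>\<^bsub>M\<^esub> mact X = mact Z \<cdot>\<^bsub>M\<^esub> ((und \<beta> \<lhd> mcarr Z) \<cdot>\<^bsub>M\<^esub> (carr (tgt \<gamma>) \<rhd> e))"
    and q: "ext_pair \<beta> X (mact Z \<cdot>\<^bsub>M\<^esub> (carr (tgt \<beta>) \<rhd> e))"
  shows "ext_pair \<alpha> (restrict_module M \<gamma> X) (mact Z \<cdot>\<^bsub>M\<^esub> ((und \<gamma>' \<lhd> mcarr Z) \<cdot>\<^bsub>M\<^esub> (carr (tgt \<alpha>) \<rhd> e)))"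
proof -
  have sq': "\<alpha> \<in> Arr (Comm C)" "\<gamma> \<in> Arr (Comm C)" "\<gamma>' \<in> Arr (Comm C)" "\<beta> \<in> Arr (Comm C)"
    and s [simp]: "src \<gamma> = src \<alpha>" "src \<gamma>' = tgt \<alpha>" "src \<beta> = tgt \<gamma>" "tgt \<gamma>' = tgt \<beta>"
    and comm: "und \<gamma>' \<cdot> und \<alpha> = und \<beta> \<cdot> und \<gamma>"
    using sq by (auto simp: base_change_square_def)
  define a b d c where abdc: "a = src \<alpha>" "b = tgt \<alpha>" "d = tgt \<gamma>" "c = tgt \<beta>"
  define f g g' h where fg: "f = und \<alpha>" "g = und \<gamma>" "g' = und \<gamma>'" "h = und \<beta>"
  note mon = Comm_ArrD(1-3)[OF sq'(1), folded abdc fg] Comm_ArrD(1-3)[OF sq'(2), unfolded s, folded abdc fg]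
    Comm_ArrD(1-3)[OF sq'(3), unfolded s, folded abdc fg] Comm_ArrD(1-3)[OF sq'(4), unfolded s, folded abdc fg]
  note [simp] = mon(1,2,5,8) monoid_mapD(1-3)[OF mon(3)] monoid_mapD(1-3)[OF mon(6)]
    monoid_mapD(1-3)[OF mon(9)] monoid_mapD(1-3)[OF mon(12)]
  let ?B = "carr b" and ?A = "carr a" and ?D = "carr d" and ?E = "carr c"
  note X = X[folded abdc] note Z = Z[folded abdc]
  define n z \<rho> \<tau> where nz: "n = mcarr X" "z = mcarr Z" "\<rho> = mact X" "\<tau> = mact Z"
  note X' [simp] = moduleD(1-4)[OF X mon(5), folded nz] and Z' [simp] = moduleD(1-4)[OF Z mon(8), folded nz]
  note Xl = moduleD(5,6)[OF X mon(5), folded nz] and Zl = moduleD(5,6)[OF Z mon(8), folded nz]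
  note [simp] = e[folded nz]
  note lin = lin[folded nz abdc fg]
  \<comment> \<open>This is \<open>cospan_act\<close>, which the square makes a coequalizer for
    every \<open>m\<close>. It is used at \<open>n\<close> and at
    \<open>?D \<odot> n\<close>.\<close>
  define k where "k m = mul c m \<cdot>\<^bsub>M\<^esub> ((g' \<lhd> (?E \<odot>\<^bsub>M\<^esub> m)) \<cdot>\<^bsub>M\<^esub> (?B \<rhd> (h \<lhd> m)))" for m
  have k: "is_coeq M (?B \<rhd> (mul d m \<cdot>\<^bsub>M\<^esub> (g \<lhd> (?D \<odot>\<^bsub>M\<^esub> m))))
      (mul b (?D \<odot>\<^bsub>M\<^esub> m) \<cdot>\<^bsub>M\<^esub> (?B \<rhd> (f \<lhd> (?D \<odot>\<^bsub>M\<^esub> m)))) (k m)" if "m \<in> Obj M" for m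
    using sq that unfolding base_change_square_def ext_pair_def cospan_act_def k_def
    by (simp flip: abdc fg)
  have k_simps [simp]: "k m \<in> Arr M" "Dom M (k m) = ?B \<odot>\<^bsub>M\<^esub> (?D \<odot>\<^bsub>M\<^esub> m)" "Cod M (k m) = ?E \<odot>\<^bsub>M\<^esub> m"
    if "m \<in> Obj M" for m
    using that by (simp_all add: k_def)
  have k_epi: "is_epi M (k m)" if "m \<in> Obj M" for m
    by (rule act_coeq_epi[OF k[OF that]])
  define q where "q = \<tau> \<cdot>\<^bsub>M\<^esub> (?E \<rhd> e)"
  define p where "p = \<tau> \<cdot>\<^bsub>M\<^esub> ((g' \<lhd> z) \<cdot>\<^bsub>M\<^esub> (?B \<rhd> e))"
  have [simp]: "q \<in> Arr M" "Dom M q = ?E \<odot>\<^bsub>M\<^esub> n" "Cod M q = z" "p \<in> Arr M" "Dom M p = ?B \<odot>\<^bsub>M\<^esub> n" "Cod M p = z"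
    by (simp_all add: q_def p_def)
  have q: "is_coeq M (?E \<rhd> \<rho>) (mul c n \<cdot>\<^bsub>M\<^esub> (?E \<rhd> (h \<lhd> n))) q"
    using assms(8) unfolding ext_pair_def q_def abdc fg nz by simp
  have ql: "q \<cdot>\<^bsub>M\<^esub> mul c n = \<tau> \<cdot>\<^bsub>M\<^esub> (?E \<rhd> q)"
    using linear_coequalizes(2)[OF sq'(4), of X Z e] X Z e lin unfolding abdc fg nz q_def by simp
  have qh: "q \<cdot>\<^bsub>M\<^esub> (h \<lhd> n) = e \<cdot>\<^bsub>M\<^esub> \<rho>"
    by (simp add: q_def lin ract_lact)
  \<comment> \<open>The square linking the two presentations. The arrow \<open>p\<close>, which is
    to be recognised as a coequalizer, is an epimorphism because \<open>q\<close> and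
    \<open>k n\<close> are.\<close>
  have qk: "q \<cdot>\<^bsub>M\<^esub> k n = p \<cdot>\<^bsub>M\<^esub> (?B \<rhd> \<rho>)"
  proof -
    have "q \<cdot>\<^bsub>M\<^esub> k n = \<tau> \<cdot>\<^bsub>M\<^esub> ((g' \<lhd> z) \<cdot>\<^bsub>M\<^esub> (?B \<rhd> (q \<cdot>\<^bsub>M\<^esub> (h \<lhd> n))))"
      by (simp add: k_def ql[THEN act_chain] ract_lact[THEN act_chain])
    then show ?thesis unfolding qh by (simp add: p_def)
  qed
  \<comment> \<open>The action \<rho> has the section \<open>un d n\<close>, and whiskering keeps it
    split. So equations on \<open>?B \<odot> n\<close> may be tested on
    \<open>?B \<odot> (?D \<odot> n)\<close>.\<close>
  have split: "is_epi M (?B \<rhd> \<rho>)"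
  proof (rule category.is_epi_split[OF act_category])
    show "(?B \<rhd> \<rho>) \<cdot>\<^bsub>M\<^esub> (?B \<rhd> un d n) = Ide M (?B \<odot>\<^bsub>M\<^esub> n)"
      using Xl(2) by (simp flip: lact_Cmp)
  qed simp_all
  have p_epi: "is_epi M p"
  proof (rule category.is_epi_right_factor[OF act_category])
    show "is_epi M (p \<cdot>\<^bsub>M\<^esub> (?B \<rhd> \<rho>))"
      unfolding qk[symmetric]
      by (rule category.epi_Cmp[OF act_category k_epi act_coeq_epi[OF q]]) simp_all
  qed simp_all
  have "is_coeq M (?B \<rhd> (\<rho> \<cdot>\<^bsub>M\<^esub> (g \<lhd> n))) (mul b n \<cdot>\<^bsub>M\<^esub> (?B \<rhd> (f \<lhd> n))) p"
  proof (rule category.is_coeqI[OF act_category _ _ p_epi])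
    have Xa: "module_over C M (src \<alpha>) (restrict_module M \<gamma> X)"
      using module_restrict[OF sq'(2)] X by (simp add: abdc)
    have Zb: "module_over C M (tgt \<alpha>) (restrict_module M \<gamma>' Z)"
      using module_restrict[OF sq'(3)] Z by (simp add: abdc)
    have "(g' \<lhd> z) \<cdot>\<^bsub>M\<^esub> (f \<lhd> z) = (h \<lhd> z) \<cdot>\<^bsub>M\<^esub> (g \<lhd> z)"
      using comm by (simp flip: ract_Cmp fg)
    then have "(\<tau> \<cdot>\<^bsub>M\<^esub> (g' \<lhd> z)) \<cdot>\<^bsub>M\<^esub> ((f \<lhd> z) \<cdot>\<^bsub>M\<^esub> (?A \<rhd> e)) = \<tau> \<cdot>\<^bsub>M\<^esub> ((h \<lhd> z) \<cdot>\<^bsub>M\<^esub> ((g \<lhd> z) \<cdot>\<^bsub>M\<^esub> (?A \<rhd> e)))"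
      by (simp add: act_chain[of "g' \<lhd> z" "f \<lhd> z"])
    also have "\<dots> = e \<cdot>\<^bsub>M\<^esub> (\<rho> \<cdot>\<^bsub>M\<^esub> (g \<lhd> n))"
      by (simp add: lin[THEN act_chain] ract_lact ract_lact[THEN act_chain])
    finally have eq: "e \<cdot>\<^bsub>M\<^esub> (\<rho> \<cdot>\<^bsub>M\<^esub> (g \<lhd> n)) = (\<tau> \<cdot>\<^bsub>M\<^esub> (g' \<lhd> z)) \<cdot>\<^bsub>M\<^esub> ((f \<lhd> z) \<cdot>\<^bsub>M\<^esub> (?A \<rhd> e))" ..
    have "((\<tau> \<cdot>\<^bsub>M\<^esub> (g' \<lhd> z)) \<cdot>\<^bsub>M\<^esub> (?B \<rhd> e)) \<cdot>\<^bsub>M\<^esub> (?B \<rhd> (\<rho> \<cdot>\<^bsub>M\<^esub> (g \<lhd> n))) =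
      ((\<tau> \<cdot>\<^bsub>M\<^esub> (g' \<lhd> z)) \<cdot>\<^bsub>M\<^esub> (?B \<rhd> e)) \<cdot>\<^bsub>M\<^esub> (mul b n \<cdot>\<^bsub>M\<^esub> (?B \<rhd> (f \<lhd> n)))"
      using linear_coequalizes(1)[OF sq'(1) Xa Zb, of e] eq e unfolding abdc fg nz
      by (simp only: restrict_module_simps)
    then show "p \<cdot>\<^bsub>M\<^esub> (?B \<rhd> (\<rho> \<cdot>\<^bsub>M\<^esub> (g \<lhd> n))) = p \<cdot>\<^bsub>M\<^esub> (mul b n \<cdot>\<^bsub>M\<^esub> (?B \<rhd> (f \<lhd> n)))"
      by (simp add: p_def)
    fix t assume t [simp]: "t \<in> Arr M" and "Dom M t = Dom M p"
      and teq: "t \<cdot>\<^bsub>M\<^esub> (?B \<rhd> (\<rho> \<cdot>\<^bsub>M\<^esub> (g \<lhd> n))) = t \<cdot>\<^bsub>M\<^esub> (mul b n \<cdot>\<^bsub>M\<^esub> (?B \<rhd> (f \<lhd> n)))"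
    then have [simp]: "Dom M t = ?B \<odot>\<^bsub>M\<^esub> n" by simp
    \<comment> \<open>An arrow \<open>t\<close> that coequalizes the pair over \<open>b\<close>
      descends in two stages: \<open>w\<close> factors through \<open>k n\<close> by
      \<open>u\<close>, and \<open>u\<close> factors through \<open>q\<close> by
      \<open>v\<close>.\<close>
    define w where "w = t \<cdot>\<^bsub>M\<^esub> (?B \<rhd> \<rho>)"
    have [simp]: "w \<in> Arr M" "Dom M w = ?B \<odot>\<^bsub>M\<^esub> (?D \<odot>\<^bsub>M\<^esub> n)" "Cod M w = Cod M t"
      by (simp_all add: w_def)
    have "w \<cdot>\<^bsub>M\<^esub> (?B \<rhd> (mul d n \<cdot>\<^bsub>M\<^esub> (g \<lhd> (?D \<odot>\<^bsub>M\<^esub> n)))) =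
      t \<cdot>\<^bsub>M\<^esub> (?B \<rhd> ((\<rho> \<cdot>\<^bsub>M\<^esub> mul d n) \<cdot>\<^bsub>M\<^esub> (g \<lhd> (?D \<odot>\<^bsub>M\<^esub> n))))"
      by (simp add: w_def)
    also have "\<dots> = (t \<cdot>\<^bsub>M\<^esub> (?B \<rhd> (\<rho> \<cdot>\<^bsub>M\<^esub> (g \<lhd> n)))) \<cdot>\<^bsub>M\<^esub> (?B \<rhd> (?A \<rhd> \<rho>))"
    proof -
      have "(\<rho> \<cdot>\<^bsub>M\<^esub> mul d n) \<cdot>\<^bsub>M\<^esub> (g \<lhd> (?D \<odot>\<^bsub>M\<^esub> n)) = (\<rho> \<cdot>\<^bsub>M\<^esub> (g \<lhd> n)) \<cdot>\<^bsub>M\<^esub> (?A \<rhd> \<rho>)"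
        unfolding Xl(1) by (simp add: ract_lact)
      then show ?thesis by simp
    qed
    also have "\<dots> = t \<cdot>\<^bsub>M\<^esub> (mul b n \<cdot>\<^bsub>M\<^esub> (?B \<rhd> ((f \<lhd> n) \<cdot>\<^bsub>M\<^esub> (?A \<rhd> \<rho>))))"
      unfolding teq by simp
    also have "\<dots> = w \<cdot>\<^bsub>M\<^esub> (mul b (?D \<odot>\<^bsub>M\<^esub> n) \<cdot>\<^bsub>M\<^esub> (?B \<rhd> (f \<lhd> (?D \<odot>\<^bsub>M\<^esub> n))))"
      by (simp add: ract_lact mul_nat[THEN act_chain] w_def)
    finally have weq: "w \<cdot>\<^bsub>M\<^esub> (?B \<rhd> (mul d n \<cdot>\<^bsub>M\<^esub> (g \<lhd> (?D \<odot>\<^bsub>M\<^esub> n)))) =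
      w \<cdot>\<^bsub>M\<^esub> (mul b (?D \<odot>\<^bsub>M\<^esub> n) \<cdot>\<^bsub>M\<^esub> (?B \<rhd> (f \<lhd> (?D \<odot>\<^bsub>M\<^esub> n))))" .
    obtain u where u [simp]: "u \<in> Arr M" "Dom M u = ?E \<odot>\<^bsub>M\<^esub> n" "Cod M u = Cod M t" and uk: "u \<cdot>\<^bsub>M\<^esub> k n = w"
      by (rule is_coeq_ex[OF k _ _ weq]) auto
    \<comment> \<open>Tested after the epimorphism \<open>k (?D \<odot> n)\<close>, where both sides
      become \<open>w\<close> precomposed with the whiskered \<open>mul d n\<close>, by
      associativity of \<rho>.\<close>
    have ueq: "u \<cdot>\<^bsub>M\<^esub> (?E \<rhd> \<rho>) = u \<cdot>\<^bsub>M\<^esub> (mul c n \<cdot>\<^bsub>M\<^esub> (?E \<rhd> (h \<lhd> n)))"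
    proof (rule act_epiD[OF k_epi[of "?D \<odot>\<^bsub>M\<^esub> n"]])
      have "(?E \<rhd> \<rho>) \<cdot>\<^bsub>M\<^esub> k (?D \<odot>\<^bsub>M\<^esub> n) = k n \<cdot>\<^bsub>M\<^esub> (?B \<rhd> (?D \<rhd> \<rho>))"
      proof -
        have "(?E \<rhd> \<rho>) \<cdot>\<^bsub>M\<^esub> k (?D \<odot>\<^bsub>M\<^esub> n) =
          (mul c n \<cdot>\<^bsub>M\<^esub> (?E \<rhd> (?E \<rhd> \<rho>))) \<cdot>\<^bsub>M\<^esub> ((g' \<lhd> (?E \<odot>\<^bsub>M\<^esub> (?D \<odot>\<^bsub>M\<^esub> n))) \<cdot>\<^bsub>M\<^esub> (?B \<rhd> (h \<lhd> (?D \<odot>\<^bsub>M\<^esub> n))))"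
          by (simp add: k_def mul_nat)
        also have "\<dots> = mul c n \<cdot>\<^bsub>M\<^esub> ((g' \<lhd> (?E \<odot>\<^bsub>M\<^esub> n)) \<cdot>\<^bsub>M\<^esub> (?B \<rhd> ((?E \<rhd> \<rho>) \<cdot>\<^bsub>M\<^esub> (h \<lhd> (?D \<odot>\<^bsub>M\<^esub> n)))))"
          by (simp add: ract_lact[THEN act_chain])
        also have "(?E \<rhd> \<rho>) \<cdot>\<^bsub>M\<^esub> (h \<lhd> (?D \<odot>\<^bsub>M\<^esub> n)) = (h \<lhd> n) \<cdot>\<^bsub>M\<^esub> (?D \<rhd> \<rho>)"
          by (simp add: ract_lact)
        finally show ?thesis by (simp add: k_def)
      qed
      then have "(u \<cdot>\<^bsub>M\<^esub> (?E \<rhd> \<rho>)) \<cdot>\<^bsub>M\<^esub> k (?D \<odot>\<^bsub>M\<^esub> n) = (u \<cdot>\<^bsub>M\<^esub> k n) \<cdot>\<^bsub>M\<^esub> (?B \<rhd> (?D \<rhd> \<rho>))"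
        by simp
      also have "\<dots> = t \<cdot>\<^bsub>M\<^esub> (?B \<rhd> (\<rho> \<cdot>\<^bsub>M\<^esub> (?D \<rhd> \<rho>)))"
        unfolding uk by (simp add: w_def)
      also have "\<dots> = w \<cdot>\<^bsub>M\<^esub> (?B \<rhd> mul d n)"
        unfolding Xl(1)[symmetric] by (simp add: w_def)
      also have "\<dots> = u \<cdot>\<^bsub>M\<^esub> (k n \<cdot>\<^bsub>M\<^esub> (?B \<rhd> mul d n))"
        by (simp flip: uk)
      also have "k n \<cdot>\<^bsub>M\<^esub> (?B \<rhd> mul d n) = (mul c n \<cdot>\<^bsub>M\<^esub> (?E \<rhd> (h \<lhd> n))) \<cdot>\<^bsub>M\<^esub> k (?D \<odot>\<^bsub>M\<^esub> n)"
      proof -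
        have "k n \<cdot>\<^bsub>M\<^esub> (?B \<rhd> mul d n) = mul c n \<cdot>\<^bsub>M\<^esub> ((g' \<lhd> (?E \<odot>\<^bsub>M\<^esub> n)) \<cdot>\<^bsub>M\<^esub> (?B \<rhd> ((h \<lhd> n) \<cdot>\<^bsub>M\<^esub> mul d n)))"
          by (simp add: k_def)
        also have "(h \<lhd> n) \<cdot>\<^bsub>M\<^esub> mul d n = mul c n \<cdot>\<^bsub>M\<^esub> ((?E \<rhd> (h \<lhd> n)) \<cdot>\<^bsub>M\<^esub> (h \<lhd> (?D \<odot>\<^bsub>M\<^esub> n)))"
          by (rule ract_mul) (use mon in simp_all)
        also have "mul c n \<cdot>\<^bsub>M\<^esub> ((g' \<lhd> (?E \<odot>\<^bsub>M\<^esub> n)) \<cdot>\<^bsub>M\<^esub> (?B \<rhd> (mul c n \<cdot>\<^bsub>M\<^esub> ((?E \<rhd> (h \<lhd> n)) \<cdot>\<^bsub>M\<^esub> (h \<lhd> (?D \<odot>\<^bsub>M\<^esub> n)))))) =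
          (mul c n \<cdot>\<^bsub>M\<^esub> (?E \<rhd> mul c n)) \<cdot>\<^bsub>M\<^esub> ((?E \<rhd> (?E \<rhd> (h \<lhd> n))) \<cdot>\<^bsub>M\<^esub>
            ((g' \<lhd> (?E \<odot>\<^bsub>M\<^esub> (?D \<odot>\<^bsub>M\<^esub> n))) \<cdot>\<^bsub>M\<^esub> (?B \<rhd> (h \<lhd> (?D \<odot>\<^bsub>M\<^esub> n)))))"
          by (simp add: ract_lact[THEN act_chain])
        also have "\<dots> = (mul c n \<cdot>\<^bsub>M\<^esub> (?E \<rhd> (h \<lhd> n))) \<cdot>\<^bsub>M\<^esub> k (?D \<odot>\<^bsub>M\<^esub> n)"
          unfolding mul_assoc[OF mon(8) X'(1)] by (simp add: k_def mul_nat[THEN act_chain])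
        finally show ?thesis .
      qed
      finally show "(u \<cdot>\<^bsub>M\<^esub> (?E \<rhd> \<rho>)) \<cdot>\<^bsub>M\<^esub> k (?D \<odot>\<^bsub>M\<^esub> n) =
        (u \<cdot>\<^bsub>M\<^esub> (mul c n \<cdot>\<^bsub>M\<^esub> (?E \<rhd> (h \<lhd> n)))) \<cdot>\<^bsub>M\<^esub> k (?D \<odot>\<^bsub>M\<^esub> n)" by simp
    qed simp_all
    obtain v where v [simp]: "v \<in> Arr M" "Dom M v = z" "Cod M v = Cod M t" and vq: "v \<cdot>\<^bsub>M\<^esub> q = u"
      by (rule is_coeq_ex[OF q _ _ ueq]) auto
    have "v \<cdot>\<^bsub>M\<^esub> p = t"
    proof (rule act_epiD[OF split])
      have "(v \<cdot>\<^bsub>M\<^esub> p) \<cdot>\<^bsub>M\<^esub> (?B \<rhd> \<rho>) = (v \<cdot>\<^bsub>M\<^esub> q) \<cdot>\<^bsub>M\<^esub> k n" by (simp add: qk)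
      then show "(v \<cdot>\<^bsub>M\<^esub> p) \<cdot>\<^bsub>M\<^esub> (?B \<rhd> \<rho>) = t \<cdot>\<^bsub>M\<^esub> (?B \<rhd> \<rho>)" unfolding vq uk w_def .
    qed simp_all
    then show "\<exists>h\<in>Hom M (Cod M p) (Cod M t). h \<cdot>\<^bsub>M\<^esub> p = t"
      by (intro bexI[of _ v]) (simp_all add: in_Hom)
  qed simp_all
  then show ?thesis unfolding ext_pair_def p_def abdc fg nz by simp
qed

text \<open>Both composites are left adjoint to \<open>restr M \<alpha>\<close> relative to
  \<open>restr M \<gamma>\<close>. For the second, the unit is the restriction of the unit \<zeta>
  of \<beta>: it has the right codomain because the two ways of restricting from
  \<open>tgt \<beta>\<close> to \<open>src \<alpha>\<close> coincide strictly, and it is universal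
  by \<open>base_change_ext_pair\<close>.\<close>

lemma base_change_nat_iso:
  assumes sq: "base_change_square \<alpha> \<gamma> \<gamma>' \<beta>"
  shows "nat_iso (Mod C M (tgt \<gamma>)) (Mod C M (tgt \<alpha>))
    (functr_comp (ext C M \<alpha>) (restr M \<gamma>)) (functr_comp (restr M \<gamma>') (ext C M \<beta>))"
proof -
  have sq': "\<alpha> \<in> Arr (Comm C)" "\<gamma> \<in> Arr (Comm C)" "\<gamma>' \<in> Arr (Comm C)" "\<beta> \<in> Arr (Comm C)"
    and s: "src \<gamma> = src \<alpha>" "src \<gamma>' = tgt \<alpha>" "src \<beta> = tgt \<gamma>" "tgt \<gamma>' = tgt \<beta>"
    and comm: "und \<gamma>' \<cdot> und \<alpha> = und \<beta> \<cdot> und \<gamma>"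
    using sq by (auto simp: base_change_square_def)
  let ?a = "src \<alpha>" and ?b = "tgt \<alpha>" and ?d = "tgt \<gamma>" and ?e = "tgt \<beta>"
  obtain \<theta> where \<theta>: "adj_unit (Mod C M ?a) (Mod C M ?a) (Mod C M ?b) id_functr (ext C M \<alpha>) (restr M \<alpha>) \<theta>"
    using ext_unit[OF sq'(1)] .
  obtain \<zeta> where \<zeta>: "adj_unit (Mod C M ?d) (Mod C M ?d) (Mod C M ?e) id_functr (ext C M \<beta>) (restr M \<beta>) \<zeta>"
    using ext_unit[OF sq'(4)] unfolding s .
  have r: "cat_functor (Mod C M ?d) (Mod C M ?a) (restr M \<gamma>)" "cat_functor (Mod C M ?b) (Mod C M ?a) (restr M \<alpha>)"
    "cat_functor (Mod C M ?e) (Mod C M ?b) (restr M \<gamma>')" "cat_functor (Mod C M ?e) (Mod C M ?d) (restr M \<beta>)"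
    using cat_functor_restr[OF sq'(2)] cat_functor_restr[OF sq'(1)] cat_functor_restr[OF sq'(3)]
      cat_functor_restr[OF sq'(4)] by (simp_all add: s)
  have L: "cat_functor (Mod C M ?a) (Mod C M ?b) (ext C M \<alpha>)" "cat_functor (Mod C M ?d) (Mod C M ?e) (ext C M \<beta>)"
    using \<theta> \<zeta> by (simp_all add: adj_unit_def)
  interpret R: cat_functor "Mod C M ?d" "Mod C M ?a" "restr M \<gamma>" by (rule r(1))
  interpret E: cat_functor "Mod C M ?d" "Mod C M ?e" "ext C M \<beta>" by (rule L(2))
  have 1: "adj_unit (Mod C M ?d) (Mod C M ?a) (Mod C M ?b) (restr M \<gamma>)
     (functr_comp (ext C M \<alpha>) (restr M \<gamma>)) (restr M \<alpha>) (\<lambda>X. \<theta> (restrict_module M \<gamma> X))"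
    unfolding adj_unit_def
  proof (intro conjI ballI)
    fix X assume "X \<in> Obj (Mod C M ?d)"
    then show "universal_arrow (Mod C M ?a) (Mod C M ?b) (restr M \<alpha>) (fob (restr M \<gamma>) X)
        (fob (functr_comp (ext C M \<alpha>) (restr M \<gamma>)) X) (\<theta> (restrict_module M \<gamma> X))"
      using \<theta> R.fob_in[of X] unfolding adj_unit_def by simp
  next
    fix f assume f: "f \<in> Arr (Mod C M ?d)"
    have "far (restr M \<gamma>) f \<in> Arr (Mod C M ?a)" using R.far_simps(1)[OF f] .
    from adj_unit_nat[OF \<theta> this] show "far (restr M \<alpha>) (far (functr_comp (ext C M \<alpha>) (restr M \<gamma>)) f) \<cdot>\<^bsub>Mod C M ?a\<^esub>
        \<theta> (restrict_module M \<gamma> (Dom (Mod C M ?d) f)) =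
       \<theta> (restrict_module M \<gamma> (Cod (Mod C M ?d) f)) \<cdot>\<^bsub>Mod C M ?a\<^esub> far (restr M \<gamma>) f"
      by simp
  qed (use r L cat_functor_comp in blast)+
  have 2: "adj_unit (Mod C M ?d) (Mod C M ?a) (Mod C M ?b) (restr M \<gamma>)
     (functr_comp (restr M \<gamma>') (ext C M \<beta>)) (restr M \<alpha>) (\<lambda>X. far (restr M \<gamma>) (\<zeta> X))"
    unfolding adj_unit_def
  proof (intro conjI ballI)
    fix X assume X0: "X \<in> Obj (Mod C M ?d)"
    then have X: "module_over C M ?d X" by simp
    let ?Z = "fob (ext C M \<beta>) X"
    have u: "universal_arrow (Mod C M ?d) (Mod C M ?e) (restr M \<beta>) X ?Z (\<zeta> X)"
      using \<zeta> X0 by (auto simp: adj_unit_def)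
    have Z: "module_over C M ?e ?Z" using E.fob_in[OF X0] by simp
    have z: "src (\<zeta> X) = X" "tgt (\<zeta> X) = restrict_module M \<beta> ?Z" "und (\<zeta> X) \<in> Arr M"
      "Dom M (und (\<zeta> X)) = mcarr X" "Cod M (und (\<zeta> X)) = mcarr ?Z"
      and zA: "\<zeta> X \<in> Arr (Mod C M ?d)"
      using universal_arrow_Dom[OF u] by (auto simp: Mod_Arr)
    have Zd: "restrict_module M \<gamma> (restrict_module M \<beta> ?Z) = restrict_module M \<alpha> (restrict_module M \<gamma>' ?Z)"
      using restrict_module_Cmp[OF sq'(2,4)] restrict_module_Cmp[OF sq'(1,3)] Z s comm by simp
    note D = Comm_ArrD[OF sq'(1)] Comm_ArrD[OF sq'(2), unfolded s] Comm_ArrD[OF sq'(3), unfolded s]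
      Comm_ArrD[OF sq'(4), unfolded s]
    note [simp] = D moduleD(1-4)[OF Z D(20)] moduleD(1-4)[OF X D(8)] z
    have lin: "und (\<zeta> X) \<cdot>\<^bsub>M\<^esub> mact X = mact ?Z \<cdot>\<^bsub>M\<^esub> ((und \<beta> \<lhd> mcarr ?Z) \<cdot>\<^bsub>M\<^esub> (carr ?d \<rhd> und (\<zeta> X)))"
      using zA by (simp add: Mod_Arr)
    have q: "ext_pair \<alpha> (restrict_module M \<gamma> X) (mact (restrict_module M \<gamma>' ?Z) \<cdot>\<^bsub>M\<^esub> (carr ?b \<rhd> und (\<zeta> X)))"
      using base_change_ext_pair[OF sq X Z z(3-5) lin universal_arrow_ext_pair[OF sq'(4), unfolded s, OF u X]]
      by simp
    have rz: "far (restr M \<gamma>) (\<zeta> X) = SArr (restrict_module M \<gamma> X) (und (\<zeta> X)) (restrict_module M \<alpha> (restrict_module M \<gamma>' ?Z))"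
      using Zd by simp
    have rA: "far (restr M \<gamma>) (\<zeta> X) \<in> Arr (Mod C M ?a)" using R.far_simps(1)[OF zA] .
    have "universal_arrow (Mod C M ?a) (Mod C M ?b) (restr M \<alpha>) (restrict_module M \<gamma> X) (restrict_module M \<gamma>' ?Z)
      (far (restr M \<gamma>) (\<zeta> X))"
      unfolding rz
      by (rule universal_arrow_ext[OF sq'(1) _ _ _ _ _ _ q])
        (use rA[unfolded rz] module_restrict[OF sq'(2)] module_restrict[OF sq'(3)] X Z in
          \<open>simp_all add: Mod_Arr s\<close>)
    then show "universal_arrow (Mod C M ?a) (Mod C M ?b) (restr M \<alpha>) (fob (restr M \<gamma>) X)
        (fob (functr_comp (restr M \<gamma>') (ext C M \<beta>)) X) (far (restr M \<gamma>) (\<zeta> X))"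
      by simp
  next
    fix f assume f: "f \<in> Arr (Mod C M ?d)"
    have "far (restr M \<beta>) (far (ext C M \<beta>) f) \<cdot>\<^bsub>Mod C M ?d\<^esub> \<zeta> (src f) = \<zeta> (tgt f) \<cdot>\<^bsub>Mod C M ?d\<^esub> f"
      using \<zeta> f unfolding adj_unit_def by simp
    moreover have "module_over C M ?e (src (far (ext C M \<beta>) f))" "module_over C M ?e (tgt (far (ext C M \<beta>) f))"
      using E.far_simps[OF f] by (auto simp: Mod_Arr)
    moreover have "restrict_module M \<alpha> (restrict_module M \<gamma>' Z) = restrict_module M \<gamma> (restrict_module M \<beta> Z)"
      if "module_over C M ?e Z" for Z
      using restrict_module_Cmp[OF sq'(2,4)] restrict_module_Cmp[OF sq'(1,3)] that s comm by simp
    ultimately show "far (restr M \<alpha>) (far (functr_comp (restr M \<gamma>') (ext C M \<beta>)) f) \<cdot>\<^bsub>Mod C M ?a\<^esub>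
        far (restr M \<gamma>) (\<zeta> (Dom (Mod C M ?d) f)) =
       far (restr M \<gamma>) (\<zeta> (Cod (Mod C M ?d) f)) \<cdot>\<^bsub>Mod C M ?a\<^esub> far (restr M \<gamma>) f"
      by simp
  qed (use r L cat_functor_comp in blast)+
  show ?thesis using adj_unit_nat_iso[OF 1 2] .
qed

end

section \<open>Pushouts of commutative monoids\<close>

context left_actegory
begin

text \<open>Companion of \<open>act_chain\<close> for equations below a whiskering. Iterating and
  combining the two yields the rule for any position in a normalised composite.\<close>

lemma lact_lift:
  assumes "p \<cdot>\<^bsub>M\<^esub> q = r" "A \<in> Obj C" "p \<in> Arr M" "q \<in> Arr M" "Cod M q = Dom M p"
  shows "(A \<rhd> p) \<cdot>\<^bsub>M\<^esub> (A \<rhd> q) = A \<rhd> r"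
  using assms by (simp flip: lact_Cmp)

text \<open>\<open>mult X \<cdot> (p \<otimes>\<^sub>a q)\<close> multiplies the values of two
  arrows. In iterated form \<open>p\<close> acts outside, \<open>q\<close> inside, and the monad
  multiplication follows.\<close>

lemma product_ract:
  assumes "comm_monoid_obj C X" "p \<in> Arr C" "q \<in> Arr C" "Cod C p = carr X" "Cod C q = carr X" "m \<in> Obj M"
    and "B = Dom C p" "D = Dom C q"
  shows "((mult X \<cdot> (p \<otimes>\<^sub>a q)) \<lhd> m) \<cdot>\<^bsub>M\<^esub> act_assoc M B D m =
    mul X m \<cdot>\<^bsub>M\<^esub> ((carr X \<rhd> (q \<lhd> m)) \<cdot>\<^bsub>M\<^esub> (p \<lhd> (D \<odot>\<^bsub>M\<^esub> m)))"
proof -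
  note [simp] = assms
  have "p \<otimes>\<^sub>a q = (Ide C (carr X) \<otimes>\<^sub>a q) \<cdot> (p \<otimes>\<^sub>a Ide C (Dom C q))"
    by (simp add: ten_merge)
  then show ?thesis
    by (simp add: mul_def act_assoc_nat_mid[THEN act_chain] act_assoc_nat_ract)
qed

end

context symmetric_monoidal
begin

notation self.lact (infixr "\<unrhd>" 75)
notation self.ract (infixr "\<unlhd>" 75)

lemma tensor_lact: "Ide C A \<otimes>\<^sub>a h = A \<unrhd> h" and tensor_ract: "f \<otimes>\<^sub>a Ide C m = f \<unlhd> m"
  by (simp_all add: self.lact_def self.ract_def)

lemma ract_unit_eqI:
  assumes "f \<in> Arr C" "g \<in> Arr C" "Dom C f = Dom C g" "Cod C f = Cod C g" "f \<unlhd> \<one> = g \<unlhd> \<one>"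
  shows "f = g"
  using tensor_unit_faithful[of f g] assms by (simp add: self.ract_def)

lemma unit_ract:
  assumes "comm_monoid_obj C a" "x \<in> Obj C"
  shows "unit a \<unlhd> x = self.un a x \<cdot> lunit C x"
  using assms by (simp add: self.un_def)

text \<open>Another coherence that is not an axiom; it is \<open>sw_unit\<close> for the self
  action, read between the right and the left triangle.\<close>

lemma runit_braid:
  assumes X: "X \<in> Obj C"
  shows "runit C X \<cdot> braid C \<one> X = lunit C X"
proof (rule ract_unit_eqI)
  note [simp] = X
  show "(runit C X \<cdot> braid C \<one> X) \<unlhd> \<one> = lunit C X \<unlhd> \<one>"
  proof (rule A.iso_cancel_right[of "assoc C \<one> X \<one>"])
    have "((runit C X \<cdot> braid C \<one> X) \<unlhd> \<one>) \<cdot> assoc C \<one> X \<one> = (X \<unrhd> lunit C \<one>) \<cdot> self.sw \<one> X \<one>"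
      by (simp add: self.sw_def flip: self.act_triangle_right')
    then show "((runit C X \<cdot> braid C \<one> X) \<unlhd> \<one>) \<cdot> assoc C \<one> X \<one> = (lunit C X \<unlhd> \<one>) \<cdot> assoc C \<one> X \<one>"
      by (simp add: self.sw_unit self.act_triangle_left')
  qed simp_all
qed (use X in simp_all)

text \<open>By commutativity the right unit law follows from the left one, once
  \<open>runit_braid\<close> identifies the two unitors up to the braiding.\<close>

lemma comm_monoid_objI:
  assumes a: "carr e \<in> Obj C" "mult e \<in> Arr C" "Dom C (mult e) = carr e \<otimes> carr e" "Cod C (mult e) = carr e"
    "unit e \<in> Arr C" "Dom C (unit e) = \<one>" "Cod C (unit e) = carr e"
    and 1: "mult e \<cdot> ((mult e \<unlhd> carr e) \<cdot> assoc C (carr e) (carr e) (carr e)) = mult e \<cdot> (carr e \<unrhd> mult e)"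
    and 2: "mult e \<cdot> (unit e \<unlhd> carr e) = lunit C (carr e)"
    and 3: "mult e \<cdot> braid C (carr e) (carr e) = mult e"
  shows "comm_monoid_obj C e"
proof -
  note [simp] = a
  have "mult e \<cdot> (carr e \<unrhd> unit e) = runit C (carr e)"
  proof (rule A.iso_cancel_right[of "braid C \<one> (carr e)"])
    have "(carr e \<unrhd> unit e) \<cdot> braid C \<one> (carr e) = braid C (carr e) (carr e) \<cdot> (unit e \<unlhd> carr e)"
      using braid_nat'[of "unit e" "Ide C (carr e)"] by (simp add: tensor_lact tensor_ract)
    then show "(mult e \<cdot> (carr e \<unrhd> unit e)) \<cdot> braid C \<one> (carr e) = runit C (carr e) \<cdot> braid C \<one> (carr e)"
      by (simp add: 2 3[THEN ten_chain] runit_braid)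
  qed simp_all
  then show ?thesis
    using 1 2 3 by (simp add: comm_monoid_obj_def Let_def in_Hom tensor_lact tensor_ract)
qed

lemma comm_monoid_laws':
  assumes "comm_monoid_obj C a"
  shows "mult a \<cdot> ((mult a \<unlhd> carr a) \<cdot> assoc C (carr a) (carr a) (carr a)) = mult a \<cdot> (carr a \<unrhd> mult a)"
    "mult a \<cdot> self.mul a (carr a) = mult a \<cdot> (carr a \<unrhd> mult a)"
    "mult a \<cdot> (unit a \<unlhd> carr a) = lunit C (carr a)"
    "mult a \<cdot> self.un a (carr a) = Ide C (carr a)"
    "mult a \<cdot> (carr a \<unrhd> unit a) = runit C (carr a)"
proof -
  note [simp] = assms
  note l = comm_monoid_laws[OF assms, unfolded tensor_lact tensor_ract]
  show "mult a \<cdot> ((mult a \<unlhd> carr a) \<cdot> assoc C (carr a) (carr a) (carr a)) = mult a \<cdot> (carr a \<unrhd> mult a)"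
    "mult a \<cdot> self.mul a (carr a) = mult a \<cdot> (carr a \<unrhd> mult a)"
    "mult a \<cdot> (unit a \<unlhd> carr a) = lunit C (carr a)"
    "mult a \<cdot> (carr a \<unrhd> unit a) = runit C (carr a)"
    using l by (simp_all add: self.mul_def)
  show "mult a \<cdot> self.un a (carr a) = Ide C (carr a)"
    by (simp add: self.un_def l(2)[THEN ten_chain])
qed

text \<open>The multiplication of the composite of the monads \<open>b \<otimes> -\<close> and \<open>d \<otimes> -\<close>, with distributive
  law \<open>sw\<close>: for a \<open>d\<close>-action \<open>\<rho>\<close> on \<open>n\<close>, the action of \<open>b \<otimes> d\<close> on the free \<open>b\<close>-module \<open>b \<otimes> n\<close>.\<close>

definition comp_mul where
  "comp_mul b d n \<rho> = (carr b \<unrhd> \<rho>) \<cdot> (self.mul b (carr d \<otimes> n) \<cdot> (carr b \<unrhd> self.sw (carr d) (carr b) n))"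

lemma comp_mul_simps [simp]:
  assumes "comm_monoid_obj C b" "comm_monoid_obj C d" "n \<in> Obj C" "\<rho> \<in> Arr C"
    "Dom C \<rho> = carr d \<otimes> n" "Cod C \<rho> = n"
  shows "comp_mul b d n \<rho> \<in> Arr C" "Dom C (comp_mul b d n \<rho>) = carr b \<otimes> (carr d \<otimes> (carr b \<otimes> n))"
    "Cod C (comp_mul b d n \<rho>) = carr b \<otimes> n"
  using assms by (simp_all add: comp_mul_def)

lemmas nats = self.mul_nat self.sw_nat self.ract_lact
text \<open>Each naturality rule in four positions: alone, within a longer composite, below a
  whiskering, and both at once. With them simplification drives composites of whiskered arrows to a
  common normal form.\<close>

lemmas nat_chains = nats nats[THEN ten_chain] nats[THEN self.lact_lift] nats[THEN self.lact_lift, THEN ten_chain]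

lemma comp_mul_nat:
  assumes [simp]: "comm_monoid_obj C b" "comm_monoid_obj C d" "\<rho> \<in> Arr C"
    "Dom C \<rho> = carr d \<otimes> n" "Cod C \<rho> = n" "\<rho>' \<in> Arr C" "Dom C \<rho>' = carr d \<otimes> n'" "Cod C \<rho>' = n'"
    "f \<in> Arr C" "Dom C f = n" "Cod C f = n'"
    and lin: "\<rho>' \<cdot> (carr d \<unrhd> f) = f \<cdot> \<rho>"
  shows "comp_mul b d n' \<rho>' \<cdot> (carr b \<unrhd> (carr d \<unrhd> (carr b \<unrhd> f))) = (carr b \<unrhd> f) \<cdot> comp_mul b d n \<rho>"
proof -
  have [simp]: "n \<in> Obj C" "n' \<in> Obj C" using A.Dom_Cod_Obj[of f] by simp_all
  show ?thesis
    by (simp add: comp_mul_def nat_chains lin[THEN self.lact_lift] lin[THEN self.lact_lift, THEN ten_chain])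
qed

text \<open>Beck's associativity of a composite monad, for an action on a free module. Both sides
  are normalised to \<open>?r\<close>, in which all exchanges come first, then the multiplications
  of \<open>b\<close>, then the two actions of \<open>d\<close>; the inputs are the multiplication
  laws of the distributive law and associativity of \<open>b\<close> and of \<rho>.\<close>

lemma comp_mul_assoc:
  assumes [simp]: "comm_monoid_obj C b" "comm_monoid_obj C d" "\<rho> \<in> Arr C"
    "Dom C \<rho> = carr d \<otimes> n" "Cod C \<rho> = n"
    and \<rho>: "\<rho> \<cdot> self.mul d n = \<rho> \<cdot> (carr d \<unrhd> \<rho>)"
  shows "comp_mul b d n \<rho> \<cdot> (carr b \<unrhd> (carr d \<unrhd> comp_mul b d n \<rho>)) =
    comp_mul b d n \<rho> \<cdot> comp_mul b d (carr d \<otimes> (carr b \<otimes> n)) (self.mul d (carr b \<otimes> n))"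
proof -
  have [simp]: "n \<in> Obj C" using A.Dom_Cod_Obj[of \<rho>] by simp
  let ?B = "carr b" and ?D = "carr d" and ?m = "self.mul" and ?s = "self.sw (carr d) (carr b)"
  let ?r = "(?B \<unrhd> \<rho>) \<cdot> ((?B \<unrhd> (?D \<unrhd> \<rho>)) \<cdot> (?m b (?D \<otimes> (?D \<otimes> n)) \<cdot> (?m b (?B \<otimes> (?D \<otimes> (?D \<otimes> n))) \<cdot>
      ((?B \<unrhd> (?B \<unrhd> ?s (?D \<otimes> n))) \<cdot> ((?B \<unrhd> (?B \<unrhd> (?D \<unrhd> ?s n))) \<cdot> (?B \<unrhd> ?s (?D \<otimes> (?B \<otimes> n))))))))"
  note ms = self.sw_mul' self.sw_mul
  note [simp] = ms[THEN self.lact_lift] ms[THEN self.lact_lift, THEN ten_chain]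
  have "comp_mul b d n \<rho> \<cdot> (?B \<unrhd> (?D \<unrhd> comp_mul b d n \<rho>)) = ?r"
    by (simp add: comp_mul_def nat_chains self.mul_assoc[THEN ten_chain])
  moreover have "comp_mul b d n \<rho> \<cdot> comp_mul b d (?D \<otimes> (?B \<otimes> n)) (?m d (?B \<otimes> n)) = ?r"
    by (simp add: comp_mul_def nat_chains self.mul_assoc[THEN ten_chain] \<rho>[THEN self.lact_lift, THEN ten_chain])
  ultimately show ?thesis by simp
qed

text \<open>The coproduct of commutative monoids. Its multiplication is that of the composite monad,
  so that its action is, up to associators, the composite of the actions of \<open>b\<close> and
  \<open>d\<close>.\<close>

definition coprod where
  "coprod b d = \<lparr>carr = carr b \<otimes> carr d,
     mult = comp_mul b d (carr d) (mult d) \<cdot> A.inv_arr (assoc C (carr b) (carr d) (carr b \<otimes> carr d)),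
     unit = self.un b (carr d) \<cdot> unit d\<rparr>"

lemma coprod_simps [simp]:
  assumes "comm_monoid_obj C b" "comm_monoid_obj C d"
  shows "carr (coprod b d) = carr b \<otimes> carr d"
    "mult (coprod b d) \<in> Arr C" "Dom C (mult (coprod b d)) = (carr b \<otimes> carr d) \<otimes> (carr b \<otimes> carr d)"
    "Cod C (mult (coprod b d)) = carr b \<otimes> carr d"
    "unit (coprod b d) \<in> Arr C" "Dom C (unit (coprod b d)) = \<one>" "Cod C (unit (coprod b d)) = carr b \<otimes> carr d"
  using assms by (simp_all add: coprod_def)

lemma coprod_mult_assoc:
  assumes "comm_monoid_obj C b" "comm_monoid_obj C d"
  shows "mult (coprod b d) \<cdot> assoc C (carr b) (carr d) (carr b \<otimes> carr d) = comp_mul b d (carr d) (mult d)"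
  using assms by (simp add: coprod_def)

text \<open>The multiplication of \<open>b \<otimes> d\<close> in words: up to rebracketing it is
  \<open>comp_mul\<close> on the free \<open>d\<close>-module over \<open>x\<close>. Calculations
  with the coproduct can then be carried out with iterated actions alone.\<close>

lemma coprod_mult_ract:
  assumes [simp]: "comm_monoid_obj C b" "comm_monoid_obj C d" "x \<in> Obj C"
  shows "(mult (coprod b d) \<unlhd> x) \<cdot> (assoc C (carr b \<otimes> carr d) (carr b \<otimes> carr d) x \<cdot>
      (assoc C (carr b) (carr d) ((carr b \<otimes> carr d) \<otimes> x) \<cdot> (carr b \<unrhd> (carr d \<unrhd> assoc C (carr b) (carr d) x)))) =
    assoc C (carr b) (carr d) x \<cdot> comp_mul b d (carr d \<otimes> x) (self.mul d x)" (is "?lhs = _")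
proof -
  let ?B = "carr b" and ?D = "carr d" and ?a = "assoc C" and ?s = "self.sw (carr d) (carr b)" and ?m = "self.mul"
  have w: "((?B \<unrhd> f) \<unlhd> x) \<cdot> ?a ?B y x = ?a ?B (Cod C f) x \<cdot> (?B \<unrhd> (f \<unlhd> x))"
    if "f \<in> Arr C" "y = Dom C f" for f y
    using that by (simp add: self.act_assoc_nat_mid tensor_lact)
  have "?lhs = ((mult (coprod b d) \<cdot> ?a ?B ?D (?B \<otimes> ?D)) \<unlhd> x) \<cdot>
     (?a ?B (?D \<otimes> (?B \<otimes> ?D)) x \<cdot> (?B \<unrhd> (?a ?D (?B \<otimes> ?D) x \<cdot> (?D \<unrhd> ?a ?B ?D x))))"
    by (simp add: self.act_pentagon_chain)
  also have "\<dots> = (((?B \<unrhd> mult d) \<cdot> ?m b (?D \<otimes> ?D)) \<unlhd> x) \<cdot> (?a ?B (?B \<otimes> (?D \<otimes> ?D)) x \<cdot>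
     (?B \<unrhd> ((?s ?D \<unlhd> x) \<cdot> (?a ?D (?B \<otimes> ?D) x \<cdot> (?D \<unrhd> ?a ?B ?D x)))))"
    unfolding coprod_mult_assoc[OF assms(1,2)] by (simp add: comp_mul_def w[THEN ten_chain])
  also have "\<dots> = ((?B \<unrhd> mult d) \<unlhd> x) \<cdot> (((?m b (?D \<otimes> ?D) \<unlhd> x) \<cdot> (?a ?B (?B \<otimes> (?D \<otimes> ?D)) x \<cdot> (?B \<unrhd> ?a ?B (?D \<otimes> ?D) x))) \<cdot>
     (?B \<unrhd> ((?B \<unrhd> ?a ?D ?D x) \<cdot> ?s (?D \<otimes> x))))"
    by (simp add: self.sw_ract)
  also have "\<dots> = ?a ?B ?D x \<cdot> ((?B \<unrhd> ((mult d \<unlhd> x) \<cdot> ?a ?D ?D x)) \<cdot> (?m b (?D \<otimes> (?D \<otimes> x)) \<cdot> (?B \<unrhd> ?s (?D \<otimes> x))))"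
    by (simp add: self.mul_ract w[THEN ten_chain] nat_chains)
  also have "\<dots> = ?a ?B ?D x \<cdot> comp_mul b d (?D \<otimes> x) (?m d x)"
    by (simp add: comp_mul_def self.mul_def)
  finally show ?thesis .
qed

text \<open>\<open>F\<close> and \<open>G\<close> are \<open>f\<close> and \<open>g\<close> with the codomain \<open>(b \<otimes> d) \<otimes> -\<close> rewritten as the word \<open>b \<otimes> (d \<otimes> -)\<close>.\<close>

lemma coprod_product_ract:
  assumes [simp]: "comm_monoid_obj C b" "comm_monoid_obj C d" "x \<in> Obj C"
    and f [simp]: "f \<in> Arr C" "Dom C f = Y" "Cod C f = carr b \<otimes> carr d"
    and g [simp]: "g \<in> Arr C" "Dom C g = Z" "Cod C g = carr b \<otimes> carr d"
    and F [simp]: "F \<in> Arr C" "Cod C F = carr b \<otimes> (carr d \<otimes> (Z \<otimes> x))"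
    and G [simp]: "G \<in> Arr C" "Cod C G = carr b \<otimes> (carr d \<otimes> x)"
    and eqF: "f \<unlhd> (Z \<otimes> x) = assoc C (carr b) (carr d) (Z \<otimes> x) \<cdot> F"
    and eqG: "g \<unlhd> x = assoc C (carr b) (carr d) x \<cdot> G"
  shows "((mult (coprod b d) \<cdot> (f \<otimes>\<^sub>a g)) \<unlhd> x) \<cdot> assoc C Y Z x =
    assoc C (carr b) (carr d) x \<cdot> (comp_mul b d (carr d \<otimes> x) (self.mul d x) \<cdot> ((carr b \<unrhd> (carr d \<unrhd> G)) \<cdot> F))"
proof -
  let ?B = "carr b" and ?D = "carr d" and ?a = "assoc C" and ?P = "carr b \<otimes> carr d"
  have [simp]: "Y \<in> Obj C" "Z \<in> Obj C" using A.Dom_Cod_Obj[of f] A.Dom_Cod_Obj[of g] by simp_all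
  have [simp]: "Dom C F = Y \<otimes> (Z \<otimes> x)" "Dom C G = Z \<otimes> x"
    using arg_cong[OF eqF, of "Dom C"] arg_cong[OF eqG, of "Dom C"] by simp_all
  have "((mult (coprod b d) \<cdot> (f \<otimes>\<^sub>a g)) \<unlhd> x) \<cdot> ?a Y Z x =
    ((mult (coprod b d)) \<unlhd> x) \<cdot> (?a ?P ?P x \<cdot> ((?P \<unrhd> (g \<unlhd> x)) \<cdot> (f \<unlhd> (Z \<otimes> x))))"
  proof -
    have "f \<otimes>\<^sub>a g = (Ide C ?P \<otimes>\<^sub>a g) \<cdot> (f \<otimes>\<^sub>a Ide C Z)"
      by (simp add: ten_merge)
    then show ?thesis
      by (simp add: self.act_assoc_nat_mid[THEN ten_chain] self.act_assoc_nat_ract)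
  qed
  also have "\<dots> = ((mult (coprod b d) \<unlhd> x) \<cdot> (?a ?P ?P x \<cdot> (?a ?B ?D (?P \<otimes> x) \<cdot> (?B \<unrhd> (?D \<unrhd> ?a ?B ?D x))))) \<cdot>
      ((?B \<unrhd> (?D \<unrhd> G)) \<cdot> F)"
    unfolding eqF eqG by (simp add: self.act_assoc_nat_lact[THEN ten_chain])
  also have "\<dots> = ?a ?B ?D x \<cdot> (comp_mul b d (?D \<otimes> x) (self.mul d x) \<cdot> ((?B \<unrhd> (?D \<unrhd> G)) \<cdot> F))"
    unfolding coprod_mult_ract[OF assms(1-3)] by simp
  finally show ?thesis .
qed

lemma comm_monoid_coprod:
  assumes [simp]: "comm_monoid_obj C b" "comm_monoid_obj C d"
  shows "comm_monoid_obj C (coprod b d)"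
proof (rule comm_monoid_objI)
  let ?B = "carr b" and ?D = "carr d" and ?a = "assoc C" and ?P = "carr b \<otimes> carr d" and ?s = "self.sw"
  let ?m = "mult (coprod b d)" and ?t = "comp_mul b d (carr d) (mult d)"
  let ?K = "\<lambda>x. ?a ?B ?D (?P \<otimes> x) \<cdot> (?B \<unrhd> (?D \<unrhd> ?a ?B ?D x))"
  \<comment> \<open>\<open>?K\<close> rebrackets a word with the letters \<open>b\<close>,
    \<open>d\<close>, \<open>b\<close>, \<open>d\<close> into two copies of
    \<open>b \<otimes> d\<close>. After precomposing with it \<open>coprod_mult_ract\<close>
    applies, and what remains is \<open>comp_mul_assoc\<close> for \<open>mult d\<close>.\<close>
  have "?m \<cdot> ((?m \<unlhd> ?P) \<cdot> ?a ?P ?P ?P) = ?m \<cdot> (?P \<unrhd> ?m)"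
  proof (rule A.iso_cancel_right[of "?K ?P"])
    have "(?m \<cdot> ((?m \<unlhd> ?P) \<cdot> ?a ?P ?P ?P)) \<cdot> ?K ?P =
       ?m \<cdot> (?a ?B ?D ?P \<cdot> comp_mul b d (?D \<otimes> ?P) (self.mul d ?P))"
      by (simp add: coprod_mult_ract)
    also have "\<dots> = ?t \<cdot> comp_mul b d (?D \<otimes> ?P) (self.mul d ?P)"
      by (simp add: coprod_mult_assoc[THEN ten_chain])
    also have "\<dots> = ?t \<cdot> (?B \<unrhd> (?D \<unrhd> ?t))"
      by (rule comp_mul_assoc[symmetric]) (simp_all add: comm_monoid_laws')
    also have "\<dots> = ?m \<cdot> (?a ?B ?D ?P \<cdot> (?B \<unrhd> (?D \<unrhd> (?m \<cdot> ?a ?B ?D ?P))))"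
      by (simp only: coprod_mult_assoc[OF assms]) (simp add: coprod_mult_assoc[THEN ten_chain])
    also have "\<dots> = (?m \<cdot> (?P \<unrhd> ?m)) \<cdot> ?K ?P"
      by (simp add: self.act_assoc_nat_lact[THEN ten_chain])
    finally show "(?m \<cdot> ((?m \<unlhd> ?P) \<cdot> ?a ?P ?P ?P)) \<cdot> ?K ?P = (?m \<cdot> (?P \<unrhd> ?m)) \<cdot> ?K ?P" .
    show "is_iso C (?K ?P)" by (rule A.is_iso_Cmp) simp_all
  qed simp_all
  then show "?m \<cdot> ((?m \<unlhd> carr (coprod b d)) \<cdot> ?a (carr (coprod b d)) (carr (coprod b d)) (carr (coprod b d))) =
     ?m \<cdot> (carr (coprod b d) \<unrhd> ?m)" by simp
  have "?m \<cdot> (unit (coprod b d) \<unlhd> ?P) = ?t \<cdot> (self.un b (?D \<otimes> ?P) \<cdot> (self.un d ?P \<cdot> lunit C ?P))"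
    by (simp add: coprod_def self.un_ract unit_ract)
  also have "\<dots> = lunit C ?P"
  proof -
    have u: "(?B \<unrhd> ?s ?D ?B ?D) \<cdot> self.un b (?D \<otimes> ?P) = self.un b (?B \<otimes> (?D \<otimes> ?D)) \<cdot> ?s ?D ?B ?D"
      by (simp add: self.un_nat)
    have v: "(?B \<unrhd> mult d) \<cdot> (?B \<unrhd> self.un d ?D) = Ide C ?P"
      by (simp add: comm_monoid_laws'(4)[THEN self.lact_lift])
    show ?thesis
      by (simp add: comp_mul_def u[THEN ten_chain] self.mul_un_left[THEN ten_chain] self.sw_un[THEN ten_chain]
        v[THEN ten_chain])
  qed
  finally show "?m \<cdot> (unit (coprod b d) \<unlhd> carr (coprod b d)) = lunit C (carr (coprod b d))" by simp
  have "?m \<cdot> braid C ?P ?P = ?m"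
  proof (rule ract_unit_eqI)
    let ?x = "\<one>"
    note hex = self.sw_hexagon self.sw_hexagon'
    \<comment> \<open>Exchanging two copies of \<open>b \<otimes> d\<close> splits, by the hexagons,
      into exchanges of the four letters.\<close>
    have h: "?s ?P ?P ?x \<cdot> ?K ?x = (?P \<unrhd> ?a ?B ?D ?x) \<cdot> (?a ?B ?D (?B \<otimes> (?D \<otimes> ?x)) \<cdot>
      ((?B \<unrhd> ?s ?B ?D (?D \<otimes> ?x)) \<cdot> (?s ?B ?B (?D \<otimes> (?D \<otimes> ?x)) \<cdot>
       ((?B \<unrhd> (?B \<unrhd> ?s ?D ?D ?x)) \<cdot> (?B \<unrhd> ?s ?D ?B (?D \<otimes> ?x))))))"
      by (simp add: hex hex[THEN ten_chain] hex[THEN self.lact_lift] hex[THEN self.lact_lift, THEN ten_chain])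
    have mb: "(?m \<unlhd> ?x) \<cdot> (?a ?P ?P ?x \<cdot> ?s ?P ?P ?x) = ((?m \<cdot> braid C ?P ?P) \<unlhd> ?x) \<cdot> ?a ?P ?P ?x"
      by (simp add: self.sw_def)
    have "(((?m \<cdot> braid C ?P ?P) \<unlhd> ?x) \<cdot> ?a ?P ?P ?x) \<cdot> ?K ?x = (?m \<unlhd> ?x) \<cdot> (?a ?P ?P ?x \<cdot> (?s ?P ?P ?x \<cdot> ?K ?x))"
      unfolding mb[symmetric] by simp
    also have "\<dots> = ((?m \<unlhd> ?x) \<cdot> (?a ?P ?P ?x \<cdot> ?K ?x)) \<cdot> ((?B \<unrhd> ?s ?B ?D (?D \<otimes> ?x)) \<cdot> (?s ?B ?B (?D \<otimes> (?D \<otimes> ?x)) \<cdot>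
       ((?B \<unrhd> (?B \<unrhd> ?s ?D ?D ?x)) \<cdot> (?B \<unrhd> ?s ?D ?B (?D \<otimes> ?x)))))"
      unfolding h by (simp add: self.act_assoc_nat_lact[THEN ten_chain])
    also have "\<dots> = ?a ?B ?D ?x \<cdot> (comp_mul b d (?D \<otimes> ?x) (self.mul d ?x) \<cdot> ((?B \<unrhd> ?s ?B ?D (?D \<otimes> ?x)) \<cdot> (?s ?B ?B (?D \<otimes> (?D \<otimes> ?x)) \<cdot>
       ((?B \<unrhd> (?B \<unrhd> ?s ?D ?D ?x)) \<cdot> (?B \<unrhd> ?s ?D ?B (?D \<otimes> ?x))))))"
      unfolding coprod_mult_ract[OF assms tunit_Obj] by simp
    also have "\<dots> = ?a ?B ?D ?x \<cdot> comp_mul b d (?D \<otimes> ?x) (self.mul d ?x)"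
    proof -
      \<comment> \<open>The exchange contained in \<open>comp_mul\<close> cancels against one mixed
        exchange of letters, and the other mixed one takes its place; those of \<open>b\<close> with
        \<open>b\<close> and of \<open>d\<close> with \<open>d\<close> are absorbed by the
        commutative multiplications.\<close>
      have 1: "(?B \<unrhd> ?s ?D ?B (?D \<otimes> ?x)) \<cdot> (?B \<unrhd> ?s ?B ?D (?D \<otimes> ?x)) = Ide C (?B \<otimes> (?B \<otimes> (?D \<otimes> (?D \<otimes> ?x))))"
        by (simp add: self.sw_sw[THEN self.lact_lift])
      show ?thesis
        by (simp add: comp_mul_def 1[THEN ten_chain] self.mul_sw[THEN ten_chain] nat_chains
          self.mul_sw[THEN self.lact_lift, THEN ten_chain])
    qed
    also have "\<dots> = ((?m \<unlhd> ?x) \<cdot> ?a ?P ?P ?x) \<cdot> ?K ?x"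
      by (simp add: coprod_mult_ract)
    finally have "((?m \<cdot> braid C ?P ?P) \<unlhd> ?x) \<cdot> ?a ?P ?P ?x = (?m \<unlhd> ?x) \<cdot> ?a ?P ?P ?x"
      by (rule A.iso_cancel_right[rotated -1]) (simp_all add: A.is_iso_Cmp)
    then show "(?m \<cdot> braid C ?P ?P) \<unlhd> ?x = ?m \<unlhd> ?x"
      by (rule A.iso_cancel_right[rotated -1]) simp_all
  qed simp_all
  then show "?m \<cdot> braid C (carr (coprod b d)) (carr (coprod b d)) = ?m" by simp
qed simp_all

end

section \<open>Injections and universal property of the coproduct\<close>

context symmetric_monoidal
begin

definition coprod_inl where
  "coprod_inl b d = (carr b \<unrhd> unit d) \<cdot> A.inv_arr (runit C (carr b))"

definition coprod_inr where
  "coprod_inr b d = self.un b (carr d)"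

lemma coprod_in_simps [simp]:
  assumes "comm_monoid_obj C b" "comm_monoid_obj C d"
  shows "coprod_inl b d \<in> Arr C" "Dom C (coprod_inl b d) = carr b" "Cod C (coprod_inl b d) = carr b \<otimes> carr d"
    "coprod_inr b d \<in> Arr C" "Dom C (coprod_inr b d) = carr d" "Cod C (coprod_inr b d) = carr b \<otimes> carr d"
  using assms by (simp_all add: coprod_inl_def coprod_inr_def)

lemma coprod_inl_ract:
  assumes [simp]: "comm_monoid_obj C b" "comm_monoid_obj C d" "x \<in> Obj C"
  shows "coprod_inl b d \<unlhd> x = assoc C (carr b) (carr d) x \<cdot> (carr b \<unrhd> self.un d x)"
proof -
  have 1: "(runit C (carr b) \<unlhd> x) \<cdot> (A.inv_arr (runit C (carr b)) \<unlhd> x) = Ide C (carr b \<otimes> x)"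
    by (simp flip: self.ract_Cmp)
  have "assoc C (carr b) \<one> x \<cdot> (carr b \<unrhd> A.inv_arr (lunit C x)) = A.inv_arr (runit C (carr b)) \<unlhd> x"
    by (rule A.iso_cancel_left[of "runit C (carr b) \<unlhd> x"])
      (simp_all add: 1 self.act_triangle_right'[THEN ten_chain])
  then show ?thesis
    by (simp add: coprod_inl_def self.un_def self.act_assoc_nat_mid[THEN ten_chain] tensor_lact)
qed

lemma coprod_inr_ract:
  assumes [simp]: "comm_monoid_obj C b" "comm_monoid_obj C d" "x \<in> Obj C"
  shows "coprod_inr b d \<unlhd> x = assoc C (carr b) (carr d) x \<cdot> self.un b (carr d \<otimes> x)"
  by (simp add: coprod_inr_def self.un_ract)

lemma monoid_map_coprod_inl:
  assumes [simp]: "comm_monoid_obj C b" "comm_monoid_obj C d"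
  shows "monoid_map b (coprod b d) (coprod_inl b d)"
  unfolding monoid_map_def
proof (intro conjI)
  let ?B = "carr b" and ?D = "carr d" and ?a = "assoc C" and ?x = "\<one>" and ?i = "coprod_inl b d"
  have un: "self.un d (?D \<otimes> \<one>) \<cdot> self.un d \<one> = (?D \<unrhd> self.un d \<one>) \<cdot> self.un d \<one>"
    by (simp add: self.un_nat)
  have w: "comp_mul b d (?D \<otimes> ?x) (self.mul d ?x) \<cdot> ((?B \<unrhd> (?D \<unrhd> (?B \<unrhd> self.un d ?x))) \<cdot> (?B \<unrhd> self.un d (?B \<otimes> ?x))) =
     (?B \<unrhd> self.un d ?x) \<cdot> self.mul b ?x"
  proof -
    have 1: "(?D \<unrhd> (?B \<unrhd> self.un d ?x)) \<cdot> self.un d (?B \<otimes> ?x) = self.un d (?B \<otimes> (?D \<otimes> ?x)) \<cdot> (?B \<unrhd> self.un d ?x)"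
      by (simp add: self.un_nat)
    show ?thesis
      by (simp add: comp_mul_def nat_chains 1[THEN self.lact_lift] self.sw_un[THEN self.lact_lift, THEN ten_chain]
        self.mul_un_left[THEN self.lact_lift, THEN ten_chain])
  qed
  show "?i \<cdot> mult b = mult (coprod b d) \<cdot> (?i \<otimes>\<^sub>a ?i)"
  proof (rule ract_unit_eqI)
    have "((mult (coprod b d) \<cdot> (?i \<otimes>\<^sub>a ?i)) \<unlhd> ?x) \<cdot> ?a ?B ?B ?x =
      ?a ?B ?D ?x \<cdot> (comp_mul b d (?D \<otimes> ?x) (self.mul d ?x) \<cdot> ((?B \<unrhd> (?D \<unrhd> (?B \<unrhd> self.un d ?x))) \<cdot> (?B \<unrhd> self.un d (?B \<otimes> ?x))))"
      by (rule coprod_product_ract) (simp_all add: coprod_inl_ract)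
    also have "\<dots> = ((?i \<cdot> mult b) \<unlhd> ?x) \<cdot> ?a ?B ?B ?x"
      unfolding w by (simp add: coprod_inl_ract self.mul_def)
    finally show "(?i \<cdot> mult b) \<unlhd> \<one> = (mult (coprod b d) \<cdot> (?i \<otimes>\<^sub>a ?i)) \<unlhd> \<one>"
      by (rule A.iso_cancel_right[OF _ _ _ _ _ sym, rotated -1]) simp_all
  qed simp_all
  show "?i \<cdot> unit b = unit (coprod b d)"
  proof (rule ract_unit_eqI)
    have 1: "(?B \<unrhd> self.un d \<one>) \<cdot> self.un b \<one> = self.un b (?D \<otimes> \<one>) \<cdot> self.un d \<one>"
      by (simp add: self.un_nat)
    show "(?i \<cdot> unit b) \<unlhd> \<one> = unit (coprod b d) \<unlhd> \<one>"
      by (simp add: coprod_inl_ract unit_ract 1[THEN ten_chain] coprod_def self.un_ract)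
  qed simp_all
qed simp_all

lemma monoid_map_coprod_inr:
  assumes [simp]: "comm_monoid_obj C b" "comm_monoid_obj C d"
  shows "monoid_map d (coprod b d) (coprod_inr b d)"
  unfolding monoid_map_def
proof (intro conjI)
  let ?B = "carr b" and ?D = "carr d" and ?a = "assoc C" and ?x = "\<one>" and ?i = "coprod_inr b d"
  have w: "comp_mul b d (?D \<otimes> ?x) (self.mul d ?x) \<cdot> ((?B \<unrhd> (?D \<unrhd> self.un b (?D \<otimes> ?x))) \<cdot> self.un b (?D \<otimes> (?D \<otimes> ?x))) =
     self.un b (?D \<otimes> ?x) \<cdot> self.mul d ?x"
    by (simp add: comp_mul_def self.sw_un'[THEN self.lact_lift, THEN ten_chain]
        self.mul_un_right[THEN ten_chain] self.un_nat)
  show "?i \<cdot> mult d = mult (coprod b d) \<cdot> (?i \<otimes>\<^sub>a ?i)"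
  proof (rule ract_unit_eqI)
    have "((mult (coprod b d) \<cdot> (?i \<otimes>\<^sub>a ?i)) \<unlhd> ?x) \<cdot> ?a ?D ?D ?x =
      ?a ?B ?D ?x \<cdot> (comp_mul b d (?D \<otimes> ?x) (self.mul d ?x) \<cdot> ((?B \<unrhd> (?D \<unrhd> self.un b (?D \<otimes> ?x))) \<cdot> self.un b (?D \<otimes> (?D \<otimes> ?x))))"
      by (rule coprod_product_ract) (simp_all add: coprod_inr_ract)
    also have "\<dots> = ((?i \<cdot> mult d) \<unlhd> ?x) \<cdot> ?a ?D ?D ?x"
      unfolding w by (simp add: coprod_inr_ract self.mul_def)
    finally show "(?i \<cdot> mult d) \<unlhd> \<one> = (mult (coprod b d) \<cdot> (?i \<otimes>\<^sub>a ?i)) \<unlhd> \<one>"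
      by (rule A.iso_cancel_right[OF _ _ _ _ _ sym, rotated -1]) simp_all
  qed simp_all
  show "?i \<cdot> unit d = unit (coprod b d)"
    by (simp add: coprod_inr_def coprod_def)
qed simp_all

text \<open>Its purpose is uniqueness: it shows that every homomorphism out of
  \<open>b \<otimes> d\<close> is the product of its two restrictions.\<close>

lemma coprod_inl_inr:
  assumes [simp]: "comm_monoid_obj C b" "comm_monoid_obj C d"
  shows "mult (coprod b d) \<cdot> (coprod_inl b d \<otimes>\<^sub>a coprod_inr b d) = Ide C (carr b \<otimes> carr d)"
proof (rule ract_unit_eqI)
  let ?B = "carr b" and ?D = "carr d" and ?a = "assoc C" and ?x = "\<one>"
  have w: "comp_mul b d (?D \<otimes> ?x) (self.mul d ?x) \<cdot> ((?B \<unrhd> (?D \<unrhd> self.un b (?D \<otimes> ?x))) \<cdot> (?B \<unrhd> self.un d (?D \<otimes> ?x))) =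
     Ide C (?B \<otimes> (?D \<otimes> ?x))"
    by (simp add: comp_mul_def self.sw_un'[THEN self.lact_lift, THEN ten_chain]
        self.mul_un_right[THEN ten_chain] self.mul_un_left[THEN self.lact_lift])
  have "((mult (coprod b d) \<cdot> (coprod_inl b d \<otimes>\<^sub>a coprod_inr b d)) \<unlhd> ?x) \<cdot> ?a ?B ?D ?x =
    ?a ?B ?D ?x \<cdot> (comp_mul b d (?D \<otimes> ?x) (self.mul d ?x) \<cdot> ((?B \<unrhd> (?D \<unrhd> self.un b (?D \<otimes> ?x))) \<cdot> (?B \<unrhd> self.un d (?D \<otimes> ?x))))"
    by (rule coprod_product_ract) (simp_all add: coprod_inr_ract coprod_inl_ract)
  then show "(mult (coprod b d) \<cdot> (coprod_inl b d \<otimes>\<^sub>a coprod_inr b d)) \<unlhd> \<one> = Ide C (?B \<otimes> ?D) \<unlhd> \<one>"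
    unfolding w by (rule_tac A.iso_cancel_right[of "?a ?B ?D ?x"]) simp_all
qed simp_all

text \<open>Multiplicativity holds because \<open>X\<close> is commutative: rewritten in words, both sides multiply the
  same four factors, in the orders \<open>b b d d\<close> and \<open>b d b d\<close>.\<close>

lemma monoid_map_copair:
  assumes [simp]: "comm_monoid_obj C b" "comm_monoid_obj C d" "comm_monoid_obj C X"
    and p: "monoid_map b X p" and q: "monoid_map d X q"
  shows "monoid_map (coprod b d) X (mult X \<cdot> (p \<otimes>\<^sub>a q))" (is "monoid_map _ _ ?F")
    and "(mult X \<cdot> (p \<otimes>\<^sub>a q)) \<cdot> coprod_inl b d = p" and "(mult X \<cdot> (p \<otimes>\<^sub>a q)) \<cdot> coprod_inr b d = q"
proof -
  let ?B = "carr b" and ?D = "carr d" and ?X = "carr X" and ?a = "assoc C" and ?P = "carr b \<otimes> carr d"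
  let ?s = "self.sw" and ?m = "self.mul X" and ?M = "mult (coprod b d)"
  note [simp] = monoid_mapD(1-3)[OF p] monoid_mapD(1-3)[OF q]
  \<comment> \<open>The copairing in words: the letters from \<open>b\<close> and \<open>d\<close>
    are sent to \<open>X\<close> and multiplied there.\<close>
  define \<Phi> where "\<Phi> x = ?m x \<cdot> ((?X \<unrhd> (q \<unlhd> x)) \<cdot> (p \<unlhd> (?D \<otimes> x)))" for x
  have [simp]: "\<Phi> x \<in> Arr C" "Dom C (\<Phi> x) = ?B \<otimes> (?D \<otimes> x)" "Cod C (\<Phi> x) = ?X \<otimes> x" if "x \<in> Obj C" for x
    using that by (simp_all add: \<Phi>_def)
  have \<Phi>: "(?F \<unlhd> x) \<cdot> ?a ?B ?D x = \<Phi> x" if "x \<in> Obj C" for x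
    unfolding \<Phi>_def by (rule self.product_ract) (use that in simp_all)
  have \<Phi>_nat: "\<Phi> y \<cdot> (?B \<unrhd> (?D \<unrhd> h)) = (?X \<unrhd> h) \<cdot> \<Phi> x" if "h \<in> Arr C" "Dom C h = x" "Cod C h = y" for h x y
    using that A.Dom_Cod_Obj[of h] by (auto simp: \<Phi>_def nat_chains)
  have pu: "(p \<unlhd> x) \<cdot> self.un b x = self.un X x" and qu: "(q \<unlhd> x) \<cdot> self.un d x = self.un X x"
    and pm: "(p \<unlhd> x) \<cdot> self.mul b x = ?m x \<cdot> ((?X \<unrhd> (p \<unlhd> x)) \<cdot> (p \<unlhd> (?B \<otimes> x)))"
    and qm: "(q \<unlhd> x) \<cdot> self.mul d x = ?m x \<cdot> ((?X \<unrhd> (q \<unlhd> x)) \<cdot> (q \<unlhd> (?D \<otimes> x)))" if "x \<in> Obj C" for x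
    using that p q by (simp_all add: self.ract_un self.ract_mul)
  have \<Phi>_mul: "\<Phi> x \<cdot> comp_mul b d (?D \<otimes> x) (self.mul d x) = ?m x \<cdot> ((?X \<unrhd> \<Phi> x) \<cdot> \<Phi> (?B \<otimes> (?D \<otimes> x)))"
    if [simp]: "x \<in> Obj C" for x
  proof -
    \<comment> \<open>The common normal form: the four letters go to \<open>X\<close> before any
      multiplication. The exchange of the two middle letters thereby takes place in
      \<open>X\<close>, where commutativity absorbs it.\<close>
    let ?Q = "?m x \<cdot> (?m (?X \<otimes> x) \<cdot> ((?X \<unrhd> ?m (?X \<otimes> x)) \<cdot> ((?X \<unrhd> (?X \<unrhd> (?X \<unrhd> (q \<unlhd> x)))) \<cdot>
      ((?X \<unrhd> (?X \<unrhd> (p \<unlhd> (?D \<otimes> x)))) \<cdot> ((?X \<unrhd> (q \<unlhd> (?B \<otimes> (?D \<otimes> x)))) \<cdot> (p \<unlhd> (?D \<otimes> (?B \<otimes> (?D \<otimes> x)))))))))"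
    have sr: "?s A B m \<cdot> (f \<unlhd> (B \<otimes> m)) = (B \<unrhd> (f \<unlhd> m)) \<cdot> ?s (Dom C f) B m"
      if "f \<in> Arr C" "B \<in> Obj C" "m \<in> Obj C" "A = Cod C f" for A B f m
      using that by (simp add: self.sw_nat_ract)
    have "\<Phi> x \<cdot> comp_mul b d (?D \<otimes> x) (self.mul d x) = ?m x \<cdot> ((?X \<unrhd> (q \<unlhd> x)) \<cdot> ((p \<unlhd> (?D \<otimes> x)) \<cdot> ((?B \<unrhd> self.mul d x) \<cdot>
        (self.mul b (?D \<otimes> (?D \<otimes> x)) \<cdot> (?B \<unrhd> ?s ?D ?B (?D \<otimes> x))))))"
      by (simp add: \<Phi>_def comp_mul_def)
    also have "\<dots> = ?m x \<cdot> ((?X \<unrhd> ?m x) \<cdot> ((?X \<unrhd> (?X \<unrhd> (q \<unlhd> x))) \<cdot> ((?X \<unrhd> (q \<unlhd> (?D \<otimes> x))) \<cdot>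
        (?m (?D \<otimes> (?D \<otimes> x)) \<cdot> ((?X \<unrhd> (p \<unlhd> (?D \<otimes> (?D \<otimes> x)))) \<cdot> ((p \<unlhd> (?B \<otimes> (?D \<otimes> (?D \<otimes> x)))) \<cdot>
        (?B \<unrhd> ?s ?D ?B (?D \<otimes> x))))))))"
      by (simp add: self.ract_lact[THEN ten_chain] qm[THEN self.lact_lift, THEN ten_chain] pm[THEN ten_chain])
    also have "\<dots> = ?m x \<cdot> ((?X \<unrhd> ?m x) \<cdot> (?m (?X \<otimes> (?X \<otimes> x)) \<cdot> ((?X \<unrhd> (?X \<unrhd> (?X \<unrhd> (q \<unlhd> x)))) \<cdot>
        ((?X \<unrhd> ((?X \<unrhd> (q \<unlhd> (?D \<otimes> x))) \<cdot> ((p \<unlhd> (?D \<otimes> (?D \<otimes> x))) \<cdot> ?s ?D ?B (?D \<otimes> x)))) \<cdot>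
         (p \<unlhd> (?D \<otimes> (?B \<otimes> (?D \<otimes> x))))))))"
      by (simp add: self.ract_lact self.mul_nat[symmetric, THEN ten_chain] nat_chains)
    also have "(?X \<unrhd> (q \<unlhd> (?D \<otimes> x))) \<cdot> ((p \<unlhd> (?D \<otimes> (?D \<otimes> x))) \<cdot> ?s ?D ?B (?D \<otimes> x)) =
      ?s ?X ?X (?D \<otimes> x) \<cdot> ((?X \<unrhd> (p \<unlhd> (?D \<otimes> x))) \<cdot> (q \<unlhd> (?B \<otimes> (?D \<otimes> x))))"
    proof -
      have "(p \<unlhd> (?D \<otimes> (?D \<otimes> x))) \<cdot> ?s ?D ?B (?D \<otimes> x) = ?s ?D ?X (?D \<otimes> x) \<cdot> (?D \<unrhd> (p \<unlhd> (?D \<otimes> x)))"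
        by (simp add: self.sw_nat_mid)
      moreover have "(?X \<unrhd> (q \<unlhd> (?D \<otimes> x))) \<cdot> ?s ?D ?X (?D \<otimes> x) = ?s ?X ?X (?D \<otimes> x) \<cdot> (q \<unlhd> (?X \<otimes> (?D \<otimes> x)))"
        by (simp add: sr)
      note this[THEN ten_chain]
      ultimately show ?thesis
        by (simp add: self.ract_lact)
    qed
    also have "?m x \<cdot> ((?X \<unrhd> ?m x) \<cdot> (?m (?X \<otimes> (?X \<otimes> x)) \<cdot> ((?X \<unrhd> (?X \<unrhd> (?X \<unrhd> (q \<unlhd> x)))) \<cdot>
        ((?X \<unrhd> (?s ?X ?X (?D \<otimes> x) \<cdot> ((?X \<unrhd> (p \<unlhd> (?D \<otimes> x))) \<cdot> (q \<unlhd> (?B \<otimes> (?D \<otimes> x)))))) \<cdot>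
         (p \<unlhd> (?D \<otimes> (?B \<otimes> (?D \<otimes> x)))))))) = ?Q"
    proof -
      have "(?X \<unrhd> (?X \<unrhd> (?X \<unrhd> (q \<unlhd> x)))) \<cdot> (?X \<unrhd> ?s ?X ?X (?D \<otimes> x)) =
        (?X \<unrhd> ?s ?X ?X (?X \<otimes> x)) \<cdot> (?X \<unrhd> (?X \<unrhd> (?X \<unrhd> (q \<unlhd> x))))"
        by (simp add: nat_chains)
      note 1 = this[THEN ten_chain]
      have 2: "?m x \<cdot> ((?X \<unrhd> ?m x) \<cdot> (?m (?X \<otimes> (?X \<otimes> x)) \<cdot> t)) = ?m x \<cdot> (?m (?X \<otimes> x) \<cdot> ((?X \<unrhd> ?m (?X \<otimes> x)) \<cdot> t))"
        if "t \<in> Arr C" "Cod C t = ?X \<otimes> (?X \<otimes> (?X \<otimes> (?X \<otimes> x)))" for t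
        using that by (simp add: self.mul_assoc[THEN ten_chain])
      show ?thesis
        by (simp add: 1 2 self.mul_sw[THEN self.lact_lift, THEN ten_chain])
    qed
    also have "?Q = ?m x \<cdot> ((?X \<unrhd> \<Phi> x) \<cdot> \<Phi> (?B \<otimes> (?D \<otimes> x)))"
    proof -
      have 2: "?m x \<cdot> ((?X \<unrhd> ?m x) \<cdot> t) = ?m x \<cdot> (?m (?X \<otimes> x) \<cdot> t)"
        if "t \<in> Arr C" "Cod C t = ?X \<otimes> (?X \<otimes> (?X \<otimes> x))" for t
        using that by (simp add: self.mul_assoc[THEN ten_chain])
      have 3: "(?X \<unrhd> (?X \<unrhd> (q \<unlhd> x))) \<cdot> ((?X \<unrhd> (p \<unlhd> (?D \<otimes> x))) \<cdot> (?m (?B \<otimes> (?D \<otimes> x)) \<cdot> t)) =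
        ?m (?X \<otimes> (?X \<otimes> x)) \<cdot> ((?X \<unrhd> (?X \<unrhd> (?X \<unrhd> (q \<unlhd> x)))) \<cdot> ((?X \<unrhd> (?X \<unrhd> (p \<unlhd> (?D \<otimes> x)))) \<cdot> t))"
        if "t \<in> Arr C" "Cod C t = ?X \<otimes> (?X \<otimes> (?B \<otimes> (?D \<otimes> x)))" for t
        using that by (simp add: nat_chains)
      show ?thesis
        by (simp add: \<Phi>_def 2 3 self.mul_assoc[THEN ten_chain])
    qed
    finally show ?thesis .
  qed
  show "monoid_map (coprod b d) X ?F"
    unfolding monoid_map_def
  proof (intro conjI)
    let ?x = "\<one>"
    let ?K = "?a ?B ?D (?P \<otimes> ?x) \<cdot> (?B \<unrhd> (?D \<unrhd> ?a ?B ?D ?x))"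
    show "?F \<cdot> ?M = mult X \<cdot> (?F \<otimes>\<^sub>a ?F)"
    proof (rule ract_unit_eqI)
      have "((mult X \<cdot> (?F \<otimes>\<^sub>a ?F)) \<unlhd> ?x) \<cdot> (?a ?P ?P ?x \<cdot> ?K) = (((mult X \<cdot> (?F \<otimes>\<^sub>a ?F)) \<unlhd> ?x) \<cdot> ?a ?P ?P ?x) \<cdot> ?K"
        by (rule A.Cmp_assoc'[symmetric]) simp_all
      also have "((mult X \<cdot> (?F \<otimes>\<^sub>a ?F)) \<unlhd> ?x) \<cdot> ?a ?P ?P ?x = ?m ?x \<cdot> ((?X \<unrhd> (?F \<unlhd> ?x)) \<cdot> (?F \<unlhd> (?P \<otimes> ?x)))"
        by (rule self.product_ract) simp_all
      also have "\<dots> \<cdot> ?K = ?m ?x \<cdot> ((?X \<unrhd> (?F \<unlhd> ?x)) \<cdot> (((?F \<unlhd> (?P \<otimes> ?x)) \<cdot> ?a ?B ?D (?P \<otimes> ?x)) \<cdot> (?B \<unrhd> (?D \<unrhd> ?a ?B ?D ?x))))"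
        by (simp del: self.ract_Cmp)
      also have "\<dots> = ?m ?x \<cdot> ((?X \<unrhd> ((?F \<unlhd> ?x) \<cdot> ?a ?B ?D ?x)) \<cdot> \<Phi> (?B \<otimes> (?D \<otimes> ?x)))"
        by (simp add: \<Phi> \<Phi>[THEN self.lact_lift, THEN ten_chain] \<Phi>[THEN self.lact_lift] \<Phi>_nat del: self.ract_Cmp)
      also have "\<dots> = ((?F \<unlhd> ?x) \<cdot> ?a ?B ?D ?x) \<cdot> comp_mul b d (?D \<otimes> ?x) (self.mul d ?x)"
        unfolding \<Phi>[OF tunit_Obj] by (simp add: \<Phi>_mul)
      also have "\<dots> = (?F \<unlhd> ?x) \<cdot> ((?M \<unlhd> ?x) \<cdot> (?a ?P ?P ?x \<cdot> ?K))"
        unfolding coprod_mult_ract[OF assms(1,2) tunit_Obj] by (rule A.Cmp_assoc') simp_all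
      also have "\<dots> = ((?F \<cdot> ?M) \<unlhd> ?x) \<cdot> (?a ?P ?P ?x \<cdot> ?K)"
        by simp
      finally show "(?F \<cdot> ?M) \<unlhd> ?x = (mult X \<cdot> (?F \<otimes>\<^sub>a ?F)) \<unlhd> ?x"
        by (rule A.iso_cancel_right[OF _ _ _ _ _ sym, rotated -1]) (simp_all add: A.is_iso_Cmp)
    qed simp_all
    show "?F \<cdot> unit (coprod b d) = unit X"
    proof (rule ract_unit_eqI)
      have "(?F \<cdot> unit (coprod b d)) \<unlhd> ?x = ((?F \<unlhd> ?x) \<cdot> ?a ?B ?D ?x) \<cdot> (self.un b (?D \<otimes> ?x) \<cdot> (self.un d ?x \<cdot> lunit C ?x))"
        by (simp add: coprod_def self.un_ract unit_ract)
      also have "\<dots> = ?m ?x \<cdot> ((?X \<unrhd> (q \<unlhd> ?x)) \<cdot> (self.un X (?D \<otimes> ?x) \<cdot> (self.un d ?x \<cdot> lunit C ?x)))"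
        unfolding \<Phi>[OF tunit_Obj] by (simp add: \<Phi>_def pu[THEN ten_chain])
      also have "\<dots> = (?m ?x \<cdot> self.un X (?X \<otimes> ?x)) \<cdot> (((q \<unlhd> ?x) \<cdot> self.un d ?x) \<cdot> lunit C ?x)"
        by (simp add: self.un_nat[THEN ten_chain])
      also have "\<dots> = unit X \<unlhd> ?x"
        by (simp add: self.mul_un_left unit_ract qu)
      finally show "(?F \<cdot> unit (coprod b d)) \<unlhd> \<one> = unit X \<unlhd> \<one>" .
    qed simp_all
  qed simp_all
  show "?F \<cdot> coprod_inl b d = p"
  proof (rule ract_unit_eqI)
    let ?x = "\<one>"
    have "(?F \<cdot> coprod_inl b d) \<unlhd> ?x = ((?F \<unlhd> ?x) \<cdot> ?a ?B ?D ?x) \<cdot> (?B \<unrhd> self.un d ?x)"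
      by (simp add: coprod_inl_ract)
    also have "\<dots> = p \<unlhd> ?x"
      unfolding \<Phi>[OF tunit_Obj]
      by (simp add: \<Phi>_def self.ract_lact qu[THEN self.lact_lift, THEN ten_chain] self.mul_un_right[THEN ten_chain])
    finally show "(?F \<cdot> coprod_inl b d) \<unlhd> \<one> = p \<unlhd> \<one>" .
  qed simp_all
  show "?F \<cdot> coprod_inr b d = q"
  proof (rule ract_unit_eqI)
    let ?x = "\<one>"
    have "(?F \<cdot> coprod_inr b d) \<unlhd> ?x = ((?F \<unlhd> ?x) \<cdot> ?a ?B ?D ?x) \<cdot> self.un b (?D \<otimes> ?x)"
      by (simp add: coprod_inr_ract)
    also have "\<dots> = ?m ?x \<cdot> ((?X \<unrhd> (q \<unlhd> ?x)) \<cdot> self.un X (?D \<otimes> ?x))"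
      unfolding \<Phi>[OF tunit_Obj] by (simp add: \<Phi>_def pu)
    also have "\<dots> = (?m ?x \<cdot> self.un X (?X \<otimes> ?x)) \<cdot> (q \<unlhd> ?x)"
      by (simp add: self.un_nat)
    also have "\<dots> = q \<unlhd> ?x" by (simp add: self.mul_un_left)
    finally show "(?F \<cdot> coprod_inr b d) \<unlhd> \<one> = q \<unlhd> \<one>" .
  qed simp_all
qed

end

context left_actegory
begin

text \<open>The pair of which \<open>b \<otimes>\<^sub>a d\<close> is the coequalizer, tensored with \<open>m\<close>.\<close>

lemma pushout_pair_ract:
  assumes [simp]: "comm_monoid_obj C b" "comm_monoid_obj C d" "f \<in> Arr C" "Dom C f = A" "Cod C f = carr b"
    "g \<in> Arr C" "Dom C g = A" "Cod C g = carr d" "m \<in> Obj M"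
  defines "i \<equiv> act_assoc M (carr b) (A \<otimes> carr d) m \<cdot>\<^bsub>M\<^esub> (carr b \<rhd> act_assoc M A (carr d) m)"
  shows "((self.mul b (carr d) \<cdot> (carr b \<unrhd> (f \<unlhd> carr d))) \<lhd> m) \<cdot>\<^bsub>M\<^esub> i =
      act_assoc M (carr b) (carr d) m \<cdot>\<^bsub>M\<^esub> (mul b (carr d \<odot>\<^bsub>M\<^esub> m) \<cdot>\<^bsub>M\<^esub> (carr b \<rhd> (f \<lhd> (carr d \<odot>\<^bsub>M\<^esub> m))))"
    and "((carr b \<unrhd> (mult d \<cdot> (g \<unlhd> carr d))) \<lhd> m) \<cdot>\<^bsub>M\<^esub> i =
      act_assoc M (carr b) (carr d) m \<cdot>\<^bsub>M\<^esub> (carr b \<rhd> (mul d m \<cdot>\<^bsub>M\<^esub> (g \<lhd> (carr d \<odot>\<^bsub>M\<^esub> m))))"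
proof -
  have A [simp]: "A \<in> Obj C" using A.Dom_Cod_Obj[of f] by simp
  have w: "((X \<unrhd> h) \<lhd> m) \<cdot>\<^bsub>M\<^esub> act_assoc M X y m = act_assoc M X (Cod C h) m \<cdot>\<^bsub>M\<^esub> (X \<rhd> (h \<lhd> m))"
    if "h \<in> Arr C" "X \<in> Obj C" "y = Dom C h" for h X y
    using that by (simp add: act_assoc_nat_mid tensor_lact)
  have v: "((h \<unlhd> X) \<lhd> m) \<cdot>\<^bsub>M\<^esub> act_assoc M y X m = act_assoc M (Cod C h) X m \<cdot>\<^bsub>M\<^esub> (h \<lhd> (X \<odot>\<^bsub>M\<^esub> m))"
    if "h \<in> Arr C" "X \<in> Obj C" "y = Dom C h" for h X y
    using that by (simp add: act_assoc_nat_ract tensor_ract)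
  have "((self.mul b (carr d) \<cdot> (carr b \<unrhd> (f \<unlhd> carr d))) \<lhd> m) \<cdot>\<^bsub>M\<^esub> i =
    ((self.mul b (carr d) \<lhd> m) \<cdot>\<^bsub>M\<^esub> (act_assoc M (carr b) (carr b \<otimes> carr d) m \<cdot>\<^bsub>M\<^esub> (carr b \<rhd> act_assoc M (carr b) (carr d) m)))
       \<cdot>\<^bsub>M\<^esub> (carr b \<rhd> (f \<lhd> (carr d \<odot>\<^bsub>M\<^esub> m)))"
    by (simp add: i_def w[THEN act_chain] v[THEN lact_lift])
  then show "((self.mul b (carr d) \<cdot> (carr b \<unrhd> (f \<unlhd> carr d))) \<lhd> m) \<cdot>\<^bsub>M\<^esub> i =
      act_assoc M (carr b) (carr d) m \<cdot>\<^bsub>M\<^esub> (mul b (carr d \<odot>\<^bsub>M\<^esub> m) \<cdot>\<^bsub>M\<^esub> (carr b \<rhd> (f \<lhd> (carr d \<odot>\<^bsub>M\<^esub> m))))"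
    by (simp add: mul_ract)
  have "((carr b \<unrhd> (mult d \<cdot> (g \<unlhd> carr d))) \<lhd> m) \<cdot>\<^bsub>M\<^esub> i =
    act_assoc M (carr b) (carr d) m \<cdot>\<^bsub>M\<^esub> (carr b \<rhd> ((mult d \<lhd> m) \<cdot>\<^bsub>M\<^esub> (((g \<unlhd> carr d) \<lhd> m) \<cdot>\<^bsub>M\<^esub> act_assoc M A (carr d) m)))"
    by (simp add: i_def w w[THEN act_chain])
  also have "\<dots> = act_assoc M (carr b) (carr d) m \<cdot>\<^bsub>M\<^esub> (carr b \<rhd> (mul d m \<cdot>\<^bsub>M\<^esub> (g \<lhd> (carr d \<odot>\<^bsub>M\<^esub> m))))"
    by (simp add: v mul_def)
  finally show "((carr b \<unrhd> (mult d \<cdot> (g \<unlhd> carr d))) \<lhd> m) \<cdot>\<^bsub>M\<^esub> i =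
      act_assoc M (carr b) (carr d) m \<cdot>\<^bsub>M\<^esub> (carr b \<rhd> (mul d m \<cdot>\<^bsub>M\<^esub> (g \<lhd> (carr d \<odot>\<^bsub>M\<^esub> m))))" .
qed

end

section \<open>Quotients and pushouts of commutative monoids\<close>

locale coeq_monoidal = symmetric_monoidal C
  for C :: "('o, 'a, 'y) smcat_scheme" (structure) +
  assumes ten_coeq_ex: "f \<in> Arr C \<Longrightarrow> g \<in> Arr C \<Longrightarrow> Dom C f = Dom C g \<Longrightarrow> Cod C f = Cod C g \<Longrightarrow> \<exists>q. is_coeq C f g q"
    and ten_lact_coeq: "X \<in> Obj C \<Longrightarrow> is_coeq C f g q \<Longrightarrow> is_coeq C (X \<unrhd> f) (X \<unrhd> g) (X \<unrhd> q)"
    and ten_ract_coeq: "X \<in> Obj C \<Longrightarrow> is_coeq C f g q \<Longrightarrow> is_coeq C (f \<unlhd> X) (g \<unlhd> X) (q \<unlhd> X)"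
begin

text \<open>The two equations for \<open>w\<close> say that the relation given by \<open>s\<close>
  and \<open>t\<close> is stable under multiplication by \<open>P\<close>, as for an ideal. Left
  multiplication therefore descends to the quotient, and the other factor follows by
  commutativity.\<close>

lemma quotient_monoid:
  assumes P: "comm_monoid_obj C P" and k: "is_coeq C s t k" and Dk: "Dom C k = carr P"
    and w: "w \<in> Arr C" "Dom C w = carr P \<otimes> Dom C s" "Cod C w = Dom C s"
    and sw: "mult P \<cdot> (carr P \<unrhd> s) = s \<cdot> w" and tw: "mult P \<cdot> (carr P \<unrhd> t) = t \<cdot> w"
  obtains e where "comm_monoid_obj C e" "carr e = Cod C k" "monoid_map P e k"
proof -
  define p E R where "p = carr P" and "E = Cod C k" and "R = Dom C s"
  note k' = is_coeqD[OF k]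
  have [simp]: "s \<in> Arr C" "t \<in> Arr C" "k \<in> Arr C" "Dom C s = R" "Dom C t = R" "Cod C s = p" "Cod C t = p"
    "Dom C k = p" "Cod C k = E" using k' Dk by (simp_all add: E_def R_def p_def)
  have [simp]: "R \<in> Obj C" "E \<in> Obj C" "p \<in> Obj C"
    using A.Dom_Cod_Obj[of s] A.Dom_Cod_Obj[of k] by simp_all
  note P' [simp] = comm_monoid_simps[OF P, folded p_def] and [simp] = P w[folded p_def, simplified]
  note laws = comm_monoid_laws(4)[OF P, folded p_def] comm_monoid_laws'(1,3)[OF P, folded p_def]
  note kst = k'(7)
  have epi_k: "is_epi C k" by (rule A.is_coeq_epi[OF k])
  have epi_l: "is_epi C (X \<unrhd> k)" and epi_r: "is_epi C (k \<unlhd> X)" if "X \<in> Obj C" for X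
    using A.is_coeq_epi ten_lact_coeq[OF that k] ten_ract_coeq[OF that k] by blast+
  have 1: "(k \<cdot> mult P) \<cdot> (p \<unrhd> s) = (k \<cdot> mult P) \<cdot> (p \<unrhd> t)"
    using sw tw kst[THEN ten_chain] by (simp add: p_def)
  \<comment> \<open>The multiplication descends one factor at a time: in \<nu> the right factor is
    passed to the quotient, in \<mu> below both are.\<close>
  obtain \<nu> where [simp]: "\<nu> \<in> Arr C" "Dom C \<nu> = p \<otimes> E" "Cod C \<nu> = E" and \<nu>: "\<nu> \<cdot> (p \<unrhd> k) = k \<cdot> mult P"
    by (rule is_coeq_ex[OF ten_lact_coeq[OF _ k] _ _ 1]) auto
  \<comment> \<open>By commutativity of \<open>P\<close>, a relation in the left factor becomes one
    in the right factor, which \<open>1\<close> already controls.\<close>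
  have br: "(k \<cdot> mult P) \<cdot> (u \<unlhd> p) = ((k \<cdot> mult P) \<cdot> (p \<unrhd> u)) \<cdot> braid C R p"
    if "u \<in> Arr C" "Dom C u = R" "Cod C u = p" for u
  proof -
    have "braid C p p \<cdot> (u \<unlhd> p) = (p \<unrhd> u) \<cdot> braid C R p"
      using braid_nat'[of u "Ide C p"] that by (simp add: tensor_lact tensor_ract)
    moreover have "(k \<cdot> mult P) \<cdot> (u \<unlhd> p) = (k \<cdot> (mult P \<cdot> braid C p p)) \<cdot> (u \<unlhd> p)"
      unfolding laws by simp
    ultimately show ?thesis using that by simp
  qed
  have 2: "\<nu> \<cdot> (s \<unlhd> E) = \<nu> \<cdot> (t \<unlhd> E)"
  proof (rule A.epiD[OF epi_l[of R]])
    have "(\<nu> \<cdot> (u \<unlhd> E)) \<cdot> (R \<unrhd> k) = (k \<cdot> mult P) \<cdot> (u \<unlhd> p)" if "u \<in> Arr C" "Dom C u = R" "Cod C u = p" for u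
      using that by (simp add: self.ract_lact \<nu>[THEN ten_chain])
    then show "(\<nu> \<cdot> (s \<unlhd> E)) \<cdot> (R \<unrhd> k) = (\<nu> \<cdot> (t \<unlhd> E)) \<cdot> (R \<unrhd> k)"
      by (simp only: br 1 \<open>s \<in> Arr C\<close> \<open>t \<in> Arr C\<close> \<open>Dom C s = R\<close> \<open>Dom C t = R\<close> \<open>Cod C s = p\<close> \<open>Cod C t = p\<close>)
  qed simp_all
  obtain \<mu> where [simp]: "\<mu> \<in> Arr C" "Dom C \<mu> = E \<otimes> E" "Cod C \<mu> = E" and \<mu>: "\<mu> \<cdot> (k \<unlhd> E) = \<nu>"
    by (rule is_coeq_ex[OF ten_ract_coeq[OF _ k] _ _ 2]) auto
  have kk: "k \<otimes>\<^sub>a k = (k \<unlhd> E) \<cdot> (p \<unrhd> k)"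
    by (simp add: ten_merge flip: tensor_lact tensor_ract)
  have epi_kk: "is_epi C (k \<otimes>\<^sub>a k)"
    unfolding kk by (rule A.epi_Cmp[OF epi_l epi_r]) simp_all
  have \<mu>k: "\<mu> \<cdot> (k \<otimes>\<^sub>a k) = k \<cdot> mult P"
    unfolding kk by (simp add: \<mu>[THEN ten_chain] \<nu>)
  let ?e = "\<lparr>carr = E, mult = \<mu>, unit = k \<cdot> unit P\<rparr>"
  have e: "comm_monoid_obj C ?e"
  proof (rule comm_monoid_objI, simp_all only: monoid_obj.simps)
    have epi3: "is_epi C (k \<otimes>\<^sub>a (k \<otimes>\<^sub>a k))"
    proof -
      have "is_epi C (p \<unrhd> (k \<otimes>\<^sub>a k))"
        unfolding kk by (simp, rule A.epi_Cmp)
          (use A.is_coeq_epi[OF ten_lact_coeq[OF _ ten_lact_coeq[OF _ k]]]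
             A.is_coeq_epi[OF ten_lact_coeq[OF _ ten_ract_coeq[OF _ k]]] in simp_all)
      moreover have "k \<otimes>\<^sub>a (k \<otimes>\<^sub>a k) = (k \<unlhd> (E \<otimes> E)) \<cdot> (p \<unrhd> (k \<otimes>\<^sub>a k))"
        by (simp add: ten_merge flip: tensor_lact tensor_ract)
      ultimately show ?thesis using A.epi_Cmp[OF _ epi_r] by simp
    qed
    show "\<mu> \<cdot> ((\<mu> \<unlhd> E) \<cdot> assoc C E E E) = \<mu> \<cdot> (E \<unrhd> \<mu>)"
    proof (rule A.epiD[OF epi3])
      have "(\<mu> \<cdot> ((\<mu> \<unlhd> E) \<cdot> assoc C E E E)) \<cdot> (k \<otimes>\<^sub>a (k \<otimes>\<^sub>a k)) =
          \<mu> \<cdot> (((\<mu> \<cdot> (k \<otimes>\<^sub>a k)) \<otimes>\<^sub>a k) \<cdot> assoc C p p p)"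
        using assoc_nat'[of k k k] by (simp add: ten_merge ten_merge[THEN ten_chain] flip: tensor_ract)
      also have "\<dots> = \<mu> \<cdot> ((k \<otimes>\<^sub>a k) \<cdot> ((mult P \<unlhd> p) \<cdot> assoc C p p p))"
        unfolding \<mu>k by (simp add: ten_merge[THEN ten_chain] flip: tensor_ract)
      also have "\<dots> = k \<cdot> (mult P \<cdot> (p \<unrhd> mult P))"
        by (simp add: \<mu>k[THEN ten_chain] laws)
      also have "\<dots> = \<mu> \<cdot> ((k \<otimes>\<^sub>a k) \<cdot> (p \<unrhd> mult P))"
        by (simp add: \<mu>k[THEN ten_chain])
      also have "\<dots> = \<mu> \<cdot> (k \<otimes>\<^sub>a (\<mu> \<cdot> (k \<otimes>\<^sub>a k)))"
        unfolding \<mu>k by (simp add: ten_merge flip: tensor_lact)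
      also have "\<dots> = (\<mu> \<cdot> (E \<unrhd> \<mu>)) \<cdot> (k \<otimes>\<^sub>a (k \<otimes>\<^sub>a k))"
        by (simp add: ten_merge flip: tensor_lact)
      finally show "(\<mu> \<cdot> ((\<mu> \<unlhd> E) \<cdot> assoc C E E E)) \<cdot> (k \<otimes>\<^sub>a (k \<otimes>\<^sub>a k)) = (\<mu> \<cdot> (E \<unrhd> \<mu>)) \<cdot> (k \<otimes>\<^sub>a (k \<otimes>\<^sub>a k))" .
    qed simp_all
    show "\<mu> \<cdot> ((k \<cdot> unit P) \<unlhd> E) = lunit C E"
    proof (rule A.epiD[OF epi_l[of \<one>]])
      have "(\<mu> \<cdot> ((k \<cdot> unit P) \<unlhd> E)) \<cdot> (\<one> \<unrhd> k) = \<mu> \<cdot> ((k \<otimes>\<^sub>a k) \<cdot> (unit P \<unlhd> p))"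
        by (simp add: ten_merge del: self.ract_Cmp flip: tensor_ract tensor_lact)
      also have "\<dots> = k \<cdot> lunit C p"
        by (simp add: \<mu>k[THEN ten_chain] laws)
      also have "\<dots> = lunit C E \<cdot> (\<one> \<unrhd> k)"
        using lunit_nat'[of k] by (simp add: tensor_lact)
      finally show "(\<mu> \<cdot> ((k \<cdot> unit P) \<unlhd> E)) \<cdot> (\<one> \<unrhd> k) = lunit C E \<cdot> (\<one> \<unrhd> k)" .
    qed simp_all
    show "\<mu> \<cdot> braid C E E = \<mu>"
    proof (rule A.epiD[OF epi_kk])
      have "(\<mu> \<cdot> braid C E E) \<cdot> (k \<otimes>\<^sub>a k) = \<mu> \<cdot> ((k \<otimes>\<^sub>a k) \<cdot> braid C p p)"
        using braid_nat'[of k k] by simp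
      also have "\<dots> = \<mu> \<cdot> (k \<otimes>\<^sub>a k)"
        by (simp add: \<mu>k[THEN ten_chain] laws) (simp add: \<mu>k)
      finally show "(\<mu> \<cdot> braid C E E) \<cdot> (k \<otimes>\<^sub>a k) = \<mu> \<cdot> (k \<otimes>\<^sub>a k)" .
    qed simp_all
  qed simp_all
  have "monoid_map P ?e k"
    unfolding monoid_map_def p_def[symmetric] by (simp add: \<mu>k)
  then show ?thesis using that[OF e] by simp
qed

text \<open>An arrow out of \<open>b \<otimes> d\<close> is multiplied on the left by \<open>b \<otimes> d\<close> through the common lift
  \<open>comp_mul b d (a \<otimes> d) _\<close> of both arrows of the pair.\<close>

lemma pushout_quotient:
  assumes [simp]: "comm_monoid_obj C a" "comm_monoid_obj C b" "comm_monoid_obj C d"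
    and f: "monoid_map a b f" and g: "monoid_map a d g"
  obtains e k where "comm_monoid_obj C e" "monoid_map (coprod b d) e k"
    "is_coeq C (carr b \<unrhd> (mult d \<cdot> (g \<unlhd> carr d))) (self.mul b (carr d) \<cdot> (carr b \<unrhd> (f \<unlhd> carr d))) k"
proof -
  let ?A = "carr a" and ?B = "carr b" and ?D = "carr d" and ?a = "assoc C" and ?s = self.sw
  note [simp] = monoid_mapD(1-3)[OF f] monoid_mapD(1-3)[OF g]
  define \<phi> where "\<phi> = mult d \<cdot> (g \<unlhd> ?D)"
  \<comment> \<open>The action of \<open>d\<close> on \<open>a \<otimes> d\<close> through the
    second factor; \<phi> is linear for it, which is what lifting the first arrow of the pair
    requires.\<close>
  define \<rho> where "\<rho> = (?A \<unrhd> mult d) \<cdot> ?s ?D ?A ?D"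
  have [simp]: "\<phi> \<in> Arr C" "Dom C \<phi> = ?A \<otimes> ?D" "Cod C \<phi> = ?D"
    "\<rho> \<in> Arr C" "Dom C \<rho> = ?D \<otimes> (?A \<otimes> ?D)" "Cod C \<rho> = ?A \<otimes> ?D"
    by (simp_all add: \<phi>_def \<rho>_def)
  let ?r = "?B \<unrhd> \<phi>" and ?t = "self.mul b ?D \<cdot> (?B \<unrhd> (f \<unlhd> ?D))"
  let ?m = "comp_mul b d ?D (mult d)" and ?w = "comp_mul b d (?A \<otimes> ?D) \<rho>"
  obtain k where k: "is_coeq C ?r ?t k" using ten_coeq_ex[of ?r ?t] by auto
  \<comment> \<open>Linearity of \<phi>: a letter of \<open>d\<close> has to pass the letter coming
    from \<open>a\<close> through \<open>g\<close>, which commutativity of \<open>d\<close>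
    permits.\<close>
  have "mult d \<cdot> (?D \<unrhd> \<phi>) = \<phi> \<cdot> \<rho>"
  proof -
    have "\<phi> \<cdot> \<rho> = (mult d \<cdot> (?D \<unrhd> mult d)) \<cdot> ((g \<unlhd> (?D \<otimes> ?D)) \<cdot> ?s ?D ?A ?D)"
      by (simp add: \<phi>_def \<rho>_def self.ract_lact[THEN ten_chain])
    also have "(g \<unlhd> (?D \<otimes> ?D)) \<cdot> ?s ?D ?A ?D = ?s ?D ?D ?D \<cdot> (?D \<unrhd> (g \<unlhd> ?D))"
      by (simp add: self.sw_nat_mid)
    also have "(mult d \<cdot> (?D \<unrhd> mult d)) \<cdot> (?s ?D ?D ?D \<cdot> (?D \<unrhd> (g \<unlhd> ?D))) =
      mult d \<cdot> ((self.mul d ?D \<cdot> ?s ?D ?D ?D) \<cdot> (?D \<unrhd> (g \<unlhd> ?D)))"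
      by (simp add: comm_monoid_laws'(2)[THEN ten_chain])
    also have "\<dots> = mult d \<cdot> (?D \<unrhd> \<phi>)"
      unfolding self.mul_sw[OF assms(3) comm_monoid_simps(1)[OF assms(3)]]
      by (simp add: \<phi>_def comm_monoid_laws'(2)[THEN ten_chain])
    finally show ?thesis ..
  qed
  then have r: "?m \<cdot> (?B \<unrhd> (?D \<unrhd> ?r)) = ?r \<cdot> ?w"
    by (intro comp_mul_nat) simp_all
  have t: "?m \<cdot> (?B \<unrhd> (?D \<unrhd> ?t)) = ?t \<cdot> ?w"
  proof -
    have 1: "?s ?D ?B ?D \<cdot> (?D \<unrhd> (f \<unlhd> ?D)) = (f \<unlhd> (?D \<otimes> ?D)) \<cdot> ?s ?D ?A ?D"
      by (simp add: self.sw_nat_mid)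
    let ?q = "(?B \<unrhd> mult d) \<cdot> (self.mul b (?D \<otimes> ?D) \<cdot> (self.mul b (?B \<otimes> (?D \<otimes> ?D)) \<cdot>
       ((?B \<unrhd> (?B \<unrhd> (f \<unlhd> (?D \<otimes> ?D)))) \<cdot> ((?B \<unrhd> (?B \<unrhd> ?s ?D ?A ?D)) \<cdot> (?B \<unrhd> ?s ?D ?B (?A \<otimes> ?D))))))"
    note lift = self.lact_lift
    have "?m \<cdot> (?B \<unrhd> (?D \<unrhd> ?t)) = ?q"
      by (simp add: comp_mul_def nat_chains self.sw_mul'[THEN lift, THEN ten_chain] self.mul_assoc[THEN ten_chain]
        1[THEN lift, THEN lift] 1[THEN lift, THEN lift, THEN ten_chain])
    moreover have "?t \<cdot> ?w = ?q"
      by (simp add: comp_mul_def \<rho>_def nat_chains)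
    ultimately show ?thesis by simp
  qed
  have P: "comm_monoid_obj C (coprod b d)" by (rule comm_monoid_coprod) simp_all
  let ?P = "?B \<otimes> ?D" and ?i = "A.inv_arr (?a ?B ?D (?B \<otimes> (?A \<otimes> ?D)))"
  \<comment> \<open>Passes from iterated actions back to \<open>b \<otimes> d\<close>: a lift
    through \<open>comp_mul\<close> becomes one through \<open>mult (coprod b d)\<close> once the
    associator is inverted.\<close>
  have lift: "mult (coprod b d) \<cdot> (?P \<unrhd> u) = u \<cdot> (?w \<cdot> ?i)"
    if u: "?m \<cdot> (?B \<unrhd> (?D \<unrhd> u)) = u \<cdot> ?w" "u \<in> Arr C" "Dom C u = ?B \<otimes> (?A \<otimes> ?D)" "Cod C u = ?P" for u
  proof (rule A.iso_cancel_right[of "?a ?B ?D (?B \<otimes> (?A \<otimes> ?D))"])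
    have "(mult (coprod b d) \<cdot> (?P \<unrhd> u)) \<cdot> ?a ?B ?D (?B \<otimes> (?A \<otimes> ?D)) =
       (mult (coprod b d) \<cdot> ?a ?B ?D ?P) \<cdot> (?B \<unrhd> (?D \<unrhd> u))"
      using u(2-) by (simp add: self.act_assoc_nat_lact)
    also have "\<dots> = u \<cdot> ?w" unfolding coprod_mult_assoc[OF assms(2,3)] by (rule u(1))
    finally show "(mult (coprod b d) \<cdot> (?P \<unrhd> u)) \<cdot> ?a ?B ?D (?B \<otimes> (?A \<otimes> ?D)) =
       (u \<cdot> (?w \<cdot> ?i)) \<cdot> ?a ?B ?D (?B \<otimes> (?A \<otimes> ?D))"
      using u(2-) by simp
  qed (use u(2-) in simp_all)
  have Dk: "Dom C k = ?P" using is_coeqD(5)[OF k] by simp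
  obtain e where "comm_monoid_obj C e" "carr e = Cod C k" "monoid_map (coprod b d) e k"
    by (rule quotient_monoid[OF P k, of "?w \<cdot> ?i"]) (use Dk lift[OF r] lift[OF t] in simp_all)
  then show ?thesis using that[of e k] k unfolding \<phi>_def by simp
qed

text \<open>In words, the letters from \<open>b\<close>, \<open>a\<close> and \<open>d\<close> are
  multiplied in \<open>X\<close>. The middle letter enters through \<open>p \<cdot> f\<close> on one
  side and through \<open>q \<cdot> g\<close> on the other, so both sides reach the normal form
  \<open>?Q\<close>.\<close>

lemma copair_coequalizes:
  assumes [simp]: "comm_monoid_obj C a" "comm_monoid_obj C b" "comm_monoid_obj C d" "comm_monoid_obj C X"
    and f: "monoid_map a b f" and g: "monoid_map a d g" and p: "monoid_map b X p" and q: "monoid_map d X q"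
    and pq: "p \<cdot> f = q \<cdot> g"
  shows "(mult X \<cdot> (p \<otimes>\<^sub>a q)) \<cdot> (carr b \<unrhd> (mult d \<cdot> (g \<unlhd> carr d))) =
    (mult X \<cdot> (p \<otimes>\<^sub>a q)) \<cdot> (self.mul b (carr d) \<cdot> (carr b \<unrhd> (f \<unlhd> carr d)))" (is "?F \<cdot> ?r = ?F \<cdot> ?t")
proof (rule ract_unit_eqI)
  let ?A = "carr a" and ?B = "carr b" and ?D = "carr d" and ?X = "carr X" and ?a = "assoc C" and ?x = "\<one>"
  note [simp] = monoid_mapD(1-3)[OF f] monoid_mapD(1-3)[OF g] monoid_mapD(1-3)[OF p] monoid_mapD(1-3)[OF q]
  let ?m = "self.mul X"
  let ?i = "?a ?B (?A \<otimes> ?D) ?x \<cdot> (?B \<unrhd> ?a ?A ?D ?x)"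
  have \<Phi>: "(?F \<unlhd> ?x) \<cdot> ?a ?B ?D ?x = ?m ?x \<cdot> ((?X \<unrhd> (q \<unlhd> ?x)) \<cdot> (p \<unlhd> (?D \<otimes> ?x)))"
    by (rule self.product_ract) simp_all
  have pm: "(p \<unlhd> (?D \<otimes> ?x)) \<cdot> self.mul b (?D \<otimes> ?x) = ?m (?D \<otimes> ?x) \<cdot> ((?X \<unrhd> (p \<unlhd> (?D \<otimes> ?x))) \<cdot> (p \<unlhd> (?B \<otimes> (?D \<otimes> ?x))))"
    and qm: "(q \<unlhd> ?x) \<cdot> self.mul d ?x = ?m ?x \<cdot> ((?X \<unrhd> (q \<unlhd> ?x)) \<cdot> (q \<unlhd> (?D \<otimes> ?x)))"
    using p q by (simp_all add: self.ract_mul)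
  have pf: "(p \<unlhd> (?D \<otimes> ?x)) \<cdot> (f \<unlhd> (?D \<otimes> ?x)) = (q \<unlhd> (?D \<otimes> ?x)) \<cdot> (g \<unlhd> (?D \<otimes> ?x))"
    using pq by (simp flip: self.ract_Cmp)
  let ?Q = "?m ?x \<cdot> (?m (?X \<otimes> ?x) \<cdot> ((?X \<unrhd> (?X \<unrhd> (q \<unlhd> ?x))) \<cdot> ((?X \<unrhd> (q \<unlhd> (?D \<otimes> ?x))) \<cdot>
      ((?X \<unrhd> (g \<unlhd> (?D \<otimes> ?x))) \<cdot> (p \<unlhd> (?A \<otimes> (?D \<otimes> ?x)))))))"
  note tr = self.pushout_pair_ract(1)[of b d f ?A g ?x] and rr = self.pushout_pair_ract(2)[of b d f ?A g ?x]
  have "((?F \<cdot> ?t) \<unlhd> ?x) \<cdot> ?i = (?F \<unlhd> ?x) \<cdot> ((?t \<unlhd> ?x) \<cdot> ?i)"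
    by simp
  also have "\<dots> = ((?F \<unlhd> ?x) \<cdot> ?a ?B ?D ?x) \<cdot> (self.mul b (?D \<otimes> ?x) \<cdot> (?B \<unrhd> (f \<unlhd> (?D \<otimes> ?x))))"
    using tr by simp
  also have "\<dots> = ?Q"
    unfolding \<Phi> by (simp add: pm[THEN ten_chain] self.ract_lact self.ract_lact[THEN ten_chain]
      self.mul_nat[symmetric, THEN ten_chain] pf[THEN self.lact_lift, THEN ten_chain])
      (simp add: nat_chains)
  finally have 1: "((?F \<cdot> ?t) \<unlhd> ?x) \<cdot> ?i = ?Q" .
  have "((?F \<cdot> ?r) \<unlhd> ?x) \<cdot> ?i = (?F \<unlhd> ?x) \<cdot> ((?r \<unlhd> ?x) \<cdot> ?i)"
    by simp
  also have "\<dots> = ((?F \<unlhd> ?x) \<cdot> ?a ?B ?D ?x) \<cdot> (?B \<unrhd> (self.mul d ?x \<cdot> (g \<unlhd> (?D \<otimes> ?x))))"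
    using rr by simp
  also have "\<dots> = ?Q"
    unfolding \<Phi> by (simp add: self.ract_lact self.ract_lact[THEN ten_chain] qm[THEN self.lact_lift, THEN ten_chain]
       self.mul_assoc[THEN ten_chain])
  finally have 2: "((?F \<cdot> ?r) \<unlhd> ?x) \<cdot> ?i = ?Q" .
  show "(?F \<cdot> ?r) \<unlhd> ?x = (?F \<cdot> ?t) \<unlhd> ?x"
    by (rule A.iso_cancel_right[OF _ _ _ _ _ trans[OF 2 1[symmetric]]]) (simp_all add: A.is_iso_Cmp)
qed (use assms in \<open>simp_all add: monoid_mapD\<close>)

end

lemma (in category) is_pullback_iso:
  assumes p: "is_pullback C f g p q" and p': "is_pullback C f g p' q'"
  obtains i where "is_iso C i" "Dom C i = Dom C p'" "Cod C i = Dom C p" "p \<cdot> i = p'" "q \<cdot> i = q'"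
proof -
  have ex: "\<exists>h. h \<in> Arr C \<and> Dom C h = Dom C s \<and> Cod C h = Dom C p \<and> p \<cdot> h = s \<and> q \<cdot> h = t"
    if "is_pullback C f g p q" "is_pullback C f g s t" for p q s t
  proof -
    have "s \<in> Hom C (Dom C s) (Dom C f)" "t \<in> Hom C (Dom C s) (Dom C g)" "f \<cdot> s = g \<cdot> t"
      using that(2) by (auto simp: is_pullback_def in_Hom)
    then have "\<exists>!h. h \<in> Hom C (Dom C s) (Dom C p) \<and> p \<cdot> h = s \<and> q \<cdot> h = t"
      using that(1) unfolding is_pullback_def by blast
    then show ?thesis by (auto simp: in_Hom)
  qed
  have uniq: "h = Ide C (Dom C p)"
    if "is_pullback C f g p q" "h \<in> Arr C" "Dom C h = Dom C p" "Cod C h = Dom C p" "p \<cdot> h = p" "q \<cdot> h = q" for p q h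
  proof -
    have "p \<in> Hom C (Dom C p) (Dom C f)" "q \<in> Hom C (Dom C p) (Dom C g)" "f \<cdot> p = g \<cdot> q"
      and [simp]: "p \<in> Arr C" "q \<in> Arr C" "Dom C q = Dom C p"
      using that(1) by (auto simp: is_pullback_def in_Hom)
    then have "\<exists>!h. h \<in> Hom C (Dom C p) (Dom C p) \<and> p \<cdot> h = p \<and> q \<cdot> h = q"
      using that(1) unfolding is_pullback_def by blast
    moreover have "h \<in> Hom C (Dom C p) (Dom C p) \<and> p \<cdot> h = p \<and> q \<cdot> h = q"
      using that by (simp add: in_Hom)
    moreover have "Ide C (Dom C p) \<in> Hom C (Dom C p) (Dom C p) \<and> p \<cdot> Ide C (Dom C p) = p \<and> q \<cdot> Ide C (Dom C p) = q"
      by (simp add: in_Hom)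
    ultimately show ?thesis by blast
  qed
  have [simp]: "p \<in> Arr C" "q \<in> Arr C" "Dom C q = Dom C p" "p' \<in> Arr C" "q' \<in> Arr C" "Dom C q' = Dom C p'"
    using p p' by (auto simp: is_pullback_def)
  obtain i where i: "i \<in> Arr C" "Dom C i = Dom C p'" "Cod C i = Dom C p" "p \<cdot> i = p'" "q \<cdot> i = q'"
    using ex[OF p p'] by blast
  obtain j where j: "j \<in> Arr C" "Dom C j = Dom C p" "Cod C j = Dom C p'" "p' \<cdot> j = p" "q' \<cdot> j = q"
    using ex[OF p' p] by blast
  have "p \<cdot> (i \<cdot> j) = p" "q \<cdot> (i \<cdot> j) = q" "p' \<cdot> (j \<cdot> i) = p'" "q' \<cdot> (j \<cdot> i) = q'"
    using i j comp_chain[OF i(4), of j] comp_chain[OF i(5), of j] comp_chain[OF j(4), of i] comp_chain[OF j(5), of i]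
    by simp_all
  then have "i \<cdot> j = Ide C (Dom C p)" "j \<cdot> i = Ide C (Dom C p')"
    using uniq[OF p, of "i \<cdot> j"] uniq[OF p', of "j \<cdot> i"] i j by simp_all
  then have "is_iso C i"
    by (intro is_isoI[of _ "Dom C p'" "Dom C p" j]) (use i j in \<open>simp_all add: in_Hom\<close>)
  then show ?thesis using that i by blast
qed

lemma (in symmetric_monoidal) Aff_simps [simp]:
  "Obj (Aff C) = {a. comm_monoid_obj C a}" "Arr (Aff C) = Arr (Comm C)" "Dom (Aff C) = tgt" "Cod (Aff C) = src"
  "g \<cdot>\<^bsub>Aff C\<^esub> f = SArr (src g) (und f \<cdot> und g) (tgt f)"
  by (simp_all add: Aff_def op_cat_def)

lemma (in symmetric_monoidal) category_Aff: "category (Aff C)"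
  unfolding Aff_def by (rule category_op_cat[OF category_Comm])

context coeq_monoidal
begin

text \<open>A compatible pair of homomorphisms induces an arrow \<open>h\<close> by descent of the
  copairing along \<open>k\<close>. That \<open>h\<close> is multiplicative is tested after the
  epimorphism \<open>k \<otimes>\<^sub>a k\<close>, where it is multiplicativity of the
  copairing.\<close>

lemma pushout_ex:
  assumes \<alpha>: "\<alpha> \<in> Arr (Comm C)" and \<gamma>: "\<gamma> \<in> Arr (Comm C)" and s: "src \<gamma> = src \<alpha>"
  obtains e k where "comm_monoid_obj C e" "monoid_map (coprod (tgt \<alpha>) (tgt \<gamma>)) e k"
    "is_coeq C (carr (tgt \<alpha>) \<unrhd> (mult (tgt \<gamma>) \<cdot> (und \<gamma> \<unlhd> carr (tgt \<gamma>))))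
      (self.mul (tgt \<alpha>) (carr (tgt \<gamma>)) \<cdot> (carr (tgt \<alpha>) \<unrhd> (und \<alpha> \<unlhd> carr (tgt \<gamma>)))) k"
    "is_pullback (Aff C) \<alpha> \<gamma> (SArr (tgt \<alpha>) (k \<cdot> coprod_inl (tgt \<alpha>) (tgt \<gamma>)) e)
      (SArr (tgt \<gamma>) (k \<cdot> coprod_inr (tgt \<alpha>) (tgt \<gamma>)) e)"
proof -
  define a b d f g where abd: "a = src \<alpha>" "b = tgt \<alpha>" "d = tgt \<gamma>" "f = und \<alpha>" "g = und \<gamma>"
  have cm [simp]: "comm_monoid_obj C a" "comm_monoid_obj C b" "comm_monoid_obj C d"
    and f: "monoid_map a b f" and g: "monoid_map a d g"
    using \<alpha> \<gamma> s by (auto simp: Comm_Arr abd)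
  let ?B = "carr b" and ?D = "carr d" and ?i = "coprod_inl b d" and ?j = "coprod_inr b d"
  obtain e k where e [simp]: "comm_monoid_obj C e" and k: "monoid_map (coprod b d) e k"
    and q: "is_coeq C (?B \<unrhd> (mult d \<cdot> (g \<unlhd> ?D))) (self.mul b ?D \<cdot> (?B \<unrhd> (f \<unlhd> ?D))) k"
    by (rule pushout_quotient[OF cm f g])
  note P [simp] = comm_monoid_coprod[OF cm(2,3)]
  note [simp] = monoid_mapD(1-3)[OF f] monoid_mapD(1-3)[OF g] monoid_mapD(1-3)[OF k, simplified]
  note ki = monoid_map_Cmp[OF monoid_map_coprod_inl[OF cm(2,3)] k cm(2) P e]
  note kj = monoid_map_Cmp[OF monoid_map_coprod_inr[OF cm(2,3)] k cm(3) P e]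
  have epi: "is_epi C k" by (rule A.is_coeq_epi[OF q])
  have epi2: "is_epi C (k \<otimes>\<^sub>a k)"
  proof -
    have "k \<otimes>\<^sub>a k = (k \<unlhd> carr e) \<cdot> ((?B \<otimes> ?D) \<unrhd> k)"
      by (simp add: ten_merge flip: tensor_lact tensor_ract)
    then show ?thesis
      using A.epi_Cmp[OF A.is_coeq_epi[OF ten_lact_coeq[OF _ q]] A.is_coeq_epi[OF ten_ract_coeq[OF _ q]],
          of "?B \<otimes> ?D" "carr e"] by simp
  qed
  \<comment> \<open>\<open>?z\<close> inserts the unit of \<open>b\<close> to the left and that of
    \<open>d\<close> to the right of a letter from \<open>a\<close>. This specialises the relation
    imposed by \<open>k\<close> to the equality of the two legs on \<open>a\<close>.\<close>
  have comm: "(k \<cdot> ?i) \<cdot> f = (k \<cdot> ?j) \<cdot> g"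
  proof (rule ract_unit_eqI)
    let ?A = "carr a" and ?a = "assoc C" and ?x = "\<one>"
    let ?c = "?a ?B (?A \<otimes> ?D) ?x \<cdot> (?B \<unrhd> ?a ?A ?D ?x)"
    let ?z = "self.un b (?A \<otimes> (?D \<otimes> ?x)) \<cdot> (?A \<unrhd> self.un d ?x)"
    note tr = self.pushout_pair_ract(1)[of b d f ?A g ?x, simplified]
      and rr = self.pushout_pair_ract(2)[of b d f ?A g ?x, simplified]
    have u1: "(?B \<unrhd> (h \<unlhd> y)) \<cdot> self.un b (?A \<otimes> y) = self.un b (X \<otimes> y) \<cdot> (h \<unlhd> y)"
      if "h \<in> Arr C" "Dom C h = ?A" "Cod C h = X" "y \<in> Obj C" for h X y
      using that A.Dom_Cod_Obj[of h] by (auto simp: self.un_nat)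
    have u2: "(?B \<unrhd> self.mul d ?x) \<cdot> self.un b (?D \<otimes> (?D \<otimes> ?x)) = self.un b (?D \<otimes> ?x) \<cdot> self.mul d ?x"
      by (simp add: self.un_nat)
    have "(k \<cdot> (self.mul b ?D \<cdot> (?B \<unrhd> (f \<unlhd> ?D)))) \<unlhd> ?x = (k \<cdot> (?B \<unrhd> (mult d \<cdot> (g \<unlhd> ?D)))) \<unlhd> ?x"
      by (simp only: is_coeqD(7)[OF q])
    then have "(k \<unlhd> ?x) \<cdot> (((self.mul b ?D \<cdot> (?B \<unrhd> (f \<unlhd> ?D))) \<unlhd> ?x) \<cdot> ?c) \<cdot> ?z =
       (k \<unlhd> ?x) \<cdot> (((?B \<unrhd> (mult d \<cdot> (g \<unlhd> ?D))) \<unlhd> ?x) \<cdot> ?c) \<cdot> ?z"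
      using ten_chain[of "k \<unlhd> ?x" "(self.mul b ?D \<cdot> (?B \<unrhd> (f \<unlhd> ?D))) \<unlhd> ?x" _ "?c \<cdot> ?z"]
        ten_chain[of "k \<unlhd> ?x" "(?B \<unrhd> (mult d \<cdot> (g \<unlhd> ?D))) \<unlhd> ?x" _ "?c \<cdot> ?z"]
      by simp
    then have "(k \<unlhd> ?x) \<cdot> (?a ?B ?D ?x \<cdot> (self.mul b (?D \<otimes> ?x) \<cdot> (?B \<unrhd> (f \<unlhd> (?D \<otimes> ?x))))) \<cdot> ?z =
       (k \<unlhd> ?x) \<cdot> (?a ?B ?D ?x \<cdot> (?B \<unrhd> (self.mul d ?x \<cdot> (g \<unlhd> (?D \<otimes> ?x))))) \<cdot> ?z"
      by (simp only: self.pushout_pair_ract[of b d f ?A g ?x] cm tunit_Obj monoid_mapD(1-3)[OF f] monoid_mapD(1-3)[OF g])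
    moreover have "(self.mul b (?D \<otimes> ?x) \<cdot> (?B \<unrhd> (f \<unlhd> (?D \<otimes> ?x)))) \<cdot> ?z = (?B \<unrhd> self.un d ?x) \<cdot> (f \<unlhd> ?x)"
      by (simp add: u1[THEN ten_chain] self.mul_un_left[THEN ten_chain] self.ract_lact)
    moreover have "(?B \<unrhd> (self.mul d ?x \<cdot> (g \<unlhd> (?D \<otimes> ?x)))) \<cdot> ?z = self.un b (?D \<otimes> ?x) \<cdot> (g \<unlhd> ?x)"
      by (simp add: u1[THEN ten_chain] u2[THEN ten_chain] self.ract_lact self.mul_un_right[THEN ten_chain])
    ultimately have "(k \<unlhd> ?x) \<cdot> (?a ?B ?D ?x \<cdot> ((?B \<unrhd> self.un d ?x) \<cdot> (f \<unlhd> ?x))) =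
       (k \<unlhd> ?x) \<cdot> (?a ?B ?D ?x \<cdot> (self.un b (?D \<otimes> ?x) \<cdot> (g \<unlhd> ?x)))"
      by simp
    then show "((k \<cdot> ?i) \<cdot> f) \<unlhd> \<one> = ((k \<cdot> ?j) \<cdot> g) \<unlhd> \<one>"
      by (simp add: coprod_inl_ract coprod_inr_ract)
  qed simp_all
  let ?\<gamma> = "SArr b (k \<cdot> ?i) e" and ?\<beta> = "SArr d (k \<cdot> ?j) e"
  have "is_pullback (Aff C) \<alpha> \<gamma> ?\<gamma> ?\<beta>"
    unfolding is_pullback_def
  proof (intro conjI allI ballI impI)
    show "?\<gamma> \<in> Arr (Aff C)" "?\<beta> \<in> Arr (Aff C)" using ki kj by (simp_all add: Comm_Arr)
    show "\<alpha> \<cdot>\<^bsub>Aff C\<^esub> ?\<gamma> = \<gamma> \<cdot>\<^bsub>Aff C\<^esub> ?\<beta>" using comm s by (simp flip: abd)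
    fix X \<sigma> \<tau> assume st: "\<sigma> \<in> Hom (Aff C) X (Dom (Aff C) \<alpha>)" "\<tau> \<in> Hom (Aff C) X (Dom (Aff C) \<gamma>)"
      and eq: "\<alpha> \<cdot>\<^bsub>Aff C\<^esub> \<sigma> = \<gamma> \<cdot>\<^bsub>Aff C\<^esub> \<tau>"
    define p r where "p = und \<sigma>" and "r = und \<tau>"
    have X [simp]: "comm_monoid_obj C X" and p: "monoid_map b X p" and r: "monoid_map d X r"
      and \<sigma>: "\<sigma> = SArr b p X" and \<tau>: "\<tau> = SArr d r X"
      using st by (auto simp: in_Hom Comm_Arr p_def r_def abd intro: sarr.expand)
    have pr: "p \<cdot> f = r \<cdot> g" using eq by (simp add: \<sigma> \<tau> abd)
    note [simp] = monoid_mapD(1-3)[OF p] monoid_mapD(1-3)[OF r]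
    let ?F = "mult X \<cdot> (p \<otimes>\<^sub>a r)"
    note F = monoid_map_copair[OF cm(2,3) X p r]
    note Fc = copair_coequalizes[OF cm X f g p r pr]
    obtain h where h [simp]: "h \<in> Arr C" "Dom C h = carr e" "Cod C h = carr X" and hk: "h \<cdot> k = ?F"
      by (rule is_coeq_ex[OF q _ _ Fc]) auto
    have hm: "monoid_map e X h"
      unfolding monoid_map_def
    proof (intro conjI)
      show "h \<cdot> mult e = mult X \<cdot> (h \<otimes>\<^sub>a h)"
      proof (rule A.epiD[OF epi2])
        have "(h \<cdot> mult e) \<cdot> (k \<otimes>\<^sub>a k) = (h \<cdot> k) \<cdot> mult (coprod b d)"
          using monoid_mapD(4)[OF k] by simp
        also have "\<dots> = mult X \<cdot> ((h \<cdot> k) \<otimes>\<^sub>a (h \<cdot> k))"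
          unfolding hk by (rule monoid_mapD(4)[OF F(1)])
        also have "\<dots> = (mult X \<cdot> (h \<otimes>\<^sub>a h)) \<cdot> (k \<otimes>\<^sub>a k)"
          by (simp add: ten_merge)
        finally show "(h \<cdot> mult e) \<cdot> (k \<otimes>\<^sub>a k) = (mult X \<cdot> (h \<otimes>\<^sub>a h)) \<cdot> (k \<otimes>\<^sub>a k)" .
      qed simp_all
      have "h \<cdot> unit e = (h \<cdot> k) \<cdot> unit (coprod b d)"
        using monoid_mapD(5)[OF k] by simp
      then show "h \<cdot> unit e = unit X" unfolding hk monoid_mapD(5)[OF F(1)] .
    qed simp_all
    have "(h \<cdot> k) \<cdot> ?i = p" "(h \<cdot> k) \<cdot> ?j = r" unfolding hk by (rule F(2,3))+
    then have hij: "h \<cdot> (k \<cdot> ?i) = p" "h \<cdot> (k \<cdot> ?j) = r" by simp_all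
    show "\<exists>!h. h \<in> Hom (Aff C) X (Dom (Aff C) ?\<gamma>) \<and> ?\<gamma> \<cdot>\<^bsub>Aff C\<^esub> h = \<sigma> \<and> ?\<beta> \<cdot>\<^bsub>Aff C\<^esub> h = \<tau>"
    proof (intro ex1I[of _ "SArr e h X"] conjI)
      show "SArr e h X \<in> Hom (Aff C) X (Dom (Aff C) ?\<gamma>)" using hm by (simp add: in_Hom Comm_Arr)
      show "?\<gamma> \<cdot>\<^bsub>Aff C\<^esub> SArr e h X = \<sigma>" "?\<beta> \<cdot>\<^bsub>Aff C\<^esub> SArr e h X = \<tau>"
        using hij by (simp_all add: \<sigma> \<tau>)
      fix \<kappa> assume *: "\<kappa> \<in> Hom (Aff C) X (Dom (Aff C) ?\<gamma>) \<and> ?\<gamma> \<cdot>\<^bsub>Aff C\<^esub> \<kappa> = \<sigma> \<and> ?\<beta> \<cdot>\<^bsub>Aff C\<^esub> \<kappa> = \<tau>"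
      define u where "u = und \<kappa>"
      have um: "monoid_map e X u" and \<kappa>: "\<kappa> = SArr e u X" and uij: "u \<cdot> (k \<cdot> ?i) = p" "u \<cdot> (k \<cdot> ?j) = r"
        using * by (auto simp: in_Hom Comm_Arr u_def \<sigma> \<tau> intro: sarr.expand)
      note [simp] = monoid_mapD(1-3)[OF um]
      note uk = monoid_map_Cmp[OF k um P e X]
      \<comment> \<open>Uniqueness: \<open>coprod_inl_inr\<close> expresses
        \<open>u \<cdot> k\<close> by its restrictions to \<open>b\<close> and \<open>d\<close>,
        which are prescribed.\<close>
      have "(u \<cdot> k) \<cdot> (mult (coprod b d) \<cdot> (?i \<otimes>\<^sub>a ?j)) = ((u \<cdot> k) \<cdot> mult (coprod b d)) \<cdot> (?i \<otimes>\<^sub>a ?j)"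
        by (rule A.Cmp_assoc'[symmetric]) simp_all
      also have "\<dots> = mult X \<cdot> ((u \<cdot> (k \<cdot> ?i)) \<otimes>\<^sub>a (u \<cdot> (k \<cdot> ?j)))"
        unfolding monoid_mapD(4)[OF uk] by (simp add: ten_merge)
      finally have "u \<cdot> k = ?F" unfolding uij coprod_inl_inr[OF cm(2,3)] by simp
      then have "u = h" by (intro A.epiD[OF epi, of u h]) (simp_all add: hk)
      then show "\<kappa> = SArr e h X" by (simp add: \<kappa>)
    qed
  qed (use \<alpha> \<gamma> s in \<open>simp_all flip: abd\<close>)
  then show ?thesis using that[OF e, of k] k q unfolding abd by blast
qed

end

section \<open>Pushout squares satisfy base change\<close>

locale actegory_setting = coeq_monoidal C + coeq_actegory C M
  for C :: "('o, 'a, 'y) smcat_scheme" (structure)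
    and M :: "('o, 'a, 'm, 'n, 'z) actegory_scheme" (structure)
begin

text \<open>\<open>pushout_pair_ract\<close> makes the pushout of monoids visible on modules: acting
  on \<open>m\<close>, the pair that defines the pushout is, up to associators, the pair presenting
  the extension of the free \<open>d\<close>-module on \<open>m\<close>.\<close>

lemma base_change_square_ex:
  assumes \<alpha>: "\<alpha> \<in> Arr (Comm C)" and \<gamma>: "\<gamma> \<in> Arr (Comm C)" and s: "src \<gamma> = src \<alpha>"
  obtains \<gamma>' \<beta> where "is_pullback (Aff C) \<alpha> \<gamma> \<gamma>' \<beta>" "base_change_square \<alpha> \<gamma> \<gamma>' \<beta>"
proof -
  define a b d f g where abd: "a = src \<alpha>" "b = tgt \<alpha>" "d = tgt \<gamma>" "f = und \<alpha>" "g = und \<gamma>"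
  have cm [simp]: "comm_monoid_obj C a" "comm_monoid_obj C b" "comm_monoid_obj C d"
    and f: "monoid_map a b f" and g: "monoid_map a d g"
    using \<alpha> \<gamma> s by (auto simp: Comm_Arr abd)
  let ?A = "carr a" and ?B = "carr b" and ?D = "carr d" and ?i = "coprod_inl b d" and ?j = "coprod_inr b d"
  obtain e k where e [simp]: "comm_monoid_obj C e" and k: "monoid_map (coprod b d) e k"
    and q: "is_coeq C (?B \<unrhd> (mult d \<cdot> (g \<unlhd> ?D))) (self.mul b ?D \<cdot> (?B \<unrhd> (f \<unlhd> ?D))) k"
    and pb: "is_pullback (Aff C) \<alpha> \<gamma> (SArr b (k \<cdot> ?i) e) (SArr d (k \<cdot> ?j) e)"
    by (rule pushout_ex[OF \<alpha> \<gamma> s, folded abd])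
  let ?\<gamma> = "SArr b (k \<cdot> ?i) e" and ?\<beta> = "SArr d (k \<cdot> ?j) e"
  note P [simp] = comm_monoid_coprod[OF cm(2,3)]
  note [simp] = monoid_mapD(1-3)[OF f] monoid_mapD(1-3)[OF g] monoid_mapD(1-3)[OF k, simplified]
  \<comment> \<open>\<open>k\<close> is the product of its two legs, so \<open>cospan_act\<close> is
    the action of \<open>k\<close> on \<open>m\<close> up to the associator.\<close>
  have ijk: "mult e \<cdot> ((k \<cdot> ?i) \<otimes>\<^sub>a (k \<cdot> ?j)) = k"
  proof -
    have "mult e \<cdot> ((k \<cdot> ?i) \<otimes>\<^sub>a (k \<cdot> ?j)) = (mult e \<cdot> (k \<otimes>\<^sub>a k)) \<cdot> (?i \<otimes>\<^sub>a ?j)"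
      by (simp add: ten_merge)
    also have "\<dots> = k \<cdot> (mult (coprod b d) \<cdot> (?i \<otimes>\<^sub>a ?j))"
      unfolding monoid_mapD(4)[OF k, symmetric] by simp
    finally show ?thesis unfolding coprod_inl_inr[OF cm(2,3)] by simp
  qed
  have "base_change_square \<alpha> \<gamma> ?\<gamma> ?\<beta>"
    unfolding base_change_square_def
  proof (intro conjI ballI)
    show "?\<gamma> \<in> Arr (Comm C)" "?\<beta> \<in> Arr (Comm C)" using pb by (auto simp: is_pullback_def)
    have "\<alpha> \<cdot>\<^bsub>Aff C\<^esub> ?\<gamma> = \<gamma> \<cdot>\<^bsub>Aff C\<^esub> ?\<beta>" using pb unfolding is_pullback_def by blast
    then show "und ?\<gamma> \<cdot> und \<alpha> = und ?\<beta> \<cdot> und \<gamma>" by simp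
    fix m assume m [simp]: "m \<in> Obj M"
    have c: "cospan_act ?\<gamma> ?\<beta> m = (k \<lhd> m) \<cdot>\<^bsub>M\<^esub> act_assoc M ?B ?D m"
    proof -
      have "((mult e \<cdot> ((k \<cdot> ?i) \<otimes>\<^sub>a (k \<cdot> ?j))) \<lhd> m) \<cdot>\<^bsub>M\<^esub> act_assoc M ?B ?D m =
        mul e m \<cdot>\<^bsub>M\<^esub> ((carr e \<rhd> ((k \<cdot> ?j) \<lhd> m)) \<cdot>\<^bsub>M\<^esub> ((k \<cdot> ?i) \<lhd> (?D \<odot>\<^bsub>M\<^esub> m)))"
        by (rule product_ract) simp_all
      moreover have "((k \<cdot> ?i) \<lhd> (carr e \<odot>\<^bsub>M\<^esub> m)) \<cdot>\<^bsub>M\<^esub> (?B \<rhd> ((k \<cdot> ?j) \<lhd> m)) =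
        (carr e \<rhd> ((k \<cdot> ?j) \<lhd> m)) \<cdot>\<^bsub>M\<^esub> ((k \<cdot> ?i) \<lhd> (?D \<odot>\<^bsub>M\<^esub> m))"
        using ract_lact[of "k \<cdot> ?i" "(k \<cdot> ?j) \<lhd> m"] by (simp del: ract_Cmp lact_Cmp)
      ultimately show ?thesis unfolding ijk cospan_act_def sarr.sel by simp
    qed
    have "is_coeq M (?B \<rhd> (mul d m \<cdot>\<^bsub>M\<^esub> (g \<lhd> (?D \<odot>\<^bsub>M\<^esub> m))))
      (mul b (?D \<odot>\<^bsub>M\<^esub> m) \<cdot>\<^bsub>M\<^esub> (?B \<rhd> (f \<lhd> (?D \<odot>\<^bsub>M\<^esub> m)))) ((k \<lhd> m) \<cdot>\<^bsub>M\<^esub> act_assoc M ?B ?D m)"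
    proof (rule category.is_coeq_iso[OF act_category ract_coeq[OF m q],
          of "act_assoc M ?B (?A \<otimes> ?D) m \<cdot>\<^bsub>M\<^esub> (?B \<rhd> act_assoc M ?A ?D m)"])
      show "is_iso M (act_assoc M ?B (?A \<otimes> ?D) m \<cdot>\<^bsub>M\<^esub> (?B \<rhd> act_assoc M ?A ?D m))"
        by (rule category.is_iso_Cmp[OF act_category]) simp_all
    qed (use pushout_pair_ract[of b d f ?A g m] in simp_all)
    then show "ext_pair \<alpha> \<lparr>mcarr = carr (tgt \<gamma>) \<odot>\<^bsub>M\<^esub> m,
         mact = mul (tgt \<gamma>) m \<cdot>\<^bsub>M\<^esub> (und \<gamma> \<lhd> (carr (tgt \<gamma>) \<odot>\<^bsub>M\<^esub> m))\<rparr> (cospan_act ?\<gamma> ?\<beta> m)"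
      unfolding ext_pair_def c by (simp flip: abd)
  qed (use \<alpha> \<gamma> s in \<open>simp_all flip: abd\<close>)
  then show ?thesis using that pb by blast
qed

text \<open>An isomorphism of the corner only postcomposes the presenting coequalizers with an
  isomorphism. This carries the property from the constructed pushout to an arbitrary one.\<close>

lemma base_change_square_iso:
  assumes sq: "base_change_square \<alpha> \<gamma> \<gamma>' \<beta>" and i: "is_iso (Comm C) i" and si: "src i = tgt \<beta>"
  shows "base_change_square \<alpha> \<gamma> (SArr (src \<gamma>') (und i \<cdot> und \<gamma>') (tgt i)) (SArr (src \<beta>) (und i \<cdot> und \<beta>) (tgt i))"
    (is "base_change_square _ _ ?\<gamma> ?\<beta>")
proof -
  have sq': "\<alpha> \<in> Arr (Comm C)" "\<gamma> \<in> Arr (Comm C)" "\<gamma>' \<in> Arr (Comm C)" "\<beta> \<in> Arr (Comm C)"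
    and s [simp]: "src \<gamma> = src \<alpha>" "src \<gamma>' = tgt \<alpha>" "src \<beta> = tgt \<gamma>" "tgt \<gamma>' = tgt \<beta>"
    and comm: "und \<gamma>' \<cdot> und \<alpha> = und \<beta> \<cdot> und \<gamma>"
    using sq by (auto simp: base_change_square_def)
  have iA: "i \<in> Arr (Comm C)" using i by (simp add: is_iso_def)
  note D = Comm_ArrD[OF sq'(1)] Comm_ArrD[OF sq'(2), unfolded s] Comm_ArrD[OF sq'(3), unfolded s]
    Comm_ArrD[OF sq'(4), unfolded s] Comm_ArrD[OF iA, unfolded si]
  note [simp] = D si
  have ui: "is_iso C (und i)"
  proof -
    obtain j where "j \<in> Arr (Comm C)" "src j = tgt i" "tgt j = src i"
      "und j \<cdot> und i = Ide C (carr (src i))" "und i \<cdot> und j = Ide C (carr (tgt i))"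
      using i by (auto simp: is_iso_def in_Hom)
    then show ?thesis
      by (intro A.is_isoI[of _ "carr (src i)" "carr (tgt i)" "und j"]) (auto simp: in_Hom dest: Comm_ArrD)
  qed
  have c: "cospan_act ?\<gamma> ?\<beta> m = (und i \<lhd> m) \<cdot>\<^bsub>M\<^esub> cospan_act \<gamma>' \<beta> m" if [simp]: "m \<in> Obj M" for m
    by (simp add: cospan_act_def ract_mul[of "tgt \<beta>" "tgt i", THEN act_chain] ract_lact ract_lact[THEN act_chain])
  show ?thesis
    unfolding base_change_square_def
  proof (intro conjI ballI)
    show "?\<gamma> \<in> Arr (Comm C)" "?\<beta> \<in> Arr (Comm C)"
      by (simp_all add: Comm_Arr monoid_map_Cmp[of _ "tgt \<beta>"])
    show "und ?\<gamma> \<cdot> und \<alpha> = und ?\<beta> \<cdot> und \<gamma>" using comm by simp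
    fix m assume m [simp]: "m \<in> Obj M"
    have q: "ext_pair \<alpha> \<lparr>mcarr = carr (tgt \<gamma>) \<odot>\<^bsub>M\<^esub> m,
         mact = mul (tgt \<gamma>) m \<cdot>\<^bsub>M\<^esub> (und \<gamma> \<lhd> (carr (tgt \<gamma>) \<odot>\<^bsub>M\<^esub> m))\<rparr> (cospan_act \<gamma>' \<beta> m)"
      using sq by (simp add: base_change_square_def)
    show "ext_pair \<alpha> \<lparr>mcarr = carr (tgt \<gamma>) \<odot>\<^bsub>M\<^esub> m,
         mact = mul (tgt \<gamma>) m \<cdot>\<^bsub>M\<^esub> (und \<gamma> \<lhd> (carr (tgt \<gamma>) \<odot>\<^bsub>M\<^esub> m))\<rparr> (cospan_act ?\<gamma> ?\<beta> m)"
      unfolding c[OF m] ext_pair_def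
      by (rule category.is_coeq_post_iso[OF act_category q[unfolded ext_pair_def]])
        (use ui in \<open>simp_all add: cospan_act_def\<close>)
  qed (use sq' in simp_all)
qed

lemma base_change_square_pullback:
  assumes pb: "is_pullback (Aff C) \<alpha> \<gamma> \<gamma>' \<beta>"
  shows "base_change_square \<alpha> \<gamma> \<gamma>' \<beta>"
proof -
  have A: "\<alpha> \<in> Arr (Comm C)" "\<gamma> \<in> Arr (Comm C)" "src \<gamma> = src \<alpha>" "\<gamma>' \<in> Arr (Comm C)" "\<beta> \<in> Arr (Comm C)"
    "src \<gamma>' = tgt \<alpha>" "src \<beta> = tgt \<gamma>"
    using pb by (auto simp: is_pullback_def)
  obtain \<gamma>0 \<beta>0 where pb0: "is_pullback (Aff C) \<alpha> \<gamma> \<gamma>0 \<beta>0" and sq: "base_change_square \<alpha> \<gamma> \<gamma>0 \<beta>0"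
    by (rule base_change_square_ex[OF A(1-3)])
  obtain i where i: "is_iso (Aff C) i" "tgt i = tgt \<gamma>'" "src i = tgt \<gamma>0"
    "\<gamma>0 \<cdot>\<^bsub>Aff C\<^esub> i = \<gamma>'" "\<beta>0 \<cdot>\<^bsub>Aff C\<^esub> i = \<beta>"
    by (rule category.is_pullback_iso[OF category_Aff pb0 pb]) auto
  have "is_iso (Comm C) i" using i(1) by (simp add: Aff_def is_iso_op_cat)
  moreover have "tgt \<gamma>0 = tgt \<beta>0" using sq by (simp add: base_change_square_def)
  ultimately show ?thesis
    using base_change_square_iso[OF sq, of i] i by simp
qed

end

section \<open>Flat covers\<close>

lemma is_cone_functor:
  assumes F: "cat_functor A B F" and D: "cat_functor J A D" and c: "is_cone J A D l \<pi>"
  shows "is_cone J B (functr_comp F D) (fob F l) (far F \<circ> \<pi>)"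
proof -
  interpret F: cat_functor A B F by fact
  interpret D: cat_functor J A D by fact
  have [simp]: "l \<in> Obj A" "\<And>j. j \<in> Obj J \<Longrightarrow> \<pi> j \<in> Arr A" "\<And>j. j \<in> Obj J \<Longrightarrow> Dom A (\<pi> j) = l"
    "\<And>j. j \<in> Obj J \<Longrightarrow> Cod A (\<pi> j) = fob D j"
    and co: "\<And>u. u \<in> Arr J \<Longrightarrow> far D u \<cdot>\<^bsub>A\<^esub> \<pi> (Dom J u) = \<pi> (Cod J u)"
    using c by (auto simp: is_cone_def in_Hom)
  show ?thesis
    unfolding is_cone_def by (auto simp: in_Hom co simp flip: F.far_Cmp_simp)
qed

lemma right_adjoint_preserves_finite_limits:
  assumes "adj_unit A A B id_functr L R \<theta>"
  shows "preserves_finite_limits B A R"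
  unfolding preserves_finite_limits_def using right_adjoint_is_limit[OF assms] by blast

lemma adj_unit_comp:
  assumes L: "adj_unit A A B id_functr L R \<theta>" and L': "adj_unit B B C id_functr L' R' \<zeta>"
  shows "adj_unit A A C id_functr (functr_comp L' L) (functr_comp R R') (\<lambda>x. far R (\<zeta> (fob L x)) \<cdot>\<^bsub>A\<^esub> \<theta> x)"
proof -
  have R: "cat_functor B A R" and R': "cat_functor C B R'" and fL: "cat_functor A B L" and fL': "cat_functor B C L'"
    using L L' by (auto simp: adj_unit_def)
  interpret R: cat_functor B A R by fact
  interpret R': cat_functor C B R' by fact
  interpret L: cat_functor A B L by fact
  interpret L': cat_functor B C L' by fact
  have u: "universal_arrow A B R x (fob L x) (\<theta> x)" if "x \<in> Obj A" for x
    using L that by (auto simp: adj_unit_def)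
  have u': "universal_arrow B C R' x (fob L' x) (\<zeta> x)" if "x \<in> Obj B" for x
    using L' that by (auto simp: adj_unit_def)
  note [simp] = universal_arrow_Dom[OF u] universal_arrow_Dom[OF u']
  have n: "far R (far L f) \<cdot>\<^bsub>A\<^esub> \<theta> (Dom A f) = \<theta> (Cod A f) \<cdot>\<^bsub>A\<^esub> f" if "f \<in> Arr A" for f
    using adj_unit_nat[OF L that] by simp
  have n': "far R' (far L' f) \<cdot>\<^bsub>B\<^esub> \<zeta> (Dom B f) = \<zeta> (Cod B f) \<cdot>\<^bsub>B\<^esub> f" if "f \<in> Arr B" for f
    using adj_unit_nat[OF L' that] by simp
  show ?thesis
    unfolding adj_unit_def
  proof (intro conjI ballI)
    fix x assume x: "x \<in> Obj A"
    then have Lx: "fob L x \<in> Obj B" by simp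
    show "universal_arrow A C (functr_comp R R') (fob id_functr x) (fob (functr_comp L' L) x)
        (far R (\<zeta> (fob L x)) \<cdot>\<^bsub>A\<^esub> \<theta> x)"
      unfolding universal_arrow_def
    proof (intro conjI ballI)
      fix c f assume c: "c \<in> Obj C" and f: "f \<in> Hom A (fob id_functr x) (fob (functr_comp R R') c)"
      have f': "f \<in> Arr A" "Dom A f = x" "Cod A f = fob R (fob R' c)" using f by (auto simp: in_Hom)
      obtain g where g: "g \<in> Arr B" "Dom B g = fob L x" "Cod B g = fob R' c" "far R g \<cdot>\<^bsub>A\<^esub> \<theta> x = f"
        using universal_arrow_ex[OF u[OF x] R'.fob_in[OF c] f'] by blast
      obtain h where h: "h \<in> Arr C" "Dom C h = fob L' (fob L x)" "Cod C h = c" "far R' h \<cdot>\<^bsub>B\<^esub> \<zeta> (fob L x) = g"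
        using universal_arrow_ex[OF u'[OF Lx] c g(1-3)] by blast
      have e: "far R (far R' k) \<cdot>\<^bsub>A\<^esub> (far R (\<zeta> (fob L x)) \<cdot>\<^bsub>A\<^esub> \<theta> x) = far R (far R' k \<cdot>\<^bsub>B\<^esub> \<zeta> (fob L x)) \<cdot>\<^bsub>A\<^esub> \<theta> x"
        if "k \<in> Arr C" "Dom C k = fob L' (fob L x)" for k
        using that x by simp
      show "\<exists>!h. h \<in> Hom C (fob (functr_comp L' L) x) c \<and>
        far (functr_comp R R') h \<cdot>\<^bsub>A\<^esub> (far R (\<zeta> (fob L x)) \<cdot>\<^bsub>A\<^esub> \<theta> x) = f"
      proof (intro ex1I[of _ h] conjI)
        show "h \<in> Hom C (fob (functr_comp L' L) x) c" using h by (simp add: in_Hom)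
        show "far (functr_comp R R') h \<cdot>\<^bsub>A\<^esub> (far R (\<zeta> (fob L x)) \<cdot>\<^bsub>A\<^esub> \<theta> x) = f"
          using e[OF h(1,2)] h(4) g(4) by simp
        fix k assume k: "k \<in> Hom C (fob (functr_comp L' L) x) c \<and>
          far (functr_comp R R') k \<cdot>\<^bsub>A\<^esub> (far R (\<zeta> (fob L x)) \<cdot>\<^bsub>A\<^esub> \<theta> x) = f"
        then have k': "k \<in> Arr C" "Dom C k = fob L' (fob L x)" "Cod C k = c" by (auto simp: in_Hom)
        have "far R' k \<cdot>\<^bsub>B\<^esub> \<zeta> (fob L x) = g"
        proof (rule universal_arrow_uniq[OF u[OF x] R])
          show "far R (far R' k \<cdot>\<^bsub>B\<^esub> \<zeta> (fob L x)) \<cdot>\<^bsub>A\<^esub> \<theta> x = far R g \<cdot>\<^bsub>A\<^esub> \<theta> x"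
            unfolding e[OF k'(1,2), symmetric] g(4) using k by simp
        qed (use k' g Lx in simp_all)
        then show "k = h"
          by (rule_tac universal_arrow_uniq[OF u'[OF Lx] R']) (use k' h in simp_all)
      qed
    qed (use x in \<open>auto simp: in_Hom\<close>)
  next
    fix f assume f: "f \<in> Arr A"
    have "far R (far R' (far L' (far L f))) \<cdot>\<^bsub>A\<^esub> (far R (\<zeta> (fob L (Dom A f))) \<cdot>\<^bsub>A\<^esub> \<theta> (Dom A f)) =
      far R (far R' (far L' (far L f)) \<cdot>\<^bsub>B\<^esub> \<zeta> (fob L (Dom A f))) \<cdot>\<^bsub>A\<^esub> \<theta> (Dom A f)"
      using f by simp
    also have "\<dots> = far R (\<zeta> (fob L (Cod A f))) \<cdot>\<^bsub>A\<^esub> (far R (far L f) \<cdot>\<^bsub>A\<^esub> \<theta> (Dom A f))"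
      using n'[of "far L f"] f by simp
    also have "\<dots> = far R (\<zeta> (fob L (Cod A f))) \<cdot>\<^bsub>A\<^esub> (\<theta> (Cod A f) \<cdot>\<^bsub>A\<^esub> f)"
      unfolding n[OF f] ..
    finally show "far (functr_comp R R') (far (functr_comp L' L) f) \<cdot>\<^bsub>A\<^esub> (far R (\<zeta> (fob L (Dom A f))) \<cdot>\<^bsub>A\<^esub> \<theta> (Dom A f)) =
      (far R (\<zeta> (fob L (Cod A f))) \<cdot>\<^bsub>A\<^esub> \<theta> (Cod A f)) \<cdot>\<^bsub>A\<^esub> far id_functr f"
      using f by simp
  qed (use R R' fL fL' cat_functor_comp cat_functor_id[OF cat_functor.axioms(1)[OF fL]] in blast)+
qed

text \<open>Functor records may differ outside the category: the restriction along a composite and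
  the composite of restrictions are known to agree only on objects and arrows, and that
  suffices.\<close>

lemma adj_unit_cong:
  assumes adj: "adj_unit X A B H F R \<theta>" and R': "cat_functor B A R'"
    and ob: "\<And>b. b \<in> Obj B \<Longrightarrow> fob R b = fob R' b" and ar: "\<And>f. f \<in> Arr B \<Longrightarrow> far R f = far R' f"
  shows "adj_unit X A B H F R' \<theta>"
proof -
  interpret F: cat_functor X B F using adj by (simp add: adj_unit_def)
  have "universal_arrow A B R' a b \<eta>" if "universal_arrow A B R a b \<eta>" for a b \<eta>
  proof -
    have "(\<exists>!h. h \<in> Hom B b b' \<and> far R h \<cdot>\<^bsub>A\<^esub> \<eta> = f) \<longleftrightarrow> (\<exists>!h. h \<in> Hom B b b' \<and> far R' h \<cdot>\<^bsub>A\<^esub> \<eta> = f)" for b' f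
      by (rule arg_cong[where f = Ex1]) (auto simp: in_Hom ar)
    then show ?thesis using that by (auto simp: universal_arrow_def ob)
  qed
  then show ?thesis
    using adj R' by (auto simp: adj_unit_def ar)
qed

lemma adj_unit_inverse:
  assumes F: "cat_functor A B F" and G: "cat_functor B A G"
    and "\<And>a. a \<in> Obj A \<Longrightarrow> fob G (fob F a) = a" "\<And>f. f \<in> Arr A \<Longrightarrow> far G (far F f) = f"
    and "\<And>b. b \<in> Obj B \<Longrightarrow> fob F (fob G b) = b" "\<And>f. f \<in> Arr B \<Longrightarrow> far F (far G f) = f"
  shows "adj_unit A A B id_functr F G (Ide A)"
proof -
  interpret F: cat_functor A B F by fact
  interpret G: cat_functor B A G by fact
  have "universal_arrow A B G x (fob F x) (Ide A x)" if x: "x \<in> Obj A" for x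
    unfolding universal_arrow_def
  proof (intro conjI ballI)
    fix b f assume b: "b \<in> Obj B" and "f \<in> Hom A x (fob G b)"
    then have f: "f \<in> Arr A" "Dom A f = x" "Cod A f = fob G b" by (auto simp: in_Hom)
    have e: "far G h \<cdot>\<^bsub>A\<^esub> Ide A x = far G h" if "h \<in> Hom B (fob F x) b" for h
      using that x assms(3) by (intro F.A.Cmp_Ide) (auto simp: in_Hom)
    show "\<exists>!h. h \<in> Hom B (fob F x) b \<and> far G h \<cdot>\<^bsub>A\<^esub> Ide A x = f"
    proof (intro ex1I[of _ "far F f"] conjI)
      show 1: "far F f \<in> Hom B (fob F x) b" using f b assms(5) by (simp add: in_Hom)
      show "far G (far F f) \<cdot>\<^bsub>A\<^esub> Ide A x = f" using e[OF 1] assms(4) f by simp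
      fix k assume k: "k \<in> Hom B (fob F x) b \<and> far G k \<cdot>\<^bsub>A\<^esub> Ide A x = f"
      then have "far F (far G k) = far F f" using e[of k] by simp
      then show "k = far F f" using k assms(6) by (simp add: in_Hom)
    qed
  qed (use x assms(3) in \<open>auto simp: in_Hom\<close>)
  then show ?thesis
    unfolding adj_unit_def using F G cat_functor_id[OF F.A.category_axioms] assms(4) by auto
qed

section \<open>Flatness and conservativity under isomorphism, composition and base change\<close>

context actegory_setting
begin

lemma cat_functor_ext:
  "\<alpha> \<in> Arr (Comm C) \<Longrightarrow> cat_functor (Mod C M (src \<alpha>)) (Mod C M (tgt \<alpha>)) (ext C M \<alpha>)"
  using left_adjoint_ext by (simp add: left_adjoint_def)

lemma restr_preserves_finite_limits:
  assumes "\<alpha> \<in> Arr (Comm C)"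
  shows "preserves_finite_limits (Mod C M (tgt \<alpha>)) (Mod C M (src \<alpha>)) (restr M \<alpha>)"
  using ext_unit[OF assms] right_adjoint_preserves_finite_limits by metis

lemma restr_is_iso:
  assumes \<alpha>: "\<alpha> \<in> Arr (Comm C)" and f: "f \<in> Arr (Mod C M (tgt \<alpha>))"
  shows "is_iso (Mod C M (src \<alpha>)) (far (restr M \<alpha>) f) \<longleftrightarrow> is_iso (Mod C M (tgt \<alpha>)) f"
  using Mod_is_iso[OF Comm_ArrD(1)[OF \<alpha>] cat_functor.far_simps(1)[OF cat_functor_restr[OF \<alpha>] f]]
    Mod_is_iso[OF Comm_ArrD(2)[OF \<alpha>] f] by simp

text \<open>Both sides are left adjoint to restriction along the composite, since restriction is
  strictly contravariant on modules.\<close>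

lemma ext_Cmp_nat_iso:
  assumes \<alpha>: "\<alpha> \<in> Arr (Comm C)" and \<beta>: "\<beta> \<in> Arr (Comm C)" and s: "tgt \<alpha> = src \<beta>"
  shows "nat_iso (Mod C M (src \<alpha>)) (Mod C M (tgt \<beta>)) (functr_comp (ext C M \<beta>) (ext C M \<alpha>))
    (ext C M (SArr (src \<alpha>) (und \<beta> \<cdot> und \<alpha>) (tgt \<beta>)))"
proof -
  let ?c = "SArr (src \<alpha>) (und \<beta> \<cdot> und \<alpha>) (tgt \<beta>)"
  have c: "?c \<in> Arr (Comm C)"
    using category.Cmp_simps(1)[OF category_Comm \<alpha> \<beta>] s by simp
  obtain \<theta> where \<theta>: "adj_unit (Mod C M (src \<alpha>)) (Mod C M (src \<alpha>)) (Mod C M (src \<beta>)) id_functr (ext C M \<alpha>) (restr M \<alpha>) \<theta>"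
    using ext_unit[OF \<alpha>] unfolding s .
  obtain \<zeta> where \<zeta>: "adj_unit (Mod C M (src \<beta>)) (Mod C M (src \<beta>)) (Mod C M (tgt \<beta>)) id_functr (ext C M \<beta>) (restr M \<beta>) \<zeta>"
    using ext_unit[OF \<beta>] .
  obtain \<xi> where \<xi>: "adj_unit (Mod C M (src \<alpha>)) (Mod C M (src \<alpha>)) (Mod C M (tgt \<beta>)) id_functr (ext C M ?c) (restr M ?c) \<xi>"
    using ext_unit[OF c] unfolding sarr.sel .
  have r: "restrict_module M \<alpha> (restrict_module M \<beta> Y) = restrict_module M ?c Y" if "module_over C M (tgt \<beta>) Y" for Y
    by (rule restrict_module_Cmp[OF \<alpha> \<beta> s that])
  have "adj_unit (Mod C M (src \<alpha>)) (Mod C M (src \<alpha>)) (Mod C M (tgt \<beta>)) id_functr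
    (functr_comp (ext C M \<beta>) (ext C M \<alpha>)) (restr M ?c) (\<lambda>x. far (restr M \<alpha>) (\<zeta> (fob (ext C M \<alpha>) x)) \<cdot>\<^bsub>Mod C M (src \<alpha>)\<^esub> \<theta> x)"
    by (rule adj_unit_cong[OF adj_unit_comp[OF \<theta> \<zeta>]])
      (use cat_functor_restr[OF c] in \<open>auto simp: r Mod_Arr\<close>)
  from adj_unit_nat_iso[OF this \<xi>] show ?thesis .
qed

text \<open>Restriction along the inverse is strictly inverse to restriction along \<alpha>, hence
  also left adjoint to it. So \<open>ext\<close> along an isomorphism inherits what is known of
  restriction functors.\<close>

lemma ext_iso_nat_iso:
  assumes \<alpha>: "is_iso (Comm C) \<alpha>"
  obtains \<beta> where "\<beta> \<in> Arr (Comm C)" "src \<beta> = tgt \<alpha>" "tgt \<beta> = src \<alpha>"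
    "nat_iso (Mod C M (src \<alpha>)) (Mod C M (tgt \<alpha>)) (restr M \<beta>) (ext C M \<alpha>)"
proof -
  obtain \<beta> where \<beta>: "\<beta> \<in> Arr (Comm C)" "src \<beta> = tgt \<alpha>" "tgt \<beta> = src \<alpha>"
    and 1: "SArr (src \<alpha>) (und \<beta> \<cdot> und \<alpha>) (tgt \<beta>) = SArr (src \<alpha>) (Ide C (carr (src \<alpha>))) (src \<alpha>)"
      "SArr (src \<beta>) (und \<alpha> \<cdot> und \<beta>) (tgt \<alpha>) = SArr (tgt \<alpha>) (Ide C (carr (tgt \<alpha>))) (tgt \<alpha>)"
    using \<alpha> by (auto simp: is_iso_def in_Hom)
  have A: "\<alpha> \<in> Arr (Comm C)" using \<alpha> by (simp add: is_iso_def)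
  note D = Comm_ArrD[OF A]
  have I: "restrict_module M (SArr a (Ide C (carr a)) a) Y = Y" if "comm_monoid_obj C a" "module_over C M a Y" for a Y
    by (rule module_obj.equality) (use moduleD[OF that(2,1)] that in simp_all)
  have r: "restrict_module M \<alpha> (restrict_module M \<beta> Y) = Y" if "module_over C M (src \<alpha>) Y" for Y
    using restrict_module_Cmp[OF A \<beta>(1), of Y] that \<beta> 1(1) I D by simp
  have r': "restrict_module M \<beta> (restrict_module M \<alpha> Y) = Y" if "module_over C M (tgt \<alpha>) Y" for Y
    using restrict_module_Cmp[OF \<beta>(1) A, of Y] that \<beta> 1(2) I D by simp
  have f: "cat_functor (Mod C M (src \<alpha>)) (Mod C M (tgt \<alpha>)) (restr M \<beta>)"
    using cat_functor_restr[OF \<beta>(1)] \<beta> by simp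
  have "adj_unit (Mod C M (src \<alpha>)) (Mod C M (src \<alpha>)) (Mod C M (tgt \<alpha>)) id_functr (restr M \<beta>) (restr M \<alpha>) (Ide (Mod C M (src \<alpha>)))"
    by (rule adj_unit_inverse[OF f cat_functor_restr[OF A]]) (auto simp: r r' Mod_Arr intro!: sarr.expand)
  moreover obtain \<theta> where "adj_unit (Mod C M (src \<alpha>)) (Mod C M (src \<alpha>)) (Mod C M (tgt \<alpha>)) id_functr (ext C M \<alpha>) (restr M \<alpha>) \<theta>"
    using ext_unit[OF A] .
  ultimately show ?thesis using that[OF \<beta>] adj_unit_nat_iso by blast
qed

lemma free_module:
  assumes "comm_monoid_obj C a" "x \<in> Obj M"
  shows "module_over C M a \<lparr>mcarr = carr a \<odot>\<^bsub>M\<^esub> x, mact = mul a x\<rparr>"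
  using assms by (simp add: module_over_iff mul_assoc mul_un_left)

text \<open>Limits of modules are limits in \<open>M\<close>; we only need that their projections are jointly monic there.\<close>

lemma Mod_limit_monic:
  assumes a: "comm_monoid_obj C a" and D: "cat_functor J (Mod C M a) D" and lim: "is_limit J (Mod C M a) D l \<pi>"
    and u: "u \<in> Arr M" "Cod M u = mcarr l" and v: "v \<in> Arr M" "Cod M v = mcarr l" "Dom M v = Dom M u"
    and eq: "\<And>j. j \<in> Obj J \<Longrightarrow> und (\<pi> j) \<cdot>\<^bsub>M\<^esub> u = und (\<pi> j) \<cdot>\<^bsub>M\<^esub> v"
  shows "u = v"
proof -
  interpret D: cat_functor J "Mod C M a" D by fact
  define x where "x = Dom M u"
  note [simp] = a u v
  have [simp]: "Dom M u = x" "x \<in> Obj M" using category.Dom_Cod_Obj(1)[OF act_category u(1)] by (simp_all add: x_def)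
  let ?X = "\<lparr>mcarr = carr a \<odot>\<^bsub>M\<^esub> x, mact = mul a x\<rparr>"
  have X: "module_over C M a ?X" by (rule free_module) simp_all
  have l: "module_over C M a l" using lim by (simp add: is_limit_def is_cone_def)
  note [simp] = moduleD(1-4)[OF l a]
  note lm = moduleD(5,6)[OF l a]
  have p: "module_over C M a (fob D j)" "src (\<pi> j) = l" "tgt (\<pi> j) = fob D j" "und (\<pi> j) \<in> Arr M"
    "Dom M (und (\<pi> j)) = mcarr l" "Cod M (und (\<pi> j)) = mcarr (fob D j)"
    "und (\<pi> j) \<cdot>\<^bsub>M\<^esub> mact l = mact (fob D j) \<cdot>\<^bsub>M\<^esub> (carr a \<rhd> und (\<pi> j))"
    "\<pi> j \<in> Arr (Mod C M a)" if "j \<in> Obj J" for j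
    using lim that by (auto simp: is_limit_def is_cone_def in_Hom Mod_Arr)
  \<comment> \<open>The linear extension of \<open>f\<close> to the free module on \<open>x\<close>.
    The vertex of a cone of modules must be a module, and the free one makes arrows of
    \<open>M\<close> out of \<open>x\<close> accessible to the limit.\<close>
  define w where "w f = SArr ?X (mact l \<cdot>\<^bsub>M\<^esub> (carr a \<rhd> f)) l" for f
  have w: "w f \<in> Arr (Mod C M a)" "src (w f) = ?X" "tgt (w f) = l"
    if [simp]: "f \<in> Arr M" "Dom M f = x" "Cod M f = mcarr l" for f
  proof -
    have "(mact l \<cdot>\<^bsub>M\<^esub> (carr a \<rhd> f)) \<cdot>\<^bsub>M\<^esub> mul a x = (mact l \<cdot>\<^bsub>M\<^esub> mul a (mcarr l)) \<cdot>\<^bsub>M\<^esub> (carr a \<rhd> (carr a \<rhd> f))"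
      by (simp add: mul_nat)
    also have "\<dots> = mact l \<cdot>\<^bsub>M\<^esub> (carr a \<rhd> (mact l \<cdot>\<^bsub>M\<^esub> (carr a \<rhd> f)))"
      unfolding lm(1) by simp
    finally show "w f \<in> Arr (Mod C M a)"
      using X l by (simp add: w_def Mod_Arr)
  qed (simp_all add: w_def)
  define \<xi> where "\<xi> j = \<pi> j \<cdot>\<^bsub>Mod C M a\<^esub> w u" for j
  have "\<pi> j \<cdot>\<^bsub>Mod C M a\<^esub> w v = \<xi> j" if j: "j \<in> Obj J" for j
  proof -
    note [simp] = p[OF j] moduleD(1-4)[OF p(1)[OF j] a]
    have "und (\<pi> j) \<cdot>\<^bsub>M\<^esub> (mact l \<cdot>\<^bsub>M\<^esub> (carr a \<rhd> f)) = mact (fob D j) \<cdot>\<^bsub>M\<^esub> (carr a \<rhd> (und (\<pi> j) \<cdot>\<^bsub>M\<^esub> f))"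
      if "f \<in> Arr M" "Dom M f = x" "Cod M f = mcarr l" for f
      using that p(7)[OF j, THEN act_chain, of "carr a \<rhd> f"] by simp
    then show ?thesis by (simp add: \<xi>_def w_def eq[OF j] del: lact_Cmp)
  qed
  note wv = this
  have cone: "is_cone J (Mod C M a) D ?X \<xi>"
    unfolding is_cone_def
  proof (intro conjI ballI)
    show "?X \<in> Obj (Mod C M a)" using X by simp
    fix j assume "j \<in> Obj J"
    then show "\<xi> j \<in> Hom (Mod C M a) ?X (fob D j)"
      unfolding \<xi>_def using category.Cmp_simps[OF category_Mod[OF a], of "w u" "\<pi> j"] w[of u] p by (simp add: in_Hom)
  next
    fix t assume t: "t \<in> Arr J"
    have "far D t \<cdot>\<^bsub>Mod C M a\<^esub> \<pi> (Dom J t) = \<pi> (Cod J t)" using lim t by (simp add: is_limit_def is_cone_def)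
    moreover have "far D t \<cdot>\<^bsub>Mod C M a\<^esub> (\<pi> (Dom J t) \<cdot>\<^bsub>Mod C M a\<^esub> w u) = (far D t \<cdot>\<^bsub>Mod C M a\<^esub> \<pi> (Dom J t)) \<cdot>\<^bsub>Mod C M a\<^esub> w u"
      by (rule category.Cmp_assoc'[OF category_Mod[OF a], symmetric])
        (use w[of u] p t D.far_simps[OF t] in simp_all)
    ultimately show "far D t \<cdot>\<^bsub>Mod C M a\<^esub> \<xi> (Dom J t) = \<xi> (Cod J t)" unfolding \<xi>_def by simp
  qed
  have "w u = w v"
    by (rule is_limit_uniq[OF lim cone]) (use w[of u] w[of v] wv in \<open>simp_all add: \<xi>_def del: Mod_simps(5)\<close>)
  then have "mact l \<cdot>\<^bsub>M\<^esub> (carr a \<rhd> u) = mact l \<cdot>\<^bsub>M\<^esub> (carr a \<rhd> v)" by (simp add: w_def)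
  then have "(mact l \<cdot>\<^bsub>M\<^esub> (carr a \<rhd> u)) \<cdot>\<^bsub>M\<^esub> un a x = (mact l \<cdot>\<^bsub>M\<^esub> (carr a \<rhd> v)) \<cdot>\<^bsub>M\<^esub> un a x" by simp
  moreover have "(mact l \<cdot>\<^bsub>M\<^esub> (carr a \<rhd> f)) \<cdot>\<^bsub>M\<^esub> un a x = f" if "f \<in> Arr M" "Dom M f = x" "Cod M f = mcarr l" for f
  proof -
    have "(mact l \<cdot>\<^bsub>M\<^esub> (carr a \<rhd> f)) \<cdot>\<^bsub>M\<^esub> un a x = (mact l \<cdot>\<^bsub>M\<^esub> un a (mcarr l)) \<cdot>\<^bsub>M\<^esub> f"
      using that by (simp add: un_nat)
    then show ?thesis using lm(2) that by simp
  qed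
  ultimately show ?thesis by simp
qed

text \<open>The given limit provides a mediating arrow that is linear over
  \<open>src \<gamma>\<close> only. Its linearity over \<open>tgt \<gamma>\<close> is an equation
  between arrows of \<open>M\<close> into \<open>mcarr l\<close>; it holds after each projection,
  and \<open>Mod_limit_monic\<close> concludes.\<close>

lemma restr_reflects_limit:
  assumes \<gamma>: "\<gamma> \<in> Arr (Comm C)" and D: "cat_functor J (Mod C M (tgt \<gamma>)) D"
    and cone: "is_cone J (Mod C M (tgt \<gamma>)) D l \<pi>"
    and lim: "is_limit J (Mod C M (src \<gamma>)) (functr_comp (restr M \<gamma>) D) (fob (restr M \<gamma>) l) (far (restr M \<gamma>) \<circ> \<pi>)"
  shows "is_limit J (Mod C M (tgt \<gamma>)) D l \<pi>"
  unfolding is_limit_def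
proof (intro conjI allI impI)
  let ?b = "src \<gamma>" and ?e = "tgt \<gamma>" and ?R = "restr M \<gamma>"
  note G = Comm_ArrD[OF \<gamma>]
  note R = cat_functor_restr[OF \<gamma>]
  interpret R: cat_functor "Mod C M ?e" "Mod C M ?b" ?R by (rule R)
  have RD: "cat_functor J (Mod C M ?b) (functr_comp ?R D)" by (rule cat_functor_comp[OF D R])
  show "is_cone J (Mod C M ?e) D l \<pi>" by fact
  fix x \<xi> assume x: "is_cone J (Mod C M ?e) D x \<xi>"
  have l: "module_over C M ?e l" and X: "module_over C M ?e x"
    using cone x by (auto simp: is_cone_def)
  note [simp] = G moduleD(1-4)[OF l G(2)] moduleD(1-4)[OF X G(2)]
  have p: "module_over C M ?e (fob D j)" "src (\<pi> j) = l" "tgt (\<pi> j) = fob D j" "und (\<pi> j) \<in> Arr M"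
    "Dom M (und (\<pi> j)) = mcarr l" "Cod M (und (\<pi> j)) = mcarr (fob D j)"
    "und (\<pi> j) \<cdot>\<^bsub>M\<^esub> mact l = mact (fob D j) \<cdot>\<^bsub>M\<^esub> (carr ?e \<rhd> und (\<pi> j))"
    and q: "src (\<xi> j) = x" "tgt (\<xi> j) = fob D j" "und (\<xi> j) \<in> Arr M"
    "Dom M (und (\<xi> j)) = mcarr x" "Cod M (und (\<xi> j)) = mcarr (fob D j)"
    "und (\<xi> j) \<cdot>\<^bsub>M\<^esub> mact x = mact (fob D j) \<cdot>\<^bsub>M\<^esub> (carr ?e \<rhd> und (\<xi> j))" if "j \<in> Obj J" for j
    using cone x that by (auto simp: is_cone_def in_Hom Mod_Arr)
  have c: "is_cone J (Mod C M ?b) (functr_comp ?R D) (fob ?R x) (far ?R \<circ> \<xi>)"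
    by (rule is_cone_functor[OF R D x])
  obtain h0 where h0: "h0 \<in> Arr (Mod C M ?b)" "src h0 = restrict_module M \<gamma> x" "tgt h0 = restrict_module M \<gamma> l"
    "\<And>j. j \<in> Obj J \<Longrightarrow> (far ?R \<circ> \<pi>) j \<cdot>\<^bsub>Mod C M ?b\<^esub> h0 = (far ?R \<circ> \<xi>) j"
    by (rule is_limit_ex[OF lim c]) auto
  define h where "h = und h0"
  have h [simp]: "h \<in> Arr M" "Dom M h = mcarr x" "Cod M h = mcarr l"
    using h0 by (auto simp: h_def Mod_Arr)
  have ph: "und (\<pi> j) \<cdot>\<^bsub>M\<^esub> h = und (\<xi> j)" if "j \<in> Obj J" for j
    using h0(4)[OF that] by (simp add: h_def)
  have monic: "u = v" if "u \<in> Arr M" "Cod M u = mcarr l" "v \<in> Arr M" "Cod M v = mcarr l" "Dom M v = Dom M u"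
    "\<And>j. j \<in> Obj J \<Longrightarrow> und (\<pi> j) \<cdot>\<^bsub>M\<^esub> u = und (\<pi> j) \<cdot>\<^bsub>M\<^esub> v" for u v
    by (rule Mod_limit_monic[OF G(1) RD lim]) (use that in simp_all)
  have "h \<cdot>\<^bsub>M\<^esub> mact x = mact l \<cdot>\<^bsub>M\<^esub> (carr ?e \<rhd> h)"
  proof (rule monic)
    fix j assume j: "j \<in> Obj J"
    note [simp] = p(2-6)[OF j] q(1-5)[OF j] moduleD(1-4)[OF p(1)[OF j] G(2)]
    have "und (\<pi> j) \<cdot>\<^bsub>M\<^esub> (h \<cdot>\<^bsub>M\<^esub> mact x) = mact (fob D j) \<cdot>\<^bsub>M\<^esub> (carr ?e \<rhd> (und (\<pi> j) \<cdot>\<^bsub>M\<^esub> h))"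
      unfolding ph[OF j] using ph[OF j, THEN act_chain, of "mact x"] by (simp add: q(6)[OF j])
    also have "\<dots> = und (\<pi> j) \<cdot>\<^bsub>M\<^esub> (mact l \<cdot>\<^bsub>M\<^esub> (carr ?e \<rhd> h))"
      using p(7)[OF j, THEN act_chain, of "carr ?e \<rhd> h"] by simp
    finally show "und (\<pi> j) \<cdot>\<^bsub>M\<^esub> (h \<cdot>\<^bsub>M\<^esub> mact x) = und (\<pi> j) \<cdot>\<^bsub>M\<^esub> (mact l \<cdot>\<^bsub>M\<^esub> (carr ?e \<rhd> h))" .
  qed simp_all
  then have hA: "SArr x h l \<in> Hom (Mod C M ?e) x l" using X l by (simp add: in_Hom Mod_Arr)
  show "\<exists>!h. h \<in> Hom (Mod C M ?e) x l \<and> (\<forall>j\<in>Obj J. \<pi> j \<cdot>\<^bsub>Mod C M ?e\<^esub> h = \<xi> j)"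
  proof (intro ex1I[of _ "SArr x h l"] conjI ballI)
    show "SArr x h l \<in> Hom (Mod C M ?e) x l" by (rule hA)
    fix j assume "j \<in> Obj J"
    then show "\<pi> j \<cdot>\<^bsub>Mod C M ?e\<^esub> SArr x h l = \<xi> j"
      using p q ph by (intro sarr.expand) simp
  next
    fix k assume k: "k \<in> Hom (Mod C M ?e) x l \<and> (\<forall>j\<in>Obj J. \<pi> j \<cdot>\<^bsub>Mod C M ?e\<^esub> k = \<xi> j)"
    have "und k = h"
    proof (rule monic)
      fix j assume j: "j \<in> Obj J"
      have "und (\<pi> j \<cdot>\<^bsub>Mod C M ?e\<^esub> k) = und (\<xi> j)" using k j by simp
      then show "und (\<pi> j) \<cdot>\<^bsub>M\<^esub> und k = und (\<pi> j) \<cdot>\<^bsub>M\<^esub> h" using ph[OF j] by simp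
    qed (use k in \<open>auto simp: in_Hom Mod_Arr\<close>)
    then show "k = SArr x h l" using k by (auto simp: in_Hom intro: sarr.expand)
  qed
qed

text \<open>\<open>\<alpha>\<^sup>* \<gamma>\<^sub>*\<close> preserves finite limits, hence so does
  the isomorphic \<open>\<gamma>'\<^sub>* \<beta>\<^sup>*\<close>; the outer restriction is then
  stripped off by reflection of limits.\<close>

lemma flat_base_change:
  assumes sq: "base_change_square \<alpha> \<gamma> \<gamma>' \<beta>" and flat: "flat C M \<alpha>"
  shows "flat C M \<beta>"
  unfolding flat_def preserves_finite_limits_def
proof (intro allI impI, elim conjE)
  have A: "\<alpha> \<in> Arr (Comm C)" "\<gamma> \<in> Arr (Comm C)" "\<gamma>' \<in> Arr (Comm C)" "\<beta> \<in> Arr (Comm C)"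
    and s: "src \<gamma> = src \<alpha>" "src \<gamma>' = tgt \<alpha>" "src \<beta> = tgt \<gamma>" "tgt \<gamma>' = tgt \<beta>"
    using sq by (auto simp: base_change_square_def)
  let ?d = "tgt \<gamma>" and ?e = "tgt \<beta>" and ?b = "tgt \<alpha>" and ?a = "src \<alpha>"
  have r: "cat_functor (Mod C M ?d) (Mod C M ?a) (restr M \<gamma>)"
    using cat_functor_restr[OF A(2)] s by simp
  have E: "cat_functor (Mod C M ?d) (Mod C M ?e) (ext C M \<beta>)"
    using cat_functor_ext[OF A(4)] s by simp
  have pres: "preserves_finite_limits (Mod C M ?d) (Mod C M ?b) (functr_comp (ext C M \<alpha>) (restr M \<gamma>))"
    using preserves_finite_limits_comp[OF restr_preserves_finite_limits[OF A(2)], of _ "ext C M \<alpha>"] flat r s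
    by (simp add: flat_def)
  have pres': "preserves_finite_limits (Mod C M ?d) (Mod C M ?b) (functr_comp (restr M \<gamma>') (ext C M \<beta>))"
    by (rule preserves_finite_limits_nat_iso[OF base_change_nat_iso[OF sq] pres])
  fix J :: "(nat, nat) cat" and D l \<pi>
  assume J: "category J" "finite (Arr J)" and D0: "cat_functor J (Mod C M (src \<beta>)) D" and lim0: "is_limit J (Mod C M (src \<beta>)) D l \<pi>"
  have D: "cat_functor J (Mod C M ?d) D" and lim: "is_limit J (Mod C M ?d) D l \<pi>" using D0 lim0 s by simp_all
  have "is_limit J (Mod C M ?b) (functr_comp (functr_comp (restr M \<gamma>') (ext C M \<beta>)) D)
    (fob (functr_comp (restr M \<gamma>') (ext C M \<beta>)) l) (far (functr_comp (restr M \<gamma>') (ext C M \<beta>)) \<circ> \<pi>)"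
    using pres' J D lim unfolding preserves_finite_limits_def by blast
  then have "is_limit J (Mod C M (src \<gamma>')) (functr_comp (restr M \<gamma>') (functr_comp (ext C M \<beta>) D))
    (fob (restr M \<gamma>') (fob (ext C M \<beta>) l)) (far (restr M \<gamma>') \<circ> (far (ext C M \<beta>) \<circ> \<pi>))"
    by (simp add: functr_comp_def comp_assoc s)
  moreover have "is_cone J (Mod C M (tgt \<gamma>')) (functr_comp (ext C M \<beta>) D) (fob (ext C M \<beta>) l) (far (ext C M \<beta>) \<circ> \<pi>)"
    using is_cone_functor[OF E D] lim s by (simp add: is_limit_def)
  moreover have "cat_functor J (Mod C M (tgt \<gamma>')) (functr_comp (ext C M \<beta>) D)"
    using cat_functor_comp[OF D E] s by simp
  ultimately have "is_limit J (Mod C M (tgt \<gamma>')) (functr_comp (ext C M \<beta>) D) (fob (ext C M \<beta>) l) (far (ext C M \<beta>) \<circ> \<pi>)"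
    by (intro restr_reflects_limit[OF A(3)])
  then show "is_limit J (Mod C M (tgt \<beta>)) (functr_comp (ext C M \<beta>) D) (fob (ext C M \<beta>) l) (far (ext C M \<beta>) \<circ> \<pi>)"
    using s by simp
qed

lemma flat_iso:
  assumes "is_iso (Comm C) \<alpha>"
  shows "flat C M \<alpha>"
proof -
  obtain \<beta> where \<beta>: "\<beta> \<in> Arr (Comm C)" "src \<beta> = tgt \<alpha>" "tgt \<beta> = src \<alpha>"
    "nat_iso (Mod C M (src \<alpha>)) (Mod C M (tgt \<alpha>)) (restr M \<beta>) (ext C M \<alpha>)"
    by (rule ext_iso_nat_iso[OF assms])
  show ?thesis
    unfolding flat_def
    by (rule preserves_finite_limits_nat_iso[OF \<beta>(4)]) (use restr_preserves_finite_limits[OF \<beta>(1)] \<beta> in simp)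
qed

lemma flat_Cmp:
  assumes \<alpha>: "\<alpha> \<in> Arr (Comm C)" and \<beta>: "\<beta> \<in> Arr (Comm C)" and s: "tgt \<alpha> = src \<beta>"
    and "flat C M \<alpha>" "flat C M \<beta>"
  shows "flat C M (SArr (src \<alpha>) (und \<beta> \<cdot> und \<alpha>) (tgt \<beta>))"
proof -
  have "preserves_finite_limits (Mod C M (src \<alpha>)) (Mod C M (tgt \<beta>)) (functr_comp (ext C M \<beta>) (ext C M \<alpha>))"
    by (rule preserves_finite_limits_comp[of _ "Mod C M (src \<beta>)"])
      (use assms cat_functor_ext[OF \<alpha>] in \<open>simp_all add: flat_def\<close>)
  then show ?thesis
    unfolding flat_def using preserves_finite_limits_nat_iso[OF ext_Cmp_nat_iso[OF \<alpha> \<beta> s]] by simp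
qed

lemma conservative_iso:
  assumes "is_iso (Comm C) (\<alpha> i)" "src (\<alpha> i) = a"
  shows "conservative_family C M a {i} \<alpha>"
proof -
  obtain \<beta> where \<beta>: "\<beta> \<in> Arr (Comm C)" "src \<beta> = tgt (\<alpha> i)" "tgt \<beta> = src (\<alpha> i)"
    "nat_iso (Mod C M (src (\<alpha> i))) (Mod C M (tgt (\<alpha> i))) (restr M \<beta>) (ext C M (\<alpha> i))"
    by (rule ext_iso_nat_iso[OF assms(1)])
  show ?thesis
    unfolding conservative_family_def
    using nat_iso_is_iso[OF \<beta>(4)] restr_is_iso[OF \<beta>(1)] \<beta> assms by simp
qed

text \<open>\<phi> is tested after restriction along \<gamma>. The extension of that restriction
  along \<open>\<alpha> j\<close> is, up to isomorphism, the restriction along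
  \<open>\<gamma>' j\<close> of the extension of \<phi> along \<open>\<beta> j\<close>, and
  restrictions reflect isomorphisms.\<close>

lemma conservative_base_change:
  assumes cons: "conservative_family C M a J \<alpha>" and \<gamma>: "src \<gamma> = a" "\<gamma> \<in> Arr (Comm C)"
    and sq: "\<And>j. j \<in> J \<Longrightarrow> base_change_square (\<alpha> j) \<gamma> (\<gamma>' j) (\<beta> j)"
  shows "conservative_family C M (tgt \<gamma>) J \<beta>"
  unfolding conservative_family_def
proof (intro ballI)
  fix \<phi> assume \<phi>: "\<phi> \<in> Arr (Mod C M (tgt \<gamma>))"
  have R\<phi>: "far (restr M \<gamma>) \<phi> \<in> Arr (Mod C M a)"
    using cat_functor.far_simps(1)[OF cat_functor_restr[OF \<gamma>(2)] \<phi>] \<gamma> by simp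
  have "is_iso (Mod C M (tgt (\<alpha> j))) (far (ext C M (\<alpha> j)) (far (restr M \<gamma>) \<phi>)) \<longleftrightarrow>
    is_iso (Mod C M (tgt (\<beta> j))) (far (ext C M (\<beta> j)) \<phi>)" if j: "j \<in> J" for j
  proof -
    have A: "\<gamma>' j \<in> Arr (Comm C)" "\<beta> j \<in> Arr (Comm C)" "src (\<gamma>' j) = tgt (\<alpha> j)" "src (\<beta> j) = tgt \<gamma>" "tgt (\<gamma>' j) = tgt (\<beta> j)"
      using sq[OF j] by (auto simp: base_change_square_def)
    have "far (ext C M (\<beta> j)) \<phi> \<in> Arr (Mod C M (tgt (\<beta> j)))"
      using cat_functor.far_simps(1)[OF cat_functor_ext[OF A(2)]] \<phi> A by simp
    then show ?thesis
      using nat_iso_is_iso[OF base_change_nat_iso[OF sq[OF j]] \<phi>] restr_is_iso[OF A(1)] A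
      by (simp del: restr_simps)
  qed
  then show "is_iso (Mod C M (tgt \<gamma>)) \<phi> \<longleftrightarrow> (\<forall>j\<in>J. is_iso (Mod C M (tgt (\<beta> j))) (far (ext C M (\<beta> j)) \<phi>))"
    using cons R\<phi> restr_is_iso[OF \<gamma>(2) \<phi>] \<gamma>(1) unfolding conservative_family_def by simp
qed

text \<open>Being an isomorphism is a conjunction over the family, so each conjunct for
  \<open>\<alpha> i\<close> is expanded through the family \<open>\<beta> i\<close>, and the result
  is reindexed along \<open>e\<close>.\<close>

lemma conservative_Cmp:
  assumes \<alpha>: "\<And>i. i \<in> J \<Longrightarrow> \<alpha> i \<in> Arr (Comm C) \<and> src (\<alpha> i) = a" and cons: "conservative_family C M a J \<alpha>"
    and \<beta>: "\<And>i j. i \<in> J \<Longrightarrow> j \<in> J' i \<Longrightarrow> \<beta> i j \<in> Arr (Comm C) \<and> src (\<beta> i j) = tgt (\<alpha> i)"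
    and cons': "\<And>i. i \<in> J \<Longrightarrow> conservative_family C M (tgt (\<alpha> i)) (J' i) (\<beta> i)"
    and e: "e ` L = (SIGMA i : J. J' i)"
  shows "conservative_family C M a L
    (\<lambda>l. case e l of (i, j) \<Rightarrow> SArr (src (\<alpha> i)) (und (\<beta> i j) \<cdot> und (\<alpha> i)) (tgt (\<beta> i j)))"
  unfolding conservative_family_def
proof (intro ballI)
  fix \<phi> assume \<phi>: "\<phi> \<in> Arr (Mod C M a)"
  let ?c = "\<lambda>i j. SArr (src (\<alpha> i)) (und (\<beta> i j) \<cdot> und (\<alpha> i)) (tgt (\<beta> i j))"
  let ?P = "\<lambda>i j. is_iso (Mod C M (tgt (\<beta> i j))) (far (ext C M (?c i j)) \<phi>)"
  have "is_iso (Mod C M (tgt (\<alpha> i))) (far (ext C M (\<alpha> i)) \<phi>) \<longleftrightarrow> (\<forall>j \<in> J' i. ?P i j)" if i: "i \<in> J" for i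
  proof -
    have A: "\<alpha> i \<in> Arr (Comm C)" "src (\<alpha> i) = a" using \<alpha>[OF i] by auto
    have "far (ext C M (\<alpha> i)) \<phi> \<in> Arr (Mod C M (tgt (\<alpha> i)))"
      using cat_functor.far_simps(1)[OF cat_functor_ext[OF A(1)]] \<phi> A by simp
    then have "is_iso (Mod C M (tgt (\<alpha> i))) (far (ext C M (\<alpha> i)) \<phi>) \<longleftrightarrow>
      (\<forall>j\<in>J' i. is_iso (Mod C M (tgt (\<beta> i j))) (far (ext C M (\<beta> i j)) (far (ext C M (\<alpha> i)) \<phi>)))"
      using cons'[OF i] unfolding conservative_family_def by blast
    also have "\<dots> \<longleftrightarrow> (\<forall>j \<in> J' i. ?P i j)"
      using nat_iso_is_iso[OF ext_Cmp_nat_iso[OF A(1)], of "\<beta> i _" \<phi>] \<beta>[OF i] \<phi> A by simp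
    finally show ?thesis .
  qed
  then have "is_iso (Mod C M a) \<phi> \<longleftrightarrow> (\<forall>(i, j) \<in> (SIGMA i : J. J' i). ?P i j)"
    using cons \<phi> unfolding conservative_family_def by auto
  also have "\<dots> \<longleftrightarrow> (\<forall>l \<in> L. case e l of (i, j) \<Rightarrow> ?P i j)"
    unfolding e[symmetric] by auto
  also have "\<dots> \<longleftrightarrow> (\<forall>l \<in> L. is_iso (Mod C M (tgt (case e l of (i, j) \<Rightarrow> ?c i j))) (far (ext C M (case e l of (i, j) \<Rightarrow> ?c i j)) \<phi>))"
    by (simp add: case_prod_beta)
  finally show "is_iso (Mod C M a) \<phi> \<longleftrightarrow>
    (\<forall>l \<in> L. is_iso (Mod C M (tgt (case e l of (i, j) \<Rightarrow> ?c i j))) (far (ext C M (case e l of (i, j) \<Rightarrow> ?c i j)) \<phi>))" .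
qed

text \<open>Treats both topologies at once: \<open>Q\<close> is the additional condition on single
  members, constantly true for fpqc covers and the property of being a spectral immersion for
  spectral ones.\<close>

lemma grothendieck_basis_cover:
  assumes Q_iso: "\<And>\<alpha>. is_iso (Comm C) \<alpha> \<Longrightarrow> Q \<alpha>"
    and Q_pullback: "\<And>\<alpha> \<gamma> \<gamma>' \<beta>. is_pullback (Aff C) \<alpha> \<gamma> \<gamma>' \<beta> \<Longrightarrow> Q \<alpha> \<Longrightarrow> Q \<beta>"
    and Q_Cmp: "\<And>\<alpha> \<beta>. \<alpha> \<in> Arr (Comm C) \<Longrightarrow> \<beta> \<in> Arr (Comm C) \<Longrightarrow> tgt \<alpha> = src \<beta> \<Longrightarrow> Q \<alpha> \<Longrightarrow> Q \<beta> \<Longrightarrow>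
      Q (SArr (src \<alpha>) (und \<beta> \<cdot> und \<alpha>) (tgt \<beta>))"
  shows "grothendieck_basis (Aff C) (\<lambda>a (I :: 'i set) \<alpha>. fpqc_cover C M a I \<alpha> \<and> (\<forall>i \<in> I. Q (\<alpha> i)))"
proof -
  let ?K = "\<lambda>a (I :: 'i set) \<alpha>. fpqc_cover C M a I \<alpha> \<and> (\<forall>i \<in> I. Q (\<alpha> i))"
  have K: "?K a I \<alpha> \<longleftrightarrow> (\<forall>i \<in> I. \<alpha> i \<in> Arr (Comm C) \<and> src (\<alpha> i) = a \<and> flat C M (\<alpha> i) \<and> Q (\<alpha> i)) \<and>
     (\<exists>J \<subseteq> I. finite J \<and> conservative_family C M a J \<alpha>)" for a I \<alpha>
    by (auto simp: fpqc_cover_def)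
  show ?thesis
  proof (rule grothendieck_basis.intro[OF category_Aff grothendieck_basis_axioms.intro])
    fix c and I :: "'i set" and f i
    assume "?K c I f" "i \<in> I"
    then show "f i \<in> Arr (Aff C) \<and> Cod (Aff C) (f i) = c" by (simp add: K)
  next
    fix c and f :: "'i \<Rightarrow> _" and i
    assume "is_iso (Aff C) (f i)" "Cod (Aff C) (f i) = c"
    then have i: "is_iso (Comm C) (f i)" "src (f i) = c"
      by (simp_all add: Aff_def is_iso_op_cat) (simp add: op_cat_def)
    have "f i \<in> Arr (Comm C)" using i(1) by (simp add: is_iso_def)
    then show "?K c {i} f"
      unfolding K using i flat_iso[OF i(1)] Q_iso[OF i(1)] conservative_iso[of f i c, OF i] by auto
  next
    fix c and I :: "'i set" and f g d i
    assume "?K c I f" and g: "g \<in> Hom (Aff C) d c" and "i \<in> I"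
    then have "f i \<in> Arr (Comm C)" "g \<in> Arr (Comm C)" "src g = src (f i)" by (auto simp: K in_Hom)
    then show "\<exists>p q. is_pullback (Aff C) (f i) g p q"
      using base_change_square_ex by metis
  next
    fix c and I :: "'i set" and f g d p q
    assume cov: "?K c I f" and g: "g \<in> Hom (Aff C) d c"
      and pb: "\<And>i. i \<in> I \<Longrightarrow> is_pullback (Aff C) (f i) g (p i) (q i)"
    have g': "g \<in> Arr (Comm C)" "src g = c" "tgt g = d" using g by (auto simp: in_Hom)
    have sq: "base_change_square (f i) g (p i) (q i)" if "i \<in> I" for i
      by (rule base_change_square_pullback[OF pb[OF that]])
    obtain J where J: "J \<subseteq> I" "finite J" "conservative_family C M c J f" using cov by (auto simp: K)
    have "conservative_family C M d J q"
      using conservative_base_change[OF J(3) g'(2,1), of p q] sq J(1) g'(3) by auto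
    moreover have "q i \<in> Arr (Comm C) \<and> src (q i) = d \<and> flat C M (q i) \<and> Q (q i)" if i: "i \<in> I" for i
      using sq[OF i] flat_base_change[OF sq[OF i]] Q_pullback[OF pb[OF i]] cov i g'(3)
      by (auto simp: base_change_square_def K)
    ultimately show "?K d I q" unfolding K using J by blast
  next
    fix c and I :: "'i set" and f :: "'i \<Rightarrow> _" and I' :: "'i \<Rightarrow> 'i set" and f' :: "'i \<Rightarrow> 'i \<Rightarrow> _"
      and e :: "'i \<Rightarrow> 'i \<times> 'i" and L
    assume cov: "?K c I f" and cov': "\<And>i. i \<in> I \<Longrightarrow> ?K (Dom (Aff C) (f i)) (I' i) (f' i)"
      and e: "bij_betw e L (SIGMA i : I. I' i)"
    have f: "f i \<in> Arr (Comm C)" "src (f i) = c" "flat C M (f i)" "Q (f i)" if "i \<in> I" for i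
      using cov that by (auto simp: K)
    have f': "f' i j \<in> Arr (Comm C)" "src (f' i j) = tgt (f i)" "flat C M (f' i j)" "Q (f' i j)"
      if "i \<in> I" "j \<in> I' i" for i j
      using cov'[OF that(1)] that(2) by (auto simp: K)
    obtain J where J: "J \<subseteq> I" "finite J" "conservative_family C M c J f" using cov by (auto simp: K)
    have "\<forall>i \<in> I. \<exists>J' \<subseteq> I' i. finite J' \<and> conservative_family C M (tgt (f i)) J' (f' i)"
      using cov' by (simp add: K)
    from bchoice[OF this] obtain J' where J': "\<And>i. i \<in> I \<Longrightarrow> J' i \<subseteq> I' i \<and> finite (J' i) \<and>
      conservative_family C M (tgt (f i)) (J' i) (f' i)" by blast
    \<comment> \<open>A finite conservative part of the composite family: finitely many outer
      members, for each of them finitely many inner ones, pulled back along the reindexing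
      \<open>e\<close>.\<close>
    define L' where "L' = {l \<in> L. e l \<in> (SIGMA i : J. J' i)}"
    have sub: "(SIGMA i : J. J' i) \<subseteq> (SIGMA i : I. I' i)" using J(1) J' by blast
    have eL': "e ` L' = (SIGMA i : J. J' i)"
    proof
      show "e ` L' \<subseteq> (SIGMA i : J. J' i)" by (auto simp: L'_def)
      show "(SIGMA i : J. J' i) \<subseteq> e ` L'"
      proof
        fix x assume x: "x \<in> (SIGMA i : J. J' i)"
        then have "x \<in> e ` L" using sub bij_betw_imp_surj_on[OF e] by (metis subsetD)
        then obtain l where "l \<in> L" "x = e l" by blast
        with x have "l \<in> L'" unfolding L'_def by (simp only: mem_Collect_eq)
        then show "x \<in> e ` L'" unfolding \<open>x = e l\<close> by (rule imageI)
      qed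
    qed
    have "finite (SIGMA i : J. J' i)" using J J' by (intro finite_SigmaI) auto
    moreover have "inj_on e L'" using bij_betw_imp_inj_on[OF e] by (rule inj_on_subset) (auto simp: L'_def)
    ultimately have fin: "finite L'" using finite_imageD[of e L'] eL' by simp
    let ?h = "\<lambda>l. case e l of (i, j) \<Rightarrow> f i \<cdot>\<^bsub>Aff C\<^esub> f' i j"
    have "conservative_family C M c L' ?h"
      unfolding Aff_simps
    proof (rule conservative_Cmp[OF _ J(3) _ _ eL'])
      fix i assume "i \<in> J"
      then have i: "i \<in> I" using J(1) by (rule rev_subsetD)
      show "f i \<in> Arr (Comm C) \<and> src (f i) = c" using f(1,2)[OF i] by simp
      show "conservative_family C M (tgt (f i)) (J' i) (f' i)" using J'[OF i] by simp
      fix j assume "j \<in> J' i"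
      then have "j \<in> I' i" using J'[OF i] by (simp add: subset_eq)
      then show "f' i j \<in> Arr (Comm C) \<and> src (f' i j) = tgt (f i)" using f'(1,2)[OF i] by simp
    qed
    moreover have "?h l \<in> Arr (Comm C) \<and> src (?h l) = c \<and> flat C M (?h l) \<and> Q (?h l)" if l: "l \<in> L" for l
    proof -
      obtain i j where ij: "e l = (i, j)" "i \<in> I" "j \<in> I' i"
        using bij_betwE[OF e] l by (cases "e l") auto
      note F = f[OF ij(2)] and F' = f'[OF ij(2,3)]
      have "SArr (src (f i)) (und (f' i j) \<cdot> und (f i)) (tgt (f' i j)) \<in> Arr (Comm C)"
        using category.Cmp_simps(1)[OF category_Comm F(1) F'(1)] F'(2) by simp
      then show ?thesis
        using F F' flat_Cmp[OF F(1) F'(1)] Q_Cmp[OF F(1) F'(1)] by (simp add: ij(1))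
    qed
    moreover have "L' \<subseteq> L" by (auto simp: L'_def)
    ultimately show "?K c L ?h" unfolding K using fin by blast
  qed
qed

lemma spectral_immersion_iff:
  assumes "\<alpha> \<in> Arr (Comm C)"
  shows "spectral_immersion TYPE('u) C M \<alpha> \<longleftrightarrow> flat C M \<alpha> \<and> category.finite_epi (Comm C) TYPE('u) \<alpha>"
  using category.finite_epi_iff[OF category_Comm, where 'u = 'u and \<alpha> = \<alpha>]
  by (simp add: spectral_immersion_def finite_type_def)

lemma grothendieck_basis_fpqc_cover:
  "grothendieck_basis (Aff C) (fpqc_cover C M :: _ \<Rightarrow> 'i set \<Rightarrow> _)"
  using grothendieck_basis_cover[of "\<lambda>_. True", where 'i = 'i] by simp

lemma grothendieck_basis_spectral_cover:
  "grothendieck_basis (Aff C) (spectral_cover TYPE('u) C M :: _ \<Rightarrow> 'i set \<Rightarrow> _)"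
proof -
  have "spectral_cover TYPE('u) C M = (\<lambda>a (I :: 'i set) \<alpha>. fpqc_cover C M a I \<alpha> \<and>
      (\<forall>i \<in> I. spectral_immersion TYPE('u) C M (\<alpha> i)))"
    by (simp add: spectral_cover_def fun_eq_iff)
  moreover have "grothendieck_basis (Aff C) (\<lambda>a (I :: 'i set) \<alpha>. fpqc_cover C M a I \<alpha> \<and>
      (\<forall>i \<in> I. spectral_immersion TYPE('u) C M (\<alpha> i)))"
  proof (rule grothendieck_basis_cover)
    fix \<alpha> assume i: "is_iso (Comm C) \<alpha>"
    then have "\<alpha> \<in> Arr (Comm C)" by (simp add: is_iso_def)
    then show "spectral_immersion TYPE('u) C M \<alpha>"
      using flat_iso[OF i] category.iso_finite_epi[OF category_Comm i, where 'u = 'u] by (simp add: spectral_immersion_iff)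
  next
    fix \<alpha> \<gamma> \<gamma>' \<beta> assume pb: "is_pullback (Aff C) \<alpha> \<gamma> \<gamma>' \<beta>" and \<alpha>: "spectral_immersion TYPE('u) C M \<alpha>"
    have A: "\<alpha> \<in> Arr (Comm C)" "\<beta> \<in> Arr (Comm C)" using pb by (auto simp: is_pullback_def)
    show "spectral_immersion TYPE('u) C M \<beta>"
      using \<alpha> flat_base_change[OF base_change_square_pullback[OF pb]]
        category.finite_epi_pushout[OF category_Comm _ pb[unfolded Aff_def], where 'u = 'u] A
      by (simp add: spectral_immersion_iff)
  next
    fix \<alpha> \<beta> assume A: "\<alpha> \<in> Arr (Comm C)" "\<beta> \<in> Arr (Comm C)" and s: "tgt \<alpha> = src \<beta>"
      and \<alpha>: "spectral_immersion TYPE('u) C M \<alpha>" and \<beta>: "spectral_immersion TYPE('u) C M \<beta>"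
    have c: "SArr (src \<alpha>) (und \<beta> \<cdot> und \<alpha>) (tgt \<beta>) \<in> Arr (Comm C)"
      using category.Cmp_simps(1)[OF category_Comm A] s by simp
    show "spectral_immersion TYPE('u) C M (SArr (src \<alpha>) (und \<beta> \<cdot> und \<alpha>) (tgt \<beta>))"
      using \<alpha> \<beta> flat_Cmp[OF A s] category.finite_epi_Cmp[OF category_Comm, where 'u = 'u and \<alpha> = \<alpha> and \<beta> = \<beta>] A s
      by (simp add: spectral_immersion_iff c)
  qed
  ultimately show ?thesis by simp
qed

end

text \<open>By closedness \<open>- \<otimes> X\<close> is a left adjoint and preserves coequalizers;
  the braiding transfers this to \<open>X \<otimes> -\<close>.\<close>

lemma coeq_monoidal_cocomplete:
  fixes C :: "('o, 'a, 'y) smcat_scheme" (structure)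
  assumes inf: "infinite (UNIV :: 'u set)" and C: "closed_symmetric_monoidal C" and cc: "cocomplete_cat TYPE('u) C"
  shows "coeq_monoidal C"
proof -
  interpret closed_symmetric_monoidal C by fact
  have r: "is_coeq C (self.ract f X) (self.ract g X) (self.ract q X)" if X: "X \<in> Obj C" and q: "is_coeq C f g q" for X f g q
  proof -
    obtain R where "left_adjoint C C \<lparr>fob = (\<lambda>b. b \<otimes> X), far = (\<lambda>f. f \<otimes>\<^sub>a Ide C X)\<rparr> R" using closed[OF X] by blast
    then obtain \<theta> where "adj_unit C C C id_functr \<lparr>fob = (\<lambda>b. b \<otimes> X), far = (\<lambda>f. f \<otimes>\<^sub>a Ide C X)\<rparr> R \<theta>"
      by (rule adj_unit_ex)
    from left_adjoint_coeq[OF this q] show ?thesis by (simp add: self.ract_def)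
  qed
  have l: "is_coeq C (self.lact X f) (self.lact X g) (self.lact X q)" if X: "X \<in> Obj C" and q: "is_coeq C f g q" for X f g q
  proof -
    note [simp] = X is_coeqD(1-3)[OF q]
    have [simp]: "Dom C f = Dom C g" "Cod C f = Dom C q" "Cod C g = Dom C q" using is_coeqD[OF q] by simp_all
    have b: "self.ract h X \<cdot> braid C X (Dom C h) = braid C X (Cod C h) \<cdot> self.lact X h" if "h \<in> Arr C" for h
      using braid_nat'[of "Ide C X" h] that by (simp add: tensor_lact tensor_ract)
    have "is_coeq C (self.lact X f) (self.lact X g) (self.ract q X \<cdot> braid C X (Dom C q))"
      by (rule A.is_coeq_iso[OF r[OF X q], of "braid C X (Dom C g)"]) (use b[of f] b[of g] in simp_all)
    from A.is_coeq_post_iso[OF this, of "braid C (Cod C q) X"] show ?thesis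
      by (simp add: b symmetry[THEN ten_chain])
  qed
  show ?thesis
    by unfold_locales (use r l cocomplete_coeq[OF inf cc tensor_category] in blast)+
qed

theorem proposition3p7:
  fixes C :: "('o, 'a) smcat" and M :: "('o, 'a, 'm, 'n) actegory"
  assumes "infinite (UNIV :: 'u set)"
    and "closed_symmetric_monoidal C"
    and "complete_cat TYPE('u) C" and "cocomplete_cat TYPE('u) C"
    and "left_actegory C M"
    and "complete_cat TYPE('u) M" and "cocomplete_cat TYPE('u) M"
    and "\<And>a. a \<in> Obj C \<Longrightarrow> preserves_colimits TYPE('u) M M (act_by C M a)"
    and "\<And>m. m \<in> Obj M \<Longrightarrow> preserves_colimits TYPE('u) C M (act_on M m)"
  shows "grothendieck_basis (Aff C)
           (fpqc_cover C M :: _ \<Rightarrow> 'i set \<Rightarrow> (_ \<Rightarrow> ('o, 'a) monoid_arr) \<Rightarrow> bool) \<and>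
         grothendieck_basis (Aff C)
           (spectral_cover TYPE('u) C M :: _ \<Rightarrow> 'i set \<Rightarrow> (_ \<Rightarrow> ('o, 'a) monoid_arr) \<Rightarrow> bool)"
proof -
  interpret left_actegory C M by fact
  interpret C: coeq_monoidal C by (rule coeq_monoidal_cocomplete[OF assms(1,2,4)])
  have by_f: "cat_functor M M (act_by C M a)" if "a \<in> Obj C" for a
    by (rule cat_functorI) (use that act_category in \<open>auto simp: act_by_def in_Hom simp flip: lact_def\<close>)
  have on_f: "cat_functor C M (act_on M m)" if "m \<in> Obj M" for m
    by (rule cat_functorI) (use that act_category tensor_category in \<open>auto simp: act_on_def in_Hom simp flip: ract_def\<close>)
  \<comment> \<open>The two whiskerings are the arrow parts of \<open>act_by\<close> and
    \<open>act_on\<close>, so the assumed preservation of colimits, applied to the walking pair,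
    gives the preservation of coequalizers asked for here.\<close>
  interpret actegory_setting C M
  proof unfold_locales
    show "\<exists>q. is_coeq M f g q" if "f \<in> Arr M" "g \<in> Arr M" "Dom M f = Dom M g" "Cod M f = Cod M g" for f g
      using cocomplete_coeq[OF assms(1,7) act_category that] by blast
    show "is_coeq M (A \<rhd> f) (A \<rhd> g) (A \<rhd> q)" if "A \<in> Obj C" "is_coeq M f g q" for A f g q
      using preserves_colimits_coeq[OF assms(1) assms(8) by_f] that by (simp add: act_by_def lact_def)
    show "is_coeq M (f \<lhd> m) (g \<lhd> m) (q \<lhd> m)" if "m \<in> Obj M" "is_coeq C f g q" for m f g q
      using preserves_colimits_coeq[OF assms(1) assms(9) on_f] that by (simp add: act_on_def ract_def)
  qed
  show ?thesis
    using grothendieck_basis_fpqc_cover grothendieck_basis_spectral_cover by blast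
qed

end
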